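(* The set $\mathcal{E}_n$ of isomorphism classes of rank $n$ real vector bundles with flat connection over $M$ is naturally bijective with $H^1(M,\mathcal{G}_n)$; that is, the map $\Theta:\mathcal{E}_n\to H^1(M,\mathcal{G}_n)$ is a bijection.
   Context: $M$ is a connected smooth manifold. $\mathcal{E}_n$ is the set of isomorphism classes of pairs $(E,\nabla)$, where $E\to M$ is a rank $n$ real vector bundle and $\nabla$ is a flat connection on $E$ (isomorphisms are vector bundle isomorphisms over the identity of $M$ carrying one connection to the other). $\mathcal{G}_n$ is the constant sheaf on $M$ of sections in $GL(n;\mathbb{R})$ (locally constant $GL(n;\mathbb{R})$-valued functions). For an open cover $\mathcal{U}=\{U_\alpha:\alpha\in A\}$ of $M$, $C^i(\mathcal{U},\mathcal{G}_n)$ denotes the Čech $i$-cochains ($i=0,1,2$), with $(\delta^0a)_{\alpha\beta}=a_\alpha^{-1}a_\beta$ and $(\delta^1a)_{\alpha\beta\gamma}=a_{\alpha\gamma}^{-1}a_{\alpha\beta}a_{\beta\gamma}$. A 1-cocycle is $a\in C^1(\mathcal{U},\mathcal{G}_n)$ with $\delta^1a=1$ (the identity matrix). Two 1-cocycles $a,a'$ are cohomologous if there is $b\in C^0(\mathcal{U},\mathcal{G}_n)$ with $a'_{\alpha\beta}=b_\alpha^{-1}a_{\alpha\beta}b_\beta$. The set of equivalence classes is $\check{H}^1(\mathcal{U},\mathcal{G}_n)$, and $H^1(M,\mathcal{G}_n)$ is the direct limit of these sets over refinements of open covers. The map $\Theta$: given $(E,\nabla)$ representing $\xi\in\mathcal{E}_n$,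 choose an open cover $\mathcal{U}=\{U_\alpha\}$ and on each $U_\alpha$ a basis of local parallel sections $h_{\alpha 1},\dots,h_{\alpha n}$ of $E$. On nonempty intersections $U_{\alpha\beta}=U_\alpha\cap U_\beta$ write $h_{\alpha i}|_{U_{\alpha\beta}}=\sum_{j=1}^n(t_{\alpha\beta})_{ij}h_{\beta j}|_{U_{\alpha\beta}}$ with $t\in C^1(\mathcal{U},\mathcal{G}_n)$ (a 1-cocycle). Then $\Theta(\xi)=[t]\in H^1(M,\mathcal{G}_n)$, which is independent of the choices. *)

theory Defs
  imports "HOL-Analysis.Analysis" "HOL-Algebra.Algebraic_Closure_Type"
begin

section \<open>Smooth maps and smooth manifolds\<close>

text \<open>For an open set \<open>S\<close> of a finite-dimensional space, \<open>Ck_on k S f\<close> says that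
  \<open>f\<close> is of class \<open>C\<^sup>k\<close> on \<open>S\<close>.\<close>

primrec Ck_on ::
  "nat \<Rightarrow> 'a::real_normed_vector set \<Rightarrow> ('a \<Rightarrow> 'b::real_normed_vector) \<Rightarrow> bool"
where
  "Ck_on 0 S f \<longleftrightarrow> continuous_on S f"
| "Ck_on (Suc k) S f \<longleftrightarrow>
     (\<forall>x\<in>S. f differentiable (at x)) \<and>
     (\<forall>v. Ck_on k S (\<lambda>x. frechet_derivative f (at x) v))"

text \<open>Smoothness on an arbitrary subset: locally the restriction of a smooth map defined on
  an open set. For open \<open>S\<close> this is ordinary smoothness; for \<open>S\<close> relatively open in a
  linear subspace it is ordinary smoothness with respect to that subspace.\<close>

definition smooth_on ::
  "'a::real_normed_vector set \<Rightarrow> ('a \<Rightarrow> 'b::real_normed_vector) \<Rightarrow> bool"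
where
  "smooth_on S f \<longleftrightarrow>
     (\<forall>x\<in>S. \<exists>T g. open T \<and> x \<in> T \<and> (\<forall>k. Ck_on k T g) \<and> (\<forall>y\<in>S \<inter> T. g y = f y))"

text \<open>The manifold is the whole type \<open>'m\<close>, with charts in the finite-dimensional vector space
  \<open>V\<close>. Taking \<open>V\<close> to be a subspace of a Euclidean space, rather than the Euclidean space
  itself, makes every dimension available, including dimension \<open>0\<close>.\<close>

type_synonym ('m, 'd) atlas = "('m set \<times> ('m \<Rightarrow> 'd)) set"

definition smooth_atlas ::
  "'d::euclidean_space set \<Rightarrow> ('m::topological_space, 'd) atlas \<Rightarrow> bool"
where
  "smooth_atlas V \<A> \<longleftrightarrow>
     subspace V \<and>
     (\<forall>x. \<exists>(W, \<phi>)\<in>\<A>. x \<in> W) \<and>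
     (\<forall>(W, \<phi>)\<in>\<A>. open W \<and> openin (top_of_set V) (\<phi> ` W) \<and>
        homeomorphism W (\<phi> ` W) \<phi> (inv_into W \<phi>)) \<and>
     (\<forall>(W, \<phi>)\<in>\<A>. \<forall>(W', \<phi>')\<in>\<A>.
        smooth_on (\<phi> ` (W \<inter> W')) (\<phi>' \<circ> inv_into W \<phi>))"

definition smooth_fun ::
  "('m::topological_space, 'd::euclidean_space) atlas \<Rightarrow> 'm set \<Rightarrow>
   ('m \<Rightarrow> 'b::real_normed_vector) \<Rightarrow> bool"
where
  "smooth_fun \<A> U f \<longleftrightarrow>
     open U \<and> (\<forall>(W, \<phi>)\<in>\<A>. smooth_on (\<phi> ` (U \<inter> W)) (f \<circ> inv_into W \<phi>))"

definition smooth_near ::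
  "('m::topological_space, 'd::euclidean_space) atlas \<Rightarrow> 'm \<Rightarrow>
   ('m \<Rightarrow> 'b::real_normed_vector) \<Rightarrow> bool"
where
  "smooth_near \<A> x f \<longleftrightarrow> (\<exists>U. x \<in> U \<and> smooth_fun \<A> U f)"


section \<open>Tangent vectors and vector fields\<close>

text \<open>A tangent vector at \<open>x\<close> is a derivation on germs at \<open>x\<close> of smooth real-valued functions.
  It is represented by an operator on all functions; the last clause fixes its values on
  functions that are not smooth near \<open>x\<close>.\<close>

type_synonym 'm tvec = "('m \<Rightarrow> real) \<Rightarrow> real"

definition tangent_space ::
  "('m::topological_space, 'd::euclidean_space) atlas \<Rightarrow> 'm \<Rightarrow> 'm tvec set"
where
  "tangent_space \<A> x = {v.
     (\<forall>f g. smooth_near \<A> x f \<and> smooth_near \<A> x g \<longrightarrow>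
        ((\<forall>\<^sub>F y in nhds x. f y = g y) \<longrightarrow> v f = v g) \<and>
        v (\<lambda>y. f y + g y) = v f + v g \<and>
        v (\<lambda>y. f y * g y) = f x * v g + g x * v f) \<and>
     (\<forall>c f. smooth_near \<A> x f \<longrightarrow> v (\<lambda>y. c * f y) = c * v f) \<and>
     (\<forall>f. \<not> smooth_near \<A> x f \<longrightarrow> v f = 0)}"

definition smooth_vector_field ::
  "('m::topological_space, 'd::euclidean_space) atlas \<Rightarrow> 'm set \<Rightarrow> ('m \<Rightarrow> 'm tvec) \<Rightarrow> bool"
where
  "smooth_vector_field \<A> U X1 \<longleftrightarrow>
     open U \<and> (\<forall>x\<in>U. X1 x \<in> tangent_space \<A> x) \<and>
     (\<forall>W f. W \<subseteq> U \<and> smooth_fun \<A> W f \<longrightarrow> smooth_fun \<A> W (\<lambda>x. X1 x f))"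

definition lie_bracket ::
  "('m::topological_space, 'd::euclidean_space) atlas \<Rightarrow>
   ('m \<Rightarrow> 'm tvec) \<Rightarrow> ('m \<Rightarrow> 'm tvec) \<Rightarrow> 'm \<Rightarrow> 'm tvec"
where
  "lie_bracket \<A> X1 X2 x f =
     (if smooth_near \<A> x f then X1 x (\<lambda>y. X2 y f) - X2 x (\<lambda>y. X1 y f) else 0)"


section \<open>Vector bundles\<close>

abbreviation real_field :: "real ring" where
  "real_field \<equiv> ring_of_type_algebra"

definition coord_space :: "(real, real ^ 'n) module" where
  "coord_space = \<lparr>carrier = UNIV, monoid.mult = (\<lambda>u w. undefined), one = undefined,
     ring.zero = 0, add = (+), smult = (*\<^sub>R)\<rparr>"

definition fibre_linear ::
  "(real, 'a) module \<Rightarrow> (real, 'b) module \<Rightarrow> ('a \<Rightarrow> 'b) \<Rightarrow> bool"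
where
  "fibre_linear A B f \<longleftrightarrow>
     f \<in> carrier A \<rightarrow> carrier B \<and>
     (\<forall>u\<in>carrier A. \<forall>w\<in>carrier A. f (u \<oplus>\<^bsub>A\<^esub> w) = f u \<oplus>\<^bsub>B\<^esub> f w) \<and>
     (\<forall>c. \<forall>u\<in>carrier A. f (c \<odot>\<^bsub>A\<^esub> u) = c \<odot>\<^bsub>B\<^esub> f u)"

text \<open>A rank \<open>n = CARD('n)\<close> bundle is a family of real vector spaces together with local
  trivialisations; the total space is the disjoint union of the fibres and the bundle
  projection sends the fibre at \<open>x\<close> to \<open>x\<close>. A trivialisation \<open>(W, \<phi>)\<close> consists of an open set
  and linear isomorphisms \<open>\<phi> x\<close> from the fibre at \<open>x\<close> to \<open>\<real>\<^sup>n\<close>, for \<open>x \<in> W\<close>. The topology and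
  the smooth structure of the total space are those for which all trivialisations are
  diffeomorphisms onto \<open>W \<times> \<real>\<^sup>n\<close>; smoothness of the transition maps makes them well defined.\<close>

record ('m, 'e, 'n) vbundle =
  fibre :: "'m \<Rightarrow> (real, 'e) module"
  trivs :: "('m set \<times> ('m \<Rightarrow> 'e \<Rightarrow> real ^ 'n)) set"

text \<open>The matrix of a fibre map at \<open>x\<close> with respect to two trivialisations.\<close>

definition triv_matrix ::
  "('m, 'e, 'n::finite) vbundle \<Rightarrow> ('m \<Rightarrow> 'e \<Rightarrow> real ^ 'n) \<Rightarrow> ('m \<Rightarrow> 'e \<Rightarrow> real ^ 'n) \<Rightarrow>
   ('m \<Rightarrow> 'e \<Rightarrow> 'e) \<Rightarrow> 'm \<Rightarrow> real ^ 'n ^ 'n"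
where
  "triv_matrix E \<phi> \<psi> F x =
     matrix (\<psi> x \<circ> F x \<circ> inv_into (carrier (fibre E x)) (\<phi> x))"

definition vector_bundle ::
  "('m::topological_space, 'd::euclidean_space) atlas \<Rightarrow> ('m, 'e, 'n::finite) vbundle \<Rightarrow> bool"
where
  "vector_bundle \<A> E \<longleftrightarrow>
     (\<forall>x. Module.module real_field (fibre E x)) \<and>
     (\<forall>x. \<exists>(W, \<phi>)\<in>trivs E. x \<in> W) \<and>
     (\<forall>(W, \<phi>)\<in>trivs E. open W \<and>
        (\<forall>x\<in>W. fibre_linear (fibre E x) coord_space (\<phi> x) \<and>
                bij_betw (\<phi> x) (carrier (fibre E x)) UNIV)) \<and>
     (\<forall>(W, \<phi>)\<in>trivs E. \<forall>(W', \<psi>)\<in>trivs E.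
        smooth_fun \<A> (W \<inter> W') (triv_matrix E \<phi> \<psi> (\<lambda>x u. u)))"

definition smooth_section ::
  "('m::topological_space, 'd::euclidean_space) atlas \<Rightarrow> ('m, 'e, 'n::finite) vbundle \<Rightarrow>
   'm set \<Rightarrow> ('m \<Rightarrow> 'e) \<Rightarrow> bool"
where
  "smooth_section \<A> E U s \<longleftrightarrow>
     open U \<and> (\<forall>x\<in>U. s x \<in> carrier (fibre E x)) \<and>
     (\<forall>(W, \<phi>)\<in>trivs E. smooth_fun \<A> (U \<inter> W) (\<lambda>x. \<phi> x (s x)))"

definition section_near ::
  "('m::topological_space, 'd::euclidean_space) atlas \<Rightarrow> ('m, 'e, 'n::finite) vbundle \<Rightarrow>
   'm \<Rightarrow> ('m \<Rightarrow> 'e) \<Rightarrow> bool"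
where
  "section_near \<A> E x s \<longleftrightarrow> (\<exists>U. x \<in> U \<and> smooth_section \<A> E U s)"

definition bundle_map ::
  "('m::topological_space, 'd::euclidean_space) atlas \<Rightarrow> ('m, 'e, 'n::finite) vbundle \<Rightarrow>
   ('m, 'e, 'n) vbundle \<Rightarrow> ('m \<Rightarrow> 'e \<Rightarrow> 'e) \<Rightarrow> bool"
where
  "bundle_map \<A> E E' F \<longleftrightarrow>
     (\<forall>x. fibre_linear (fibre E x) (fibre E' x) (F x)) \<and>
     (\<forall>(W, \<phi>)\<in>trivs E. \<forall>(W', \<psi>)\<in>trivs E'.
        smooth_fun \<A> (W \<inter> W') (triv_matrix E \<phi> \<psi> F))"


section \<open>Flat connections\<close>

text \<open>\<open>D x v s\<close> is the covariant derivative at \<open>x\<close>, in the direction of the tangent vector \<open>v\<close> at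
  \<open>x\<close>, of a section \<open>s\<close> that is defined and smooth near \<open>x\<close>. This is the connection as a
  differential operator from local sections of \<open>E\<close> to local sections of \<open>T\<^sup>*M \<otimes> E\<close>.
  Only its values on such \<open>v\<close> and \<open>s\<close> are meaningful.\<close>

type_synonym ('m, 'e) cov_deriv = "'m \<Rightarrow> 'm tvec \<Rightarrow> ('m \<Rightarrow> 'e) \<Rightarrow> 'e"

definition bundle_connection ::
  "('m::topological_space, 'd::euclidean_space) atlas \<Rightarrow> ('m, 'e, 'n::finite) vbundle \<Rightarrow>
   ('m, 'e) cov_deriv \<Rightarrow> bool"
where
  "bundle_connection \<A> E D \<longleftrightarrow>
     (\<forall>x. \<forall>v\<in>tangent_space \<A> x. \<forall>s. section_near \<A> E x s \<longrightarrow>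
        D x v s \<in> carrier (fibre E x)) \<and>
     (\<forall>x. \<forall>v\<in>tangent_space \<A> x. \<forall>s s'. section_near \<A> E x s \<and> section_near \<A> E x s' \<and>
        (\<forall>\<^sub>F y in nhds x. s y = s' y) \<longrightarrow> D x v s = D x v s') \<and>
     (\<forall>x. \<forall>v\<in>tangent_space \<A> x. \<forall>w\<in>tangent_space \<A> x. \<forall>a b s. section_near \<A> E x s \<longrightarrow>
        D x (\<lambda>f. a * v f + b * w f) s =
          a \<odot>\<^bsub>fibre E x\<^esub> D x v s \<oplus>\<^bsub>fibre E x\<^esub> b \<odot>\<^bsub>fibre E x\<^esub> D x w s) \<and>
     (\<forall>x. \<forall>v\<in>tangent_space \<A> x. \<forall>s s'. section_near \<A> E x s \<and> section_near \<A> E x s' \<longrightarrow>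
        D x v (\<lambda>y. s y \<oplus>\<^bsub>fibre E y\<^esub> s' y) = D x v s \<oplus>\<^bsub>fibre E x\<^esub> D x v s') \<and>
     (\<forall>x. \<forall>v\<in>tangent_space \<A> x. \<forall>f s. smooth_near \<A> x f \<and> section_near \<A> E x s \<longrightarrow>
        D x v (\<lambda>y. f y \<odot>\<^bsub>fibre E y\<^esub> s y) =
          v f \<odot>\<^bsub>fibre E x\<^esub> s x \<oplus>\<^bsub>fibre E x\<^esub> f x \<odot>\<^bsub>fibre E x\<^esub> D x v s) \<and>
     (\<forall>U X1 s. smooth_vector_field \<A> U X1 \<and> smooth_section \<A> E U s \<longrightarrow>
        smooth_section \<A> E U (\<lambda>x. D x (X1 x) s))"

definition curvature ::
  "('m::topological_space, 'd::euclidean_space) atlas \<Rightarrow> ('m, 'e, 'n::finite) vbundle \<Rightarrow>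
   ('m, 'e) cov_deriv \<Rightarrow> ('m \<Rightarrow> 'm tvec) \<Rightarrow> ('m \<Rightarrow> 'm tvec) \<Rightarrow> ('m \<Rightarrow> 'e) \<Rightarrow> 'm \<Rightarrow> 'e"
where
  "curvature \<A> E D X1 X2 s x =
     (D x (X1 x) (\<lambda>y. D y (X2 y) s) \<ominus>\<^bsub>fibre E x\<^esub> D x (X2 x) (\<lambda>y. D y (X1 y) s))
       \<ominus>\<^bsub>fibre E x\<^esub> D x (lie_bracket \<A> X1 X2 x) s"

definition flat_connection ::
  "('m::topological_space, 'd::euclidean_space) atlas \<Rightarrow> ('m, 'e, 'n::finite) vbundle \<Rightarrow>
   ('m, 'e) cov_deriv \<Rightarrow> bool"
where
  "flat_connection \<A> E D \<longleftrightarrow>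
     bundle_connection \<A> E D \<and>
     (\<forall>U X1 X2 s. smooth_vector_field \<A> U X1 \<and> smooth_vector_field \<A> U X2 \<and>
        smooth_section \<A> E U s \<longrightarrow>
        (\<forall>x\<in>U. curvature \<A> E D X1 X2 s x = \<zero>\<^bsub>fibre E x\<^esub>))"

type_synonym ('m, 'e, 'n) conn_bundle = "('m, 'e, 'n) vbundle \<times> ('m, 'e) cov_deriv"

definition flat_bundles ::
  "('m::topological_space, 'd::euclidean_space) atlas \<Rightarrow> ('m, 'e, 'n::finite) conn_bundle set"
where
  "flat_bundles \<A> = {(E, D). vector_bundle \<A> E \<and> flat_connection \<A> E D}"

definition flat_iso ::
  "('m::topological_space, 'd::euclidean_space) atlas \<Rightarrow>
   (('m, 'e, 'n::finite) conn_bundle \<times> ('m, 'e, 'n) conn_bundle) set"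
where
  "flat_iso \<A> = {((E, D), (E', D')).
     (E, D) \<in> flat_bundles \<A> \<and> (E', D') \<in> flat_bundles \<A> \<and>
     (\<exists>F G. bundle_map \<A> E E' F \<and> bundle_map \<A> E' E G \<and>
        (\<forall>x. \<forall>u\<in>carrier (fibre E x). G x (F x u) = u) \<and>
        (\<forall>x. \<forall>u\<in>carrier (fibre E' x). F x (G x u) = u) \<and>
        (\<forall>x. \<forall>v\<in>tangent_space \<A> x. \<forall>s. section_near \<A> E x s \<longrightarrow>
           D' x v (\<lambda>y. F y (s y)) = F x (D x v s)))}"

text \<open>The fibres are carried by subsets of \<open>'e\<close>. Every bundle is isomorphic to one of this form as
  soon as \<open>\<real>\<^sup>n\<close> injects into \<open>'e\<close>; without such an injection there may be no bundle at all.\<close>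

definition iso_classes ::
  "('m::topological_space, 'd::euclidean_space) atlas \<Rightarrow>
   ('m, 'e, 'n::finite) conn_bundle set set"
where
  "iso_classes \<A> = flat_bundles \<A> // flat_iso \<A>"


section \<open>Cech cohomology with coefficients in the constant sheaf \<open>GL(n; \<real>)\<close>\<close>

type_synonym ('i, 'm) cover = "'i set \<times> ('i \<Rightarrow> 'm set)"

definition open_cover :: "('i, 'm::topological_space) cover \<Rightarrow> bool" where
  "open_cover \<U> \<longleftrightarrow> (\<forall>\<alpha>\<in>fst \<U>. open (snd \<U> \<alpha>)) \<and> (\<Union>\<alpha>\<in>fst \<U>. snd \<U> \<alpha>) = UNIV"

definition GL_sections :: "'m::topological_space set \<Rightarrow> ('m \<Rightarrow> real ^ 'n ^ 'n::finite) set" where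
  "GL_sections U = {g. \<forall>x\<in>U. invertible (g x) \<and>
     (\<exists>W. open W \<and> x \<in> W \<and> (\<forall>y\<in>U \<inter> W. g y = g x))}"

type_synonym ('i, 'm, 'n) cochain1 = "'i \<Rightarrow> 'i \<Rightarrow> 'm \<Rightarrow> real ^ 'n ^ 'n"

definition C0 ::
  "('i, 'm::topological_space) cover \<Rightarrow> ('i \<Rightarrow> 'm \<Rightarrow> real ^ 'n ^ 'n::finite) set"
where
  "C0 \<U> = {b. \<forall>\<alpha>\<in>fst \<U>. b \<alpha> \<in> GL_sections (snd \<U> \<alpha>)}"

definition C1 ::
  "('i, 'm::topological_space) cover \<Rightarrow> ('i, 'm, 'n::finite) cochain1 set"
where
  "C1 \<U> = {a. \<forall>\<alpha>\<in>fst \<U>. \<forall>\<beta>\<in>fst \<U>. a \<alpha> \<beta> \<in> GL_sections (snd \<U> \<alpha> \<inter> snd \<U> \<beta>)}"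

definition delta1 ::
  "('i, 'm, 'n::finite) cochain1 \<Rightarrow> 'i \<Rightarrow> 'i \<Rightarrow> 'i \<Rightarrow> 'm \<Rightarrow> real ^ 'n ^ 'n"
where
  "delta1 a \<alpha> \<beta> \<gamma> x = matrix_inv (a \<alpha> \<gamma> x) ** a \<alpha> \<beta> x ** a \<beta> \<gamma> x"

definition Z1 ::
  "('i, 'm::topological_space) cover \<Rightarrow> ('i, 'm, 'n::finite) cochain1 set"
where
  "Z1 \<U> = {a \<in> C1 \<U>. \<forall>\<alpha>\<in>fst \<U>. \<forall>\<beta>\<in>fst \<U>. \<forall>\<gamma>\<in>fst \<U>.
     \<forall>x\<in>snd \<U> \<alpha> \<inter> snd \<U> \<beta> \<inter> snd \<U> \<gamma>. delta1 a \<alpha> \<beta> \<gamma> x = mat 1}"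

text \<open>Cochains are compared only on the intersections over which they are sections, so cocycles
  that differ only elsewhere are cohomologous and have the same class.\<close>

definition cohomologous ::
  "('i, 'm::topological_space) cover \<Rightarrow>
   (('i, 'm, 'n::finite) cochain1 \<times> ('i, 'm, 'n) cochain1) set"
where
  "cohomologous \<U> = {(a, a'). a \<in> Z1 \<U> \<and> a' \<in> Z1 \<U> \<and>
     (\<exists>b\<in>C0 \<U>. \<forall>\<alpha>\<in>fst \<U>. \<forall>\<beta>\<in>fst \<U>. \<forall>x\<in>snd \<U> \<alpha> \<inter> snd \<U> \<beta>.
        a' \<alpha> \<beta> x = matrix_inv (b \<alpha> x) ** a \<alpha> \<beta> x ** b \<beta> x)}"

definition H1_cover ::
  "('i, 'm::topological_space) cover \<Rightarrow> ('i, 'm, 'n::finite) cochain1 set set"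
where
  "H1_cover \<U> = Z1 \<U> // cohomologous \<U>"

definition refinement_map ::
  "('i, 'm::topological_space) cover \<Rightarrow> ('i, 'm) cover \<Rightarrow> ('i \<Rightarrow> 'i) \<Rightarrow> bool"
where
  "refinement_map \<V> \<U> r \<longleftrightarrow>
     (\<forall>\<alpha>\<in>fst \<V>. r \<alpha> \<in> fst \<U> \<and> snd \<V> \<alpha> \<subseteq> snd \<U> (r \<alpha>))"

definition restrict_class ::
  "('i, 'm::topological_space) cover \<Rightarrow> ('i \<Rightarrow> 'i) \<Rightarrow>
   ('i, 'm, 'n::finite) cochain1 set \<Rightarrow> ('i, 'm, 'n) cochain1 set"
where
  "restrict_class \<V> r c = cohomologous \<V> `` ((\<lambda>a \<alpha> \<beta>. a (r \<alpha>) (r \<beta>)) ` c)"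

type_synonym ('i, 'm, 'n) cover_class = "('i, 'm) cover \<times> ('i, 'm, 'n) cochain1 set"

definition cover_classes :: "('i, 'm::topological_space, 'n::finite) cover_class set" where
  "cover_classes = {(\<U>, c). open_cover \<U> \<and> c \<in> H1_cover \<U>}"

definition limit_rel ::
  "(('i, 'm::topological_space, 'n::finite) cover_class \<times> ('i, 'm, 'n) cover_class) set"
where
  "limit_rel = {((\<U>, c), (\<U>', c')).
     (\<U>, c) \<in> cover_classes \<and> (\<U>', c') \<in> cover_classes \<and>
     (\<exists>\<V> r r'. open_cover \<V> \<and> refinement_map \<V> \<U> r \<and> refinement_map \<V> \<U>' r' \<and>
        restrict_class \<V> r c = restrict_class \<V> r' c')}"

text \<open>The direct limit of the sets \<open>H1_cover \<U>\<close> over the open covers of \<open>M\<close> with index set in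
  \<open>'i\<close>. If \<open>'m set\<close> injects into \<open>'i\<close>, then every open cover, whatever its index set, has the
  same refinements as one of these.\<close>

definition H1 :: "('i, 'm::topological_space, 'n::finite) cover_class set set" where
  "H1 = cover_classes // limit_rel"


section \<open>The map from flat bundles to cohomology\<close>

definition fibre_basis :: "(real, 'e) module \<Rightarrow> ('n::finite \<Rightarrow> 'e) \<Rightarrow> bool" where
  "fibre_basis A e \<longleftrightarrow>
     (\<forall>i. e i \<in> carrier A) \<and>
     (\<forall>u\<in>carrier A. \<exists>!c :: real ^ 'n. u = (\<Oplus>\<^bsub>A\<^esub>i\<in>UNIV. (c $ i) \<odot>\<^bsub>A\<^esub> e i))"

definition parallel_section ::
  "('m::topological_space, 'd::euclidean_space) atlas \<Rightarrow> ('m, 'e, 'n::finite) vbundle \<Rightarrow>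
   ('m, 'e) cov_deriv \<Rightarrow> 'm set \<Rightarrow> ('m \<Rightarrow> 'e) \<Rightarrow> bool"
where
  "parallel_section \<A> E D U s \<longleftrightarrow>
     smooth_section \<A> E U s \<and>
     (\<forall>x\<in>U. \<forall>v\<in>tangent_space \<A> x. D x v s = \<zero>\<^bsub>fibre E x\<^esub>)"

definition parallel_frames ::
  "('m::topological_space, 'd::euclidean_space) atlas \<Rightarrow> ('m, 'e, 'n::finite) vbundle \<Rightarrow>
   ('m, 'e) cov_deriv \<Rightarrow> ('i, 'm) cover \<Rightarrow> ('i \<Rightarrow> 'n \<Rightarrow> 'm \<Rightarrow> 'e) \<Rightarrow> bool"
where
  "parallel_frames \<A> E D \<U> h \<longleftrightarrow>
     (\<forall>\<alpha>\<in>fst \<U>. (\<forall>i. parallel_section \<A> E D (snd \<U> \<alpha>) (h \<alpha> i)) \<and>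
        (\<forall>x\<in>snd \<U> \<alpha>. fibre_basis (fibre E x) (\<lambda>i. h \<alpha> i x)))"

definition frame_transition ::
  "('m::topological_space, 'e, 'n::finite) vbundle \<Rightarrow> ('i, 'm) cover \<Rightarrow>
   ('i \<Rightarrow> 'n \<Rightarrow> 'm \<Rightarrow> 'e) \<Rightarrow> ('i, 'm, 'n) cochain1 \<Rightarrow> bool"
where
  "frame_transition E \<U> h t \<longleftrightarrow>
     t \<in> C1 \<U> \<and>
     (\<forall>\<alpha>\<in>fst \<U>. \<forall>\<beta>\<in>fst \<U>. \<forall>x\<in>snd \<U> \<alpha> \<inter> snd \<U> \<beta>. \<forall>i.
        h \<alpha> i x = (\<Oplus>\<^bsub>fibre E x\<^esub>j\<in>UNIV. (t \<alpha> \<beta> x $ i $ j) \<odot>\<^bsub>fibre E x\<^esub> h \<beta> j x))"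

text \<open>The class is specified by a definite description over all choices of a representative of
  \<open>\<xi>\<close>, of a cover and of parallel frames. The frames are bases of the fibres at every point of
  the covering set; the sets need not be connected.\<close>

definition Theta ::
  "('m::topological_space, 'd::euclidean_space) atlas \<Rightarrow>
   ('m, 'e, 'n::finite) conn_bundle set \<Rightarrow> ('i, 'm, 'n) cover_class set"
where
  "Theta \<A> \<xi> = (THE \<tau>. \<exists>E D \<U> h t. (E, D) \<in> \<xi> \<and> open_cover \<U> \<and>
     parallel_frames \<A> E D \<U> h \<and> frame_transition E \<U> h t \<and>
     \<tau> = limit_rel `` {(\<U>, cohomologous \<U> `` {t})})"

end

theory Submission
  imports Defs
begin

text \<open>A flat connection has enough local parallel sections: around every point there is a frame of
  parallel sections, and two parallel frames over the same set differ by a locally constant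
  matrix. Everything else is bookkeeping with such frames.

  Parallel frames (\<open>ex_local_parallel_frame\<close>). In a chart and a trivialisation a section is
  parallel when its coordinates \<open>g\<close> solve \<open>dg = - A g\<close>, where \<open>A\<close> is the matrix-valued \<open>1\<close>-form
  of the connection, and flatness is the integrability condition \<open>dA + A \<and> A = 0\<close>. The
  equation is solved without ordinary differential equations and their dependence on
  parameters. Let \<open>K\<close> be the homotopy operator that integrates forms along the rays from a
  centre \<open>p\<close>, so that \<open>dK + Kd = id\<close>. The iteration \<open>g\<^sub>n\<^sub>+\<^sub>1 = w - K(A g\<^sub>n)\<close> contracts on a small
  ball. Writing \<open>\<omega>\<^sub>n = dg\<^sub>n + A g\<^sub>n\<close>, flatness turns Cartan's formula into
  \<open>\<omega>\<^sub>n\<^sub>+\<^sub>1 = A (g\<^sub>n\<^sub>+\<^sub>1 - g\<^sub>n) - K(A \<and> \<omega>\<^sub>n)\<close>, so \<open>\<omega>\<^sub>n\<close> tends to \<open>0\<close> as well and the limit of the \<open>g\<^sub>n\<close> is a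
  solution. To pass from coordinate directions to all tangent vectors one needs that a
  derivation on germs is a combination of coordinate derivatives
  (\<open>tangent_vector_expand\<close>, from Hadamard's lemma).

  Changes of frame (\<open>frame_change_locally_constant\<close>). In a parallel frame a section
  \<open>\<Sum> c\<^sub>i h\<^sub>i\<close> has covariant derivative \<open>\<Sum> v(c\<^sub>i) h\<^sub>i\<close>. Hence the coefficients of a parallel section
  are annihilated by all tangent vectors, that is, they are locally constant. So the
  transition matrices of a family of parallel frames form a cocycle. An isomorphism carries
  parallel frames to parallel frames with the same transition matrices, so isomorphic bundles
  give cocycles that become cohomologous on a common refinement, and \<open>\<Theta>\<close> is well defined
  (\<open>Theta_eq\<close>).

  Injectivity (\<open>common_refinement_imp_isomorphic\<close>). If the cocycles of two bundles become
  cohomologous through a cochain \<open>b\<close>, replacing the frames \<open>h'\<close> of the second by \<open>b h'\<close> makes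
  the transition matrices equal, and then \<open>h\<^sub>i \<mapsto> (b h')\<^sub>i\<close> is a well-defined isomorphism.

  Surjectivity (\<open>cocycle_flat_bundle\<close>, \<open>cocycle_frame_change\<close>). A cocycle \<open>a\<close> glues copies of
  \<open>U\<^sub>\<alpha> \<times> \<real>\<^sup>n\<close>; differentiation of coordinates is independent of \<open>\<alpha>\<close> because \<open>a\<close> is locally constant,
  it is flat, and the coordinate frames are parallel with transition matrices \<open>a\<close>.\<close>

(* The dollar sign is to denote vector components only. *)
no_notation fps_nth (infixl \<open>$\<close> 75)

section \<open>Calculus of smooth maps\<close>

lemma Ck_on_subset: "Ck_on k S f \<Longrightarrow> T \<subseteq> S \<Longrightarrow> Ck_on k T f"
  by (induction k arbitrary: f) (auto intro: continuous_on_subset)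

lemma Ck_on_has_derivative:
  "Ck_on (Suc k) S f \<Longrightarrow> x \<in> S \<Longrightarrow> (f has_derivative frechet_derivative f (at x)) (at x)"
  by (simp add: frechet_derivative_works)

lemma Ck_on_SucD: "Ck_on (Suc k) S f \<Longrightarrow> Ck_on k S f"
proof (induction k arbitrary: f)
  case 0
  then show ?case
    by (auto intro!: continuous_at_imp_continuous_on differentiable_imp_continuous_within)
qed simp

lemma Ck_on_cong:
  assumes "open S" "\<And>x. x \<in> S \<Longrightarrow> f x = g x" "Ck_on k S f"
  shows "Ck_on k S g"
  using assms(2,3)
proof (induction k arbitrary: f g)
  case 0
  then show ?case by (simp cong: continuous_on_cong)
next
  case (Suc k)
  have d: "(g has_derivative frechet_derivative f (at x)) (at x)" if "x \<in> S" for x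
    by (rule has_derivative_transform_within_open[OF Ck_on_has_derivative[OF Suc.prems(2) that] assms(1) that])
       (simp add: Suc.prems(1))
  then have eq: "frechet_derivative g (at x) = frechet_derivative f (at x)" if "x \<in> S" for x
    using that frechet_derivative_at by metis
  show ?case
    using d Suc.prems(2) Suc.IH[of "\<lambda>x. frechet_derivative f (at x) v" "\<lambda>x. frechet_derivative g (at x) v" for v]
    by (auto simp: eq differentiable_def)
qed

lemma Ck_on_SucI:
  assumes "open S" "\<And>x. x \<in> S \<Longrightarrow> (f has_derivative f' x) (at x)"
    and "\<And>v. Ck_on k S (\<lambda>x. f' x v)"
  shows "Ck_on (Suc k) S f"
proof -
  have "frechet_derivative f (at x) = f' x" if "x \<in> S" for x
    using assms(2)[OF that] frechet_derivative_at by metis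
  then have "Ck_on k S (\<lambda>x. frechet_derivative f (at x) v)" for v
    by (intro Ck_on_cong[OF assms(1) _ assms(3)[of v]]) auto
  then show ?thesis
    using assms(2) by (auto simp: differentiable_def)
qed

lemma Ck_on_const: "open S \<Longrightarrow> Ck_on k S (\<lambda>x. c)"
  by (induction k arbitrary: c) (auto intro!: Ck_on_SucI[where f' = "\<lambda>x v. 0"] simp del: Ck_on.simps(2))

lemma Ck_on_linear:
  assumes "open S" "bounded_linear f"
  shows "Ck_on k S f"
proof (cases k)
  case 0
  then show ?thesis using assms by (simp add: linear_continuous_on)
next
  case (Suc n)
  then show ?thesis
    using assms by (auto intro!: Ck_on_SucI[where f' = "\<lambda>x. f"] Ck_on_const
      bounded_linear_imp_has_derivative simp del: Ck_on.simps(2))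
qed

lemma Ck_on_add:
  assumes "open S" "Ck_on k S f" "Ck_on k S g"
  shows "Ck_on k S (\<lambda>x. f x + g x)"
  using assms(2,3)
proof (induction k arbitrary: f g)
  case 0
  then show ?case by (simp add: continuous_on_add)
next
  case (Suc k)
  note D = Ck_on_has_derivative[OF Suc.prems(1)] Ck_on_has_derivative[OF Suc.prems(2)]
  show ?case
    by (rule Ck_on_SucI[OF assms(1) has_derivative_add[OF D]])
       (use Suc in auto)
qed

lemma Ck_on_sum:
  assumes "open S" "\<And>i. i \<in> I \<Longrightarrow> Ck_on k S (f i)"
  shows "Ck_on k S (\<lambda>x. \<Sum>i\<in>I. f i x)"
  using assms(2)
  by (induction I rule: infinite_finite_induct) (auto intro!: Ck_on_const Ck_on_add assms(1))

lemma Ck_on_bilinear: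
  assumes "bounded_bilinear b" "open S" "Ck_on k S f" "Ck_on k S g"
  shows "Ck_on k S (\<lambda>x. b (f x) (g x))"
  using assms(3,4)
proof (induction k arbitrary: f g)
  case 0
  then show ?case by (simp add: bounded_bilinear.continuous_on[OF assms(1)])
next
  case (Suc k)
  note D = Ck_on_has_derivative[OF Suc.prems(1)] Ck_on_has_derivative[OF Suc.prems(2)]
  show ?case
  proof (rule Ck_on_SucI[OF assms(2) bounded_bilinear.FDERIV[OF assms(1) D]])
    fix v
    show "Ck_on k S (\<lambda>x. b (f x) (frechet_derivative g (at x) v) + b (frechet_derivative f (at x) v) (g x))"
      by (intro Ck_on_add assms(2) Suc.IH)
         (use Suc.prems Ck_on_SucD[OF Suc.prems(1)] Ck_on_SucD[OF Suc.prems(2)] in auto)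
  qed
qed

text \<open>The class \<open>C\<^sup>k\<close> is defined through derivatives in fixed directions, whereas the chain rule
  differentiates \<open>g\<close> in the direction \<open>f' v\<close> that moves with the point. Expanding this direction
  in a basis reduces it to fixed ones.\<close>

lemma Ck_on_compose:
  fixes f :: "'a::real_normed_vector \<Rightarrow> 'b::euclidean_space"
    and g :: "'b \<Rightarrow> 'c::real_normed_vector"
  assumes "open S" "open T" "f ` S \<subseteq> T" "Ck_on k S f" "Ck_on k T g"
  shows "Ck_on k S (\<lambda>x. g (f x))"
  using assms(4,5)
proof (induction k arbitrary: g)
  case 0
  then show ?case using assms(3) by (simp add: continuous_on_compose2)
next
  case (Suc k)
  note D = Ck_on_has_derivative[OF Suc.prems(1)] Ck_on_has_derivative[OF Suc.prems(2)]
  have mem: "f x \<in> T" if "x \<in> S" for x using assms(3) that by auto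
  show ?case
  proof (rule Ck_on_SucI[OF assms(1) has_derivative_compose[OF D]])
    fix v
    let ?f' = "\<lambda>x. frechet_derivative f (at x) v"
    have "frechet_derivative g (at (f x)) (?f' x)
        = (\<Sum>b\<in>Basis. (?f' x \<bullet> b) *\<^sub>R frechet_derivative g (at (f x)) b)" if "x \<in> S" for x
    proof -
      have l: "linear (frechet_derivative g (at (f x)))"
        using D(2)[OF mem[OF that]] has_derivative_linear by blast
      have "frechet_derivative g (at (f x)) (\<Sum>b\<in>Basis. (?f' x \<bullet> b) *\<^sub>R b)
          = (\<Sum>b\<in>Basis. (?f' x \<bullet> b) *\<^sub>R frechet_derivative g (at (f x)) b)"
        by (simp add: linear_sum[OF l] linear_scale[OF l])
      then show ?thesis by (simp add: euclidean_representation)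
    qed
    moreover have "Ck_on k S (\<lambda>x. \<Sum>b\<in>Basis. (?f' x \<bullet> b) *\<^sub>R frechet_derivative g (at (f x)) b)"
      using Suc.prems Ck_on_SucD[OF Suc.prems(1)]
      by (intro Ck_on_sum Ck_on_bilinear[OF bounded_bilinear_scaleR] Ck_on_bilinear[OF bounded_bilinear_inner]
          Ck_on_const assms(1) Suc.IH) auto
    ultimately show "Ck_on k S (\<lambda>x. frechet_derivative g (at (f x)) (?f' x))"
      by (intro Ck_on_cong[OF assms(1) _ \<open>Ck_on k S (\<lambda>x. \<Sum>b\<in>Basis. _ b x)\<close>]) auto
  qed (use mem in auto)
qed

lemma Ck_on_locally:
  assumes "\<And>x. x \<in> S \<Longrightarrow> \<exists>T. open T \<and> x \<in> T \<and> Ck_on k T f"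
  shows "Ck_on k S f"
  using assms
proof (induction k arbitrary: f)
  case 0
  show ?case
    unfolding Ck_on.simps
  proof (rule continuous_at_imp_continuous_on, rule ballI)
    fix x assume "x \<in> S"
    then obtain T where "open T" "x \<in> T" "continuous_on T f" using 0 by force
    then show "isCont f x" using continuous_on_eq_continuous_at by blast
  qed
next
  case (Suc k)
  show ?case unfolding Ck_on.simps
  proof (intro conjI ballI allI)
    fix x assume "x \<in> S"
    then show "f differentiable at x" using Suc.prems by fastforce
  next
    fix v show "Ck_on k S (\<lambda>x. frechet_derivative f (at x) v)"
      by (rule Suc.IH) (use Suc.prems in force)
  qed
qed

lemma Ck_on_inverse: "Ck_on k (- {0}) (inverse :: real \<Rightarrow> real)"
proof (induction k)
  case 0
  then show ?case by (auto intro!: continuous_on_inverse continuous_on_id)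
next
  case (Suc k)
  have op: "open (- {0::real})" by auto
  show ?case
  proof (rule Ck_on_SucI[OF op has_derivative_inverse'])
    fix v
    show "Ck_on k (- {0}) (\<lambda>x::real. - (inverse x * v * inverse x))"
      using Ck_on_bilinear[OF bounded_bilinear_mult op Suc
          Ck_on_bilinear[OF bounded_bilinear_mult op Ck_on_const[OF op, of k "-v"] Suc]]
      by (simp add: mult.assoc)
  qed auto
qed


text \<open>Openness is part of the notion, so that derivatives at points of \<open>S\<close> depend only on the
  values on \<open>S\<close>.\<close>

definition Cinf_on :: "'a::real_normed_vector set \<Rightarrow> ('a \<Rightarrow> 'b::real_normed_vector) \<Rightarrow> bool" where
  "Cinf_on S f \<longleftrightarrow> open S \<and> (\<forall>k. Ck_on k S f)"

lemma Cinf_onD: "Cinf_on S f \<Longrightarrow> Ck_on k S f" "Cinf_on S f \<Longrightarrow> open S"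
  by (simp_all add: Cinf_on_def)

lemma Cinf_on_subset: "Cinf_on S f \<Longrightarrow> open T \<Longrightarrow> T \<subseteq> S \<Longrightarrow> Cinf_on T f"
  by (auto simp: Cinf_on_def intro: Ck_on_subset)

lemma Cinf_on_cong: "Cinf_on S f \<Longrightarrow> (\<And>x. x \<in> S \<Longrightarrow> f x = g x) \<Longrightarrow> Cinf_on S g"
  by (auto simp: Cinf_on_def intro: Ck_on_cong)

lemma Cinf_on_locally:
  assumes "\<And>x. x \<in> S \<Longrightarrow> \<exists>T. x \<in> T \<and> T \<subseteq> S \<and> Cinf_on T f"
  shows "Cinf_on S f"
proof -
  have "open S"
    unfolding open_subopen[of S] using assms by (force simp: Cinf_on_def)
  moreover have "Ck_on k S f" for k
    by (rule Ck_on_locally) (use assms in \<open>force simp: Cinf_on_def\<close>)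
  ultimately show ?thesis by (auto simp: Cinf_on_def)
qed

lemma Cinf_on_has_derivative:
  "Cinf_on S f \<Longrightarrow> x \<in> S \<Longrightarrow> (f has_derivative frechet_derivative f (at x)) (at x)"
  using Ck_on_has_derivative Cinf_onD(1) by blast

lemma Cinf_on_continuous_on: "Cinf_on S f \<Longrightarrow> continuous_on S f"
  using Cinf_onD(1)[of S f 0] by simp

lemma Cinf_on_derivative: "Cinf_on S f \<Longrightarrow> Cinf_on S (\<lambda>x. frechet_derivative f (at x) v)"
  unfolding Cinf_on_def by (metis Ck_on.simps(2))

lemma Cinf_on_const: "open S \<Longrightarrow> Cinf_on S (\<lambda>x. c)"
  by (simp add: Cinf_on_def Ck_on_const)

lemma Cinf_on_linear: "open S \<Longrightarrow> bounded_linear f \<Longrightarrow> Cinf_on S f"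
  by (simp add: Cinf_on_def Ck_on_linear)

lemma Cinf_on_sum:
  "open S \<Longrightarrow> (\<And>i. i \<in> I \<Longrightarrow> Cinf_on S (f i)) \<Longrightarrow> Cinf_on S (\<lambda>x. \<Sum>i\<in>I. f i x)"
  by (simp add: Cinf_on_def Ck_on_sum)

lemma Cinf_on_bilinear:
  "bounded_bilinear b \<Longrightarrow> Cinf_on S f \<Longrightarrow> Cinf_on S g \<Longrightarrow> Cinf_on S (\<lambda>x. b (f x) (g x))"
  by (simp add: Cinf_on_def Ck_on_bilinear)

lemma Cinf_on_compose:
  fixes f :: "'a::real_normed_vector \<Rightarrow> 'b::euclidean_space"
  shows "Cinf_on S f \<Longrightarrow> Cinf_on T g \<Longrightarrow> f ` S \<subseteq> T \<Longrightarrow> Cinf_on S (\<lambda>x. g (f x))"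
  unfolding Cinf_on_def by (blast intro: Ck_on_compose)

lemma Cinf_on_prod:
  fixes f :: "'i \<Rightarrow> 'a::real_normed_vector \<Rightarrow> real"
  shows "open S \<Longrightarrow> (\<And>i. i \<in> I \<Longrightarrow> Cinf_on S (f i)) \<Longrightarrow> Cinf_on S (\<lambda>x. \<Prod>i\<in>I. f i x)"
  by (induction I rule: infinite_finite_induct)
     (auto intro!: Cinf_on_const Cinf_on_bilinear[OF bounded_bilinear_mult])

lemma bounded_linear_axis: "bounded_linear (axis i :: 'b::euclidean_space \<Rightarrow> 'b ^ 'n)"
  by (intro linear_conv_bounded_linear[THEN iffD1] linearI) (auto simp: axis_def vec_eq_iff)

lemma vec_lambda_eq_sum_axis: "(\<chi> i. f i) = (\<Sum>i\<in>UNIV. axis i (f i))"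
  by (simp add: vec_eq_iff axis_def)

lemma Cinf_on_vec_lambda:
  fixes f :: "'n::finite \<Rightarrow> 'a::real_normed_vector \<Rightarrow> 'b::euclidean_space"
  assumes "open S" "\<And>i. Cinf_on S (f i)"
  shows "Cinf_on S (\<lambda>x. \<chi> i. f i x)"
  unfolding vec_lambda_eq_sum_axis
  by (intro Cinf_on_sum assms(1)
      Cinf_on_compose[OF assms(2) Cinf_on_linear[OF open_UNIV bounded_linear_axis]]) auto

lemma Cinf_on_vec_nth:
  fixes f :: "'a::real_normed_vector \<Rightarrow> 'b::euclidean_space ^ 'n"
  assumes "Cinf_on S f"
  shows "Cinf_on S (\<lambda>x. f x $ i)"
  by (rule Cinf_on_compose[OF assms Cinf_on_linear[OF open_UNIV bounded_linear_vec_nth]]) auto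

lemma Cinf_on_det:
  fixes f :: "'a::real_normed_vector \<Rightarrow> real ^ 'n ^ 'n"
  assumes "Cinf_on S f"
  shows "Cinf_on S (\<lambda>x. det (f x))"
  unfolding det_def
  by (intro Cinf_on_sum Cinf_onD(2)[OF assms] Cinf_on_bilinear[OF bounded_bilinear_mult] Cinf_on_const
      Cinf_on_prod Cinf_on_vec_nth assms)

lemma matrix_inv_right: "invertible A \<Longrightarrow> A ** matrix_inv A = mat 1"
  and matrix_inv_left: "invertible A \<Longrightarrow> matrix_inv A ** A = mat 1"
  using someI_ex[of "\<lambda>A'. A ** A' = mat 1 \<and> A' ** A = mat 1"]
  unfolding invertible_def matrix_inv_def by auto

text \<open>By Cramer's rule the entries of the inverse are quotients of determinants.\<close>

lemma Cinf_on_matrix_inv: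
  fixes f :: "'a::real_normed_vector \<Rightarrow> real ^ 'n ^ 'n"
  assumes f: "Cinf_on S f" and inv: "\<And>x. x \<in> S \<Longrightarrow> invertible (f x)"
  shows "Cinf_on S (\<lambda>x. matrix_inv (f x))"
proof -
  note op = Cinf_onD(2)[OF f]
  let ?N = "\<lambda>i j x. (\<chi> k l. if l = i then axis j 1 $ k else f x $ k $ l) :: real ^ 'n ^ 'n"
  have eq: "(\<chi> i j. inverse (det (f x)) * det (?N i j x)) = matrix_inv (f x)" if "x \<in> S" for x
  proof -
    have d: "det (f x) \<noteq> 0" using inv[OF that] by (simp add: invertible_det_nz)
    have ii: "f x ** matrix_inv (f x) = mat 1" using inv[OF that]
      by (simp add: matrix_inv_right)
    have "matrix_inv (f x) $ i $ j = det (?N i j x) / det (f x)" for i j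
    proof -
      have "f x *v column j (matrix_inv (f x)) = column j (f x ** matrix_inv (f x))"
        by (simp add: column_def matrix_matrix_mult_def matrix_vector_mult_def vec_eq_iff)
      also have "\<dots> = axis j 1" by (simp add: ii column_def mat_def axis_def vec_eq_iff)
      finally have "column j (matrix_inv (f x)) = (\<chi> k. det (\<chi> a b. if b = k then axis j 1 $ a else f x $ a $ b) / det (f x))"
        using cramer[OF d] by blast
      then have "column j (matrix_inv (f x)) $ i = det (?N i j x) / det (f x)" by simp
      then show ?thesis by (simp add: column_def)
    qed
    then show ?thesis by (simp add: vec_eq_iff field_simps)
  qed
  have N: "Cinf_on S (\<lambda>x. ?N i j x)" for i j
  proof (intro Cinf_on_vec_lambda op)
    show "Cinf_on S (\<lambda>x. if l = i then axis j 1 $ k else f x $ k $ l)" for k l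
      by (cases "l = i") (simp_all add: Cinf_on_const op Cinf_on_vec_nth f)
  qed
  have "Cinf_on S (\<lambda>x. inverse (det (f x)))"
    using inv by (intro Cinf_on_compose[OF Cinf_on_det[OF f], where g = inverse and T = "- {0}"])
      (auto simp: Cinf_on_def Ck_on_inverse invertible_det_nz)
  then show ?thesis
    by (intro Cinf_on_cong[OF _ eq] Cinf_on_vec_lambda op Cinf_on_bilinear[OF bounded_bilinear_mult]
        Cinf_on_det[OF N])
qed

lemma bounded_bilinear_matrix_matrix_mult:
  "bounded_bilinear ((**) :: real ^ 'm ^ 'n \<Rightarrow> real ^ 'k ^ 'm \<Rightarrow> real ^ 'k ^ 'n)"
  unfolding bilinear_conv_bounded_bilinear[symmetric] bilinear_def
  by (auto intro!: linearI simp: matrix_matrix_mult_def vec_eq_iff algebra_simps sum.distrib sum_distrib_left)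

lemma bounded_bilinear_vector_matrix_mult:
  "bounded_bilinear ((v*) :: real ^ 'n \<Rightarrow> real ^ 'm ^ 'n \<Rightarrow> real ^ 'm)"
  unfolding bilinear_conv_bounded_bilinear[symmetric] bilinear_def
  by (auto intro!: linearI simp: vector_matrix_mult_def vec_eq_iff algebra_simps sum.distrib sum_distrib_left)

section \<open>Integrals along rays, Taylor expansion and symmetry of second derivatives\<close>

lemma Ck_on_imp_continuous_on: "Ck_on k S f \<Longrightarrow> continuous_on S f"
proof (induction k)
  case (Suc k)
  then show ?case using Ck_on_SucD by blast
qed simp

lemma Blinfun_derivative_apply:
  assumes "Ck_on (Suc k) S f" "x \<in> S"
  shows "blinfun_apply (Blinfun (frechet_derivative f (at x))) = frechet_derivative f (at x)"
  using has_derivative_bounded_linear[OF Ck_on_has_derivative[OF assms]]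
  by (rule bounded_linear_Blinfun_apply)

lemma continuous_on_Blinfun_derivative:
  fixes f :: "'a::euclidean_space \<Rightarrow> 'b::real_normed_vector"
  assumes "Ck_on (Suc k) S f"
  shows "continuous_on S (\<lambda>x. Blinfun (frechet_derivative f (at x)))"
proof (rule continuous_on_blinfun_componentwise)
  fix i :: 'a
  have "continuous_on S (\<lambda>x. frechet_derivative f (at x) i)"
    using assms by (auto intro: Ck_on_imp_continuous_on)
  then show "continuous_on S (\<lambda>x. Blinfun (frechet_derivative f (at x)) i)"
    by (simp add: Blinfun_derivative_apply[OF assms] cong: continuous_on_cong)
qed

lemma ray_in_convex:
  fixes p :: "'a::real_vector"
  assumes "convex S" "p \<in> S" "y \<in> S" "0 \<le> t" "t \<le> 1"
  shows "p + t *\<^sub>R (y - p) \<in> S"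
proof -
  have "p + t *\<^sub>R (y - p) = (1 - t) *\<^sub>R p + t *\<^sub>R y" by (simp add: algebra_simps)
  then show ?thesis using assms by (simp add: convex_def)
qed

lemma continuous_on_ray_integrand:
  fixes p :: "'a::real_normed_vector" and f :: "'a \<Rightarrow> 'b::real_normed_vector"
  assumes "convex S" "p \<in> S" "continuous_on S f"
  shows "continuous_on (S \<times> cbox 0 1) (\<lambda>(y, t). t ^ m *\<^sub>R f (p + t *\<^sub>R (y - p)))"
  unfolding case_prod_unfold
proof (intro continuous_on_scaleR)
  have "p + t *\<^sub>R (y - p) \<in> S" if "y \<in> S" "t \<in> cbox 0 1" for y t
    using ray_in_convex[OF assms(1,2), of y t] that by (simp add: cbox_interval)
  then show "continuous_on (S \<times> cbox 0 1) (\<lambda>z. f (p + snd z *\<^sub>R (fst z - p)))"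
    by (intro continuous_on_compose2[OF assms(3)]) (auto intro!: continuous_intros)
qed (auto intro!: continuous_intros)

lemma continuous_on_ray:
  fixes p :: "'a::real_normed_vector" and f :: "'a \<Rightarrow> 'b::real_normed_vector"
  assumes "convex S" "p \<in> S" "continuous_on S f" "y \<in> S"
  shows "continuous_on {0..1} (\<lambda>t. f (p + t *\<^sub>R (y - p)))"
  using ray_in_convex[OF assms(1,2,4)]
  by (intro continuous_on_compose2[OF assms(3)]) (auto intro!: continuous_intros)

text \<open>Differentiation under the integral. Every derivative brings out a factor \<open>t\<close>; the weight
  \<open>t\<^sup>m\<close> lets the formula be iterated.\<close>

lemma has_derivative_ray_integral:
  fixes f :: "'a::euclidean_space \<Rightarrow> 'b::banach"
  assumes S: "open S" "convex S" "p \<in> S" and f: "Ck_on (Suc k) S f" and y: "y \<in> S"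
  shows "((\<lambda>y. integral {0..1} (\<lambda>t. t ^ m *\<^sub>R f (p + t *\<^sub>R (y - p)))) has_derivative
    (\<lambda>v. integral {0..1} (\<lambda>t. t ^ Suc m *\<^sub>R frechet_derivative f (at (p + t *\<^sub>R (y - p))) v))) (at y)"
proof -
  have ray: "p + t *\<^sub>R (y - p) \<in> S" if "y \<in> S" "t \<in> cbox 0 1" for y t
    using ray_in_convex[OF S(2,3), of y t] that by (simp add: cbox_interval)
  let ?B = "\<lambda>y t. (t ^ Suc m) *\<^sub>R Blinfun (frechet_derivative f (at (p + t *\<^sub>R (y - p))))"
  note cB = continuous_on_ray_integrand[OF S(2,3) continuous_on_Blinfun_derivative[OF f], of "Suc m"]
  have cBy: "continuous_on (cbox 0 1) (?B y)"
    using continuous_on_ray[OF S(2,3) continuous_on_Blinfun_derivative[OF f] y]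
    by (auto simp: cbox_interval intro!: continuous_intros)
  have "((\<lambda>y. integral (cbox 0 1) (\<lambda>t. t ^ m *\<^sub>R f (p + t *\<^sub>R (y - p)))) has_derivative
    blinfun_apply (integral (cbox 0 1) (?B y))) (at y within S)"
  proof (rule leibniz_rule[OF _ _ cB y S(2)])
    fix x t assume "x \<in> S" "t \<in> cbox 0 (1::real)"
    note m = ray[OF this]
    have "((\<lambda>x. t ^ m *\<^sub>R f (p + t *\<^sub>R (x - p))) has_derivative
      (\<lambda>v. t ^ m *\<^sub>R frechet_derivative f (at (p + t *\<^sub>R (x - p))) (t *\<^sub>R v))) (at x)"
      by (rule has_derivative_scaleR_right, rule has_derivative_compose[where f = "\<lambda>x. p + t *\<^sub>R (x - p)"])
         (auto intro!: derivative_eq_intros simp: Ck_on_has_derivative[OF f m])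
    also have "(\<lambda>v. t ^ m *\<^sub>R frechet_derivative f (at (p + t *\<^sub>R (x - p))) (t *\<^sub>R v)) = ?B x t"
      using linear_scale[OF has_derivative_linear[OF Ck_on_has_derivative[OF f m]]]
      by (simp add: blinfun.scaleR_left Blinfun_derivative_apply[OF f m] fun_eq_iff mult.commute)
    finally show "((\<lambda>x. t ^ m *\<^sub>R f (p + t *\<^sub>R (x - p))) has_derivative ?B x t) (at x within S)"
      by (rule has_derivative_at_withinI)
  next
    fix x assume "x \<in> S"
    then have "continuous_on {0..1} (\<lambda>t. t ^ m *\<^sub>R f (p + t *\<^sub>R (x - p)))"
      using continuous_on_ray[OF S(2,3) Ck_on_imp_continuous_on[OF f]] by (auto intro!: continuous_intros)
    then show "(\<lambda>t. t ^ m *\<^sub>R f (p + t *\<^sub>R (x - p))) integrable_on cbox 0 1"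
      unfolding cbox_interval by (rule integrable_continuous_interval)
  qed
  then have "((\<lambda>y. integral {0..1} (\<lambda>t. t ^ m *\<^sub>R f (p + t *\<^sub>R (y - p)))) has_derivative
    blinfun_apply (integral (cbox 0 1) (?B y))) (at y)"
    unfolding at_within_open[OF y S(1)] cbox_interval .
  also have "blinfun_apply (integral (cbox 0 1) (?B y))
    = (\<lambda>v. integral {0..1} (\<lambda>t. t ^ Suc m *\<^sub>R frechet_derivative f (at (p + t *\<^sub>R (y - p))) v))"
  proof
    fix v
    have "blinfun_apply (integral (cbox 0 1) (?B y)) v = integral (cbox 0 1) (\<lambda>t. ?B y t v)"
      by (rule blinfun_apply_integral[OF integrable_continuous[OF cBy]])
    also have "\<dots> = integral (cbox 0 1) (\<lambda>t. t ^ Suc m *\<^sub>R frechet_derivative f (at (p + t *\<^sub>R (y - p))) v)"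
      by (rule integral_cong) (simp add: blinfun.scaleR_left Blinfun_derivative_apply[OF f ray[OF y]])
    finally show "blinfun_apply (integral (cbox 0 1) (?B y)) v
      = integral {0..1} (\<lambda>t. t ^ Suc m *\<^sub>R frechet_derivative f (at (p + t *\<^sub>R (y - p))) v)"
      by (simp add: cbox_interval)
  qed
  finally show ?thesis .
qed

lemma Ck_on_ray_integral:
  fixes f :: "'a::euclidean_space \<Rightarrow> 'b::banach"
  assumes S: "open S" "convex S" "p \<in> S" and f: "Ck_on k S f"
  shows "Ck_on k S (\<lambda>y. integral {0..1} (\<lambda>t. t ^ m *\<^sub>R f (p + t *\<^sub>R (y - p))))"
  using f
proof (induction k arbitrary: f m)
  case (0 f m)
  then have "continuous_on S f" by simp
  from integral_continuous_on_param[OF continuous_on_ray_integrand[OF S(2,3) this]]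
  show ?case by (simp add: cbox_interval)
next
  case (Suc k f m)
  show ?case
  proof (rule Ck_on_SucI[OF S(1) has_derivative_ray_integral[OF S Suc.prems]])
    fix v
    have "Ck_on k S (\<lambda>x. frechet_derivative f (at x) v)" using Suc.prems by simp
    then show "Ck_on k S (\<lambda>y. integral {0..1} (\<lambda>t. t ^ Suc m *\<^sub>R frechet_derivative f (at (p + t *\<^sub>R (y - p))) v))"
      by (rule Suc.IH)
  qed
qed

text \<open>The fundamental theorem of calculus on the segment from \<open>p\<close> to \<open>y\<close>, with the derivative
  of \<open>f\<close> in the direction \<open>y - p\<close> expanded in the basis.\<close>

lemma Hadamard_expansion:
  fixes f :: "'a::euclidean_space \<Rightarrow> real"
  assumes S: "convex S" "p \<in> S" and f: "Cinf_on S f"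
  obtains g where "\<And>b. b \<in> Basis \<Longrightarrow> Cinf_on S (g b)"
    and "\<And>y. y \<in> S \<Longrightarrow> f y = f p + (\<Sum>b\<in>Basis. ((y - p) \<bullet> b) * g b y)"
    and "\<And>b. b \<in> Basis \<Longrightarrow> g b p = frechet_derivative f (at p) b"
proof -
  let ?d = "\<lambda>b y. frechet_derivative f (at y) b"
  let ?g = "\<lambda>b y. integral {0..1} (\<lambda>t. ?d b (p + t *\<^sub>R (y - p)))"
  note op = Cinf_onD(2)[OF f]
  have smooth: "Cinf_on S (?g b)" for b
    using Ck_on_ray_integral[OF op S, where m = 0 and f = "?d b"] Cinf_on_derivative[OF f, of b]
    by (simp add: Cinf_on_def)
  have "f y = f p + (\<Sum>b\<in>Basis. ((y - p) \<bullet> b) * ?g b y)" if y: "y \<in> S" for y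
  proof -
  have m: "p + t *\<^sub>R (y - p) \<in> S" if "0 \<le> t" "t \<le> 1" for t
    using ray_in_convex[OF S y] that by auto
  have "((\<lambda>t. frechet_derivative f (at (p + t *\<^sub>R (y - p))) (y - p)) has_integral
      f (p + 1 *\<^sub>R (y - p)) - f (p + 0 *\<^sub>R (y - p))) {0..1}"
  proof (rule fundamental_theorem_of_calculus)
    fix t :: real assume "t \<in> {0..1}"
    then have t: "p + t *\<^sub>R (y - p) \<in> S" using m by auto
    have "((\<lambda>t. f (p + t *\<^sub>R (y - p))) has_derivative
      (\<lambda>h. frechet_derivative f (at (p + t *\<^sub>R (y - p))) (h *\<^sub>R (y - p)))) (at t)"
      by (rule has_derivative_compose[where f = "\<lambda>t. p + t *\<^sub>R (y - p)"])
        (auto intro!: derivative_eq_intros simp: Cinf_on_has_derivative[OF f t])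
    then show "((\<lambda>t. f (p + t *\<^sub>R (y - p))) has_vector_derivative frechet_derivative f (at (p + t *\<^sub>R (y - p))) (y - p))
      (at t within {0..1})"
      using linear_scale[OF has_derivative_linear[OF Cinf_on_has_derivative[OF f t]]]
      by (auto simp: has_vector_derivative_def intro: has_derivative_at_withinI)
  qed simp
  then have "f y - f p = integral {0..1} (\<lambda>t. frechet_derivative f (at (p + t *\<^sub>R (y - p))) (y - p))"
    by (simp add: integral_unique)
  also have "\<dots> = integral {0..1} (\<lambda>t. \<Sum>b\<in>Basis. ((y - p) \<bullet> b) * ?d b (p + t *\<^sub>R (y - p)))"
  proof (rule integral_cong)
    fix t :: real assume "t \<in> {0..1}"
    then have l: "linear (frechet_derivative f (at (p + t *\<^sub>R (y - p))))"
      using has_derivative_linear[OF Cinf_on_has_derivative[OF f m]] by auto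
    have "frechet_derivative f (at (p + t *\<^sub>R (y - p))) (\<Sum>b\<in>Basis. ((y - p) \<bullet> b) *\<^sub>R b)
      = (\<Sum>b\<in>Basis. ((y - p) \<bullet> b) * ?d b (p + t *\<^sub>R (y - p)))"
      by (simp add: linear_sum[OF l] linear_scale[OF l])
    then show "frechet_derivative f (at (p + t *\<^sub>R (y - p))) (y - p)
      = (\<Sum>b\<in>Basis. ((y - p) \<bullet> b) * ?d b (p + t *\<^sub>R (y - p)))"
      by (simp add: euclidean_representation)
  qed
  also have "\<dots> = (\<Sum>b\<in>Basis. integral {0..1} (\<lambda>t. ((y - p) \<bullet> b) * ?d b (p + t *\<^sub>R (y - p))))"
  proof (rule integral_sum)
    fix b :: 'a
    have "continuous_on {0..1} (\<lambda>t. ?d b (p + t *\<^sub>R (y - p)))"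
      by (rule continuous_on_compose2[OF Cinf_on_continuous_on[OF Cinf_on_derivative[OF f, of b]]])
        (use m in \<open>auto intro!: continuous_intros\<close>)
    then show "(\<lambda>t. ((y - p) \<bullet> b) * ?d b (p + t *\<^sub>R (y - p))) integrable_on {0..1}"
      by (intro integrable_continuous_interval continuous_intros)
  qed simp
  also have "\<dots> = (\<Sum>b\<in>Basis. ((y - p) \<bullet> b) * ?g b y)"
    by simp
  finally show ?thesis by (simp only: diff_eq_eq add.commute)
  qed
  then show thesis
    by (intro that[of ?g] smooth) simp_all
qed

lemma frechet_derivative_line:
  fixes f :: "'a::real_normed_vector \<Rightarrow> real"
  assumes f: "Cinf_on S f" and m: "a + t *\<^sub>R u \<in> S"
  shows "((\<lambda>t. f (a + t *\<^sub>R u)) has_real_derivative frechet_derivative f (at (a + t *\<^sub>R u)) u) (at t)"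
proof -
  have "((\<lambda>t. f (a + t *\<^sub>R u)) has_derivative (\<lambda>h. frechet_derivative f (at (a + t *\<^sub>R u)) (h *\<^sub>R u))) (at t)"
    by (rule has_derivative_compose[where f = "\<lambda>t. a + t *\<^sub>R u", OF _ Cinf_on_has_derivative[OF f m]])
      (auto intro!: derivative_eq_intros)
  moreover have "(\<lambda>h. frechet_derivative f (at (a + t *\<^sub>R u)) (h *\<^sub>R u)) = (*) (frechet_derivative f (at (a + t *\<^sub>R u)) u)"
    by (rule ext) (simp add: linear_scale[OF has_derivative_linear[OF Cinf_on_has_derivative[OF f m]]])
  ultimately show ?thesis
    by (simp add: has_field_derivative_def)
qed

text \<open>The mean value theorem, first in the direction \<open>u\<close> and then in the direction \<open>v\<close>. The left
  side is symmetric in \<open>u\<close> and \<open>v\<close>, which yields the symmetry of second derivatives.\<close>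

lemma second_difference_mean_value:
  fixes f :: "'a::real_normed_vector \<Rightarrow> real"
  assumes f: "Cinf_on S f" and s: "0 < s"
    and m: "\<And>a b. 0 \<le> a \<Longrightarrow> a \<le> s \<Longrightarrow> 0 \<le> b \<Longrightarrow> b \<le> s \<Longrightarrow> x + a *\<^sub>R u + b *\<^sub>R v \<in> S"
  shows "\<exists>a b. 0 < a \<and> a < s \<and> 0 < b \<and> b < s \<and>
    f (x + s *\<^sub>R u + s *\<^sub>R v) - f (x + s *\<^sub>R u) - f (x + s *\<^sub>R v) + f x
      = s * s * frechet_derivative (\<lambda>y. frechet_derivative f (at y) u) (at (x + a *\<^sub>R u + b *\<^sub>R v)) v"
proof -
  let ?fu = "\<lambda>y. frechet_derivative f (at y) u"
  have "\<exists>a. 0 < a \<and> a < s \<and>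
     (f ((x + s *\<^sub>R v) + s *\<^sub>R u) - f (x + s *\<^sub>R u)) - (f ((x + s *\<^sub>R v) + 0 *\<^sub>R u) - f (x + 0 *\<^sub>R u))
     = (s - 0) * (?fu ((x + s *\<^sub>R v) + a *\<^sub>R u) - ?fu (x + a *\<^sub>R u))"
    by (rule MVT2[OF s, where f = "\<lambda>a. f ((x + s *\<^sub>R v) + a *\<^sub>R u) - f (x + a *\<^sub>R u)"],
        intro DERIV_diff frechet_derivative_line[OF f])
      (use m[of _ s] m[of _ 0] s in \<open>auto simp: algebra_simps\<close>)
  then obtain a where a: "0 < a" "a < s" and eq: "f (x + s *\<^sub>R u + s *\<^sub>R v) - f (x + s *\<^sub>R u) - f (x + s *\<^sub>R v) + f x
    = s * (?fu ((x + a *\<^sub>R u) + s *\<^sub>R v) - ?fu ((x + a *\<^sub>R u) + 0 *\<^sub>R v))"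
    by (auto simp: algebra_simps)
  have "\<exists>b. 0 < b \<and> b < s \<and> ?fu ((x + a *\<^sub>R u) + s *\<^sub>R v) - ?fu ((x + a *\<^sub>R u) + 0 *\<^sub>R v)
     = (s - 0) * frechet_derivative ?fu (at (x + a *\<^sub>R u + b *\<^sub>R v)) v"
    by (rule MVT2[OF s], intro frechet_derivative_line[OF Cinf_on_derivative[OF f]])
      (use m[of a] a in auto)
  then show ?thesis using a eq by auto
qed

lemma second_derivative_symmetric:
  fixes f :: "'a::real_normed_vector \<Rightarrow> real"
  assumes f: "Cinf_on S f" and x: "x \<in> S"
  shows "frechet_derivative (\<lambda>y. frechet_derivative f (at y) u) (at x) v
       = frechet_derivative (\<lambda>y. frechet_derivative f (at y) v) (at x) u"
proof -
  let ?D = "\<lambda>u v y. frechet_derivative (\<lambda>y. frechet_derivative f (at y) u) (at y) v"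
  obtain e where e: "e > 0" "ball x e \<subseteq> S" using Cinf_onD(2)[OF f] x openE by blast
  have cont: "(?D u v \<longlongrightarrow> ?D u v x) (at x)" for u v
    using Cinf_on_continuous_on[OF Cinf_on_derivative[OF Cinf_on_derivative[OF f, of u], of v]]
      Cinf_onD(2)[OF f] x by (auto simp: continuous_on_eq_continuous_at isCont_def)
  have close: "\<exists>d>0. \<forall>y. dist y x < d \<longrightarrow> \<bar>?D u v y - ?D u v x\<bar> < r" if "r > 0" for r u v
    using cont[of u v] that unfolding LIM_def by (metis dist_self dist_real_def)
  show ?thesis
  proof (rule ccontr)
    assume ne: "?D u v x \<noteq> ?D v u x"
    define r where "r = \<bar>?D u v x - ?D v u x\<bar> / 2"
    have r: "r > 0" using ne by (simp add: r_def)
    obtain d1 where d1: "d1 > 0" "\<And>y. dist y x < d1 \<Longrightarrow> \<bar>?D u v y - ?D u v x\<bar> < r" using close[OF r] by blast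
    obtain d2 where d2: "d2 > 0" "\<And>y. dist y x < d2 \<Longrightarrow> \<bar>?D v u y - ?D v u x\<bar> < r" using close[OF r] by blast
    define d where "d = Min {e, d1, d2}"
    have d: "d > 0" "d \<le> e" "d \<le> d1" "d \<le> d2" using e d1 d2 by (auto simp: d_def)
    define s where "s = d / (2 * (norm u + norm v + 1))"
    have s: "s > 0" using d unfolding s_def by (simp add: add_nonneg_pos)
    have near: "dist (x + a *\<^sub>R u + b *\<^sub>R v) x < d" if "0 \<le> a" "a \<le> s" "0 \<le> b" "b \<le> s" for a b
    proof -
      have "dist (x + a *\<^sub>R u + b *\<^sub>R v) x = norm (a *\<^sub>R u + b *\<^sub>R v)" by (simp add: dist_norm)
      also have "\<dots> \<le> a * norm u + b * norm v" using that norm_triangle_ineq[of "a *\<^sub>R u" "b *\<^sub>R v"] by simp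
      also have "\<dots> \<le> s * norm u + s * norm v" using that by (intro add_mono mult_right_mono) auto
      also have "\<dots> < s * (2 * (norm u + norm v + 1))" using s by (simp add: algebra_simps add_nonneg_pos)
      also have "\<dots> = d" using add_nonneg_pos[of "norm u + norm v" 1] unfolding s_def by simp
      finally show ?thesis .
    qed
    then have inS: "x + a *\<^sub>R u + b *\<^sub>R v \<in> S" if "0 \<le> a" "a \<le> s" "0 \<le> b" "b \<le> s" for a b
      using that d e(2) by (force simp: dist_commute mem_ball)
    obtain a b where ab: "0 < a" "a < s" "0 < b" "b < s"
      "f (x + s *\<^sub>R u + s *\<^sub>R v) - f (x + s *\<^sub>R u) - f (x + s *\<^sub>R v) + f x = s * s * ?D u v (x + a *\<^sub>R u + b *\<^sub>R v)"
      using second_difference_mean_value[OF f s inS] by blast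
    have inS': "x + a *\<^sub>R v + b *\<^sub>R u \<in> S" if "0 \<le> a" "a \<le> s" "0 \<le> b" "b \<le> s" for a b
      using inS[of b a] that by (simp add: add.commute add.left_commute)
    obtain a' b' where ab': "0 < a'" "a' < s" "0 < b'" "b' < s"
      "f (x + s *\<^sub>R v + s *\<^sub>R u) - f (x + s *\<^sub>R v) - f (x + s *\<^sub>R u) + f x = s * s * ?D v u (x + a' *\<^sub>R v + b' *\<^sub>R u)"
      using second_difference_mean_value[OF f s inS'] by blast
    have "s * s * ?D u v (x + a *\<^sub>R u + b *\<^sub>R v) = s * s * ?D v u (x + a' *\<^sub>R v + b' *\<^sub>R u)"
      using ab(5) ab'(5) by (simp add: algebra_simps)
    then have "?D u v (x + a *\<^sub>R u + b *\<^sub>R v) = ?D v u (x + a' *\<^sub>R v + b' *\<^sub>R u)" using s by simp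
    moreover have "\<bar>?D u v (x + a *\<^sub>R u + b *\<^sub>R v) - ?D u v x\<bar> < r"
      using near[of a b] ab d by (intro d1) auto
    moreover have "\<bar>?D v u (x + a' *\<^sub>R v + b' *\<^sub>R u) - ?D v u x\<bar> < r"
      using near[of b' a'] ab' d by (intro d2) (auto simp: algebra_simps)
    ultimately have "\<bar>?D u v x - ?D v u x\<bar> < 2 * r" by linarith
    then show False by (simp add: r_def)
  qed
qed

section \<open>Integration of flat linear systems\<close>

lemma geometric_Cauchy_limit:
  fixes u :: "nat \<Rightarrow> 'a::banach"
  assumes d: "\<And>n. norm (u (Suc n) - u n) \<le> C / 2 ^ n"
  obtains l where "u \<longlonglongrightarrow> l" "\<And>n. norm (u n - l) \<le> 2 * C / 2 ^ n"
proof -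
  have C: "0 \<le> C" using order_trans[OF norm_ge_zero d[of 0]] by simp
  have tail: "norm (u (n + m) - u n) \<le> 2 * C / 2 ^ n - 2 * C / 2 ^ (n + m)" for n m
  proof (induction m)
    case (Suc m)
    have "norm (u (n + Suc m) - u n) \<le> norm (u (Suc (n + m)) - u (n + m)) + norm (u (n + m) - u n)"
      using norm_triangle_ineq[of "u (Suc (n + m)) - u (n + m)" "u (n + m) - u n"] by simp
    also have "\<dots> \<le> C / 2 ^ (n + m) + (2 * C / 2 ^ n - 2 * C / 2 ^ (n + m))"
      by (intro add_mono d Suc)
    also have "\<dots> = 2 * C / 2 ^ n - 2 * C / 2 ^ (n + Suc m)" by (simp add: field_simps)
    finally show ?case .
  qed simp
  then have tail': "norm (u (n + m) - u n) \<le> 2 * C / 2 ^ n" for n m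
    by (rule order_trans) (use C in simp)
  have lim0: "(\<lambda>n. 2 * C / 2 ^ n) \<longlonglongrightarrow> 0"
    using tendsto_mult_right_zero[OF LIMSEQ_power_zero[of "1/2::real"], of "2 * C"]
    by (simp add: power_divide)
  have "Cauchy u"
  proof (rule CauchyI)
    fix e :: real assume "0 < e"
    then obtain N where N: "2 * C / 2 ^ N < e / 2"
      using order_tendstoD(2)[OF lim0, of "e / 2"] by (auto simp: eventually_sequentially)
    have near: "norm (u m - u N) \<le> 2 * C / 2 ^ N" if "m \<ge> N" for m
      using tail'[of N "m - N"] that by simp
    have "norm (u m - u n) < e" if "m \<ge> N" "n \<ge> N" for m n
    proof -
      have "norm (u m - u n) \<le> norm (u m - u N) + norm (u n - u N)"
        using norm_triangle_ineq4[of "u m - u N" "u n - u N"] by simp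
      with N near[OF that(1)] near[OF that(2)] show ?thesis by linarith
    qed
    then show "\<exists>M. \<forall>m\<ge>M. \<forall>n\<ge>M. norm (u m - u n) < e" by blast
  qed
  then obtain l where l: "u \<longlonglongrightarrow> l" using convergent_eq_Cauchy by blast
  moreover have "norm (u n - l) \<le> 2 * C / 2 ^ n" for n
  proof (rule Lim_bounded)
    show "(\<lambda>m. norm (u n - u m)) \<longlonglongrightarrow> norm (u n - l)" by (intro tendsto_intros l)
    show "\<forall>m\<ge>n. norm (u n - u m) \<le> 2 * C / 2 ^ n"
      using tail'[of n "m - n" for m] by (metis le_add_diff_inverse norm_minus_commute)
  qed
  ultimately show thesis using that by blast
qed

text \<open>The system \<open>dg = - A g\<close> on an open set \<open>S\<close>, where \<open>A y v\<close> is the endomorphism that the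
  connection form assigns to the direction \<open>v\<close> at \<open>y\<close>. The last assumption is
  \<open>dA + A \<and> A = 0\<close>.\<close>

locale flat_linear_system =
  fixes S :: "'d::euclidean_space set" and A :: "'d \<Rightarrow> 'd \<Rightarrow> 'a::euclidean_space \<Rightarrow> 'a"
  assumes bilinear_A: "\<And>y. bilinear (A y)"
    and smooth_A: "\<And>v w. Cinf_on S (\<lambda>y. A y v w)"
    and flat_A: "\<And>y u v w. y \<in> S \<Longrightarrow>
      frechet_derivative (\<lambda>y. A y v w) (at y) u - frechet_derivative (\<lambda>y. A y u w) (at y) v
      + A y u (A y v w) - A y v (A y u w) = 0"
begin

lemma linear_A: "linear (A y v)" and linear_A': "linear (\<lambda>v. A y v w)"
  using bilinear_A[of y] by (auto simp: bilinear_def)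

lemma A_expand: "A y v w = (\<Sum>j\<in>Basis. (w \<bullet> j) *\<^sub>R A y v j)"
  and A_expand': "A y v w = (\<Sum>b\<in>Basis. (v \<bullet> b) *\<^sub>R A y b w)"
proof -
  have "A y v (\<Sum>j\<in>Basis. (w \<bullet> j) *\<^sub>R j) = (\<Sum>j\<in>Basis. (w \<bullet> j) *\<^sub>R A y v j)"
    by (simp add: linear_sum[OF linear_A] linear_scale[OF linear_A])
  then show "A y v w = (\<Sum>j\<in>Basis. (w \<bullet> j) *\<^sub>R A y v j)" by (simp add: euclidean_representation)
  have "A y (\<Sum>b\<in>Basis. (v \<bullet> b) *\<^sub>R b) w = (\<Sum>b\<in>Basis. (v \<bullet> b) *\<^sub>R A y b w)"
    by (simp add: linear_sum[OF linear_A'] linear_scale[OF linear_A'])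
  then show "A y v w = (\<Sum>b\<in>Basis. (v \<bullet> b) *\<^sub>R A y b w)" by (simp add: euclidean_representation)
qed

lemma openS: "open S" using Cinf_onD(2)[OF smooth_A] .

lemma Ck_on_A_apply:
  assumes "T \<subseteq> S" "open T" "Ck_on k T g"
  shows "Ck_on k T (\<lambda>y. A y v (g y))"
proof (rule Ck_on_cong)
  show "Ck_on k T (\<lambda>y. \<Sum>j\<in>Basis. (g y \<bullet> j) *\<^sub>R A y v j)"
    by (intro Ck_on_sum Ck_on_bilinear[OF bounded_bilinear_scaleR] Ck_on_bilinear[OF bounded_bilinear_inner]
        Ck_on_const assms Ck_on_subset[OF Cinf_onD(1)[OF smooth_A]])
  show "(\<Sum>j\<in>Basis. (g y \<bullet> j) *\<^sub>R A y v j) = A y v (g y)" for y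
    by (rule A_expand[symmetric])
qed (rule assms)

lemma Cinf_on_A_apply: "Cinf_on S g \<Longrightarrow> Cinf_on S (\<lambda>y. A y v (g y))"
  using Ck_on_A_apply[OF order_refl openS] by (simp add: Cinf_on_def)

text \<open>The curvature identity for a section: with \<open>\<nabla>\<^sub>u g = \<partial>\<^sub>u g + A u g\<close>, flatness makes the
  exterior derivative of the \<open>1\<close>-form \<open>v \<mapsto> A v g\<close> depend on \<open>\<nabla>g\<close> alone.\<close>

lemma A_apply_derivative_antisymmetric:
  assumes y: "y \<in> S" and g: "Cinf_on S g"
  defines "\<omega> \<equiv> \<lambda>u. frechet_derivative g (at y) u + A y u (g y)"
  shows "frechet_derivative (\<lambda>y. A y v (g y)) (at y) u - frechet_derivative (\<lambda>y. A y u (g y)) (at y) v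
    = A y v (\<omega> u) - A y u (\<omega> v)"
proof -
  let ?Dg = "frechet_derivative g (at y)"
  have D: "frechet_derivative (\<lambda>y. A y v (g y)) (at y) u
    = frechet_derivative (\<lambda>y'. A y' v (g y)) (at y) u + A y v (?Dg u)" for u v
  proof -
    note DA = Cinf_on_has_derivative[OF smooth_A y]
    have "((\<lambda>y. \<Sum>j\<in>Basis. (g y \<bullet> j) *\<^sub>R A y v j) has_derivative
      (\<lambda>u. \<Sum>j\<in>Basis. (g y \<bullet> j) *\<^sub>R frechet_derivative (\<lambda>y. A y v j) (at y) u + (?Dg u \<bullet> j) *\<^sub>R A y v j)) (at y)"
      by (intro has_derivative_sum has_derivative_scaleR has_derivative_inner_left Cinf_on_has_derivative[OF g y] DA)
    then have 1: "frechet_derivative (\<lambda>y. A y v (g y)) (at y)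
      = (\<lambda>u. \<Sum>j\<in>Basis. (g y \<bullet> j) *\<^sub>R frechet_derivative (\<lambda>y. A y v j) (at y) u + (?Dg u \<bullet> j) *\<^sub>R A y v j)"
      unfolding A_expand[symmetric] by (rule frechet_derivative_at[symmetric])
    have "((\<lambda>y'. \<Sum>j\<in>Basis. (g y \<bullet> j) *\<^sub>R A y' v j) has_derivative
      (\<lambda>u. \<Sum>j\<in>Basis. (g y \<bullet> j) *\<^sub>R frechet_derivative (\<lambda>y. A y v j) (at y) u)) (at y)"
      by (intro has_derivative_sum has_derivative_scaleR_right DA)
    then have 2: "frechet_derivative (\<lambda>y'. A y' v (g y)) (at y)
      = (\<lambda>u. \<Sum>j\<in>Basis. (g y \<bullet> j) *\<^sub>R frechet_derivative (\<lambda>y. A y v j) (at y) u)"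
      unfolding A_expand[symmetric] by (rule frechet_derivative_at[symmetric])
    show ?thesis unfolding 1 2 A_expand[of y v "?Dg u"] by (simp add: sum.distrib)
  qed
  show ?thesis
    using flat_A[OF y, of v "g y" u] unfolding D[of v u] D[of u v]
    by (simp add: \<omega>_def linear_add[OF linear_A] algebra_simps)
qed

lemma A_apply_derivative_linear:
  assumes y: "y \<in> S" and g: "Cinf_on S g"
  shows "frechet_derivative (\<lambda>y. A y q (g y)) (at y) u
    = (\<Sum>b\<in>Basis. (q \<bullet> b) *\<^sub>R frechet_derivative (\<lambda>y. A y b (g y)) (at y) u)"
proof -
  have "((\<lambda>y. \<Sum>b\<in>Basis. (q \<bullet> b) *\<^sub>R A y b (g y)) has_derivative
    (\<lambda>u. \<Sum>b\<in>Basis. (q \<bullet> b) *\<^sub>R frechet_derivative (\<lambda>y. A y b (g y)) (at y) u)) (at y)"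
    by (intro has_derivative_sum has_derivative_scaleR_right Cinf_on_has_derivative[OF Cinf_on_A_apply[OF g] y])
  then have "frechet_derivative (\<lambda>y. A y q (g y)) (at y)
    = (\<lambda>u. \<Sum>b\<in>Basis. (q \<bullet> b) *\<^sub>R frechet_derivative (\<lambda>y. A y b (g y)) (at y) u)"
    unfolding A_expand'[symmetric] by (rule frechet_derivative_at[symmetric])
  then show ?thesis by simp
qed

text \<open>The Picard operator for parallel transport along the rays from \<open>p\<close>.\<close>

definition ray_transport :: "'d \<Rightarrow> 'a \<Rightarrow> ('d \<Rightarrow> 'a) \<Rightarrow> 'd \<Rightarrow> 'a" where
  "ray_transport p w g x =
     w - (\<Sum>b\<in>Basis. ((x - p) \<bullet> b) *\<^sub>R integral {0..1} (\<lambda>t. A (p + t *\<^sub>R (x - p)) b (g (p + t *\<^sub>R (x - p)))))"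

lemma ray_transport_center [simp]: "ray_transport p w g p = w"
  by (simp add: ray_transport_def)

definition picard :: "'d \<Rightarrow> 'a \<Rightarrow> nat \<Rightarrow> 'd \<Rightarrow> 'a" where
  "picard p w n = (ray_transport p w ^^ n) (\<lambda>x. w)"

lemma picard_0 [simp]: "picard p w 0 = (\<lambda>x. w)"
  and picard_Suc [simp]: "picard p w (Suc n) = ray_transport p w (picard p w n)"
  by (simp_all add: picard_def)

context
  fixes p assumes S: "convex S" "p \<in> S"
begin

lemma Cinf_on_ray_transport:
  assumes g: "Cinf_on S g"
  shows "Cinf_on S (ray_transport p w g)"
proof -
  have "Ck_on k S (\<lambda>x. integral {0..1} (\<lambda>t. A (p + t *\<^sub>R (x - p)) b (g (p + t *\<^sub>R (x - p)))))" for k b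
    using Ck_on_ray_integral[OF openS S Ck_on_A_apply[OF order_refl openS Cinf_onD(1)[OF g]], where m = 0] by simp
  then have J: "Cinf_on S (\<lambda>x. integral {0..1} (\<lambda>t. A (p + t *\<^sub>R (x - p)) b (g (p + t *\<^sub>R (x - p)))))" for b
    by (simp add: Cinf_on_def openS)
  have lin: "Cinf_on S (\<lambda>x. (x - p) \<bullet> b)" for b
  proof -
    have "Cinf_on S (\<lambda>x. x \<bullet> b + (- (p \<bullet> b)))"
      unfolding Cinf_on_def
      using Ck_on_add[OF openS Ck_on_linear[OF openS bounded_linear_inner_left] Ck_on_const[OF openS]] openS
      by blast
    then show ?thesis by (rule Cinf_on_cong) (simp add: inner_diff_left)
  qed
  have sm: "Cinf_on S (\<lambda>x. - 1 *\<^sub>R (\<Sum>b\<in>Basis. ((x - p) \<bullet> b) *\<^sub>R integral {0..1} (\<lambda>t. A (p + t *\<^sub>R (x - p)) b (g (p + t *\<^sub>R (x - p))))))"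
    by (intro Cinf_on_bilinear[OF bounded_bilinear_scaleR] Cinf_on_sum lin J openS Cinf_on_const)
  have "Ck_on k S (ray_transport p w g)" for k
    by (rule Ck_on_cong[OF openS _ Ck_on_add[OF openS Ck_on_const[OF openS, of k w] Cinf_onD(1)[OF sm]]])
      (simp add: ray_transport_def)
  then show ?thesis by (simp add: Cinf_on_def openS)
qed

lemma ray_transport_eq:
  assumes g: "Cinf_on S g" and x: "x \<in> S"
  shows "ray_transport p w g x = w - integral {0..1} (\<lambda>t. A (p + t *\<^sub>R (x - p)) (x - p) (g (p + t *\<^sub>R (x - p))))"
proof -
  have "integral {0..1} (\<lambda>t. \<Sum>b\<in>Basis. ((x - p) \<bullet> b) *\<^sub>R A (p + t *\<^sub>R (x - p)) b (g (p + t *\<^sub>R (x - p))))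
    = (\<Sum>b\<in>Basis. integral {0..1} (\<lambda>t. ((x - p) \<bullet> b) *\<^sub>R A (p + t *\<^sub>R (x - p)) b (g (p + t *\<^sub>R (x - p)))))"
    by (intro integral_sum integrable_continuous_interval continuous_on_scaleR continuous_on_const
        continuous_on_ray[OF S Cinf_on_continuous_on[OF Cinf_on_A_apply[OF g]] x]) simp
  then show ?thesis unfolding ray_transport_def A_expand'[symmetric] by simp
qed

text \<open>Cartan's formula for the homotopy operator \<open>K\<close> along rays, \<open>dK + Kd = id\<close>, applied to the
  \<open>1\<close>-form \<open>A g\<close>.\<close>

lemma ray_transport_derivative:
  assumes g: "Cinf_on S g" and x: "x \<in> S"
  defines "\<omega> \<equiv> \<lambda>y u. frechet_derivative g (at y) u + A y u (g y)"
  shows "frechet_derivative (ray_transport p w g) (at x) v = - A x v (g x)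
    - integral {0..1} (\<lambda>t. t *\<^sub>R (A (p + t *\<^sub>R (x - p)) (x - p) (\<omega> (p + t *\<^sub>R (x - p)) v)
        - A (p + t *\<^sub>R (x - p)) v (\<omega> (p + t *\<^sub>R (x - p)) (x - p))))"
proof -
  let ?q = "x - p" and ?z = "\<lambda>t. p + t *\<^sub>R (x - p)"
  let ?h = "\<lambda>v y. A y v (g y)"
  let ?Dh = "\<lambda>v y u. frechet_derivative (\<lambda>y. A y v (g y)) (at y) u"
  note h = Cinf_on_A_apply[OF g]
  have z: "?z t \<in> S" if "t \<in> {0..1}" for t using ray_in_convex[OF S x] that by simp
  have c: "continuous_on {0..1} (\<lambda>t. ?h v (?z t))" for v
    using continuous_on_ray[OF S Cinf_on_continuous_on[OF h] x] .
  have cD: "continuous_on {0..1} (\<lambda>t. t *\<^sub>R ?Dh v (?z t) u)" for v u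
    using continuous_on_ray[OF S Cinf_on_continuous_on[OF Cinf_on_derivative[OF h]] x]
    by (intro continuous_on_scaleR continuous_on_id)
  note int = integrable_continuous_interval
  have "((\<lambda>x. \<Sum>b\<in>Basis. ((x - p) \<bullet> b) *\<^sub>R integral {0..1} (\<lambda>t. ?h b (p + t *\<^sub>R (x - p)))) has_derivative
    (\<lambda>v. \<Sum>b\<in>Basis. (?q \<bullet> b) *\<^sub>R integral {0..1} (\<lambda>t. t *\<^sub>R ?Dh b (?z t) v)
       + (v \<bullet> b) *\<^sub>R integral {0..1} (\<lambda>t. ?h b (?z t)))) (at x)"
  proof (intro has_derivative_sum has_derivative_scaleR)
    show "((\<lambda>x. (x - p) \<bullet> b) has_derivative (\<lambda>v. v \<bullet> b)) (at x)" for b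
      by (auto intro!: derivative_eq_intros)
    show "((\<lambda>x. integral {0..1} (\<lambda>t. ?h b (p + t *\<^sub>R (x - p)))) has_derivative
      (\<lambda>v. integral {0..1} (\<lambda>t. t *\<^sub>R ?Dh b (?z t) v))) (at x)" for b
      using has_derivative_ray_integral[OF openS S Cinf_onD(1)[OF h] x, where m = 0] by simp
  qed
  then have "((\<lambda>x. w - (\<Sum>b\<in>Basis. ((x - p) \<bullet> b) *\<^sub>R integral {0..1} (\<lambda>t. ?h b (p + t *\<^sub>R (x - p))))) has_derivative
    (\<lambda>v. 0 - (\<Sum>b\<in>Basis. (?q \<bullet> b) *\<^sub>R integral {0..1} (\<lambda>t. t *\<^sub>R ?Dh b (?z t) v)
       + (v \<bullet> b) *\<^sub>R integral {0..1} (\<lambda>t. ?h b (?z t))))) (at x)"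
    by (intro has_derivative_diff has_derivative_const)
  then have "frechet_derivative (ray_transport p w g) (at x) v
    = - (\<Sum>b\<in>Basis. (?q \<bullet> b) *\<^sub>R integral {0..1} (\<lambda>t. t *\<^sub>R ?Dh b (?z t) v)
       + (v \<bullet> b) *\<^sub>R integral {0..1} (\<lambda>t. ?h b (?z t)))"
    unfolding ray_transport_def[abs_def] by (simp only: frechet_derivative_at[symmetric] diff_0)
  also have "(\<Sum>b\<in>Basis. (?q \<bullet> b) *\<^sub>R integral {0..1} (\<lambda>t. t *\<^sub>R ?Dh b (?z t) v)
       + (v \<bullet> b) *\<^sub>R integral {0..1} (\<lambda>t. ?h b (?z t)))
    = integral {0..1} (\<lambda>t. t *\<^sub>R ?Dh ?q (?z t) v) + integral {0..1} (\<lambda>t. ?h v (?z t))"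
  proof -
    have "integral {0..1} (\<lambda>t. t *\<^sub>R ?Dh ?q (?z t) v)
      = integral {0..1} (\<lambda>t. \<Sum>b\<in>Basis. (?q \<bullet> b) *\<^sub>R (t *\<^sub>R ?Dh b (?z t) v))"
      by (rule integral_cong)
        (simp only: A_apply_derivative_linear[OF z g, of _ ?q] scaleR_sum_right scaleR_left_commute)
    also have "\<dots> = (\<Sum>b\<in>Basis. integral {0..1} (\<lambda>t. (?q \<bullet> b) *\<^sub>R (t *\<^sub>R ?Dh b (?z t) v)))"
      by (intro integral_sum int continuous_on_scaleR[OF continuous_on_const] cD) simp
    finally have 1: "integral {0..1} (\<lambda>t. t *\<^sub>R ?Dh ?q (?z t) v)
      = (\<Sum>b\<in>Basis. (?q \<bullet> b) *\<^sub>R integral {0..1} (\<lambda>t. t *\<^sub>R ?Dh b (?z t) v))" by (simp only: integral_cmul)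
    have "integral {0..1} (\<lambda>t. ?h v (?z t)) = integral {0..1} (\<lambda>t. \<Sum>b\<in>Basis. (v \<bullet> b) *\<^sub>R ?h b (?z t))"
      unfolding A_expand'[symmetric] ..
    also have "\<dots> = (\<Sum>b\<in>Basis. integral {0..1} (\<lambda>t. (v \<bullet> b) *\<^sub>R ?h b (?z t)))"
      by (intro integral_sum int continuous_on_scaleR[OF continuous_on_const] c) simp
    finally have 2: "integral {0..1} (\<lambda>t. ?h v (?z t)) = (\<Sum>b\<in>Basis. (v \<bullet> b) *\<^sub>R integral {0..1} (\<lambda>t. ?h b (?z t)))"
      by (simp only: integral_cmul)
    show ?thesis unfolding 1 2 by (rule sum.distrib)
  qed
  also have "integral {0..1} (\<lambda>t. t *\<^sub>R ?Dh ?q (?z t) v)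
    = integral {0..1} (\<lambda>t. t *\<^sub>R ?Dh v (?z t) ?q)
      + integral {0..1} (\<lambda>t. t *\<^sub>R (A (?z t) ?q (\<omega> (?z t) v) - A (?z t) v (\<omega> (?z t) ?q)))"
  proof -
    have "integral {0..1} (\<lambda>t. t *\<^sub>R ?Dh ?q (?z t) v) - integral {0..1} (\<lambda>t. t *\<^sub>R ?Dh v (?z t) ?q)
      = integral {0..1} (\<lambda>t. t *\<^sub>R ?Dh ?q (?z t) v - t *\<^sub>R ?Dh v (?z t) ?q)"
      by (intro integral_diff[symmetric] int cD)
    also have "\<dots> = integral {0..1} (\<lambda>t. t *\<^sub>R (A (?z t) ?q (\<omega> (?z t) v) - A (?z t) v (\<omega> (?z t) ?q)))"
      by (rule integral_cong)
        (simp only: scaleR_diff_right[symmetric] A_apply_derivative_antisymmetric[OF z g] \<omega>_def)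
    finally show ?thesis by (simp only: diff_eq_eq add.commute)
  qed
  also have "integral {0..1} (\<lambda>t. ?h v (?z t)) = ?h v x - integral {0..1} (\<lambda>t. t *\<^sub>R ?Dh v (?z t) ?q)"
  proof -
    have "((\<lambda>t. t *\<^sub>R ?Dh v (?z t) ?q + ?h v (?z t)) has_integral 1 *\<^sub>R ?h v (?z 1) - 0 *\<^sub>R ?h v (?z 0)) {0..1}"
    proof (rule fundamental_theorem_of_calculus)
      fix t :: real assume t: "t \<in> {0..1}"
      have "((\<lambda>t. ?h v (?z t)) has_derivative (\<lambda>s. ?Dh v (?z t) (s *\<^sub>R ?q))) (at t)"
        by (rule has_derivative_compose[where f = ?z, OF _ Cinf_on_has_derivative[OF h z[OF t]]])
          (auto intro!: derivative_eq_intros)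
      then have "((\<lambda>t. ?h v (?z t)) has_vector_derivative ?Dh v (?z t) ?q) (at t within {0..1})"
        using linear_scale[OF has_derivative_linear[OF Cinf_on_has_derivative[OF h z[OF t]]]]
        by (auto simp: has_vector_derivative_def intro: has_derivative_at_withinI)
      from has_vector_derivative_scaleR[OF DERIV_ident this]
      show "((\<lambda>t. t *\<^sub>R ?h v (?z t)) has_vector_derivative t *\<^sub>R ?Dh v (?z t) ?q + ?h v (?z t)) (at t within {0..1})"
        by simp
    qed simp
    then have "integral {0..1} (\<lambda>t. t *\<^sub>R ?Dh v (?z t) ?q + ?h v (?z t)) = ?h v x"
      by (simp add: integral_unique)
    then have "integral {0..1} (\<lambda>t. t *\<^sub>R ?Dh v (?z t) ?q) + integral {0..1} (\<lambda>t. ?h v (?z t)) = ?h v x"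
      using integral_add[OF int[OF cD] int[OF c]] by (simp only:)
    then show ?thesis by (simp only: eq_diff_eq add.commute)
  qed
  moreover have "- (a + i + (h - a)) = - h - i" for a i h :: 'a by simp
  ultimately show ?thesis by (simp only:)
qed

lemma bound_A:
  assumes K: "compact K" "K \<subseteq> S"
  obtains M where "M > 0" "\<And>y v w. y \<in> K \<Longrightarrow> norm (A y v w) \<le> M * norm v * norm w"
proof -
  have "\<exists>B\<ge>0. \<forall>y\<in>K. norm (A y b j) \<le> B" for b j
  proof -
    have "continuous_on K (\<lambda>y. A y b j)"
      using continuous_on_subset[OF Cinf_on_continuous_on[OF smooth_A] K(2)] .
    then have "bounded ((\<lambda>y. A y b j) ` K)"
      by (intro compact_imp_bounded compact_continuous_image K)
    then show ?thesis by (auto simp: bounded_pos intro: less_imp_le)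
  qed
  then obtain B where B: "\<And>b j. B b j \<ge> 0" "\<And>b j y. y \<in> K \<Longrightarrow> norm (A y b j) \<le> B b j"
    by metis
  define M where "M = 1 + (\<Sum>j\<in>Basis. \<Sum>b\<in>Basis. B b j)"
  have "norm (A y v w) \<le> M * norm v * norm w" if y: "y \<in> K" for y v w
  proof -
    have "A y v w = (\<Sum>j\<in>Basis. \<Sum>b\<in>Basis. (w \<bullet> j) *\<^sub>R (v \<bullet> b) *\<^sub>R A y b j)"
      by (subst A_expand) (simp only: A_expand'[of y v] scaleR_sum_right)
    then have "norm (A y v w) \<le> (\<Sum>j\<in>Basis. \<Sum>b\<in>Basis. norm ((w \<bullet> j) *\<^sub>R (v \<bullet> b) *\<^sub>R A y b j))"
      by (simp only:) (intro order_trans[OF norm_sum] sum_mono order_refl)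
    also have "\<dots> \<le> (\<Sum>j\<in>Basis. \<Sum>b\<in>Basis. (norm v * norm w) * B b j)"
    proof (intro sum_mono)
      fix j :: 'a and b :: 'd assume "j \<in> Basis" "b \<in> Basis"
      then have "\<bar>w \<bullet> j\<bar> \<le> norm w" "\<bar>v \<bullet> b\<bar> \<le> norm v" by (auto intro: Basis_le_norm)
      then have "\<bar>w \<bullet> j\<bar> * (\<bar>v \<bullet> b\<bar> * norm (A y b j)) \<le> norm w * (norm v * B b j)"
        using B y by (intro mult_mono) auto
      then show "norm ((w \<bullet> j) *\<^sub>R (v \<bullet> b) *\<^sub>R A y b j) \<le> (norm v * norm w) * B b j"
        by (simp add: abs_mult mult.commute mult.left_commute)
    qed
    also have "\<dots> = (M - 1) * norm v * norm w"
      by (simp add: M_def sum_distrib_left[symmetric])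
    also have "\<dots> \<le> M * norm v * norm w" by (intro mult_right_mono) auto
    finally show ?thesis .
  qed
  moreover have "M > 0" unfolding M_def using B(1) by (intro add_pos_nonneg sum_nonneg) auto
  ultimately show thesis using that by blast
qed

context
  fixes r M :: real and w :: 'a
  assumes r: "0 < r" "ball p r \<subseteq> S" "8 * r * M \<le> 1"
    and M: "0 < M" "\<And>y v w. y \<in> ball p r \<Longrightarrow> norm (A y v w) \<le> M * norm v * norm w"
begin

lemma ray_in_ball: "x \<in> ball p r \<Longrightarrow> t \<in> {0..1} \<Longrightarrow> p + t *\<^sub>R (x - p) \<in> ball p r"
  using ray_in_convex[OF convex_ball, of p p r x t] r(1) by simp

text \<open>The radius is small enough for \<open>A\<close>, evaluated on a vector from the centre, to have norm at
  most \<open>1/8\<close>. This makes the iteration, and the recursion for its defect, contract.\<close>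

lemma norm_A_ray_le:
  assumes "x \<in> ball p r" "y \<in> ball p r"
  shows "norm (A y (x - p) u) \<le> norm u / 8"
proof -
  have "norm (A y (x - p) u) \<le> M * norm (x - p) * norm u" by (rule M(2)[OF assms(2)])
  also have "\<dots> \<le> M * r * norm u"
    using assms(1) M(1) by (intro mult_right_mono mult_left_mono) (auto simp: dist_norm norm_minus_commute)
  also have "\<dots> \<le> 1 / 8 * norm u"
    using r(3) by (intro mult_right_mono) (auto simp: mult.commute)
  finally show ?thesis by simp
qed

lemma Cinf_on_picard: "Cinf_on S (picard p w n)"
  by (induction n) (simp_all add: Cinf_on_const openS Cinf_on_ray_transport)

lemma picard_center: "picard p w n p = w"
  by (cases n) simp_all

lemma continuous_on_A_ray:
  assumes "Cinf_on S g" "x \<in> S"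
  shows "continuous_on {0..1} (\<lambda>t. A (p + t *\<^sub>R (x - p)) v (g (p + t *\<^sub>R (x - p))))"
  by (rule continuous_on_ray[OF S Cinf_on_continuous_on[OF Cinf_on_A_apply[OF assms(1)]] assms(2)])

lemma picard_step: 
  "x \<in> ball p r \<Longrightarrow> norm (picard p w (Suc n) x - picard p w n x) \<le> norm w / 2 ^ n"
proof (induction n arbitrary: x)
  case 0
  have xS: "x \<in> S" using 0 r by auto
  have "norm (integral {0..1} (\<lambda>t. A (p + t *\<^sub>R (x - p)) (x - p) w)) \<le> norm w / 8 * (1 - 0)"
    using norm_A_ray_le[OF 0 ray_in_ball[OF 0]]
    by (intro integral_bound continuous_on_A_ray[OF Cinf_on_const[OF openS] xS]) auto
  moreover have "picard p w (Suc 0) x - picard p w 0 x = - integral {0..1} (\<lambda>t. A (p + t *\<^sub>R (x - p)) (x - p) w)"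
    using ray_transport_eq[OF Cinf_on_const[OF openS] xS, of w w] by simp
  ultimately have "norm (picard p w (Suc 0) x - picard p w 0 x) \<le> norm w / 8" by simp
  then show ?case by (rule order_trans) simp
next
  case (Suc n)
  have xS: "x \<in> S" using Suc.prems r by auto
  let ?z = "\<lambda>t. p + t *\<^sub>R (x - p)"
  note c = continuous_on_A_ray[OF Cinf_on_picard xS, of "x - p"]
  have "picard p w (Suc (Suc n)) x - picard p w (Suc n) x
    = integral {0..1} (\<lambda>t. A (?z t) (x - p) (picard p w n (?z t))) - integral {0..1} (\<lambda>t. A (?z t) (x - p) (picard p w (Suc n) (?z t)))"
    unfolding picard_Suc[of _ _ "Suc n"] picard_Suc[of _ _ n]
    by (simp add: ray_transport_eq[OF Cinf_on_picard xS] ray_transport_eq[OF Cinf_on_ray_transport[OF Cinf_on_picard] xS])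
  also have "\<dots> = integral {0..1} (\<lambda>t. A (?z t) (x - p) (picard p w n (?z t)) - A (?z t) (x - p) (picard p w (Suc n) (?z t)))"
    by (intro integral_diff[symmetric] integrable_continuous_interval c)
  finally have eq: "picard p w (Suc (Suc n)) x - picard p w (Suc n) x = \<dots>" .
  have "norm (integral {0..1} (\<lambda>t. A (?z t) (x - p) (picard p w n (?z t)) - A (?z t) (x - p) (picard p w (Suc n) (?z t))))
    \<le> norm w / 2 ^ Suc n * (1 - 0)"
  proof (intro integral_bound continuous_on_diff c)
    fix t :: real assume t: "t \<in> {0..1}"
    note z = ray_in_ball[OF Suc.prems t]
    have "norm (A (?z t) (x - p) (picard p w n (?z t)) - A (?z t) (x - p) (picard p w (Suc n) (?z t)))
      = norm (A (?z t) (x - p) (picard p w n (?z t) - picard p w (Suc n) (?z t)))"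
      by (simp only: linear_diff[OF linear_A])
    also have "\<dots> \<le> norm (picard p w n (?z t) - picard p w (Suc n) (?z t)) / 8"
      by (rule norm_A_ray_le[OF Suc.prems z])
    also have "\<dots> \<le> (norm w / 2 ^ n) / 8"
      using Suc.IH[OF z] by (simp only: norm_minus_commute divide_right_mono)
    also have "\<dots> \<le> norm w / 2 ^ Suc n" by (simp add: divide_simps)
    finally show "norm (A (?z t) (x - p) (picard p w n (?z t)) - A (?z t) (x - p) (picard p w (Suc n) (?z t))) \<le> norm w / 2 ^ Suc n" .
  qed simp
  then show ?case unfolding eq by simp
qed

text \<open>The covariant derivative of the \<open>n\<close>-th iterate, which vanishes in the limit.\<close>

definition picard_defect :: "nat \<Rightarrow> 'd \<Rightarrow> 'd \<Rightarrow> 'a" where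
  "picard_defect n x v = frechet_derivative (picard p w n) (at x) v + A x v (picard p w n x)"

text \<open>By Cartan's formula the defects satisfy
  \<open>\<omega>\<^sub>n\<^sub>+\<^sub>1 = A (g\<^sub>n\<^sub>+\<^sub>1 - g\<^sub>n) - K(A \<and> \<omega>\<^sub>n)\<close>. The first term decays geometrically and the second
  is at most a quarter of the preceding bound.\<close>

lemma picard_defect_bound:
  "x \<in> ball p r \<Longrightarrow> norm (picard_defect n x v) \<le> 4 * M * norm w / 2 ^ n * norm v"
proof (induction n arbitrary: x v)
  case 0
  have "norm (A x v w) \<le> M * norm v * norm w" by (rule M(2)[OF 0])
  also have "\<dots> \<le> 4 * (M * norm v * norm w)" using M(1) by simp
  finally show ?case by (simp add: picard_defect_def mult.commute mult.left_commute)
next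
  case (Suc n)
  have xS: "x \<in> S" using Suc.prems r by auto
  let ?z = "\<lambda>t. p + t *\<^sub>R (x - p)"
  let ?f = "\<lambda>t. t *\<^sub>R (A (?z t) (x - p) (picard_defect n (?z t) v) - A (?z t) v (picard_defect n (?z t) (x - p)))"
  let ?W = "4 * M * norm w / 2 ^ n"
  have W: "0 \<le> ?W" using M(1) by simp
  have smooth: "Cinf_on S (\<lambda>x. picard_defect n x u)" for u
    unfolding picard_defect_def Cinf_on_def
    using Ck_on_add[OF openS Cinf_onD(1)[OF Cinf_on_derivative[OF Cinf_on_picard]] Cinf_onD(1)[OF Cinf_on_A_apply[OF Cinf_on_picard]]] openS
    by blast
  have "norm (integral {0..1} ?f) \<le> ?W * norm v / 4 * (1 - 0)"
  proof (rule integral_bound)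
    show "continuous_on {0..1} ?f"
      by (intro continuous_on_scaleR continuous_on_id continuous_on_diff continuous_on_A_ray[OF smooth xS])
    fix t :: real assume t: "t \<in> {0..1}"
    note z = ray_in_ball[OF Suc.prems t]
    have "norm (A (?z t) (x - p) (picard_defect n (?z t) v)) \<le> norm (picard_defect n (?z t) v) / 8"
      by (rule norm_A_ray_le[OF Suc.prems z])
    also have "\<dots> \<le> ?W * norm v / 8" using Suc.IH[OF z, of v] by (rule divide_right_mono) simp
    finally have 1: "norm (A (?z t) (x - p) (picard_defect n (?z t) v)) \<le> ?W * norm v / 8" .
    have nx: "norm (x - p) \<le> r" using Suc.prems by (simp add: dist_norm norm_minus_commute)
    have "norm (A (?z t) v (picard_defect n (?z t) (x - p))) \<le> M * norm v * norm (picard_defect n (?z t) (x - p))"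
      by (rule M(2)[OF z])
    also have "\<dots> \<le> M * norm v * (?W * norm (x - p))"
      using Suc.IH[OF z] M(1) by (intro mult_left_mono) auto
    also have "\<dots> \<le> M * norm v * (?W * r)"
      using nx M(1) W by (intro mult_left_mono) auto
    also have "\<dots> = (?W * norm v) * (r * M)" by (simp add: mult.commute mult.left_commute)
    also have "\<dots> \<le> (?W * norm v) * (1 / 8)"
      using r(3) by (intro mult_left_mono mult_nonneg_nonneg[OF W norm_ge_zero]) (simp add: mult.commute)
    finally have 2: "norm (A (?z t) v (picard_defect n (?z t) (x - p))) \<le> ?W * norm v / 8" by simp
    have "norm (?f t) \<le> 1 * (?W * norm v / 8 + ?W * norm v / 8)"
      unfolding norm_scaleR
      using t 1 2 norm_triangle_ineq4[of "A (?z t) (x - p) (picard_defect n (?z t) v)" "A (?z t) v (picard_defect n (?z t) (x - p))"]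
      by (intro mult_mono) auto
    then show "norm (?f t) \<le> ?W * norm v / 4" by simp
  qed simp
  then have I: "norm (integral {0..1} ?f) \<le> ?W * norm v / 4" by simp
  have "norm (A x v (picard p w (Suc n) x - picard p w n x)) \<le> M * norm v * norm (picard p w (Suc n) x - picard p w n x)"
    by (rule M(2)[OF Suc.prems])
  also have "\<dots> \<le> M * norm v * (norm w / 2 ^ n)"
    using picard_step[OF Suc.prems] M(1) by (intro mult_left_mono) auto
  finally have J: "norm (A x v (picard p w (Suc n) x - picard p w n x)) \<le> ?W * norm v / 4" by (simp add: mult.commute mult.left_commute)
  have "picard_defect (Suc n) x v = A x v (picard p w (Suc n) x - picard p w n x) - integral {0..1} ?f"
    using ray_transport_derivative[OF Cinf_on_picard xS, of w n v]
    by (simp add: picard_defect_def linear_diff[OF linear_A])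
  then have "norm (picard_defect (Suc n) x v) \<le> norm (A x v (picard p w (Suc n) x - picard p w n x)) + norm (integral {0..1} ?f)"
    by (simp only: norm_triangle_ineq4)
  also have "\<dots> \<le> ?W * norm v / 4 + ?W * norm v / 4" by (rule add_mono[OF J I])
  also have "\<dots> = 4 * M * norm w / 2 ^ Suc n * norm v" by simp
  finally show ?case .
qed

lemma solution_on_ball:
  "\<exists>g. g p = w \<and> Cinf_on (ball p r) g \<and> (\<forall>x\<in>ball p r. \<forall>v. frechet_derivative g (at x) v = - A x v (g x))"
proof -
  have "\<exists>l. (\<lambda>n. picard p w n x) \<longlonglongrightarrow> l \<and> (\<forall>n. norm (picard p w n x - l) \<le> 2 * norm w / 2 ^ n)" if "x \<in> ball p r" for x
    using geometric_Cauchy_limit[of "\<lambda>n. picard p w n x" "norm w"] picard_step[OF that] by metis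
  then obtain G where G: "\<And>x. x \<in> ball p r \<Longrightarrow> (\<lambda>n. picard p w n x) \<longlonglongrightarrow> G x"
    "\<And>x n. x \<in> ball p r \<Longrightarrow> norm (picard p w n x - G x) \<le> 2 * norm w / 2 ^ n"
    by metis
  have pb: "p \<in> ball p r" using r(1) by simp
  have "\<exists>g. \<forall>x\<in>ball p r. (\<lambda>n. picard p w n x) \<longlonglongrightarrow> g x \<and> (g has_derivative (\<lambda>v. - A x v (G x))) (at x within ball p r)"
  proof (rule has_derivative_sequence[OF convex_ball _ _ pb])
    show "(picard p w n has_derivative frechet_derivative (picard p w n) (at x)) (at x within ball p r)" if "x \<in> ball p r" for n x
      using Cinf_on_has_derivative[OF Cinf_on_picard] that r(2) by (blast intro: has_derivative_at_withinI)
    show "(\<lambda>n. picard p w n p) \<longlonglongrightarrow> w" by (simp add: picard_center)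
    fix e :: real assume e: "0 < e"
    have "(\<lambda>n. 6 * M * norm w * (1 / 2) ^ n) \<longlonglongrightarrow> 0"
      by (intro tendsto_mult_right_zero LIMSEQ_power_zero) simp
    then have "\<forall>\<^sub>F n in sequentially. 6 * M * norm w * (1 / 2) ^ n < e"
      by (rule order_tendstoD(2)) (rule e)
    then show "\<forall>\<^sub>F n in sequentially. \<forall>x\<in>ball p r. \<forall>h. norm (frechet_derivative (picard p w n) (at x) h - - A x h (G x)) \<le> e * norm h"
    proof (rule eventually_mono, intro ballI allI)
      fix n x h assume n: "6 * M * norm w * (1 / 2) ^ n < e" and x: "x \<in> ball p r"
      have "frechet_derivative (picard p w n) (at x) h - - A x h (G x)
        = picard_defect n x h - A x h (picard p w n x - G x)"
        by (simp add: picard_defect_def linear_diff[OF linear_A])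
      then have "norm (frechet_derivative (picard p w n) (at x) h - - A x h (G x))
        \<le> norm (picard_defect n x h) + norm (A x h (picard p w n x - G x))"
        by (simp only: norm_triangle_ineq4)
      also have "\<dots> \<le> 4 * M * norm w / 2 ^ n * norm h + M * norm h * (2 * norm w / 2 ^ n)"
        by (intro add_mono picard_defect_bound[OF x] order_trans[OF M(2)[OF x]] mult_left_mono[OF G(2)[OF x]])
          (use M(1) in auto)
      also have "\<dots> = (6 * M * norm w * (1 / 2) ^ n) * norm h" by (simp add: power_divide algebra_simps)
      also have "\<dots> \<le> e * norm h" using n by (intro mult_right_mono) auto
      finally show "norm (frechet_derivative (picard p w n) (at x) h - - A x h (G x)) \<le> e * norm h" .
    qed
  qed
  then obtain g where g: "\<And>x. x \<in> ball p r \<Longrightarrow> (\<lambda>n. picard p w n x) \<longlonglongrightarrow> g x"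
    "\<And>x. x \<in> ball p r \<Longrightarrow> (g has_derivative (\<lambda>v. - A x v (G x))) (at x within ball p r)" by blast
  have gG: "G x = g x" if "x \<in> ball p r" for x
    using LIMSEQ_unique[OF G(1)[OF that] g(1)[OF that]] .
  have D: "(g has_derivative (\<lambda>v. - A x v (g x))) (at x)" if "x \<in> ball p r" for x
    using g(2)[OF that] at_within_open[OF that open_ball] gG[OF that] by simp
  have gp: "g p = w" using LIMSEQ_unique[OF g(1)[OF pb]] by (simp add: picard_center)
  \<comment> \<open>The equation \<open>dg = - A g\<close> gains one derivative at a time.\<close>
  have "Ck_on k (ball p r) g" for k
  proof (induction k)
    case 0
    then show ?case
      by (auto intro!: continuous_at_imp_continuous_on has_derivative_continuous[OF D])
  next
    case (Suc k)
    show ?case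
    proof (rule Ck_on_SucI[OF open_ball D])
      fix v
      show "Ck_on k (ball p r) (\<lambda>x. - A x v (g x))"
        using Ck_on_bilinear[OF bounded_bilinear_scaleR open_ball Ck_on_const[OF open_ball, of k p r "-1::real"]
            Ck_on_A_apply[OF r(2) open_ball Suc, of v]] by simp
    qed
  qed
  then show ?thesis
    using gp D frechet_derivative_at by (intro exI[of _ g]) (force simp: Cinf_on_def fun_eq_iff)
qed

end

lemma solution_exists:
  obtains r where "r > 0" "ball p r \<subseteq> S"
    "\<And>w. \<exists>g. g p = w \<and> Cinf_on (ball p r) g \<and> (\<forall>x\<in>ball p r. \<forall>v. frechet_derivative g (at x) v = - A x v (g x))"
proof -
  obtain R where R: "R > 0" "cball p R \<subseteq> S" using openS S(2) open_contains_cball by blast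
  obtain M where M: "M > 0" "\<And>y v w. y \<in> cball p R \<Longrightarrow> norm (A y v w) \<le> M * norm v * norm w"
    using bound_A[OF compact_cball R(2)] by blast
  define r where "r = min R (1 / (8 * M))"
  have "r > 0" using R M by (simp add: r_def)
  moreover have "ball p r \<subseteq> S" using R by (auto simp: r_def)
  moreover have "8 * r * M \<le> 1" using M(1) by (auto simp: r_def min_def field_simps)
  moreover have "norm (A y v w) \<le> M * norm v * norm w" if "y \<in> ball p r" for y v w
    using M(2) that by (simp add: r_def)
  ultimately have "\<exists>g. g p = w \<and> Cinf_on (ball p r) g \<and> (\<forall>x\<in>ball p r. \<forall>v. frechet_derivative g (at x) v = - A x v (g x))" for w
    using M(1) by (intro solution_on_ball[of r M])
  then show thesis using \<open>r > 0\<close> \<open>ball p r \<subseteq> S\<close> by (intro that)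
qed

end

end

section \<open>Smooth functions on a manifold\<close>

locale smooth_manifold =
  fixes V :: "'d::euclidean_space set" and \<A> :: "('m::topological_space, 'd) atlas"
  assumes atlas: "smooth_atlas V \<A>"
begin

text \<open>A linear retraction of the ambient Euclidean space onto \<open>V\<close>. Pulling functions back along it
  turns relatively open subsets of \<open>V\<close> into open subsets of the ambient space, where Frechet
  derivatives are available.\<close>

definition P :: "'d \<Rightarrow> 'd" where
  "P = (SOME P. linear P \<and> range P \<subseteq> V \<and> (\<forall>v\<in>V. P v = v))"

lemma P: "linear P" "P y \<in> V" "v \<in> V \<Longrightarrow> P v = v"
proof -
  have "subspace V" using atlas by (simp add: smooth_atlas_def)
  then have "\<exists>g. range g \<subseteq> V \<and> linear g \<and> (\<forall>v\<in>V. g (id v) = v)"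
    by (intro linear_exists_left_inverse_on linear_id) auto
  then have "\<exists>P. linear P \<and> range P \<subseteq> V \<and> (\<forall>v\<in>V. P v = v)" by auto
  from someI_ex[OF this] show "linear P" "P y \<in> V" "v \<in> V \<Longrightarrow> P v = v"
    unfolding P_def by auto
qed

lemma bounded_linear_P: "bounded_linear P"
  using P(1) linear_conv_bounded_linear by blast

lemma P_idem [simp]: "P (P y) = P y"
  by (rule P) (rule P)

definition chart_dom :: "('m \<Rightarrow> 'd) \<Rightarrow> 'm set \<Rightarrow> 'd set" where
  "chart_dom \<phi> U = {y. P y \<in> \<phi> ` U}"

definition chart_rep :: "'m set \<Rightarrow> ('m \<Rightarrow> 'd) \<Rightarrow> ('m \<Rightarrow> 'b) \<Rightarrow> 'd \<Rightarrow> 'b" where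
  "chart_rep W \<phi> f y = f (inv_into W \<phi> (P y))"

lemma chart_dom_mono: "U \<subseteq> U' \<Longrightarrow> chart_dom \<phi> U \<subseteq> chart_dom \<phi> U'"
  by (auto simp: chart_dom_def)

text \<open>A local extension of \<open>h\<close> can always be replaced by the single extension \<open>h \<circ> P\<close>.\<close>

lemma smooth_on_iff_Cinf_on:
  assumes S: "openin (top_of_set V) S"
  shows "smooth_on S h \<longleftrightarrow> Cinf_on {y. P y \<in> S} (\<lambda>y. h (P y))"
proof -
  have op: "open {y. P y \<in> S'}" if oi: "openin (top_of_set V) S'" for S'
  proof -
    obtain T where T: "open T" "S' = V \<inter> T" using oi by (auto simp: openin_open)
    have "{y. P y \<in> S'} = P -` T" using T P(2) by auto
    then show ?thesis
      using open_vimage[OF T(1) linear_continuous_on[OF bounded_linear_P]] by simp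
  qed
  have SV: "S \<subseteq> V" using S openin_imp_subset by blast
  show ?thesis
  proof
    assume sm: "smooth_on S h"
    show "Cinf_on {y. P y \<in> S} (\<lambda>y. h (P y))"
    proof (rule Cinf_on_locally)
      fix y assume "y \<in> {y. P y \<in> S}"
      then have y: "P y \<in> S" by simp
      obtain T g where T: "open T" "P y \<in> T" "\<forall>k. Ck_on k T g" "\<forall>z\<in>S \<inter> T. g z = h z"
        using bspec[OF sm[unfolded smooth_on_def] y] by (elim exE conjE)
      have o: "open {y. P y \<in> S \<inter> T}"
        by (rule op) (use S T(1) in \<open>auto intro: openin_Int_open\<close>)
      have "Cinf_on {y. P y \<in> S \<inter> T} (\<lambda>y. g (P y))"
        by (rule Cinf_on_compose[OF Cinf_on_linear[OF o bounded_linear_P], of T])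
          (use T in \<open>auto simp: Cinf_on_def\<close>)
      then have "Cinf_on {y. P y \<in> S \<inter> T} (\<lambda>y. h (P y))"
        by (rule Cinf_on_cong) (use T(4) in auto)
      then show "\<exists>T. y \<in> T \<and> T \<subseteq> {y. P y \<in> S} \<and> Cinf_on T (\<lambda>y. h (P y))"
        using T(2) y by (intro exI[of _ "{y. P y \<in> S \<inter> T}"]) auto
    qed
  next
    assume c: "Cinf_on {y. P y \<in> S} (\<lambda>y. h (P y))"
    show "smooth_on S h"
      unfolding smooth_on_def
    proof
      fix x assume "x \<in> S"
      then show "\<exists>T g. open T \<and> x \<in> T \<and> (\<forall>k. Ck_on k T g) \<and> (\<forall>y\<in>S \<inter> T. g y = h y)"
        using c SV P(3) op[OF S]
        by (intro exI[of _ "{y. P y \<in> S}"] exI[of _ "\<lambda>y. h (P y)"] conjI) (auto simp: Cinf_on_def)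
    qed
  qed
qed

lemma chartD:
  assumes "(W, \<phi>) \<in> \<A>"
  shows "open W" "openin (top_of_set V) (\<phi> ` W)" "homeomorphism W (\<phi> ` W) \<phi> (inv_into W \<phi>)"
    "inj_on \<phi> W" "continuous_on W \<phi>"
    and "\<And>x. x \<in> W \<Longrightarrow> inv_into W \<phi> (\<phi> x) = x" "\<And>x. x \<in> W \<Longrightarrow> \<phi> x \<in> V"
    and "\<And>x. x \<in> W \<Longrightarrow> P (\<phi> x) = \<phi> x"
proof -
  show 1: "open W" "openin (top_of_set V) (\<phi> ` W)" "homeomorphism W (\<phi> ` W) \<phi> (inv_into W \<phi>)"
    using atlas assms unfolding smooth_atlas_def by auto
  show 2: "\<And>x. x \<in> W \<Longrightarrow> inv_into W \<phi> (\<phi> x) = x" using 1(3) by (auto simp: homeomorphism_def)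
  then show "inj_on \<phi> W" by (metis inj_on_def)
  show "continuous_on W \<phi>" using 1(3) by (auto simp: homeomorphism_def)
  show 3: "\<And>x. x \<in> W \<Longrightarrow> \<phi> x \<in> V" using 1(2) openin_imp_subset by blast
  show "\<And>x. x \<in> W \<Longrightarrow> P (\<phi> x) = \<phi> x" using P(3) 3 by blast
qed

lemma openin_chart_image:
  assumes "(W, \<phi>) \<in> \<A>" "open U" "U \<subseteq> W"
  shows "openin (top_of_set V) (\<phi> ` U)"
proof -
  note c = chartD[OF assms(1)]
  have "openin (top_of_set W) U" using assms c(1) by (auto simp: openin_open)
  then have "openin (top_of_set (\<phi> ` W)) (\<phi> ` U)"
    using c(3) by (metis homeomorphism_imp_open_map)
  then show ?thesis using c(2) openin_trans by blast
qed

lemma open_chart_dom: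
  assumes "(W, \<phi>) \<in> \<A>" "open U" "U \<subseteq> W"
  shows "open (chart_dom \<phi> U)"
proof -
  obtain T where T: "open T" "\<phi> ` U = V \<inter> T"
    using openin_chart_image[OF assms] by (auto simp: openin_open)
  have "chart_dom \<phi> U = P -` T" using T P(2) by (auto simp: chart_dom_def)
  then show ?thesis using open_vimage[OF T(1) linear_continuous_on[OF bounded_linear_P]] by simp
qed

lemma chart_in_dom: "(W, \<phi>) \<in> \<A> \<Longrightarrow> U \<subseteq> W \<Longrightarrow> x \<in> U \<Longrightarrow> \<phi> x \<in> chart_dom \<phi> U"
  using chartD(8) by (fastforce simp: chart_dom_def)

lemma chart_rep_at: "(W, \<phi>) \<in> \<A> \<Longrightarrow> x \<in> W \<Longrightarrow> chart_rep W \<phi> f (\<phi> x) = f x"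
  by (simp add: chart_rep_def chartD)

lemma chart_domE:
  assumes "(W, \<phi>) \<in> \<A>" "U \<subseteq> W" "y \<in> chart_dom \<phi> U"
  obtains x where "x \<in> U" "P y = \<phi> x" "inv_into W \<phi> (P y) = x"
  using assms chartD(6)[OF assms(1)] by (auto simp: chart_dom_def)

lemma chart_dom_inv:
  assumes "(W, \<phi>) \<in> \<A>" "U \<subseteq> W" "y \<in> chart_dom \<phi> U"
  shows "inv_into W \<phi> (P y) \<in> U" "\<phi> (inv_into W \<phi> (P y)) = P y"
  by (rule chart_domE[OF assms]; simp)+

lemma smooth_fun_iff_chart:
  "smooth_fun \<A> U f \<longleftrightarrow> open U \<and> (\<forall>(W, \<phi>)\<in>\<A>. Cinf_on (chart_dom \<phi> (U \<inter> W)) (chart_rep W \<phi> f))"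
proof -
  have "smooth_on (\<phi> ` (U \<inter> W)) (f \<circ> inv_into W \<phi>) \<longleftrightarrow> Cinf_on (chart_dom \<phi> (U \<inter> W)) (chart_rep W \<phi> f)"
    if "open U" "(W, \<phi>) \<in> \<A>" for W \<phi>
  proof -
    have oi: "openin (top_of_set V) (\<phi> ` (U \<inter> W))"
      using that chartD(1)[OF that(2)] by (intro openin_chart_image[OF that(2)]) auto
    show ?thesis
      unfolding smooth_on_iff_Cinf_on[OF oi] chart_dom_def chart_rep_def[abs_def] comp_def ..
  qed
  then show ?thesis unfolding smooth_fun_def by (auto split: prod.splits)
qed

lemma smooth_fun_open: "smooth_fun \<A> U f \<Longrightarrow> open U"
  by (simp add: smooth_fun_def)

lemma smooth_fun_Cinf_on:
  "smooth_fun \<A> U f \<Longrightarrow> (W, \<phi>) \<in> \<A> \<Longrightarrow> Cinf_on (chart_dom \<phi> (U \<inter> W)) (chart_rep W \<phi> f)"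
  by (auto simp: smooth_fun_iff_chart)

lemma ex_chart: obtains W \<phi> where "(W, \<phi>) \<in> \<A>" "x \<in> W"
  using atlas unfolding smooth_atlas_def by blast

text \<open>One chart around every point suffices, because the transition maps are smooth.\<close>

lemma smooth_funI_chart:
  assumes U: "open U" and loc: "\<And>x. x \<in> U \<Longrightarrow> \<exists>W \<phi> U'. (W, \<phi>) \<in> \<A> \<and> x \<in> U' \<and> U' \<subseteq> U \<inter> W \<and>
      open U' \<and> Cinf_on (chart_dom \<phi> U') (chart_rep W \<phi> f)"
  shows "smooth_fun \<A> U f"
  unfolding smooth_fun_iff_chart
proof (intro conjI U ballI, clarify)
  fix W' \<psi> assume \<psi>: "(W', \<psi>) \<in> \<A>"
  show "Cinf_on (chart_dom \<psi> (U \<inter> W')) (chart_rep W' \<psi> f)"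
  proof (rule Cinf_on_locally)
    fix y assume "y \<in> chart_dom \<psi> (U \<inter> W')"
    then obtain x where x: "x \<in> U" "x \<in> W'" "P y = \<psi> x" by (auto simp: chart_dom_def)
    obtain W \<phi> U' where c: "(W, \<phi>) \<in> \<A>" "x \<in> U'" "U' \<subseteq> U \<inter> W" "open U'"
      "Cinf_on (chart_dom \<phi> U') (chart_rep W \<phi> f)" using loc[OF x(1)] by blast
    have tr: "smooth_on (\<psi> ` (W' \<inter> W)) (\<phi> \<circ> inv_into W' \<psi>)"
      using atlas \<psi> c(1) unfolding smooth_atlas_def by blast
    have oi: "openin (top_of_set V) (\<psi> ` (W' \<inter> W))"
      using chartD(1)[OF \<psi>] chartD(1)[OF c(1)] by (intro openin_chart_image[OF \<psi>]) auto
    have tr': "Cinf_on (chart_dom \<psi> (W' \<inter> W)) (\<lambda>y. \<phi> (inv_into W' \<psi> (P y)))"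
      using tr unfolding smooth_on_iff_Cinf_on[OF oi] chart_dom_def by simp
    have "open (chart_dom \<psi> (U' \<inter> W'))"
      using chartD(1)[OF \<psi>] c(4) by (intro open_chart_dom[OF \<psi>]) auto
    then have "Cinf_on (chart_dom \<psi> (U' \<inter> W')) (\<lambda>y. \<phi> (inv_into W' \<psi> (P y)))"
      using c(3) by (intro Cinf_on_subset[OF tr'] chart_dom_mono) auto
    then have "Cinf_on (chart_dom \<psi> (U' \<inter> W')) (\<lambda>y. chart_rep W \<phi> f (\<phi> (inv_into W' \<psi> (P y))))"
    proof (rule Cinf_on_compose[OF _ c(5)], safe)
      fix y assume "y \<in> chart_dom \<psi> (U' \<inter> W')"
      then have "inv_into W' \<psi> (P y) \<in> U'" using chart_dom_inv(1)[OF \<psi>, of "U' \<inter> W'"] by blast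
      then show "\<phi> (inv_into W' \<psi> (P y)) \<in> chart_dom \<phi> U'"
        using chart_in_dom[OF c(1), of U'] c(3) by auto
    qed
    then have "Cinf_on (chart_dom \<psi> (U' \<inter> W')) (chart_rep W' \<psi> f)"
    proof (rule Cinf_on_cong)
      fix y assume "y \<in> chart_dom \<psi> (U' \<inter> W')"
      then have "inv_into W' \<psi> (P y) \<in> W" using chart_dom_inv(1)[OF \<psi>, of "U' \<inter> W'"] c(3) by blast
      then show "chart_rep W \<phi> f (\<phi> (inv_into W' \<psi> (P y))) = chart_rep W' \<psi> f y"
        unfolding chart_rep_def[of W'] by (rule chart_rep_at[OF c(1)])
    qed
    moreover have "y \<in> chart_dom \<psi> (U' \<inter> W')" using x c(2) by (auto simp: chart_dom_def)
    moreover have "chart_dom \<psi> (U' \<inter> W') \<subseteq> chart_dom \<psi> (U \<inter> W')"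
      using c(3) by (intro chart_dom_mono) auto
    ultimately show "\<exists>T. y \<in> T \<and> T \<subseteq> chart_dom \<psi> (U \<inter> W') \<and> Cinf_on T (chart_rep W' \<psi> f)" by blast
  qed
qed

lemma smooth_fun_subset:
  assumes "smooth_fun \<A> U f" "open U'" "U' \<subseteq> U" shows "smooth_fun \<A> U' f"
  unfolding smooth_fun_iff_chart
proof (intro conjI assms(2) ballI, clarify)
  fix W \<phi> assume c: "(W, \<phi>) \<in> \<A>"
  show "Cinf_on (chart_dom \<phi> (U' \<inter> W)) (chart_rep W \<phi> f)"
    by (rule Cinf_on_subset[OF smooth_fun_Cinf_on[OF assms(1) c] open_chart_dom[OF c] chart_dom_mono])
      (use assms chartD(1)[OF c] in auto)
qed

lemma smooth_fun_locally:
  assumes "\<And>x. x \<in> U \<Longrightarrow> \<exists>N. x \<in> N \<and> smooth_fun \<A> N f" and U: "open U"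
  shows "smooth_fun \<A> U f"
proof (rule smooth_funI_chart[OF U])
  fix x assume x: "x \<in> U"
  obtain N where N: "x \<in> N" "smooth_fun \<A> N f" using assms(1)[OF x] by blast
  obtain W \<phi> where c: "(W, \<phi>) \<in> \<A>" "x \<in> W" by (rule ex_chart)
  have o: "open (N \<inter> U \<inter> W)" using smooth_fun_open[OF N(2)] U chartD(1)[OF c(1)] by auto
  have "Cinf_on (chart_dom \<phi> (N \<inter> U \<inter> W)) (chart_rep W \<phi> f)"
    by (rule Cinf_on_subset[OF smooth_fun_Cinf_on[OF N(2) c(1)] open_chart_dom[OF c(1) o] chart_dom_mono]) auto
  then show "\<exists>W \<phi> U'. (W, \<phi>) \<in> \<A> \<and> x \<in> U' \<and> U' \<subseteq> U \<inter> W \<and>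
      open U' \<and> Cinf_on (chart_dom \<phi> U') (chart_rep W \<phi> f)"
    using c x N(1) o by - (rule exI[of _ W], rule exI[of _ \<phi>], rule exI[of _ "N \<inter> U \<inter> W"], auto)
qed

lemma smooth_fun_cong:
  assumes "smooth_fun \<A> U f" "\<And>x. x \<in> U \<Longrightarrow> f x = g x"
  shows "smooth_fun \<A> U g"
  unfolding smooth_fun_iff_chart
proof (intro conjI smooth_fun_open[OF assms(1)] ballI, clarify)
  fix W \<phi> assume c: "(W, \<phi>) \<in> \<A>"
  show "Cinf_on (chart_dom \<phi> (U \<inter> W)) (chart_rep W \<phi> g)"
  proof (rule Cinf_on_cong[OF smooth_fun_Cinf_on[OF assms(1) c]])
    fix y assume "y \<in> chart_dom \<phi> (U \<inter> W)"
    then show "chart_rep W \<phi> f y = chart_rep W \<phi> g y"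
      using chart_dom_inv(1)[OF c, of "U \<inter> W" y] assms(2) by (simp add: chart_rep_def)
  qed
qed

lemma smooth_fun_via_charts:
  assumes "open U" "\<And>W \<phi>. (W, \<phi>) \<in> \<A> \<Longrightarrow> open (chart_dom \<phi> (U \<inter> W)) \<Longrightarrow> Cinf_on (chart_dom \<phi> (U \<inter> W)) (chart_rep W \<phi> f)"
  shows "smooth_fun \<A> U f"
  unfolding smooth_fun_iff_chart
proof (intro conjI assms(1) ballI, clarify)
  fix W \<phi> assume c: "(W, \<phi>) \<in> \<A>"
  show "Cinf_on (chart_dom \<phi> (U \<inter> W)) (chart_rep W \<phi> f)"
    using assms(1) chartD(1)[OF c] by (intro assms(2)[OF c] open_chart_dom[OF c]) auto
qed

lemma smooth_fun_const: "open U \<Longrightarrow> smooth_fun \<A> U (\<lambda>x. c)"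
  by (rule smooth_fun_via_charts) (auto simp: chart_rep_def[abs_def] intro: Cinf_on_const)

lemma smooth_fun_bilinear:
  assumes "bounded_bilinear b" "smooth_fun \<A> U f" "smooth_fun \<A> U g"
  shows "smooth_fun \<A> U (\<lambda>x. b (f x) (g x))"
  using Cinf_on_bilinear[OF assms(1) smooth_fun_Cinf_on[OF assms(2)] smooth_fun_Cinf_on[OF assms(3)]]
  by (intro smooth_fun_via_charts smooth_fun_open[OF assms(2)]) (simp add: chart_rep_def[abs_def])

lemma smooth_fun_sum:
  assumes "open U" "\<And>i. i \<in> I \<Longrightarrow> smooth_fun \<A> U (f i)"
  shows "smooth_fun \<A> U (\<lambda>x. \<Sum>i\<in>I. f i x)"
proof (rule smooth_fun_via_charts[OF assms(1)])
  fix W \<phi> assume c: "(W, \<phi>) \<in> \<A>" and o: "open (chart_dom \<phi> (U \<inter> W))"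
  have "Cinf_on (chart_dom \<phi> (U \<inter> W)) (\<lambda>y. \<Sum>i\<in>I. chart_rep W \<phi> (f i) y)"
    by (intro Cinf_on_sum o smooth_fun_Cinf_on[OF assms(2) c])
  then show "Cinf_on (chart_dom \<phi> (U \<inter> W)) (chart_rep W \<phi> (\<lambda>x. \<Sum>i\<in>I. f i x))"
    by (simp add: chart_rep_def[abs_def])
qed

lemma smooth_fun_add:
  assumes "smooth_fun \<A> U f" "smooth_fun \<A> U g"
  shows "smooth_fun \<A> U (\<lambda>x. f x + g x)"
  using Ck_on_add[OF Cinf_onD(2)[OF smooth_fun_Cinf_on[OF assms(1)]]
      Cinf_onD(1)[OF smooth_fun_Cinf_on[OF assms(1)]] Cinf_onD(1)[OF smooth_fun_Cinf_on[OF assms(2)]]]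
  by (intro smooth_fun_via_charts smooth_fun_open[OF assms(1)]) (simp add: chart_rep_def[abs_def] Cinf_on_def)

lemma smooth_fun_compose:
  fixes f :: "'m \<Rightarrow> 'b::euclidean_space"
  assumes "smooth_fun \<A> U f" "Cinf_on T g" "f ` U \<subseteq> T"
  shows "smooth_fun \<A> U (\<lambda>x. g (f x))"
proof (rule smooth_fun_via_charts[OF smooth_fun_open[OF assms(1)]])
  fix W \<phi> assume c: "(W, \<phi>) \<in> \<A>"
  have "Cinf_on (chart_dom \<phi> (U \<inter> W)) (\<lambda>y. g (chart_rep W \<phi> f y))"
    by (rule Cinf_on_compose[OF smooth_fun_Cinf_on[OF assms(1) c] assms(2)])
      (use assms(3) chart_dom_inv(1)[OF c, of "U \<inter> W"] in \<open>auto simp: chart_rep_def image_subset_iff\<close>)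
  then show "Cinf_on (chart_dom \<phi> (U \<inter> W)) (chart_rep W \<phi> (\<lambda>x. g (f x)))"
    by (simp add: chart_rep_def[abs_def])
qed

lemma smooth_fun_linear:
  fixes f :: "'m \<Rightarrow> 'b::euclidean_space"
  assumes "smooth_fun \<A> U f" "bounded_linear g"
  shows "smooth_fun \<A> U (\<lambda>x. g (f x))"
  by (rule smooth_fun_compose[OF assms(1) Cinf_on_linear[OF open_UNIV assms(2)]]) simp

lemma smooth_fun_vec_lambda:
  fixes f :: "'n::finite \<Rightarrow> 'm \<Rightarrow> 'b::euclidean_space"
  assumes "open U" "\<And>i. smooth_fun \<A> U (f i)"
  shows "smooth_fun \<A> U (\<lambda>x. \<chi> i. f i x)"
  unfolding vec_lambda_eq_sum_axis
  by (intro smooth_fun_sum assms(1) smooth_fun_linear[OF assms(2) bounded_linear_axis])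

lemma smooth_fun_vec_nth:
  fixes f :: "'m \<Rightarrow> 'b::euclidean_space ^ 'n"
  assumes "smooth_fun \<A> U f" shows "smooth_fun \<A> U (\<lambda>x. f x $ i)"
  by (rule smooth_fun_linear[OF assms bounded_linear_vec_nth])

lemma smooth_fun_matrix_inv:
  fixes f :: "'m \<Rightarrow> real ^ 'n ^ 'n"
  assumes "smooth_fun \<A> U f" "\<And>x. x \<in> U \<Longrightarrow> invertible (f x)"
  shows "smooth_fun \<A> U (\<lambda>x. matrix_inv (f x))"
proof (rule smooth_fun_via_charts[OF smooth_fun_open[OF assms(1)]])
  fix W \<phi> assume c: "(W, \<phi>) \<in> \<A>"
  have "Cinf_on (chart_dom \<phi> (U \<inter> W)) (\<lambda>y. matrix_inv (chart_rep W \<phi> f y))"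
    by (rule Cinf_on_matrix_inv[OF smooth_fun_Cinf_on[OF assms(1) c]])
      (use assms(2) chart_dom_inv(1)[OF c, of "U \<inter> W"] in \<open>auto simp: chart_rep_def\<close>)
  then show "Cinf_on (chart_dom \<phi> (U \<inter> W)) (chart_rep W \<phi> (\<lambda>x. matrix_inv (f x)))"
    by (simp add: chart_rep_def[abs_def])
qed

lemma smooth_fun_chart:
  assumes c: "(W, \<phi>) \<in> \<A>" shows "smooth_fun \<A> W \<phi>"
proof (rule smooth_funI_chart[OF chartD(1)[OF c]])
  fix x assume "x \<in> W"
  have "Cinf_on (chart_dom \<phi> W) (chart_rep W \<phi> \<phi>)"
    by (rule Cinf_on_cong[OF Cinf_on_linear[OF open_chart_dom[OF c chartD(1)[OF c] order_refl] bounded_linear_P]])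
      (auto simp: chart_rep_def chart_dom_def chartD(6)[OF c])
  then show "\<exists>W' \<phi>' U'. (W', \<phi>') \<in> \<A> \<and> x \<in> U' \<and> U' \<subseteq> W \<inter> W' \<and>
      open U' \<and> Cinf_on (chart_dom \<phi>' U') (chart_rep W' \<phi>' \<phi>)"
    using c chartD(1)[OF c] \<open>x \<in> W\<close> by (intro exI[of _ W] exI[of _ \<phi>] exI[of _ W]) auto
qed

lemma smooth_near_I: "smooth_fun \<A> U f \<Longrightarrow> x \<in> U \<Longrightarrow> smooth_near \<A> x f"
  by (auto simp: smooth_near_def)

lemma smooth_near_combine:
  assumes "smooth_near \<A> x f" "smooth_near \<A> x g"
  obtains U where "x \<in> U" "smooth_fun \<A> U f" "smooth_fun \<A> U g"
proof -
  obtain U U' where U: "x \<in> U" "smooth_fun \<A> U f" "x \<in> U'" "smooth_fun \<A> U' g"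
    using assms by (auto simp: smooth_near_def)
  have o: "open (U \<inter> U')" by (intro open_Int smooth_fun_open[OF U(2)] smooth_fun_open[OF U(4)])
  show thesis
    by (rule that[of "U \<inter> U'", OF _ smooth_fun_subset[OF U(2) o] smooth_fun_subset[OF U(4) o]])
      (use U in auto)
qed

lemma smooth_near_cong:
  assumes "smooth_near \<A> x f" "\<forall>\<^sub>F y in nhds x. f y = g y"
  shows "smooth_near \<A> x g"
proof -
  obtain U where U: "x \<in> U" "smooth_fun \<A> U f" using assms(1) by (auto simp: smooth_near_def)
  obtain N where N: "open N" "x \<in> N" "\<And>y. y \<in> N \<Longrightarrow> f y = g y"
    using assms(2) by (auto simp: eventually_nhds)
  have "smooth_fun \<A> (U \<inter> N) g"
    by (rule smooth_fun_cong[OF smooth_fun_subset[OF U(2)]]) (use smooth_fun_open[OF U(2)] N in auto)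
  then show ?thesis using U N by (intro smooth_near_I[of "U \<inter> N"]) auto
qed

lemma smooth_near_const: "smooth_near \<A> x (\<lambda>y. c)"
  by (rule smooth_near_I[OF smooth_fun_const[OF open_UNIV]]) simp

lemma smooth_near_bilinear:
  assumes b: "bounded_bilinear b" and fg: "smooth_near \<A> x f" "smooth_near \<A> x g"
  shows "smooth_near \<A> x (\<lambda>y. b (f y) (g y))"
proof -
  obtain U where "x \<in> U" "smooth_fun \<A> U f" "smooth_fun \<A> U g" using smooth_near_combine[OF fg] .
  then show ?thesis by (intro smooth_near_I[of U] smooth_fun_bilinear[OF b])
qed

lemma smooth_near_add:
  assumes fg: "smooth_near \<A> x f" "smooth_near \<A> x g"
  shows "smooth_near \<A> x (\<lambda>y. f y + g y)"
proof -
  obtain U where "x \<in> U" "smooth_fun \<A> U f" "smooth_fun \<A> U g" using smooth_near_combine[OF fg] .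
  then show ?thesis by (intro smooth_near_I[of U] smooth_fun_add)
qed

lemma smooth_near_sum:
  "finite I \<Longrightarrow> (\<And>i. i \<in> I \<Longrightarrow> smooth_near \<A> x (f i)) \<Longrightarrow> smooth_near \<A> x (\<lambda>y. \<Sum>i\<in>I. f i y)"
  by (induction I rule: finite_induct) (auto intro: smooth_near_const smooth_near_add)

end

section \<open>Tangent vectors in a chart\<close>

context smooth_manifold
begin

lemma tangent_space_zero: "v \<in> tangent_space \<A> x \<Longrightarrow> \<not> smooth_near \<A> x f \<Longrightarrow> v f = 0"
  and tangent_space_scale: "v \<in> tangent_space \<A> x \<Longrightarrow> smooth_near \<A> x f \<Longrightarrow> v (\<lambda>y. c * f y) = c * v f"
  and tangent_space_cong: "v \<in> tangent_space \<A> x \<Longrightarrow> smooth_near \<A> x f \<Longrightarrow> smooth_near \<A> x g \<Longrightarrow>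
    \<forall>\<^sub>F y in nhds x. f y = g y \<Longrightarrow> v f = v g"
  and tangent_space_add: "v \<in> tangent_space \<A> x \<Longrightarrow> smooth_near \<A> x f \<Longrightarrow> smooth_near \<A> x g \<Longrightarrow>
    v (\<lambda>y. f y + g y) = v f + v g"
  and tangent_space_mult: "v \<in> tangent_space \<A> x \<Longrightarrow> smooth_near \<A> x f \<Longrightarrow> smooth_near \<A> x g \<Longrightarrow>
    v (\<lambda>y. f y * g y) = f x * v g + g x * v f"
  unfolding tangent_space_def mem_Collect_eq by blast+

lemma tangent_space_const: "v \<in> tangent_space \<A> x \<Longrightarrow> v (\<lambda>y. c) = 0"
  using tangent_space_mult[of v x "\<lambda>y. 1" "\<lambda>y. 1"] tangent_space_scale[of v x "\<lambda>y. 1" c]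
  by (simp add: smooth_near_const)

lemma tangent_space_sum:
  assumes v: "v \<in> tangent_space \<A> x" and "finite I" "\<And>i. i \<in> I \<Longrightarrow> smooth_near \<A> x (f i)"
  shows "v (\<lambda>y. \<Sum>i\<in>I. f i y) = (\<Sum>i\<in>I. v (f i))"
  using assms(2,3)
  by (induction I rule: finite_induct)
    (simp_all add: tangent_space_const[OF v] tangent_space_add[OF v] smooth_near_sum)

lemma tangent_space_lincomb:
  assumes v: "v \<in> tangent_space \<A> x" and w: "w \<in> tangent_space \<A> x"
  shows "(\<lambda>f. a * v f + b * w f) \<in> tangent_space \<A> x"
proof -
  have cong: "a * v f + b * w f = a * v g + b * w g"
    if "smooth_near \<A> x f" "smooth_near \<A> x g" "\<forall>\<^sub>F y in nhds x. f y = g y" for f g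
    using tangent_space_cong[OF v that] tangent_space_cong[OF w that] by simp
  have add: "a * v (\<lambda>y. f y + g y) + b * w (\<lambda>y. f y + g y) = (a * v f + b * w f) + (a * v g + b * w g)"
    and mult: "a * v (\<lambda>y. f y * g y) + b * w (\<lambda>y. f y * g y) = f x * (a * v g + b * w g) + g x * (a * v f + b * w f)"
    if "smooth_near \<A> x f" "smooth_near \<A> x g" for f g
    unfolding tangent_space_add[OF v that] tangent_space_add[OF w that]
      tangent_space_mult[OF v that] tangent_space_mult[OF w that]
    by (simp_all only: algebra_simps)
  have scale: "a * v (\<lambda>y. c * f y) + b * w (\<lambda>y. c * f y) = c * (a * v f + b * w f)"
    if "smooth_near \<A> x f" for c f
    unfolding tangent_space_scale[OF v that] tangent_space_scale[OF w that] by (simp only: algebra_simps)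
  have zero: "a * v f + b * w f = 0" if "\<not> smooth_near \<A> x f" for f
    using tangent_space_zero[OF v that] tangent_space_zero[OF w that] by simp
  show ?thesis
    unfolding tangent_space_def
    by (intro CollectI conjI allI impI; (elim conjE)?; (rule cong add mult scale zero; assumption))
qed

lemma tangent_space_zero_vector: "(\<lambda>f. 0) \<in> tangent_space \<A> x"
  by (simp add: tangent_space_def)

lemma chart_rep_near:
  assumes c: "(W, \<phi>) \<in> \<A>" and x: "x \<in> W" and f: "smooth_near \<A> x f"
  obtains U where "open U" "x \<in> U" "U \<subseteq> W" "smooth_fun \<A> U f" "Cinf_on (chart_dom \<phi> U) (chart_rep W \<phi> f)"
    "\<phi> x \<in> chart_dom \<phi> U"
proof -
  obtain U where U: "x \<in> U" "smooth_fun \<A> U f" using f by (auto simp: smooth_near_def)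
  have o: "open (U \<inter> W)" using smooth_fun_open[OF U(2)] chartD(1)[OF c] by (rule open_Int)
  show thesis
    using U x smooth_fun_Cinf_on[OF U(2) c] smooth_fun_subset[OF U(2) o]
      chart_in_dom[OF c, of "U \<inter> W" x]
    by (intro that[of "U \<inter> W"] o) auto
qed

text \<open>The derivative in the direction \<open>b\<close> of the chart. Tangent vectors vanish on functions that
  are not smooth, hence the default value. The direction may be any vector of the ambient space;
  since \<open>chart_rep\<close> factors through \<open>P\<close>, the result is that for \<open>P b\<close>.\<close>

definition chart_vec :: "'m set \<Rightarrow> ('m \<Rightarrow> 'd) \<Rightarrow> 'd \<Rightarrow> 'm \<Rightarrow> 'm tvec" where
  "chart_vec W \<phi> b x f =
     (if smooth_near \<A> x f then frechet_derivative (chart_rep W \<phi> f) (at (\<phi> x)) b else 0)"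

lemma chart_rep_has_derivative:
  assumes "(W, \<phi>) \<in> \<A>" "x \<in> W" "smooth_near \<A> x f"
  shows "(chart_rep W \<phi> f has_derivative frechet_derivative (chart_rep W \<phi> f) (at (\<phi> x))) (at (\<phi> x))"
  by (rule chart_rep_near[OF assms]) (rule Cinf_on_has_derivative)

lemma chart_vec_eqI:
  assumes "(chart_rep W \<phi> f has_derivative D) (at (\<phi> x))" "smooth_near \<A> x f"
  shows "chart_vec W \<phi> b x f = D b"
  using assms frechet_derivative_at[OF assms(1)] by (simp add: chart_vec_def)

lemma chart_vec_tangent:
  assumes c: "(W, \<phi>) \<in> \<A>" and x: "x \<in> W"
  shows "chart_vec W \<phi> b x \<in> tangent_space \<A> x"
proof -
  note D = chart_rep_has_derivative[OF c x]
  have cong: "chart_vec W \<phi> b x f = chart_vec W \<phi> b x g"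
    if fg: "smooth_near \<A> x f" "smooth_near \<A> x g" "\<forall>\<^sub>F y in nhds x. f y = g y" for f g
  proof -
    obtain N where N: "open N" "x \<in> N" "\<And>y. y \<in> N \<Longrightarrow> f y = g y"
      using fg(3) by (auto simp: eventually_nhds)
    have o: "open (chart_dom \<phi> (N \<inter> W))" using N(1) chartD(1)[OF c] by (intro open_chart_dom[OF c]) auto
    have "(chart_rep W \<phi> g has_derivative frechet_derivative (chart_rep W \<phi> f) (at (\<phi> x))) (at (\<phi> x))"
    proof (rule has_derivative_transform_within_open[OF D[OF fg(1)] o])
      show "\<phi> x \<in> chart_dom \<phi> (N \<inter> W)" using chart_in_dom[OF c, of "N \<inter> W" x] N x by auto
      show "chart_rep W \<phi> f y = chart_rep W \<phi> g y" if "y \<in> chart_dom \<phi> (N \<inter> W)" for y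
        using N(3) chart_dom_inv(1)[OF c _ that] by (simp add: chart_rep_def)
    qed
    from chart_vec_eqI[OF this fg(2)] show ?thesis using fg(1) by (simp add: chart_vec_def)
  qed
  have add: "chart_vec W \<phi> b x (\<lambda>y. f y + g y) = chart_vec W \<phi> b x f + chart_vec W \<phi> b x g"
    and mult: "chart_vec W \<phi> b x (\<lambda>y. f y * g y) = f x * chart_vec W \<phi> b x g + g x * chart_vec W \<phi> b x f"
    if fg: "smooth_near \<A> x f" "smooth_near \<A> x g" for f g
  proof -
    have "(chart_rep W \<phi> (\<lambda>y. f y + g y) has_derivative (\<lambda>b. frechet_derivative (chart_rep W \<phi> f) (at (\<phi> x)) b
        + frechet_derivative (chart_rep W \<phi> g) (at (\<phi> x)) b)) (at (\<phi> x))"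
      using has_derivative_add[OF D[OF fg(1)] D[OF fg(2)]] by (simp add: chart_rep_def[abs_def])
    from chart_vec_eqI[OF this smooth_near_add[OF fg]]
    show "chart_vec W \<phi> b x (\<lambda>y. f y + g y) = chart_vec W \<phi> b x f + chart_vec W \<phi> b x g"
      using fg by (simp add: chart_vec_def)
    have "(chart_rep W \<phi> (\<lambda>y. f y * g y) has_derivative (\<lambda>b. f x * frechet_derivative (chart_rep W \<phi> g) (at (\<phi> x)) b
        + frechet_derivative (chart_rep W \<phi> f) (at (\<phi> x)) b * g x)) (at (\<phi> x))"
      using has_derivative_mult[OF D[OF fg(1)] D[OF fg(2)]]
      by (simp add: chart_rep_def[abs_def] chartD(6)[OF c x] chartD(8)[OF c x])
    from chart_vec_eqI[OF this smooth_near_bilinear[OF bounded_bilinear_mult fg]]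
    show "chart_vec W \<phi> b x (\<lambda>y. f y * g y) = f x * chart_vec W \<phi> b x g + g x * chart_vec W \<phi> b x f"
      using fg by (simp add: chart_vec_def)
  qed
  have scale: "chart_vec W \<phi> b x (\<lambda>y. a * f y) = a * chart_vec W \<phi> b x f" if f: "smooth_near \<A> x f" for a f
  proof -
    have "(chart_rep W \<phi> (\<lambda>y. a) has_derivative (\<lambda>b. 0)) (at (\<phi> x))"
      by (simp add: chart_rep_def[abs_def])
    from chart_vec_eqI[OF this smooth_near_const] mult[OF smooth_near_const f, of a] show ?thesis by simp
  qed
  have zero: "chart_vec W \<phi> b x f = 0" if "\<not> smooth_near \<A> x f" for f
    using that by (simp add: chart_vec_def)
  show ?thesis
    unfolding tangent_space_def
    by (intro CollectI conjI allI impI; (elim conjE)?; (rule cong add mult scale zero; assumption))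
qed

lemma chart_rep_derivative_P:
  assumes F: "Cinf_on D (\<lambda>y. f (P y))" and y: "y \<in> D" "P y \<in> D"
  shows "frechet_derivative (\<lambda>y. f (P y)) (at (P y)) b = frechet_derivative (\<lambda>y. f (P y)) (at y) b"
proof -
  let ?F = "\<lambda>y. f (P y)"
  have *: "frechet_derivative ?F (at z) = (\<lambda>u. frechet_derivative ?F (at (P z)) (P u))" if "P z \<in> D" for z
  proof -
    have "((\<lambda>z. ?F (P z)) has_derivative (\<lambda>u. frechet_derivative ?F (at (P z)) (P u))) (at z)"
      by (rule has_derivative_compose[OF bounded_linear_imp_has_derivative[OF bounded_linear_P]
            Cinf_on_has_derivative[OF F that]])
    then show ?thesis by (auto dest: frechet_derivative_at)
  qed
  show ?thesis
    using fun_cong[OF *[of y, OF y(2)], of b] fun_cong[OF *[of "P y", unfolded P_idem, OF y(2)], of b]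
    by (rule trans[OF _ sym, rotated])
qed

text \<open>The coordinate expression of \<open>\<partial>\<^sub>b f\<close> is the derivative of the coordinate expression of \<open>f\<close> also
  at points off \<open>V\<close>, because the latter is constant along the kernel of \<open>P\<close>.\<close>

lemma chart_rep_chart_vec:
  assumes c: "(W, \<phi>) \<in> \<A>" and U: "U \<subseteq> W" "smooth_fun \<A> U f" and y: "y \<in> chart_dom \<phi> U"
  shows "chart_rep W \<phi> (\<lambda>x. chart_vec W \<phi> b x f) y = frechet_derivative (chart_rep W \<phi> f) (at y) b"
proof -
  have F: "Cinf_on (chart_dom \<phi> U) (\<lambda>y. f (inv_into W \<phi> (P y)))"
    using smooth_fun_Cinf_on[OF U(2) c] U(1) by (simp add: Int_absorb2 chart_rep_def[abs_def])
  have P: "P y \<in> chart_dom \<phi> U" using y by (simp add: chart_dom_def)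
  have "smooth_near \<A> (inv_into W \<phi> (P y)) f"
    by (rule smooth_near_I[OF U(2) chart_dom_inv(1)[OF c U(1) y]])
  then have "chart_rep W \<phi> (\<lambda>x. chart_vec W \<phi> b x f) y
    = frechet_derivative (\<lambda>y. f (inv_into W \<phi> (P y))) (at (P y)) b"
    by (simp add: chart_rep_def[abs_def] chart_vec_def chart_dom_inv(2)[OF c U(1) y])
  also have "\<dots> = frechet_derivative (\<lambda>y. f (inv_into W \<phi> (P y))) (at y) b"
    by (rule chart_rep_derivative_P[OF F y P])
  finally show ?thesis by (simp add: chart_rep_def[abs_def])
qed

lemma smooth_fun_chart_vec:
  assumes c: "(W, \<phi>) \<in> \<A>" and U: "U \<subseteq> W" "smooth_fun \<A> U f"
  shows "smooth_fun \<A> U (\<lambda>x. chart_vec W \<phi> b x f)"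
proof (rule smooth_funI_chart[OF smooth_fun_open[OF U(2)]])
  fix x assume x: "x \<in> U"
  have F: "Cinf_on (chart_dom \<phi> U) (chart_rep W \<phi> f)"
    using smooth_fun_Cinf_on[OF U(2) c] U(1) by (simp add: Int_absorb2)
  have "Cinf_on (chart_dom \<phi> U) (chart_rep W \<phi> (\<lambda>x. chart_vec W \<phi> b x f))"
    by (rule Cinf_on_cong[OF Cinf_on_derivative[OF F]]) (rule chart_rep_chart_vec[OF c U, symmetric])
  then show "\<exists>W' \<phi>' U'. (W', \<phi>') \<in> \<A> \<and> x \<in> U' \<and> U' \<subseteq> U \<inter> W' \<and> open U' \<and>
      Cinf_on (chart_dom \<phi>' U') (chart_rep W' \<phi>' (\<lambda>x. chart_vec W \<phi> b x f))"
    using c U(1) x smooth_fun_open[OF U(2)]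
    by - (rule exI[of _ W], rule exI[of _ \<phi>], rule exI[of _ U], auto)
qed

lemma smooth_vector_field_chart_vec:
  assumes c: "(W, \<phi>) \<in> \<A>" and U: "open U" "U \<subseteq> W"
  shows "smooth_vector_field \<A> U (\<lambda>x. chart_vec W \<phi> b x)"
  unfolding smooth_vector_field_def
  using U chart_vec_tangent[OF c] smooth_fun_chart_vec[OF c] by blast

text \<open>Coordinate fields commute because second derivatives are symmetric. So the bracket term
  drops out of their curvature.\<close>

lemma lie_bracket_chart_vec:
  assumes c: "(W, \<phi>) \<in> \<A>" and x: "x \<in> W"
  shows "lie_bracket \<A> (\<lambda>x. chart_vec W \<phi> a x) (\<lambda>x. chart_vec W \<phi> b x) x = (\<lambda>f. 0)"
proof
  fix f :: "'m \<Rightarrow> real"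
  show "lie_bracket \<A> (\<lambda>x. chart_vec W \<phi> a x) (\<lambda>x. chart_vec W \<phi> b x) x f = 0"
  proof (cases "smooth_near \<A> x f")
    case True
    obtain U where U: "open U" "x \<in> U" "U \<subseteq> W" "smooth_fun \<A> U f" "Cinf_on (chart_dom \<phi> U) (chart_rep W \<phi> f)"
      "\<phi> x \<in> chart_dom \<phi> U" by (rule chart_rep_near[OF c x True])
    have "chart_vec W \<phi> a x (\<lambda>y. chart_vec W \<phi> b y f)
      = frechet_derivative (\<lambda>y. frechet_derivative (chart_rep W \<phi> f) (at y) b) (at (\<phi> x)) a" for a b
    proof -
      have "(chart_rep W \<phi> (\<lambda>y. chart_vec W \<phi> b y f) has_derivative
        frechet_derivative (\<lambda>y. frechet_derivative (chart_rep W \<phi> f) (at y) b) (at (\<phi> x))) (at (\<phi> x))"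
        by (rule has_derivative_transform_within_open[OF Cinf_on_has_derivative[OF Cinf_on_derivative[OF U(5)] U(6)]
              Cinf_onD(2)[OF U(5)] U(6)])
          (rule chart_rep_chart_vec[OF c U(3,4), symmetric])
      from chart_vec_eqI[OF this smooth_near_I[OF smooth_fun_chart_vec[OF c U(3,4)] U(2)]] show ?thesis .
    qed
    then show ?thesis
      using True second_derivative_symmetric[OF U(5,6)] by (simp add: lie_bracket_def)
  qed (simp add: lie_bracket_def)
qed

text \<open>Near \<open>x\<close>, Hadamard's lemma writes \<open>f\<close> as \<open>f(x)\<close> plus a combination of products of functions
  \<open>\<phi>\<^sub>b - \<phi>\<^sub>b(x)\<close>, which vanish at \<open>x\<close>, and smooth functions whose values at \<open>x\<close> are the partial
  derivatives of \<open>f\<close>. A derivation sees only these data.\<close>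

lemma tangent_vector_expand:
  assumes c: "(W, \<phi>) \<in> \<A>" and x: "x \<in> W" and v: "v \<in> tangent_space \<A> x"
  shows "v f = (\<Sum>b\<in>Basis. v (\<lambda>y. \<phi> y \<bullet> b) * chart_vec W \<phi> b x f)"
proof (cases "smooth_near \<A> x f")
  case True
  obtain U where U: "open U" "x \<in> U" "U \<subseteq> W" "smooth_fun \<A> U f" "Cinf_on (chart_dom \<phi> U) (chart_rep W \<phi> f)"
    "\<phi> x \<in> chart_dom \<phi> U" by (rule chart_rep_near[OF c x True])
  obtain e where e: "e > 0" "ball (\<phi> x) e \<subseteq> chart_dom \<phi> U"
    using Cinf_onD(2)[OF U(5)] U(6) openE by blast
  let ?B = "ball (\<phi> x) e" and ?F = "chart_rep W \<phi> f"
  have centre: "\<phi> x \<in> ?B" using e(1) by simp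
  obtain g where g: "\<And>b. b \<in> Basis \<Longrightarrow> Cinf_on ?B (g b)"
    "\<And>y. y \<in> ?B \<Longrightarrow> ?F y = ?F (\<phi> x) + (\<Sum>b\<in>Basis. ((y - \<phi> x) \<bullet> b) * g b y)"
    "\<And>b. b \<in> Basis \<Longrightarrow> g b (\<phi> x) = frechet_derivative ?F (at (\<phi> x)) b"
  proof (rule Hadamard_expansion[OF convex_ball centre Cinf_on_subset[OF U(5) open_ball e(2)]], goal_cases)
    case (1 g)
    from 1(2-4) show ?case by (rule 1(1))
  qed
  obtain N where N: "open N" "U \<inter> \<phi> -` ?B = U \<inter> N"
  proof -
    have "openin (top_of_set U) (U \<inter> \<phi> -` ?B)"
      by (rule continuous_openin_preimage_gen[OF continuous_on_subset[OF chartD(5)[OF c] U(3)] open_ball])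
    then show thesis using that by (auto simp: openin_open)
  qed
  let ?N = "U \<inter> N"
  have N': "open ?N" "x \<in> ?N" "?N \<subseteq> W" "\<And>y. y \<in> ?N \<Longrightarrow> \<phi> y \<in> ?B"
    using N U e(1) by auto
  have s\<phi>: "smooth_fun \<A> ?N \<phi>" by (rule smooth_fun_subset[OF smooth_fun_chart[OF c] N'(1,3)])
  have sg: "smooth_near \<A> x (\<lambda>y. g b (\<phi> y))" if "b \<in> Basis" for b
    using N'(4) by (intro smooth_near_I[OF smooth_fun_compose[OF s\<phi> g(1)[OF that]] N'(2)]) auto
  have sb: "smooth_near \<A> x (\<lambda>y. \<phi> y \<bullet> b)" for b
    by (rule smooth_near_I[OF smooth_fun_linear[OF s\<phi> bounded_linear_inner_left] N'(2)])
  have sd: "smooth_near \<A> x (\<lambda>y. (\<phi> y - \<phi> x) \<bullet> b)" for b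
    using smooth_near_add[OF sb smooth_near_const, of b "- (\<phi> x \<bullet> b)"] by (simp add: inner_diff_left)
  have dir_deriv: "v (\<lambda>y. (\<phi> y - \<phi> x) \<bullet> b) = v (\<lambda>y. \<phi> y \<bullet> b)" for b
    using tangent_space_add[OF v sb smooth_near_const, of b "- (\<phi> x \<bullet> b)"] tangent_space_const[OF v]
    by (simp add: inner_diff_left)
  have st: "smooth_near \<A> x (\<lambda>y. ((\<phi> y - \<phi> x) \<bullet> b) * g b (\<phi> y))" if "b \<in> Basis" for b
    by (rule smooth_near_bilinear[OF bounded_bilinear_mult sd sg[OF that]])
  have ss: "smooth_near \<A> x (\<lambda>y. \<Sum>b\<in>Basis. ((\<phi> y - \<phi> x) \<bullet> b) * g b (\<phi> y))"
    by (intro smooth_near_sum st) auto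
  have "v f = v (\<lambda>y. f x + (\<Sum>b\<in>Basis. ((\<phi> y - \<phi> x) \<bullet> b) * g b (\<phi> y)))"
  proof (rule tangent_space_cong[OF v True smooth_near_add[OF smooth_near_const ss]])
    show "\<forall>\<^sub>F y in nhds x. f y = f x + (\<Sum>b\<in>Basis. ((\<phi> y - \<phi> x) \<bullet> b) * g b (\<phi> y))"
      unfolding eventually_nhds
    proof (intro exI[of _ ?N] conjI ballI N'(1,2))
      fix y assume y: "y \<in> ?N"
      then show "f y = f x + (\<Sum>b\<in>Basis. ((\<phi> y - \<phi> x) \<bullet> b) * g b (\<phi> y))"
        using g(2)[OF N'(4)[OF y]] N'(3) x by (auto simp: chart_rep_at[OF c])
    qed
  qed
  also have "\<dots> = (\<Sum>b\<in>Basis. v (\<lambda>y. ((\<phi> y - \<phi> x) \<bullet> b) * g b (\<phi> y)))"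
    using tangent_space_add[OF v smooth_near_const ss] tangent_space_const[OF v]
      tangent_space_sum[OF v finite_Basis st] by simp
  also have "\<dots> = (\<Sum>b\<in>Basis. v (\<lambda>y. \<phi> y \<bullet> b) * chart_vec W \<phi> b x f)"
  proof (rule sum.cong[OF refl])
    fix b :: 'd assume b: "b \<in> Basis"
    show "v (\<lambda>y. ((\<phi> y - \<phi> x) \<bullet> b) * g b (\<phi> y)) = v (\<lambda>y. \<phi> y \<bullet> b) * chart_vec W \<phi> b x f"
      using tangent_space_mult[OF v sd sg[OF b], of b] g(3)[OF b] True
      by (simp add: dir_deriv chart_vec_def)
  qed
  finally show ?thesis .
qed (simp add: tangent_space_zero[OF v] chart_vec_def)

text \<open>The partial derivatives in a chart are among the values \<open>v f\<close>, so \<open>f\<close> is constant on a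
  coordinate ball.\<close>

lemma smooth_fun_locally_constant:
  assumes f: "smooth_fun \<A> U f" and zero: "\<And>x v. x \<in> U \<Longrightarrow> v \<in> tangent_space \<A> x \<Longrightarrow> v f = 0" and x: "x \<in> U"
  shows "\<exists>N. open N \<and> x \<in> N \<and> (\<forall>y\<in>U \<inter> N. f y = f x)"
proof -
  obtain W \<phi> where c: "(W, \<phi>) \<in> \<A>" "x \<in> W" by (rule ex_chart)
  let ?F = "chart_rep W \<phi> f" and ?D = "chart_dom \<phi> (U \<inter> W)"
  have F: "Cinf_on ?D ?F" by (rule smooth_fun_Cinf_on[OF f c(1)])
  have "\<phi> x \<in> ?D" using chart_in_dom[OF c(1), of "U \<inter> W" x] x c(2) by auto
  then obtain e where e: "e > 0" "ball (\<phi> x) e \<subseteq> ?D"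
    using Cinf_onD(2)[OF F] openE by blast
  have o: "open (U \<inter> W)" using smooth_fun_open[OF f] chartD(1)[OF c(1)] by auto
  have fUW: "smooth_fun \<A> (U \<inter> W) f" by (rule smooth_fun_subset[OF f o]) auto
  have D0: "(?F has_derivative (\<lambda>h. 0)) (at y within ball (\<phi> x) e)" if y: "y \<in> ball (\<phi> x) e" for y
  proof -
    have yD: "y \<in> ?D" using e(2) y by auto
    have "frechet_derivative ?F (at y) b = 0" for b
    proof -
      let ?z = "inv_into W \<phi> (P y)"
      have z: "?z \<in> U \<inter> W" by (rule chart_dom_inv(1)[OF c(1) _ yD]) auto
      have "chart_vec W \<phi> b ?z f = 0"
        by (rule zero[OF _ chart_vec_tangent[OF c(1)]]) (use z in auto)
      then show ?thesis
        using chart_rep_chart_vec[OF c(1) _ fUW yD, of b] by (simp add: chart_rep_def)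
    qed
    then have "frechet_derivative ?F (at y) = (\<lambda>h. 0)" by auto
    then show ?thesis using Cinf_on_has_derivative[OF F yD] by (auto intro: has_derivative_at_withinI)
  qed
  obtain k where k: "\<And>y. y \<in> ball (\<phi> x) e \<Longrightarrow> ?F y = k"
    using has_derivative_zero_constant[OF convex_ball D0] by blast
  have "openin (top_of_set W) (W \<inter> \<phi> -` ball (\<phi> x) e)"
    by (rule continuous_openin_preimage_gen[OF chartD(5)[OF c(1)] open_ball])
  then have N: "open (W \<inter> \<phi> -` ball (\<phi> x) e)"
    using chartD(1)[OF c(1)] by (metis openin_open_trans)
  show ?thesis
  proof (intro exI[of _ "W \<inter> \<phi> -` ball (\<phi> x) e"] conjI N ballI)
    show "x \<in> W \<inter> \<phi> -` ball (\<phi> x) e" using c(2) e(1) by simp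
    fix y assume "y \<in> U \<inter> (W \<inter> \<phi> -` ball (\<phi> x) e)"
    then show "f y = f x"
      using k[of "\<phi> y"] k[of "\<phi> x"] e(1) c(2) by (simp add: chart_rep_at[OF c(1)])
  qed
qed

end

section \<open>Linear algebra in a fibre\<close>

lemma invertible_matrix_inv: "invertible A \<Longrightarrow> invertible (matrix_inv A)"
  using matrix_inv_left matrix_inv_right unfolding invertible_def by blast

lemma matrix_mult_inv_cancel:
  fixes A B :: "real ^ 'n ^ 'n"
  assumes "invertible A"
  shows "B ** A ** matrix_inv A = B" "B ** matrix_inv A ** A = B"
    "A ** (matrix_inv A ** B) = B" "matrix_inv A ** (A ** B) = B"
  using assms by (simp_all add: matrix_mul_assoc[symmetric] matrix_inv_left matrix_inv_right)
    (simp_all add: matrix_mul_assoc matrix_inv_left matrix_inv_right)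

lemma carrier_real_field [simp]: "carrier real_field = UNIV"
  by (simp add: ring_of_type_algebra_def)

lemma coord_space_simps [simp]:
  "carrier coord_space = UNIV" "u \<oplus>\<^bsub>coord_space\<^esub> w = u + w" "c \<odot>\<^bsub>coord_space\<^esub> u = c *\<^sub>R u"
  by (simp_all add: coord_space_def)

text \<open>Identities between fibre elements are proved by applying a trivialisation, which turns them
  into identities in \<open>\<real>\<^sup>n\<close>.\<close>

locale coordinate_iso =
  fixes M :: "(real, 'e) module" and f :: "'e \<Rightarrow> real ^ 'n"
  assumes module_M: "Module.module real_field M"
    and linear_f: "fibre_linear M coord_space f"
    and bij_f: "bij_betw f (carrier M) UNIV"
begin

interpretation M: Module.module real_field M by (rule module_M)

lemma closed [simp, intro]:
  "u \<in> carrier M \<Longrightarrow> w \<in> carrier M \<Longrightarrow> u \<oplus>\<^bsub>M\<^esub> w \<in> carrier M"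
  "u \<in> carrier M \<Longrightarrow> c \<odot>\<^bsub>M\<^esub> u \<in> carrier M"
  "\<zero>\<^bsub>M\<^esub> \<in> carrier M"
  "u \<in> carrier M \<Longrightarrow> w \<in> carrier M \<Longrightarrow> u \<ominus>\<^bsub>M\<^esub> w \<in> carrier M"
  by (auto intro: M.smult_closed)

lemma finsum_closed [simp, intro]:
  "(\<And>i. i \<in> I \<Longrightarrow> e i \<in> carrier M) \<Longrightarrow> (\<Oplus>\<^bsub>M\<^esub>i\<in>I. e i) \<in> carrier M"
  by (rule M.finsum_closed) auto

lemma map_add: "u \<in> carrier M \<Longrightarrow> w \<in> carrier M \<Longrightarrow> f (u \<oplus>\<^bsub>M\<^esub> w) = f u + f w"
  and map_scale: "u \<in> carrier M \<Longrightarrow> f (c \<odot>\<^bsub>M\<^esub> u) = c *\<^sub>R f u"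
  using linear_f by (simp_all add: fibre_linear_def)

lemma map_zero: "f \<zero>\<^bsub>M\<^esub> = 0"
  using map_add[of "\<zero>\<^bsub>M\<^esub>" "\<zero>\<^bsub>M\<^esub>"] by simp

lemma map_minus:
  assumes "u \<in> carrier M" "w \<in> carrier M" shows "f (u \<ominus>\<^bsub>M\<^esub> w) = f u - f w"
proof -
  have n: "\<ominus>\<^bsub>M\<^esub> w \<in> carrier M" using assms by simp
  have "f (w \<oplus>\<^bsub>M\<^esub> \<ominus>\<^bsub>M\<^esub> w) = 0" using assms by (simp add: M.r_neg map_zero)
  then have "f (\<ominus>\<^bsub>M\<^esub> w) = - f w" using map_add[OF assms(2) n] by (simp add: add_eq_0_iff)
  then show ?thesis using map_add[OF assms(1) n] by (simp add: a_minus_def)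
qed

lemma map_finsum:
  assumes "finite I" "\<And>i. i \<in> I \<Longrightarrow> e i \<in> carrier M"
  shows "f (\<Oplus>\<^bsub>M\<^esub>i\<in>I. e i) = (\<Sum>i\<in>I. f (e i))"
  using assms
proof (induction I rule: finite_induct)
  case empty then show ?case by (simp add: map_zero)
next
  case (insert i I)
  have "(\<Oplus>\<^bsub>M\<^esub>j\<in>insert i I. e j) = e i \<oplus>\<^bsub>M\<^esub> (\<Oplus>\<^bsub>M\<^esub>j\<in>I. e j)"
    using insert by (intro M.finsum_insert) auto
  then show ?case using insert by (simp add: map_add)
qed

lemma map_eq_iff: "u \<in> carrier M \<Longrightarrow> w \<in> carrier M \<Longrightarrow> f u = f w \<longleftrightarrow> u = w"
  using bij_f by (auto simp: bij_betw_def inj_on_def)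

lemma inv_carrier [simp, intro]: "inv_into (carrier M) f c \<in> carrier M"
  and map_inv [simp]: "f (inv_into (carrier M) f c) = c"
  and inv_map [simp]: "u \<in> carrier M \<Longrightarrow> inv_into (carrier M) f (f u) = u"
  using bij_f by (auto simp: bij_betw_def f_inv_into_f intro: inv_into_into)

lemma map_lincomb:
  assumes "\<And>i. e i \<in> carrier M"
  shows "f (\<Oplus>\<^bsub>M\<^esub>i\<in>UNIV. (c $ i) \<odot>\<^bsub>M\<^esub> e i) = c v* (\<chi> i. f (e i))"
  using assms by (simp add: map_finsum map_scale vector_matrix_mult_def vec_eq_iff mult.commute)

lemma eq_lincomb_iff:
  assumes "\<And>i. e i \<in> carrier M" "u \<in> carrier M"
  shows "u = (\<Oplus>\<^bsub>M\<^esub>i\<in>UNIV. (c $ i) \<odot>\<^bsub>M\<^esub> e i) \<longleftrightarrow> f u = c v* (\<chi> i. f (e i))"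
proof -
  have "(\<Oplus>\<^bsub>M\<^esub>i\<in>UNIV. (c $ i) \<odot>\<^bsub>M\<^esub> e i) \<in> carrier M" using assms(1) by auto
  from map_eq_iff[OF assms(2) this] show ?thesis by (simp add: map_lincomb[OF assms(1)])
qed

lemma eq_lincombs_iff:
  assumes "\<And>i. e i \<in> carrier M" "\<And>i. u i \<in> carrier M"
  shows "(\<forall>i. u i = (\<Oplus>\<^bsub>M\<^esub>j\<in>UNIV. (t $ i $ j) \<odot>\<^bsub>M\<^esub> e j)) \<longleftrightarrow> (\<chi> i. f (u i)) = t ** (\<chi> i. f (e i))"
proof -
  have "((\<chi> i. f (u i)) = t ** (\<chi> i. f (e i))) \<longleftrightarrow> (\<forall>i. f (u i) = (t $ i) v* (\<chi> i. f (e i)))"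
    by (simp add: vec_eq_iff matrix_matrix_mult_def vector_matrix_mult_def mult.commute)
  moreover have "u i = (\<Oplus>\<^bsub>M\<^esub>j\<in>UNIV. (t $ i $ j) \<odot>\<^bsub>M\<^esub> e j) \<longleftrightarrow> f (u i) = (t $ i) v* (\<chi> i. f (e i))" for i
    by (rule eq_lincomb_iff[OF assms])
  ultimately show ?thesis by simp
qed

text \<open>The rows of the matrix are the coordinates of the \<open>e\<^sub>i\<close>, so the coefficients of \<open>u\<close> are the
  solutions \<open>c\<close> of \<open>c H = f(u)\<close>.\<close>

lemma fibre_basis_iff:
  fixes e :: "'n \<Rightarrow> 'e"
  assumes "\<And>i. e i \<in> carrier M"
  shows "fibre_basis M e \<longleftrightarrow> invertible (\<chi> i. f (e i))"
proof
  let ?H = "\<chi> i. f (e i)"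
  assume b: "fibre_basis M e"
  have "\<exists>c. c v* ?H = axis k 1" for k
  proof -
    obtain c where "inv_into (carrier M) f (axis k 1) = (\<Oplus>\<^bsub>M\<^esub>i\<in>UNIV. (c $ i) \<odot>\<^bsub>M\<^esub> e i)"
      using b inv_carrier unfolding fibre_basis_def by blast
    then show ?thesis using eq_lincomb_iff[where e = e, OF assms inv_carrier, of "axis k 1" c] by auto
  qed
  then obtain C where C: "\<And>k. C k v* ?H = axis k 1" by metis
  have "(\<chi> k. C k) ** ?H = mat 1"
    using C by (simp add: vec_eq_iff matrix_matrix_mult_def vector_matrix_mult_def mat_def axis_def mult.commute)
  then show "invertible ?H" using invertible_left_inverse by blast
next
  let ?H = "\<chi> i. f (e i)"
  assume i: "invertible ?H"
  have "\<exists>!c. f u = c v* ?H" for u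
  proof (rule ex1I)
    show "f u = (f u v* matrix_inv ?H) v* ?H"
      by (simp add: vector_matrix_mul_assoc matrix_inv_left[OF i])
    fix c assume "f u = c v* ?H"
    then show "c = f u v* matrix_inv ?H"
      by (simp add: vector_matrix_mul_assoc matrix_inv_right[OF i])
  qed
  then show "fibre_basis M e"
    unfolding fibre_basis_def using assms eq_lincomb_iff[where e = e, OF assms] by simp
qed

end

lemma matrix_fibre_map:
  assumes M: "coordinate_iso M f" and N: "coordinate_iso N g" and F: "fibre_linear M N F" and u: "u \<in> carrier M"
  shows "matrix (g \<circ> F \<circ> inv_into (carrier M) f) *v f u = g (F u)"
proof -
  interpret M: coordinate_iso M f by (rule M)
  interpret N: coordinate_iso N g by (rule N)
  let ?L = "g \<circ> F \<circ> inv_into (carrier M) f"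
  have F': "\<And>u. u \<in> carrier M \<Longrightarrow> F u \<in> carrier N"
    "\<And>u w. u \<in> carrier M \<Longrightarrow> w \<in> carrier M \<Longrightarrow> F (u \<oplus>\<^bsub>M\<^esub> w) = F u \<oplus>\<^bsub>N\<^esub> F w"
    "\<And>u c. u \<in> carrier M \<Longrightarrow> F (c \<odot>\<^bsub>M\<^esub> u) = c \<odot>\<^bsub>N\<^esub> F u"
    using F by (auto simp: fibre_linear_def)
  have "linear ?L"
  proof (rule linearI)
    fix a b :: "real ^ 'b" and c :: real
    let ?i = "inv_into (carrier M) f"
    have "?i (a + b) = ?i a \<oplus>\<^bsub>M\<^esub> ?i b" "?i (c *\<^sub>R a) = c \<odot>\<^bsub>M\<^esub> ?i a"
      by (subst M.map_eq_iff[symmetric]; simp add: M.map_add M.map_scale)+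
    then show "?L (a + b) = ?L a + ?L b" "?L (c *\<^sub>R a) = c *\<^sub>R ?L a"
      by (simp_all add: F' N.map_add N.map_scale)
  qed
  then show ?thesis using u by (simp add: matrix_works)
qed

section \<open>Sections of a vector bundle\<close>

lemma bounded_bilinear_matrix_vector_mult:
  "bounded_bilinear ((*v) :: real ^ 'm ^ 'n \<Rightarrow> real ^ 'm \<Rightarrow> real ^ 'n)"
  unfolding bilinear_conv_bounded_bilinear[symmetric] bilinear_def
  by (auto intro!: linearI simp: matrix_vector_mult_def vec_eq_iff algebra_simps sum.distrib sum_distrib_left)

definition lift :: "('m, 'e, 'n::finite) vbundle \<Rightarrow> ('m \<Rightarrow> 'e \<Rightarrow> real ^ 'n) \<Rightarrow> ('m \<Rightarrow> real ^ 'n) \<Rightarrow> 'm \<Rightarrow> 'e" where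
  "lift E \<psi> \<sigma> x = inv_into (carrier (fibre E x)) (\<psi> x) (\<sigma> x)"

context smooth_manifold
begin

lemma triv_iso:
  assumes "vector_bundle \<A> E" "(W, \<psi>) \<in> trivs E" "x \<in> W"
  shows "coordinate_iso (fibre E x) (\<psi> x)"
  using assms unfolding vector_bundle_def coordinate_iso_def by fast

lemma triv_open: "vector_bundle \<A> E \<Longrightarrow> (W, \<psi>) \<in> trivs E \<Longrightarrow> open W"
  unfolding vector_bundle_def by fast

lemma ex_triv: assumes "vector_bundle \<A> E" obtains W \<psi> where "(W, \<psi>) \<in> trivs E" "x \<in> W"
proof -
  have "\<forall>x. \<exists>(W, \<psi>)\<in>trivs E. x \<in> W" using assms unfolding vector_bundle_def by (elim conjE)
  then have "\<exists>(W, \<psi>)\<in>trivs E. x \<in> W" by (rule spec)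
  then show thesis using that by auto
qed

lemma triv_transition:
  assumes "vector_bundle \<A> E" "(W, \<psi>) \<in> trivs E" "(W', \<psi>') \<in> trivs E"
  shows "smooth_fun \<A> (W \<inter> W') (triv_matrix E \<psi> \<psi>' (\<lambda>x u. u))"
proof -
  have "\<forall>(W, \<phi>)\<in>trivs E. \<forall>(W', \<psi>)\<in>trivs E. smooth_fun \<A> (W \<inter> W') (triv_matrix E \<phi> \<psi> (\<lambda>x u. u))"
    using assms(1) unfolding vector_bundle_def by (elim conjE)
  from bspec[OF this assms(2)] have "\<forall>(W', \<psi>')\<in>trivs E. smooth_fun \<A> (W \<inter> W') (triv_matrix E \<psi> \<psi>' (\<lambda>x u. u))"
    by simp
  from bspec[OF this assms(3)] show ?thesis by simp
qed

lemma triv_matrix_apply: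
  assumes "vector_bundle \<A> E" "vector_bundle \<A> E'" "(W, \<psi>) \<in> trivs E" "(W', \<psi>') \<in> trivs E'"
    "x \<in> W" "x \<in> W'" "fibre_linear (fibre E x) (fibre E' x) (F x)" "u \<in> carrier (fibre E x)"
  shows "triv_matrix E \<psi> \<psi>' F x *v \<psi> x u = \<psi>' x (F x u)"
  unfolding triv_matrix_def
  by (rule matrix_fibre_map[OF triv_iso[OF assms(1,3,5)] triv_iso[OF assms(2,4,6)] assms(7,8)])

lemma fibre_linear_id: "fibre_linear M M (\<lambda>u. u)"
  by (simp add: fibre_linear_def)

lemma smooth_section_open: "smooth_section \<A> E U s \<Longrightarrow> open U"
  and smooth_section_carrier: "smooth_section \<A> E U s \<Longrightarrow> x \<in> U \<Longrightarrow> s x \<in> carrier (fibre E x)"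
  by (simp_all add: smooth_section_def)

lemma smooth_section_coord:
  "smooth_section \<A> E U s \<Longrightarrow> (W, \<psi>) \<in> trivs E \<Longrightarrow> smooth_fun \<A> (U \<inter> W) (\<lambda>x. \<psi> x (s x))"
  by (auto simp: smooth_section_def)

text \<open>It is enough to test smoothness in one trivialisation around each point, because the
  transition matrices are smooth.\<close>

lemma smooth_sectionI:
  assumes E: "vector_bundle \<A> E" and U: "open U" and s: "\<And>x. x \<in> U \<Longrightarrow> s x \<in> carrier (fibre E x)"
    and loc: "\<And>x. x \<in> U \<Longrightarrow> \<exists>W \<psi> N. (W, \<psi>) \<in> trivs E \<and> x \<in> N \<and> N \<subseteq> U \<inter> W \<and> smooth_fun \<A> N (\<lambda>x. \<psi> x (s x))"
  shows "smooth_section \<A> E U s"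
  unfolding smooth_section_def
proof (intro conjI U)
  show "\<forall>x\<in>U. s x \<in> carrier (fibre E x)" using s by blast
next
  show "\<forall>(W, \<psi>)\<in>trivs E. smooth_fun \<A> (U \<inter> W) (\<lambda>x. \<psi> x (s x))"
  proof clarify
  fix W' \<psi>' assume t': "(W', \<psi>') \<in> trivs E"
  show "smooth_fun \<A> (U \<inter> W') (\<lambda>x. \<psi>' x (s x))"
  proof (rule smooth_fun_locally)
    show "open (U \<inter> W')" using U triv_open[OF E t'] by (rule open_Int)
    fix x assume x: "x \<in> U \<inter> W'"
    obtain W \<psi> N where t: "(W, \<psi>) \<in> trivs E" and N: "x \<in> N" "N \<subseteq> U \<inter> W" "smooth_fun \<A> N (\<lambda>x. \<psi> x (s x))"
      using loc[of x] x by auto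
    let ?N = "N \<inter> W'"
    have o: "open ?N" using smooth_fun_open[OF N(3)] triv_open[OF E t'] by (rule open_Int)
    have "smooth_fun \<A> ?N (triv_matrix E \<psi> \<psi>' (\<lambda>x u. u))"
      by (rule smooth_fun_subset[OF triv_transition[OF E t t'] o]) (use N(2) in auto)
    from smooth_fun_bilinear[OF bounded_bilinear_matrix_vector_mult this smooth_fun_subset[OF N(3) o]]
    have "smooth_fun \<A> ?N (\<lambda>x. triv_matrix E \<psi> \<psi>' (\<lambda>x u. u) x *v \<psi> x (s x))" by simp
    then have "smooth_fun \<A> ?N (\<lambda>x. \<psi>' x (s x))"
    proof (rule smooth_fun_cong)
      fix y assume y: "y \<in> ?N"
      show "triv_matrix E \<psi> \<psi>' (\<lambda>x u. u) y *v \<psi> y (s y) = \<psi>' y (s y)"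
        by (rule triv_matrix_apply[OF E E t t' _ _ fibre_linear_id s]) (use y N(2) in auto)
    qed
    then show "\<exists>N. x \<in> N \<and> smooth_fun \<A> N (\<lambda>x. \<psi>' x (s x))" using N(1) x by blast
  qed
  qed
qed

lemma smooth_section_lift:
  assumes E: "vector_bundle \<A> E" and t: "(W, \<psi>) \<in> trivs E" and \<sigma>: "smooth_fun \<A> U \<sigma>" and U: "U \<subseteq> W"
  shows "smooth_section \<A> E U (lift E \<psi> \<sigma>)"
proof (rule smooth_sectionI[OF E smooth_fun_open[OF \<sigma>]])
  fix x assume x: "x \<in> U"
  note iso = coordinate_iso.inv_carrier[OF triv_iso[OF E t]] coordinate_iso.map_inv[OF triv_iso[OF E t]]
  show "lift E \<psi> \<sigma> x \<in> carrier (fibre E x)" using iso x U by (auto simp: lift_def)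
  have "smooth_fun \<A> U (\<lambda>x. \<psi> x (lift E \<psi> \<sigma> x))"
    by (rule smooth_fun_cong[OF \<sigma>]) (use iso U in \<open>auto simp: lift_def\<close>)
  then show "\<exists>W \<psi>' N. (W, \<psi>') \<in> trivs E \<and> x \<in> N \<and> N \<subseteq> U \<inter> W \<and> smooth_fun \<A> N (\<lambda>x. \<psi>' x (lift E \<psi> \<sigma> x))"
    using t x U by (intro exI[of _ W] exI[of _ \<psi>] exI[of _ U]) auto
qed

lemma lift_coord:
  assumes "vector_bundle \<A> E" "(W, \<psi>) \<in> trivs E" "x \<in> W"
  shows "\<psi> x (lift E \<psi> \<sigma> x) = \<sigma> x" "lift E \<psi> \<sigma> x \<in> carrier (fibre E x)"
    "s x \<in> carrier (fibre E x) \<Longrightarrow> lift E \<psi> (\<lambda>y. \<psi> y (s y)) x = s x"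
  using triv_iso[OF assms] by (simp_all add: lift_def coordinate_iso.map_inv coordinate_iso.inv_carrier coordinate_iso.inv_map)

lemma section_near_lift:
  assumes E: "vector_bundle \<A> E" and t: "(W, \<psi>) \<in> trivs E" "x \<in> W" and \<sigma>: "smooth_near \<A> x \<sigma>"
  shows "section_near \<A> E x (lift E \<psi> \<sigma>)"
proof -
  obtain U where U: "x \<in> U" "smooth_fun \<A> U \<sigma>" using \<sigma> by (auto simp: smooth_near_def)
  have o: "open (U \<inter> W)" using smooth_fun_open[OF U(2)] triv_open[OF E t(1)] by (rule open_Int)
  have "smooth_section \<A> E (U \<inter> W) (lift E \<psi> \<sigma>)"
    by (rule smooth_section_lift[OF E t(1) smooth_fun_subset[OF U(2) o]]) auto
  then show ?thesis unfolding section_near_def using U(1) t(2) by blast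
qed

lemma section_nearD:
  assumes E: "vector_bundle \<A> E" and t: "(W, \<psi>) \<in> trivs E" "x \<in> W" and s: "section_near \<A> E x s"
  shows "smooth_near \<A> x (\<lambda>y. \<psi> y (s y))" "\<forall>\<^sub>F y in nhds x. lift E \<psi> (\<lambda>y. \<psi> y (s y)) y = s y"
    "s x \<in> carrier (fibre E x)"
proof -
  obtain U where U: "x \<in> U" "smooth_section \<A> E U s" using s by (auto simp: section_near_def)
  show "smooth_near \<A> x (\<lambda>y. \<psi> y (s y))"
    by (rule smooth_near_I[OF smooth_section_coord[OF U(2) t(1)]]) (use U t in auto)
  show "s x \<in> carrier (fibre E x)" by (rule smooth_section_carrier[OF U(2,1)])
  have o: "open (U \<inter> W)" using smooth_section_open[OF U(2)] triv_open[OF E t(1)] by (rule open_Int)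
  show "\<forall>\<^sub>F y in nhds x. lift E \<psi> (\<lambda>y. \<psi> y (s y)) y = s y"
    unfolding eventually_nhds
    using o U(1) t(2) lift_coord(3)[OF E t(1)] smooth_section_carrier[OF U(2)]
    by (intro exI[of _ "U \<inter> W"]) auto
qed

lemma section_near_cong:
  assumes E: "vector_bundle \<A> E" and s: "section_near \<A> E x s" and eq: "\<forall>\<^sub>F y in nhds x. s y = s' y"
  shows "section_near \<A> E x s'"
proof -
  obtain U where U: "x \<in> U" "smooth_section \<A> E U s" using s by (auto simp: section_near_def)
  obtain N where N: "open N" "x \<in> N" "\<And>y. y \<in> N \<Longrightarrow> s y = s' y" using eq by (auto simp: eventually_nhds)
  have oU: "open U" by (rule smooth_section_open[OF U(2)])
  have "smooth_section \<A> E (U \<inter> N) s'"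
    unfolding smooth_section_def
  proof (intro conjI ballI, goal_cases)
    case 1 show ?case using oU N(1) by (rule open_Int)
  next
    case (2 y) then show ?case using smooth_section_carrier[OF U(2), of y] N(3) by simp
  next
    case (3 c)
    obtain W \<psi> where c: "c = (W, \<psi>)" by force
    have o: "open (U \<inter> N \<inter> W)" using oU N(1) triv_open[OF E] 3 c by blast
    have "smooth_fun \<A> (U \<inter> N \<inter> W) (\<lambda>x. \<psi> x (s x))"
      by (rule smooth_fun_subset[OF smooth_section_coord[OF U(2)] o]) (use 3 c in auto)
    then have "smooth_fun \<A> (U \<inter> N \<inter> W) (\<lambda>x. \<psi> x (s' x))"
      by (rule smooth_fun_cong) (use N(3) in auto)
    then show ?case by (simp add: c)
  qed
  then show ?thesis unfolding section_near_def using U(1) N(2) by blast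
qed

end

section \<open>Connections in a local trivialisation\<close>

definition dir_deriv :: "'m tvec \<Rightarrow> ('m \<Rightarrow> real ^ 'n) \<Rightarrow> real ^ 'n" where
  "dir_deriv v \<sigma> = (\<chi> i. v (\<lambda>y. \<sigma> y $ i))"

text \<open>The rows are the coordinates of the members of the frame, so changes of frame multiply the
  matrix from the left.\<close>

definition frame_matrix :: "('m \<Rightarrow> 'e \<Rightarrow> real ^ 'n) \<Rightarrow> ('n \<Rightarrow> 'm \<Rightarrow> 'e) \<Rightarrow> 'm \<Rightarrow> real ^ 'n ^ 'n" where
  "frame_matrix \<psi> h x = (\<chi> i. \<psi> x (h i x))"

definition frame_coeff :: "('m, 'e, 'n::finite) vbundle \<Rightarrow> ('n \<Rightarrow> 'm \<Rightarrow> 'e) \<Rightarrow> ('m \<Rightarrow> 'e) \<Rightarrow> 'm \<Rightarrow> real ^ 'n" where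
  "frame_coeff E h s x = (THE c. s x = (\<Oplus>\<^bsub>fibre E x\<^esub>i\<in>UNIV. (c $ i) \<odot>\<^bsub>fibre E x\<^esub> h i x))"

text \<open>The matrix \<open>t\<close> with \<open>k\<^sub>i = \<Sum> t\<^sub>i\<^sub>j h\<^sub>j\<close>.\<close>

definition frame_change :: "('m, 'e, 'n::finite) vbundle \<Rightarrow> ('n \<Rightarrow> 'm \<Rightarrow> 'e) \<Rightarrow> ('n \<Rightarrow> 'm \<Rightarrow> 'e) \<Rightarrow> 'm \<Rightarrow> real ^ 'n ^ 'n" where
  "frame_change E h k x = (\<chi> i. frame_coeff E h (k i) x)"

lemma locally_constant_vec:
  fixes f :: "'m::topological_space \<Rightarrow> 'b ^ 'n"
  assumes "\<And>i. \<exists>N. open N \<and> x \<in> N \<and> (\<forall>y\<in>U \<inter> N. f y $ i = f x $ i)"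
  shows "\<exists>N. open N \<and> x \<in> N \<and> (\<forall>y\<in>U \<inter> N. f y = f x)"
proof -
  obtain N where N: "\<And>i. open (N i)" "\<And>i. x \<in> N i" "\<And>i y. y \<in> U \<inter> N i \<Longrightarrow> f y $ i = f x $ i"
    using assms by metis
  have "open (\<Inter>i. N i)" using N(1) by (intro open_INT) auto
  then show ?thesis using N(2,3) by (intro exI[of _ "\<Inter>i. N i"]) (auto simp: vec_eq_iff)
qed

context smooth_manifold
begin

lemma smooth_near_vec_nth:
  fixes \<sigma> :: "'m \<Rightarrow> real ^ 'n"
  shows "smooth_near \<A> x \<sigma> \<Longrightarrow> smooth_near \<A> x (\<lambda>y. \<sigma> y $ i)"
  unfolding smooth_near_def using smooth_fun_vec_nth by blast

lemma dir_deriv_cong: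
  assumes v: "v \<in> tangent_space \<A> x" and \<sigma>: "smooth_near \<A> x \<sigma>" and eq: "\<forall>\<^sub>F y in nhds x. \<sigma> y = \<tau> y"
  shows "dir_deriv v \<sigma> = dir_deriv v \<tau>"
proof -
  have "smooth_near \<A> x \<tau>" by (rule smooth_near_cong[OF \<sigma> eq])
  moreover have "\<forall>\<^sub>F y in nhds x. \<sigma> y $ i = \<tau> y $ i" for i using eq by (rule eventually_mono) simp
  ultimately have "v (\<lambda>y. \<sigma> y $ i) = v (\<lambda>y. \<tau> y $ i)" for i
    by (intro tangent_space_cong[OF v] smooth_near_vec_nth \<sigma>)
  then show ?thesis by (simp add: dir_deriv_def)
qed

lemma dir_deriv_const: "v \<in> tangent_space \<A> x \<Longrightarrow> dir_deriv v (\<lambda>y. c) = 0"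
  by (simp add: dir_deriv_def vec_eq_iff tangent_space_const)

lemma smooth_fun_locally_constant_vec:
  fixes \<sigma> :: "'m \<Rightarrow> real ^ 'n"
  assumes "smooth_fun \<A> U \<sigma>" "\<And>x v. x \<in> U \<Longrightarrow> v \<in> tangent_space \<A> x \<Longrightarrow> dir_deriv v \<sigma> = 0" "x \<in> U"
  shows "\<exists>N. open N \<and> x \<in> N \<and> (\<forall>y\<in>U \<inter> N. \<sigma> y = \<sigma> x)"
  using assms(2)
  by (intro locally_constant_vec smooth_fun_locally_constant[OF smooth_fun_vec_nth[OF assms(1)] _ assms(3)])
    (simp add: dir_deriv_def vec_eq_iff)

lemma chart_rep_dir_deriv:
  fixes \<sigma> :: "'m \<Rightarrow> real ^ 'n"
  assumes c: "(W, \<phi>) \<in> \<A>" and U: "U \<subseteq> W" "smooth_fun \<A> U \<sigma>" and y: "y \<in> chart_dom \<phi> U"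
  shows "dir_deriv (chart_vec W \<phi> b (inv_into W \<phi> (P y))) \<sigma> = frechet_derivative (chart_rep W \<phi> \<sigma>) (at y) b"
proof -
  have F: "Cinf_on (chart_dom \<phi> U) (chart_rep W \<phi> \<sigma>)"
    using smooth_fun_Cinf_on[OF U(2) c] U(1) by (simp add: Int_absorb2)
  have "chart_vec W \<phi> b (inv_into W \<phi> (P y)) (\<lambda>y. \<sigma> y $ i) = frechet_derivative (chart_rep W \<phi> \<sigma>) (at y) b $ i" for i
  proof -
    have "chart_vec W \<phi> b (inv_into W \<phi> (P y)) (\<lambda>y. \<sigma> y $ i)
      = frechet_derivative (chart_rep W \<phi> (\<lambda>y. \<sigma> y $ i)) (at y) b"
      using chart_rep_chart_vec[OF c U(1) smooth_fun_vec_nth[OF U(2)] y, of b i] by (simp add: chart_rep_def)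
    also have "(chart_rep W \<phi> (\<lambda>y. \<sigma> y $ i) has_derivative (\<lambda>b. frechet_derivative (chart_rep W \<phi> \<sigma>) (at y) b $ i)) (at y)"
      using bounded_linear.has_derivative[OF bounded_linear_vec_nth Cinf_on_has_derivative[OF F y], of i]
      by (simp add: chart_rep_def[abs_def])
    then have "frechet_derivative (chart_rep W \<phi> (\<lambda>y. \<sigma> y $ i)) (at y) = (\<lambda>b. frechet_derivative (chart_rep W \<phi> \<sigma>) (at y) b $ i)"
      by (rule frechet_derivative_at[symmetric])
    finally show ?thesis .
  qed
  then show ?thesis by (simp add: dir_deriv_def vec_eq_iff)
qed

context
  fixes E :: "('m, 'e, 'n::finite) vbundle" and D :: "('m, 'e) cov_deriv"
  assumes E: "vector_bundle \<A> E" and D: "bundle_connection \<A> E D"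
begin

lemma conn_carrier:
  assumes "v \<in> tangent_space \<A> x" "section_near \<A> E x s"
  shows "D x v s \<in> carrier (fibre E x)"
proof -
  have "\<forall>x. \<forall>v\<in>tangent_space \<A> x. \<forall>s. section_near \<A> E x s \<longrightarrow> D x v s \<in> carrier (fibre E x)"
    using D unfolding bundle_connection_def by (elim conjE)
  then show ?thesis using assms by blast
qed

lemma conn_cong:
  assumes "v \<in> tangent_space \<A> x" "section_near \<A> E x s" "\<forall>\<^sub>F y in nhds x. s y = s' y"
  shows "D x v s = D x v s'"
proof -
  have "\<forall>x. \<forall>v\<in>tangent_space \<A> x. \<forall>s s'. section_near \<A> E x s \<and> section_near \<A> E x s' \<and>
        (\<forall>\<^sub>F y in nhds x. s y = s' y) \<longrightarrow> D x v s = D x v s'"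
    using D unfolding bundle_connection_def by (elim conjE)
  then show ?thesis using assms section_near_cong[OF E assms(2,3)] by blast
qed

lemma conn_linear:
  assumes "v \<in> tangent_space \<A> x" "w \<in> tangent_space \<A> x" "section_near \<A> E x s"
  shows "D x (\<lambda>f. a * v f + b * w f) s =
          a \<odot>\<^bsub>fibre E x\<^esub> D x v s \<oplus>\<^bsub>fibre E x\<^esub> b \<odot>\<^bsub>fibre E x\<^esub> D x w s"
proof -
  have "\<forall>x. \<forall>v\<in>tangent_space \<A> x. \<forall>w\<in>tangent_space \<A> x. \<forall>a b s. section_near \<A> E x s \<longrightarrow>
        D x (\<lambda>f. a * v f + b * w f) s =
          a \<odot>\<^bsub>fibre E x\<^esub> D x v s \<oplus>\<^bsub>fibre E x\<^esub> b \<odot>\<^bsub>fibre E x\<^esub> D x w s"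
    using D unfolding bundle_connection_def by (elim conjE)
  then show ?thesis using assms by blast
qed

lemma conn_add:
  assumes "v \<in> tangent_space \<A> x" "section_near \<A> E x s" "section_near \<A> E x s'"
  shows "D x v (\<lambda>y. s y \<oplus>\<^bsub>fibre E y\<^esub> s' y) = D x v s \<oplus>\<^bsub>fibre E x\<^esub> D x v s'"
proof -
  have "\<forall>x. \<forall>v\<in>tangent_space \<A> x. \<forall>s s'. section_near \<A> E x s \<and> section_near \<A> E x s' \<longrightarrow>
        D x v (\<lambda>y. s y \<oplus>\<^bsub>fibre E y\<^esub> s' y) = D x v s \<oplus>\<^bsub>fibre E x\<^esub> D x v s'"
    using D unfolding bundle_connection_def by (elim conjE)
  then show ?thesis using assms by blast
qed

lemma conn_leibniz:
  assumes "v \<in> tangent_space \<A> x" "smooth_near \<A> x f" "section_near \<A> E x s"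
  shows "D x v (\<lambda>y. f y \<odot>\<^bsub>fibre E y\<^esub> s y) =
          v f \<odot>\<^bsub>fibre E x\<^esub> s x \<oplus>\<^bsub>fibre E x\<^esub> f x \<odot>\<^bsub>fibre E x\<^esub> D x v s"
proof -
  have "\<forall>x. \<forall>v\<in>tangent_space \<A> x. \<forall>f s. smooth_near \<A> x f \<and> section_near \<A> E x s \<longrightarrow>
        D x v (\<lambda>y. f y \<odot>\<^bsub>fibre E y\<^esub> s y) =
          v f \<odot>\<^bsub>fibre E x\<^esub> s x \<oplus>\<^bsub>fibre E x\<^esub> f x \<odot>\<^bsub>fibre E x\<^esub> D x v s"
    using D unfolding bundle_connection_def by (elim conjE)
  then show ?thesis using assms by blast
qed

lemma conn_smooth:
  assumes "smooth_vector_field \<A> U Y" "smooth_section \<A> E U s"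
  shows "smooth_section \<A> E U (\<lambda>x. D x (Y x) s)"
proof -
  have "\<forall>U X1 s. smooth_vector_field \<A> U X1 \<and> smooth_section \<A> E U s \<longrightarrow>
        smooth_section \<A> E U (\<lambda>x. D x (X1 x) s)"
    using D unfolding bundle_connection_def by (elim conjE)
  then show ?thesis using assms by blast
qed

text \<open>The connection read in a trivialisation, as an operator on \<open>\<real>\<^sup>n\<close>-valued functions. Working
  with it replaces sums in varying fibres by sums in \<open>\<real>\<^sup>n\<close>.\<close>

definition conn_coord :: "('m \<Rightarrow> 'e \<Rightarrow> real ^ 'n) \<Rightarrow> 'm \<Rightarrow> 'm tvec \<Rightarrow> ('m \<Rightarrow> real ^ 'n) \<Rightarrow> real ^ 'n" where
  "conn_coord \<psi> x v \<sigma> = \<psi> x (D x v (lift E \<psi> \<sigma>))"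

context
  fixes W \<psi> x
  assumes t: "(W, \<psi>) \<in> trivs E" and x: "x \<in> W"
begin

interpretation fib: coordinate_iso "fibre E x" "\<psi> x" by (rule triv_iso[OF E t x])

lemma eventually_in_triv: "\<forall>\<^sub>F y in nhds x. y \<in> W"
  using triv_open[OF E t] x by (rule eventually_nhds_in_open)

lemma conn_coord_eq:
  assumes "v \<in> tangent_space \<A> x" "section_near \<A> E x s"
  shows "\<psi> x (D x v s) = conn_coord \<psi> x v (\<lambda>y. \<psi> y (s y))"
proof -
  have "\<forall>\<^sub>F y in nhds x. s y = lift E \<psi> (\<lambda>y. \<psi> y (s y)) y"
    using section_nearD(2)[OF E t x assms(2)] by (rule eventually_mono) simp
  then show ?thesis using conn_cong[OF assms] by (simp add: conn_coord_def)
qed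

lemma conn_coord_cong:
  assumes v: "v \<in> tangent_space \<A> x" and \<sigma>: "smooth_near \<A> x \<sigma>" and eq: "\<forall>\<^sub>F y in nhds x. \<sigma> y = \<tau> y"
  shows "conn_coord \<psi> x v \<sigma> = conn_coord \<psi> x v \<tau>"
proof -
  have "\<forall>\<^sub>F y in nhds x. lift E \<psi> \<sigma> y = lift E \<psi> \<tau> y"
    using eq by (rule eventually_mono) (simp add: lift_def)
  then show ?thesis using conn_cong[OF v section_near_lift[OF E t x \<sigma>]] by (simp add: conn_coord_def)
qed

lemma conn_coord_add:
  assumes v: "v \<in> tangent_space \<A> x" and \<sigma>: "smooth_near \<A> x \<sigma>" and \<tau>: "smooth_near \<A> x \<tau>"
  shows "conn_coord \<psi> x v (\<lambda>y. \<sigma> y + \<tau> y) = conn_coord \<psi> x v \<sigma> + conn_coord \<psi> x v \<tau>"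
proof -
  note s = section_near_lift[OF E t x \<sigma>] section_near_lift[OF E t x \<tau>]
  have "\<forall>\<^sub>F y in nhds x. lift E \<psi> (\<lambda>y. \<sigma> y + \<tau> y) y = lift E \<psi> \<sigma> y \<oplus>\<^bsub>fibre E y\<^esub> lift E \<psi> \<tau> y"
    using eventually_in_triv
  proof (rule eventually_mono)
    fix y assume y: "y \<in> W"
    interpret y: coordinate_iso "fibre E y" "\<psi> y" by (rule triv_iso[OF E t y])
    show "lift E \<psi> (\<lambda>y. \<sigma> y + \<tau> y) y = lift E \<psi> \<sigma> y \<oplus>\<^bsub>fibre E y\<^esub> lift E \<psi> \<tau> y"
      by (subst y.map_eq_iff[symmetric]) (auto simp: lift_coord[OF E t y] y.map_add)
  qed
  from conn_cong[OF v section_near_lift[OF E t x smooth_near_add[OF \<sigma> \<tau>]] this]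
  show ?thesis
    using conn_carrier[OF v s(1)] conn_carrier[OF v s(2)]
    by (simp add: conn_coord_def conn_add[OF v s] fib.map_add)
qed

lemma conn_coord_scale:
  assumes v: "v \<in> tangent_space \<A> x" and f: "smooth_near \<A> x f" and \<sigma>: "smooth_near \<A> x \<sigma>"
  shows "conn_coord \<psi> x v (\<lambda>y. f y *\<^sub>R \<sigma> y) = v f *\<^sub>R \<sigma> x + f x *\<^sub>R conn_coord \<psi> x v \<sigma>"
proof -
  note s = section_near_lift[OF E t x \<sigma>]
  have "\<forall>\<^sub>F y in nhds x. lift E \<psi> (\<lambda>y. f y *\<^sub>R \<sigma> y) y = f y \<odot>\<^bsub>fibre E y\<^esub> lift E \<psi> \<sigma> y"
    using eventually_in_triv
  proof (rule eventually_mono)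
    fix y assume y: "y \<in> W"
    interpret y: coordinate_iso "fibre E y" "\<psi> y" by (rule triv_iso[OF E t y])
    show "lift E \<psi> (\<lambda>y. f y *\<^sub>R \<sigma> y) y = f y \<odot>\<^bsub>fibre E y\<^esub> lift E \<psi> \<sigma> y"
      by (subst y.map_eq_iff[symmetric]) (auto simp: lift_coord[OF E t y] y.map_scale)
  qed
  from conn_cong[OF v section_near_lift[OF E t x smooth_near_bilinear[OF bounded_bilinear_scaleR f \<sigma>]] this]
  show ?thesis
    using conn_carrier[OF v s]
    by (simp add: conn_coord_def conn_leibniz[OF v f s] fib.map_add fib.map_scale lift_coord[OF E t x])
qed

lemma conn_coord_zero:
  assumes v: "v \<in> tangent_space \<A> x" shows "conn_coord \<psi> x v (\<lambda>y. 0) = 0"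
  using conn_coord_scale[OF v smooth_near_const[where c = 0] smooth_near_const[where c = 0]]
  by (simp add: tangent_space_const[OF v])

lemma conn_coord_sum:
  assumes v: "v \<in> tangent_space \<A> x" and "finite I" and "\<And>i. i \<in> I \<Longrightarrow> smooth_near \<A> x (\<sigma> i)"
  shows "conn_coord \<psi> x v (\<lambda>y. \<Sum>i\<in>I. \<sigma> i y) = (\<Sum>i\<in>I. conn_coord \<psi> x v (\<sigma> i))"
  using assms(2,3)
  by (induction I rule: finite_induct)
    (simp_all add: conn_coord_zero[OF v] conn_coord_add[OF v] smooth_near_sum)

lemma linear_conn_coord_const:
  assumes v: "v \<in> tangent_space \<A> x" shows "linear (\<lambda>w. conn_coord \<psi> x v (\<lambda>y. w))"
proof (rule linearI)
  fix a b :: "real ^ 'n" and c :: real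
  show "conn_coord \<psi> x v (\<lambda>y. a + b) = conn_coord \<psi> x v (\<lambda>y. a) + conn_coord \<psi> x v (\<lambda>y. b)"
    by (rule conn_coord_add[OF v smooth_near_const smooth_near_const])
  show "conn_coord \<psi> x v (\<lambda>y. c *\<^sub>R a) = c *\<^sub>R conn_coord \<psi> x v (\<lambda>y. a)"
    using conn_coord_scale[OF v smooth_near_const smooth_near_const, of c a] by (simp add: tangent_space_const[OF v])
qed

text \<open>In a trivialisation a connection is \<open>d\<close> plus an endomorphism-valued form, namely its value on
  constant functions.\<close>

lemma conn_coord_formula:
  assumes v: "v \<in> tangent_space \<A> x" and \<sigma>: "smooth_near \<A> x \<sigma>"
  shows "conn_coord \<psi> x v \<sigma> = dir_deriv v \<sigma> + conn_coord \<psi> x v (\<lambda>y. \<sigma> x)"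
proof -
  note n = smooth_near_vec_nth[OF \<sigma>]
  have rep: "w = (\<Sum>i\<in>UNIV. w $ i *\<^sub>R axis i 1)" for w :: "real ^ 'n"
    by (simp add: vec_eq_iff axis_def if_distrib cong: if_cong)
  have "conn_coord \<psi> x v \<sigma> = conn_coord \<psi> x v (\<lambda>y. \<Sum>i\<in>UNIV. \<sigma> y $ i *\<^sub>R axis i 1)"
    using rep by simp
  also have "\<dots> = (\<Sum>i\<in>UNIV. v (\<lambda>y. \<sigma> y $ i) *\<^sub>R axis i 1 + \<sigma> x $ i *\<^sub>R conn_coord \<psi> x v (\<lambda>y. axis i 1))"
    by (subst conn_coord_sum[OF v])
      (simp_all add: conn_coord_scale[OF v n smooth_near_const] smooth_near_bilinear[OF bounded_bilinear_scaleR n smooth_near_const])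
  also have "\<dots> = (\<Sum>i\<in>UNIV. v (\<lambda>y. \<sigma> y $ i) *\<^sub>R axis i 1) + conn_coord \<psi> x v (\<lambda>y. \<Sum>i\<in>UNIV. \<sigma> x $ i *\<^sub>R axis i 1)"
    by (simp add: sum.distrib linear_sum[OF linear_conn_coord_const[OF v]] linear_scale[OF linear_conn_coord_const[OF v]])
  also have "\<dots> = dir_deriv v \<sigma> + conn_coord \<psi> x v (\<lambda>y. \<sigma> x)"
    using rep[of "dir_deriv v \<sigma>"] rep[of "\<sigma> x"] by (simp add: dir_deriv_def)
  finally show ?thesis .
qed

lemma conn_coord_linear:
  assumes v: "v \<in> tangent_space \<A> x" and w: "w \<in> tangent_space \<A> x" and \<sigma>: "smooth_near \<A> x \<sigma>"
  shows "conn_coord \<psi> x (\<lambda>f. a * v f + b * w f) \<sigma> = a *\<^sub>R conn_coord \<psi> x v \<sigma> + b *\<^sub>R conn_coord \<psi> x w \<sigma>"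
  using conn_carrier[OF v section_near_lift[OF E t x \<sigma>]] conn_carrier[OF w section_near_lift[OF E t x \<sigma>]]
  by (simp add: conn_coord_def conn_linear[OF v w section_near_lift[OF E t x \<sigma>]] fib.map_add fib.map_scale)

lemma conn_coord_lincomb:
  assumes w: "\<And>b. b \<in> B \<Longrightarrow> w b \<in> tangent_space \<A> x" and B: "finite B" and \<sigma>: "smooth_near \<A> x \<sigma>"
  shows "(\<lambda>f. \<Sum>b\<in>B. c b * w b f) \<in> tangent_space \<A> x \<and>
    conn_coord \<psi> x (\<lambda>f. \<Sum>b\<in>B. c b * w b f) \<sigma> = (\<Sum>b\<in>B. c b *\<^sub>R conn_coord \<psi> x (w b) \<sigma>)"
  using B w
proof (induction B rule: finite_induct)
  case empty
  note z = tangent_space_zero_vector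
  show ?case using conn_coord_linear[OF z z \<sigma>, of 0 0] by (simp add: z)
next
  case (insert b B)
  let ?u = "\<lambda>f. \<Sum>b\<in>B. c b * w b f"
  have u: "?u \<in> tangent_space \<A> x" "conn_coord \<psi> x ?u \<sigma> = (\<Sum>b\<in>B. c b *\<^sub>R conn_coord \<psi> x (w b) \<sigma>)"
    using insert by auto
  have eq: "(\<lambda>f. \<Sum>b\<in>insert b B. c b * w b f) = (\<lambda>f. c b * w b f + 1 * ?u f)"
    using insert by (simp add: fun_eq_iff)
  show ?case
    unfolding eq
    using tangent_space_lincomb[OF insert.prems[of b] u(1), of "c b" 1] conn_coord_linear[OF insert.prems[of b] u(1) \<sigma>, of "c b" 1] u(2) insert
    by simp
qed

text \<open>Leibniz rule for a section expanded in a frame that is parallel at \<open>x\<close>: only the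
  coefficients are differentiated.\<close>

lemma conn_parallel_frame:
  assumes v: "v \<in> tangent_space \<A> x"
    and h: "\<And>i. section_near \<A> E x (h i)" "\<And>i. D x v (h i) = \<zero>\<^bsub>fibre E x\<^esub>"
    and c: "smooth_near \<A> x c" and s: "section_near \<A> E x s"
    and eq: "\<forall>\<^sub>F y in nhds x. \<psi> y (s y) = c y v* frame_matrix \<psi> h y"
  shows "\<psi> x (D x v s) = dir_deriv v c v* frame_matrix \<psi> h x"
proof -
  note n = smooth_near_vec_nth[OF c] and hn = section_nearD(1)[OF E t x h(1)]
  have "\<psi> x (D x v s) = conn_coord \<psi> x v (\<lambda>y. \<psi> y (s y))" by (rule conn_coord_eq[OF v s])
  also have "\<dots> = conn_coord \<psi> x v (\<lambda>y. \<Sum>i\<in>UNIV. c y $ i *\<^sub>R \<psi> y (h i y))"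
    by (rule conn_coord_cong[OF v section_nearD(1)[OF E t x s]])
      (use eq in \<open>simp add: frame_matrix_def vector_matrix_mult_def vec_eq_iff mult.commute\<close>)
  also have "\<dots> = (\<Sum>i\<in>UNIV. conn_coord \<psi> x v (\<lambda>y. c y $ i *\<^sub>R \<psi> y (h i y)))"
    by (rule conn_coord_sum[OF v finite smooth_near_bilinear[OF bounded_bilinear_scaleR n hn]])
  also have "\<dots> = (\<Sum>i\<in>UNIV. v (\<lambda>y. c y $ i) *\<^sub>R \<psi> x (h i x))"
    using conn_coord_eq[OF v h(1)] h(2) by (simp add: conn_coord_scale[OF v n hn] fib.map_zero)
  also have "\<dots> = dir_deriv v c v* frame_matrix \<psi> h x"
    by (simp add: dir_deriv_def frame_matrix_def vector_matrix_mult_def vec_eq_iff mult.commute)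
  finally show ?thesis .
qed

end

end

section \<open>Frames and changes of frame\<close>

definition frame_on :: "('m, 'e, 'n::finite) vbundle \<Rightarrow> 'm set \<Rightarrow> ('n \<Rightarrow> 'm \<Rightarrow> 'e) \<Rightarrow> bool" where
  "frame_on E U h \<longleftrightarrow> (\<forall>i. smooth_section \<A> E U (h i)) \<and> (\<forall>x\<in>U. fibre_basis (fibre E x) (\<lambda>i. h i x))"

definition parallel_frame_on ::
  "('m, 'e, 'n::finite) vbundle \<Rightarrow> ('m, 'e) cov_deriv \<Rightarrow> 'm set \<Rightarrow> ('n \<Rightarrow> 'm \<Rightarrow> 'e) \<Rightarrow> bool" where
  "parallel_frame_on E D U h \<longleftrightarrow>
     (\<forall>i. parallel_section \<A> E D U (h i)) \<and> (\<forall>x\<in>U. fibre_basis (fibre E x) (\<lambda>i. h i x))"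

lemma parallel_frame_imp_frame: "parallel_frame_on E D U h \<Longrightarrow> frame_on E U h"
  by (simp add: parallel_frame_on_def frame_on_def parallel_section_def)

lemma frame_section: "frame_on E U h \<Longrightarrow> smooth_section \<A> E U (h i)"
  by (simp add: frame_on_def)

lemma frame_carrier: "frame_on E U h \<Longrightarrow> x \<in> U \<Longrightarrow> h i x \<in> carrier (fibre E x)"
  by (rule smooth_section_carrier[OF frame_section])

lemma frame_open: "frame_on E U h \<Longrightarrow> open U"
  by (rule smooth_section_open[OF frame_section])

context
  fixes E :: "('m, 'e, 'n::finite) vbundle"
  assumes E: "vector_bundle \<A> E"
begin

lemma frame_matrix_invertible:
  assumes h: "frame_on E U h" and t: "(W, \<psi>) \<in> trivs E" and x: "x \<in> U" "x \<in> W"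
  shows "invertible (frame_matrix \<psi> h x)"
  using coordinate_iso.fibre_basis_iff[OF triv_iso[OF E t x(2)], where e = "\<lambda>i. h i x", OF frame_carrier[OF h x(1)]] h x(1)
  by (simp add: frame_on_def frame_matrix_def)

lemma smooth_fun_frame_matrix:
  assumes h: "frame_on E U h" and t: "(W, \<psi>) \<in> trivs E"
  shows "smooth_fun \<A> (U \<inter> W) (frame_matrix \<psi> h)"
  unfolding frame_matrix_def[abs_def]
  by (intro smooth_fun_vec_lambda open_Int frame_open[OF h] triv_open[OF E t] smooth_section_coord[OF frame_section[OF h] t])

lemma frame_coeff_eq:
  assumes h: "frame_on E U h" and s: "s x \<in> carrier (fibre E x)" and t: "(W, \<psi>) \<in> trivs E" and x: "x \<in> U" "x \<in> W"
  shows "frame_coeff E h s x = \<psi> x (s x) v* matrix_inv (frame_matrix \<psi> h x)"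
proof -
  have hc: "h i x \<in> carrier (fibre E x)" for i by (rule frame_carrier[OF h x(1)])
  note inv = frame_matrix_invertible[OF h t x]
  have "s x = (\<Oplus>\<^bsub>fibre E x\<^esub>i\<in>UNIV. (c $ i) \<odot>\<^bsub>fibre E x\<^esub> h i x) \<longleftrightarrow> c = \<psi> x (s x) v* matrix_inv (frame_matrix \<psi> h x)" for c
  proof -
    have "s x = (\<Oplus>\<^bsub>fibre E x\<^esub>i\<in>UNIV. (c $ i) \<odot>\<^bsub>fibre E x\<^esub> h i x) \<longleftrightarrow> \<psi> x (s x) = c v* frame_matrix \<psi> h x"
      using coordinate_iso.eq_lincomb_iff[OF triv_iso[OF E t x(2)], where e = "\<lambda>i. h i x", OF hc s]
      by (simp add: frame_matrix_def)
    also have "\<dots> \<longleftrightarrow> c = \<psi> x (s x) v* matrix_inv (frame_matrix \<psi> h x)"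
      using inv by (auto simp: vector_matrix_mul_assoc matrix_inv_left matrix_inv_right)
    finally show ?thesis .
  qed
  then show ?thesis unfolding frame_coeff_def by simp
qed

lemma frame_coeff_coord:
  assumes h: "frame_on E U h" and s: "s x \<in> carrier (fibre E x)" and t: "(W, \<psi>) \<in> trivs E" and x: "x \<in> U" "x \<in> W"
  shows "\<psi> x (s x) = frame_coeff E h s x v* frame_matrix \<psi> h x"
  using frame_coeff_eq[where s = s and x = x, OF assms] matrix_inv_left[OF frame_matrix_invertible[OF h t x]]
  by (simp add: vector_matrix_mul_assoc)

lemma smooth_fun_frame_coeff:
  assumes h: "frame_on E U h" and s: "smooth_section \<A> E U s"
  shows "smooth_fun \<A> U (frame_coeff E h s)"
proof (rule smooth_fun_locally[OF _ smooth_section_open[OF s]])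
  fix x assume x: "x \<in> U"
  obtain W \<psi> where t: "(W, \<psi>) \<in> trivs E" "x \<in> W" using ex_triv[OF E] .
  have "smooth_fun \<A> (U \<inter> W) (\<lambda>x. \<psi> x (s x) v* matrix_inv (frame_matrix \<psi> h x))"
    by (intro smooth_fun_bilinear[OF bounded_bilinear_vector_matrix_mult] smooth_section_coord[OF s t(1)]
        smooth_fun_matrix_inv smooth_fun_frame_matrix[OF h t(1)] frame_matrix_invertible[OF h t(1)]) auto
  then have "smooth_fun \<A> (U \<inter> W) (frame_coeff E h s)"
  proof (rule smooth_fun_cong)
    fix y assume y: "y \<in> U \<inter> W"
    show "\<psi> y (s y) v* matrix_inv (frame_matrix \<psi> h y) = frame_coeff E h s y"
      by (rule frame_coeff_eq[where s = s and x = y, OF h smooth_section_carrier[OF s] t(1), symmetric]) (use y in auto)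
  qed
  then show "\<exists>N. x \<in> N \<and> smooth_fun \<A> N (frame_coeff E h s)" using x t(2) by blast
qed

lemma frame_change_matrix:
  assumes h: "frame_on E U h" and k: "frame_on E U' k" and t: "(W, \<psi>) \<in> trivs E" and x: "x \<in> U" "x \<in> U'" "x \<in> W"
  shows "frame_matrix \<psi> k x = frame_change E h k x ** frame_matrix \<psi> h x"
proof -
  have "k i x \<in> carrier (fibre E x)" for i by (rule frame_carrier[OF k x(2)])
  then have "\<psi> x (k i x) = frame_coeff E h (k i) x v* frame_matrix \<psi> h x" for i
    by (rule frame_coeff_coord[where s = "k i" and x = x, OF h _ t x(1,3)])
  then show ?thesis
    by (simp add: frame_matrix_def frame_change_def vec_eq_iff matrix_matrix_mult_def vector_matrix_mult_def mult.commute)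
qed

lemma frame_expand_iff:
  assumes h: "frame_on E U h" and k: "frame_on E U' k" and x: "x \<in> U" "x \<in> U'"
  shows "(\<forall>i. k i x = (\<Oplus>\<^bsub>fibre E x\<^esub>j\<in>UNIV. (a $ i $ j) \<odot>\<^bsub>fibre E x\<^esub> h j x)) \<longleftrightarrow> a = frame_change E h k x"
proof -
  obtain W \<psi> where t: "(W, \<psi>) \<in> trivs E" "x \<in> W" using ex_triv[OF E] .
  have hc: "h i x \<in> carrier (fibre E x)" for i by (rule frame_carrier[OF h x(1)])
  have kc: "k i x \<in> carrier (fibre E x)" for i by (rule frame_carrier[OF k x(2)])
  have "(\<forall>i. k i x = (\<Oplus>\<^bsub>fibre E x\<^esub>j\<in>UNIV. (a $ i $ j) \<odot>\<^bsub>fibre E x\<^esub> h j x)) \<longleftrightarrow> frame_matrix \<psi> k x = a ** frame_matrix \<psi> h x"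
    using coordinate_iso.eq_lincombs_iff[OF triv_iso[OF E t], where e = "\<lambda>i. h i x" and u = "\<lambda>i. k i x", OF hc kc]
    by (simp add: frame_matrix_def)
  also have "\<dots> \<longleftrightarrow> a = frame_change E h k x"
    using frame_change_matrix[OF h k t(1) x t(2)] matrix_mult_inv_cancel(1)[OF frame_matrix_invertible[OF h t(1) x(1) t(2)]]
    by metis
  finally show ?thesis .
qed

lemma frame_change_invertible:
  assumes h: "frame_on E U h" and k: "frame_on E U' k" and x: "x \<in> U" "x \<in> U'"
  shows "invertible (frame_change E h k x)"
proof -
  obtain W \<psi> where t: "(W, \<psi>) \<in> trivs E" "x \<in> W" using ex_triv[OF E] .
  show ?thesis
    using frame_change_matrix[OF h k t(1) x t(2)] frame_matrix_invertible[OF k t(1) x(2) t(2)]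
    by (metis det_mul invertible_det_nz mult_zero_left)
qed

lemma frame_change_trans:
  assumes "frame_on E U h" "frame_on E U' k" "frame_on E U'' l" "x \<in> U" "x \<in> U'" "x \<in> U''"
  shows "frame_change E h l x = frame_change E k l x ** frame_change E h k x"
proof -
  obtain W \<psi> where t: "(W, \<psi>) \<in> trivs E" "x \<in> W" using ex_triv[OF E] .
  have "frame_change E h l x ** frame_matrix \<psi> h x = (frame_change E k l x ** frame_change E h k x) ** frame_matrix \<psi> h x"
    using frame_change_matrix[OF assms(1,3) t(1) assms(4,6) t(2)] frame_change_matrix[OF assms(2,3) t(1) assms(5,6) t(2)]
      frame_change_matrix[OF assms(1,2) t(1) assms(4,5) t(2)] by (simp add: matrix_mul_assoc)
  then show ?thesis
    using matrix_mult_inv_cancel(1)[OF frame_matrix_invertible[OF assms(1) t(1) assms(4) t(2)]] by metis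
qed

end

lemma frame_on_subset:
  assumes h: "frame_on E U h" and U': "open U'" "U' \<subseteq> U" and E: "vector_bundle \<A> E"
  shows "frame_on E U' h"
  unfolding frame_on_def smooth_section_def
proof (intro conjI allI ballI, goal_cases)
  case 1 show ?case by (rule U'(1))
next
  case (2 i x) then show ?case using h U'(2) by (auto simp: frame_on_def smooth_section_def)
next
  case (3 i c)
  obtain W \<psi> where c: "c = (W, \<psi>)" by force
  have "smooth_fun \<A> (U' \<inter> W) (\<lambda>x. \<psi> x (h i x))"
  proof (rule smooth_fun_subset[OF smooth_section_coord[OF frame_section[OF h]]])
    show t: "(W, \<psi>) \<in> trivs E" using 3 c by simp
    show "open (U' \<inter> W)" using U'(1) triv_open[OF E t] by (rule open_Int)
  qed (use U'(2) in auto)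
  then show ?case by (simp add: c)
next
  case (4 x) then show ?case using h U'(2) by (auto simp: frame_on_def)
qed

lemma parallel_frame_on_subset:
  assumes h: "parallel_frame_on E D U h" and U': "open U'" "U' \<subseteq> U" and E: "vector_bundle \<A> E"
  shows "parallel_frame_on E D U' h"
  using frame_on_subset[OF parallel_frame_imp_frame[OF h] U' E] h U'(2)
  by (auto simp: parallel_frame_on_def frame_on_def parallel_section_def)

text \<open>Differentiating \<open>k\<^sub>i = \<Sum> t\<^sub>i\<^sub>j h\<^sub>j\<close> covariantly gives \<open>0 = \<Sum> v(t\<^sub>i\<^sub>j) h\<^sub>j\<close>, so every tangent
  vector annihilates the coefficients.\<close>

lemma frame_change_locally_constant:
  assumes E: "vector_bundle \<A> E" and D: "bundle_connection \<A> E D"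
    and h: "parallel_frame_on E D U h" and k: "parallel_frame_on E D U k"
  shows "frame_change E h k \<in> GL_sections U"
proof -
  note hf = parallel_frame_imp_frame[OF h] and kf = parallel_frame_imp_frame[OF k]
  have near: "section_near \<A> E x (h i)" "section_near \<A> E x (k i)" if "x \<in> U" for x i
    unfolding section_near_def using that frame_section[OF hf] frame_section[OF kf] by blast+
  have sm: "smooth_fun \<A> U (frame_coeff E h (k i))" for i
    using smooth_fun_frame_coeff[OF E hf] kf by (simp add: frame_on_def)
  have zero: "dir_deriv v (frame_coeff E h (k i)) = 0" if x: "x \<in> U" and v: "v \<in> tangent_space \<A> x" for x v i
  proof -
    obtain W \<psi> where t: "(W, \<psi>) \<in> trivs E" "x \<in> W" using ex_triv[OF E] .
    have o: "open (U \<inter> W)" using smooth_fun_open[OF sm] triv_open[OF E t(1)] by (rule open_Int)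
    have D0: "D x v (h j) = \<zero>\<^bsub>fibre E x\<^esub>" "D x v (k j) = \<zero>\<^bsub>fibre E x\<^esub>" for j
      using h k x v by (simp_all add: parallel_frame_on_def parallel_section_def)
    have "\<psi> x (D x v (k i)) = dir_deriv v (frame_coeff E h (k i)) v* frame_matrix \<psi> h x"
    proof (rule conn_parallel_frame[where h = h and c = "frame_coeff E h (k i)" and s = "k i" and \<psi> = \<psi> and x = x and v = v,
          OF E D t v near(1)[OF x] D0(1) smooth_near_I[OF sm x] near(2)[OF x]])
      show "\<forall>\<^sub>F y in nhds x. \<psi> y (k i y) = frame_coeff E h (k i) y v* frame_matrix \<psi> h y"
        unfolding eventually_nhds
      proof (intro exI[of _ "U \<inter> W"] conjI ballI o)
        show "x \<in> U \<inter> W" using x t(2) by simp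
        fix y assume y: "y \<in> U \<inter> W"
        show "\<psi> y (k i y) = frame_coeff E h (k i) y v* frame_matrix \<psi> h y"
          by (rule frame_coeff_coord[where s = "k i" and x = y, OF E hf frame_carrier[OF kf] t(1)]) (use y in auto)
      qed
    qed
    then have z: "dir_deriv v (frame_coeff E h (k i)) v* frame_matrix \<psi> h x = 0"
      using coordinate_iso.map_zero[OF triv_iso[OF E t]] D0(2) by simp
    have "dir_deriv v (frame_coeff E h (k i))
      = (dir_deriv v (frame_coeff E h (k i)) v* frame_matrix \<psi> h x) v* matrix_inv (frame_matrix \<psi> h x)"
      unfolding vector_matrix_mul_assoc
      by (simp add: matrix_inv_right[OF frame_matrix_invertible[OF E hf t(1) x t(2)]])
    also have "\<dots> = 0" unfolding z by (simp add: vector_matrix_mult_def vec_eq_iff)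
    finally show ?thesis .
  qed
  show ?thesis
    unfolding GL_sections_def mem_Collect_eq
  proof (intro ballI conjI)
    fix x assume x: "x \<in> U"
    show "invertible (frame_change E h k x)" by (rule frame_change_invertible[OF E hf kf x x])
    have lc: "\<exists>N. open N \<and> x \<in> N \<and> (\<forall>y\<in>U \<inter> N. frame_coeff E h (k i) y = frame_coeff E h (k i) x)" for i
      by (rule smooth_fun_locally_constant_vec[OF sm _ x]) (rule zero)
    have "\<exists>N. open N \<and> x \<in> N \<and> (\<forall>y\<in>U \<inter> N. frame_change E h k y = frame_change E h k x)"
      by (rule locally_constant_vec) (use lc in \<open>simp add: frame_change_def\<close>)
    then show "\<exists>W. open W \<and> x \<in> W \<and> (\<forall>y\<in>U \<inter> W. frame_change E h k y = frame_change E h k x)" .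
  qed
qed

end

section \<open>Local parallel frames\<close>

context smooth_manifold
begin

lemma chart_vec_linear:
  assumes c: "(W, \<phi>) \<in> \<A>" and x: "x \<in> W"
  shows "chart_vec W \<phi> (a *\<^sub>R u + b *\<^sub>R v) x = (\<lambda>f. a * chart_vec W \<phi> u x f + b * chart_vec W \<phi> v x f)"
proof
  fix f :: "'m \<Rightarrow> real"
  show "chart_vec W \<phi> (a *\<^sub>R u + b *\<^sub>R v) x f = a * chart_vec W \<phi> u x f + b * chart_vec W \<phi> v x f"
  proof (cases "smooth_near \<A> x f")
    case True
    note l = has_derivative_linear[OF chart_rep_has_derivative[OF c x True]]
    show ?thesis using True by (simp add: chart_vec_def linear_add[OF l] linear_scale[OF l])
  qed (simp add: chart_vec_def)
qed

lemma smooth_fun_chart_preimage: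
  fixes G :: "'d \<Rightarrow> 'b::real_normed_vector"
  assumes c: "(W, \<phi>) \<in> \<A>" and U: "open U" "U \<subseteq> W" and G: "Cinf_on T G"
  shows "open (U \<inter> \<phi> -` T)" "smooth_fun \<A> (U \<inter> \<phi> -` T) (\<lambda>x. G (\<phi> x))"
proof -
  have "openin (top_of_set U) (U \<inter> \<phi> -` T)"
    by (rule continuous_openin_preimage_gen[OF continuous_on_subset[OF chartD(5)[OF c] U(2)] Cinf_onD(2)[OF G]])
  then show o: "open (U \<inter> \<phi> -` T)" using U(1) openin_open_trans by blast
  have "smooth_fun \<A> (U \<inter> \<phi> -` T) \<phi>"
    by (rule smooth_fun_subset[OF smooth_fun_chart[OF c] o]) (use U(2) in auto)
  then show "smooth_fun \<A> (U \<inter> \<phi> -` T) (\<lambda>x. G (\<phi> x))"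
    by (rule smooth_fun_compose[OF _ G]) auto
qed

text \<open>The direction is projected because \<open>G\<close> is an arbitrary function on an open subset of the
  ambient space, of which only the values on \<open>V\<close> enter the left side.\<close>

lemma dir_deriv_chart_function:
  fixes G :: "'d \<Rightarrow> real ^ 'n"
  assumes c: "(W, \<phi>) \<in> \<A>" and x: "x \<in> W" and G: "Cinf_on T G" "\<phi> x \<in> T"
  shows "dir_deriv (chart_vec W \<phi> b x) (\<lambda>x. G (\<phi> x)) = frechet_derivative G (at (\<phi> x)) (P b)"
proof -
  let ?U = "W \<inter> \<phi> -` T"
  note s = smooth_fun_chart_preimage[OF c chartD(1)[OF c] order_refl G(1)]
  have xU: "x \<in> ?U" using x G(2) by simp
  have Px: "P (\<phi> x) = \<phi> x" by (rule chartD(8)[OF c x])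
  have "((\<lambda>y. G (P y)) has_derivative (\<lambda>b. frechet_derivative G (at (\<phi> x)) (P b))) (at (\<phi> x))"
    by (rule has_derivative_compose[OF bounded_linear_imp_has_derivative[OF bounded_linear_P]])
      (use Cinf_on_has_derivative[OF G] Px in simp)
  then have "(chart_rep W \<phi> (\<lambda>x. G (\<phi> x)) has_derivative (\<lambda>b. frechet_derivative G (at (\<phi> x)) (P b))) (at (\<phi> x))"
  proof (rule has_derivative_transform_within_open[OF _ open_chart_dom[OF c s(1)] chart_in_dom[OF c _ xU]])
    fix y assume "y \<in> chart_dom \<phi> ?U"
    then show "G (P y) = chart_rep W \<phi> (\<lambda>x. G (\<phi> x)) y"
      using chart_dom_inv(2)[OF c, of ?U y] by (simp add: chart_rep_def)
  qed auto
  then have "frechet_derivative (chart_rep W \<phi> (\<lambda>x. G (\<phi> x))) (at (\<phi> x)) = (\<lambda>b. frechet_derivative G (at (\<phi> x)) (P b))"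
    by (rule frechet_derivative_at[symmetric])
  moreover have "dir_deriv (chart_vec W \<phi> b (inv_into W \<phi> (P (\<phi> x)))) (\<lambda>x. G (\<phi> x))
    = frechet_derivative (chart_rep W \<phi> (\<lambda>x. G (\<phi> x))) (at (\<phi> x)) b"
    by (rule chart_rep_dir_deriv[OF c _ s(2) chart_in_dom[OF c _ xU]]) auto
  ultimately show ?thesis by (simp add: Px chartD(6)[OF c x])
qed

lemma chart_vec_P:
  assumes c: "(W, \<phi>) \<in> \<A>" and x: "x \<in> W"
  shows "chart_vec W \<phi> (P b) x = chart_vec W \<phi> b x"
proof
  fix f :: "'m \<Rightarrow> real"
  show "chart_vec W \<phi> (P b) x f = chart_vec W \<phi> b x f"
  proof (cases "smooth_near \<A> x f")
    case True
    let ?F = "chart_rep W \<phi> f"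
    have Px: "P (\<phi> x) = \<phi> x" by (rule chartD(8)[OF c x])
    have "((\<lambda>y. ?F (P y)) has_derivative (\<lambda>b. frechet_derivative ?F (at (\<phi> x)) (P b))) (at (\<phi> x))"
      by (rule has_derivative_compose[OF bounded_linear_imp_has_derivative[OF bounded_linear_P]])
        (use chart_rep_has_derivative[OF c x True] Px in simp)
    then have "(?F has_derivative (\<lambda>b. frechet_derivative ?F (at (\<phi> x)) (P b))) (at (\<phi> x))"
      by (simp add: chart_rep_def[abs_def])
    from frechet_derivative_at[OF this] have "frechet_derivative ?F (at (\<phi> x)) b = frechet_derivative ?F (at (\<phi> x)) (P b)"
      by metis
    then show ?thesis using True by (simp add: chart_vec_def)
  qed (simp add: chart_vec_def)
qed

lemma flat_connectionD:
  assumes "flat_connection \<A> E D"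
  shows "bundle_connection \<A> E D"
    and "smooth_vector_field \<A> U Y \<Longrightarrow> smooth_vector_field \<A> U Z \<Longrightarrow> smooth_section \<A> E U s \<Longrightarrow> x \<in> U \<Longrightarrow>
      curvature \<A> E D Y Z s x = \<zero>\<^bsub>fibre E x\<^esub>"
  using assms unfolding flat_connection_def by blast+

context
  fixes E :: "('m, 'e, 'n::finite) vbundle" and D W \<phi> O' \<psi>
  assumes E: "vector_bundle \<A> E" and D: "flat_connection \<A> E D"
    and c: "(W, \<phi>) \<in> \<A>" and t: "(O', \<psi>) \<in> trivs E"
begin

private abbreviation (input) "U0 \<equiv> W \<inter> O'"

definition christoffel :: "'d \<Rightarrow> real ^ 'n \<Rightarrow> 'm \<Rightarrow> real ^ 'n" where
  "christoffel v w x = conn_coord E D \<psi> x (chart_vec W \<phi> v x) (\<lambda>y. w)"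

text \<open>The connection form in the chart, pulled back along \<open>P\<close> to an open subset of the ambient
  space. The value \<open>0\<close> elsewhere makes it bilinear at every point.\<close>

definition conn_form :: "'d \<Rightarrow> 'd \<Rightarrow> real ^ 'n \<Rightarrow> real ^ 'n" where
  "conn_form y v w = (if y \<in> chart_dom \<phi> U0 then chart_rep W \<phi> (christoffel v w) y else 0)"

lemmas BD = flat_connectionD(1)[OF D]

lemma open_U0: "open U0"
  using chartD(1)[OF c] triv_open[OF E t] by (rule open_Int)

lemma christoffel_linear:
  assumes x: "x \<in> U0"
  shows "linear (\<lambda>v. christoffel v w x)" "linear (\<lambda>w. christoffel v w x)"
proof -
  have xW: "x \<in> W" "x \<in> O'" using x by auto
  show "linear (\<lambda>w. christoffel v w x)"
    unfolding christoffel_def by (rule linear_conn_coord_const[OF E BD t xW(2) chart_vec_tangent[OF c xW(1)]])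
  have *: "christoffel (a *\<^sub>R u + b *\<^sub>R v) w x = a *\<^sub>R christoffel u w x + b *\<^sub>R christoffel v w x" for a b u v
    unfolding christoffel_def chart_vec_linear[OF c xW(1)]
    by (rule conn_coord_linear[OF E BD t xW(2) chart_vec_tangent[OF c xW(1)] chart_vec_tangent[OF c xW(1)] smooth_near_const])
  show "linear (\<lambda>v. christoffel v w x)"
    using *[of 1 _ 1] *[of _ _ 0] by (intro linearI) simp_all
qed

lemma smooth_section_const_lift: "smooth_section \<A> E U0 (lift E \<psi> (\<lambda>y. w))"
  by (rule smooth_section_lift[OF E t smooth_fun_const[OF open_U0]]) auto

lemma smooth_section_christoffel:
  "smooth_section \<A> E U0 (\<lambda>x. D x (chart_vec W \<phi> v x) (lift E \<psi> (\<lambda>y. w)))"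
  by (rule conn_smooth[OF E BD smooth_vector_field_chart_vec[OF c open_U0] smooth_section_const_lift]) auto

lemma smooth_fun_christoffel: "smooth_fun \<A> U0 (christoffel v w)"
proof -
  have "smooth_fun \<A> (U0 \<inter> O') (\<lambda>x. \<psi> x (D x (chart_vec W \<phi> v x) (lift E \<psi> (\<lambda>y. w))))"
    by (rule smooth_section_coord[OF smooth_section_christoffel t])
  then show ?thesis by (simp add: christoffel_def[abs_def] conn_coord_def[OF E BD] Int_assoc)
qed

lemma second_covariant_derivative:
  assumes x: "x \<in> U0"
  shows "\<psi> x (D x (chart_vec W \<phi> u x) (\<lambda>y. D y (chart_vec W \<phi> v y) (lift E \<psi> (\<lambda>y. w))))
    = dir_deriv (chart_vec W \<phi> u x) (christoffel v w) + christoffel u (christoffel v w x) x"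
proof -
  have xW: "x \<in> W" "x \<in> O'" using x by auto
  note T = chart_vec_tangent[OF c xW(1)]
  have "section_near \<A> E x (\<lambda>y. D y (chart_vec W \<phi> v y) (lift E \<psi> (\<lambda>y. w)))"
    unfolding section_near_def using smooth_section_christoffel x by blast
  then have "\<psi> x (D x (chart_vec W \<phi> u x) (\<lambda>y. D y (chart_vec W \<phi> v y) (lift E \<psi> (\<lambda>y. w))))
    = conn_coord E D \<psi> x (chart_vec W \<phi> u x) (christoffel v w)"
    using conn_coord_eq[OF E BD t xW(2) T] by (simp add: christoffel_def[abs_def] conn_coord_def[OF E BD])
  also have "\<dots> = dir_deriv (chart_vec W \<phi> u x) (christoffel v w) + christoffel u (christoffel v w x) x"
    using conn_coord_formula[OF E BD t xW(2) T smooth_near_I[OF smooth_fun_christoffel x]]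
    by (simp add: christoffel_def)
  finally show ?thesis .
qed

text \<open>The vanishing of the curvature of two coordinate fields on a section that is constant in the
  trivialisation is the equation \<open>dA + A \<and> A = 0\<close>.\<close>

lemma christoffel_flat:
  assumes x: "x \<in> U0"
  shows "dir_deriv (chart_vec W \<phi> u x) (christoffel v w) - dir_deriv (chart_vec W \<phi> v x) (christoffel u w)
    + christoffel u (christoffel v w x) x - christoffel v (christoffel u w x) x = 0"
proof -
  have xW: "x \<in> W" "x \<in> O'" using x by auto
  let ?X = "\<lambda>v x. chart_vec W \<phi> v x" and ?e = "lift E \<psi> (\<lambda>y. w)"
  interpret fib: coordinate_iso "fibre E x" "\<psi> x" by (rule triv_iso[OF E t xW(2)])
  note T = chart_vec_tangent[OF c xW(1)]
  have vf: "smooth_vector_field \<A> U0 (?X v)" for v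
    by (rule smooth_vector_field_chart_vec[OF c open_U0]) auto
  have near: "section_near \<A> E x (\<lambda>y. D y (?X v y) ?e)" "section_near \<A> E x ?e" for v
    unfolding section_near_def using smooth_section_christoffel smooth_section_const_lift x by blast+
  have car: "D x (?X u x) (\<lambda>y. D y (?X v y) ?e) \<in> carrier (fibre E x)" for u v
    by (rule conn_carrier[OF E BD T near(1)])
  have z: "D x (\<lambda>f. 0) ?e \<in> carrier (fibre E x)" "\<psi> x (D x (\<lambda>f. 0) ?e) = 0"
    using conn_carrier[OF E BD tangent_space_zero_vector near(2)]
      conn_coord_lincomb[OF E BD t xW(2), of "{}" _ "\<lambda>y. w"]
    by (simp_all add: conn_coord_def[OF E BD] smooth_near_const)
  have "curvature \<A> E D (?X u) (?X v) ?e x = \<zero>\<^bsub>fibre E x\<^esub>"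
    by (rule flat_connectionD(2)[OF D vf vf smooth_section_const_lift x])
  then have "\<psi> x (curvature \<A> E D (?X u) (?X v) ?e x) = 0" by (simp add: fib.map_zero)
  then have "\<psi> x (D x (?X u x) (\<lambda>y. D y (?X v y) ?e)) - \<psi> x (D x (?X v x) (\<lambda>y. D y (?X u y) ?e)) = 0"
    unfolding curvature_def lie_bracket_chart_vec[OF c xW(1)]
    using car z by (simp add: fib.map_minus)
  then show ?thesis unfolding second_covariant_derivative[OF x] by (simp add: algebra_simps)
qed

lemma Cinf_on_christoffel: "Cinf_on (chart_dom \<phi> U0) (chart_rep W \<phi> (christoffel v w))"
  using smooth_fun_Cinf_on[OF smooth_fun_christoffel c] by (simp add: Int_absorb2 Int_commute Int_left_commute)

lemma flat_linear_system_conn_form: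
  assumes S: "open S" "S \<subseteq> chart_dom \<phi> U0"
  shows "flat_linear_system S conn_form"
proof
  fix y :: 'd
  show "bilinear (conn_form y)"
  proof (cases "y \<in> chart_dom \<phi> U0")
    case True
    then have "inv_into W \<phi> (P y) \<in> U0" by (intro chart_dom_inv(1)[OF c]) auto
    from christoffel_linear[OF this] True show ?thesis
      by (simp add: bilinear_def conn_form_def chart_rep_def)
  next
    case False then show ?thesis by (simp add: bilinear_def conn_form_def linear_iff)
  qed
next
  fix v :: 'd and w :: "real ^ 'n"
  show sm: "Cinf_on S (\<lambda>y. conn_form y v w)"
    by (rule Cinf_on_cong[OF Cinf_on_subset[OF Cinf_on_christoffel S]]) (use S(2) in \<open>auto simp: conn_form_def\<close>)
next
  fix y u v :: 'd and w :: "real ^ 'n"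
  assume y: "y \<in> S"
  let ?x = "inv_into W \<phi> (P y)"
  have yD: "y \<in> chart_dom \<phi> U0" using y S by auto
  have x: "?x \<in> U0" by (rule chart_dom_inv(1)[OF c _ yD]) auto
  have d: "frechet_derivative (\<lambda>y. conn_form y v w) (at y) u = dir_deriv (chart_vec W \<phi> u ?x) (christoffel v w)" for u v
  proof -
    have "((\<lambda>y. conn_form y v w) has_derivative frechet_derivative (chart_rep W \<phi> (christoffel v w)) (at y)) (at y)"
      by (rule has_derivative_transform_within_open[OF Cinf_on_has_derivative[OF Cinf_on_christoffel yD] S(1) y])
        (use S(2) in \<open>auto simp: conn_form_def\<close>)
    then have "frechet_derivative (\<lambda>y. conn_form y v w) (at y) = frechet_derivative (chart_rep W \<phi> (christoffel v w)) (at y)"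
      by (rule frechet_derivative_at[symmetric])
    then show ?thesis
      using chart_rep_dir_deriv[OF c _ smooth_fun_christoffel yD] by simp
  qed
  show "frechet_derivative (\<lambda>y. conn_form y v w) (at y) u - frechet_derivative (\<lambda>y. conn_form y u w) (at y) v
    + conn_form y u (conn_form y v w) - conn_form y v (conn_form y u w) = 0"
    unfolding d using christoffel_flat[OF x, of u v w] yD by (simp add: conn_form_def chart_rep_def)
qed

text \<open>Tangent vectors are combinations of coordinate vectors, and the connection is linear in the
  tangent vector.\<close>

lemma parallel_if_parallel_along_chart:
  assumes x: "x \<in> U0" and s: "section_near \<A> E x s" and v: "v \<in> tangent_space \<A> x"
    and zero: "\<And>b. \<psi> x (D x (chart_vec W \<phi> b x) s) = 0"
  shows "D x v s = \<zero>\<^bsub>fibre E x\<^esub>"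
proof -
  have xW: "x \<in> W" "x \<in> O'" using x by auto
  interpret fib: coordinate_iso "fibre E x" "\<psi> x" by (rule triv_iso[OF E t xW(2)])
  note T = chart_vec_tangent[OF c xW(1)]
  let ?\<sigma> = "\<lambda>y. \<psi> y (s y)"
  have \<sigma>: "smooth_near \<A> x ?\<sigma>" by (rule section_nearD(1)[OF E t xW(2) s])
  have v_eq: "v = (\<lambda>f. \<Sum>b\<in>Basis. v (\<lambda>y. \<phi> y \<bullet> b) * chart_vec W \<phi> b x f)"
    by (rule ext, rule tangent_vector_expand[OF c xW(1) v])
  have "conn_coord E D \<psi> x (\<lambda>f. \<Sum>b\<in>Basis. v (\<lambda>y. \<phi> y \<bullet> b) * chart_vec W \<phi> b x f) ?\<sigma>
    = (\<Sum>b\<in>Basis. v (\<lambda>y. \<phi> y \<bullet> b) *\<^sub>R conn_coord E D \<psi> x (chart_vec W \<phi> b x) ?\<sigma>)"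
    by (rule conjunct2[OF conn_coord_lincomb[OF E BD t xW(2) T finite_Basis \<sigma>]])
  also have "\<dots> = 0" using zero conn_coord_eq[OF E BD t xW(2) T s] by simp
  finally have "\<psi> x (D x v s) = 0"
    using conn_coord_eq[OF E BD t xW(2) v s] v_eq by metis
  then show ?thesis
    using fib.map_eq_iff[OF conn_carrier[OF E BD v s] fib.closed(3)] fib.map_zero by simp
qed

text \<open>The solutions of \<open>dg = - A g\<close> whose values at the centre are the standard basis vectors are
  the coordinates of parallel sections. They are a frame where their determinant does not
  vanish, in particular near the centre.\<close>

lemma local_parallel_frame:
  assumes x0: "x0 \<in> U0"
  obtains U h where "open U" "x0 \<in> U" "parallel_frame_on E D U h"
proof -
  let ?p = "\<phi> x0" and ?D = "chart_dom \<phi> U0"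
  have pD: "?p \<in> ?D" by (rule chart_in_dom[OF c _ x0]) auto
  obtain R where R: "R > 0" "ball ?p R \<subseteq> ?D"
    using open_chart_dom[OF c open_U0] pD openE by blast
  interpret S: flat_linear_system "ball ?p R" conn_form
    by (rule flat_linear_system_conn_form[OF open_ball R(2)])
  have pB: "?p \<in> ball ?p R" using R(1) by simp
  obtain r where r: "r > 0" "ball ?p r \<subseteq> ball ?p R"
    and sol: "\<And>w. \<exists>g. g ?p = w \<and> Cinf_on (ball ?p r) g \<and> (\<forall>y\<in>ball ?p r. \<forall>v. frechet_derivative g (at y) v = - conn_form y v (g y))"
    using S.solution_exists[OF convex_ball pB] by blast
  have "\<forall>i. \<exists>g. g ?p = axis i 1 \<and> Cinf_on (ball ?p r) g \<and> (\<forall>y\<in>ball ?p r. \<forall>v. frechet_derivative g (at y) v = - conn_form y v (g y))"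
    using sol by blast
  then obtain g :: "'n \<Rightarrow> 'd \<Rightarrow> real ^ 'n" where g: "\<And>i. g i ?p = axis i 1" "\<And>i. Cinf_on (ball ?p r) (g i)"
    "\<And>i y v. y \<in> ball ?p r \<Longrightarrow> frechet_derivative (g i) (at y) v = - conn_form y v (g i y)"
    by metis
  let ?G = "\<lambda>y. \<chi> i. g i y"
  have G: "Cinf_on (ball ?p r) ?G" by (intro Cinf_on_vec_lambda open_ball g(2))
  define T where "T = {y \<in> ball ?p r. det (?G y) \<noteq> 0}"
  have "open (ball ?p r \<inter> (\<lambda>y. det (?G y)) -` (- {0}))"
    by (rule continuous_open_preimage[OF Cinf_on_continuous_on[OF Cinf_on_det[OF G]] open_ball]) auto
  then have oT: "open T" by (simp add: T_def vimage_def Int_def Collect_conj_eq[symmetric])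
  have TB: "T \<subseteq> ball ?p r" by (auto simp: T_def)
  have pT: "?p \<in> T"
  proof -
    have "?G ?p = mat 1" by (simp add: g(1) vec_eq_iff mat_def axis_def)
    then show ?thesis using r(1) by (simp add: T_def)
  qed
  have gT: "Cinf_on T (g i)" for i by (rule Cinf_on_subset[OF g(2) oT TB])
  define U where "U = U0 \<inter> \<phi> -` T"
  have oU: "open U" and s\<sigma>: "smooth_fun \<A> U (\<lambda>x. g i (\<phi> x))" for i
    using smooth_fun_chart_preimage[OF c open_U0 _ gT] unfolding U_def by auto
  define h where "h i = lift E \<psi> (\<lambda>x. g i (\<phi> x))" for i
  have hs: "smooth_section \<A> E U (h i)" for i
    unfolding h_def by (rule smooth_section_lift[OF E t s\<sigma>]) (auto simp: U_def)
  have hc: "\<psi> x (h i x) = g i (\<phi> x)" "h i x \<in> carrier (fibre E x)" if "x \<in> U" for i x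
    using lift_coord(1,2)[OF E t, of x] that by (auto simp: h_def U_def)
  have par: "D x v (h i) = \<zero>\<^bsub>fibre E x\<^esub>" if x: "x \<in> U" and v: "v \<in> tangent_space \<A> x" for x v i
  proof (rule parallel_if_parallel_along_chart[OF _ _ v])
    show xU: "x \<in> U0" using x by (auto simp: U_def)
    then have xW: "x \<in> W" "x \<in> O'" by auto
    note T = chart_vec_tangent[OF c xW(1)]
    have \<phi>T: "\<phi> x \<in> T" "\<phi> x \<in> ball ?p r" using x TB by (auto simp: U_def)
    show hn: "section_near \<A> E x (h i)" unfolding section_near_def using hs x by blast
    fix b
    have near: "smooth_near \<A> x (\<lambda>x. g i (\<phi> x))" by (rule smooth_near_I[OF s\<sigma> x])
    have "\<psi> x (D x (chart_vec W \<phi> b x) (h i)) = conn_coord E D \<psi> x (chart_vec W \<phi> b x) (\<lambda>x. g i (\<phi> x))"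
      by (simp add: h_def conn_coord_def[OF E BD])
    also have "\<dots> = dir_deriv (chart_vec W \<phi> b x) (\<lambda>x. g i (\<phi> x)) + christoffel b (g i (\<phi> x)) x"
      using conn_coord_formula[OF E BD t xW(2) T near] by (simp add: christoffel_def)
    also have "dir_deriv (chart_vec W \<phi> b x) (\<lambda>x. g i (\<phi> x)) = - conn_form (\<phi> x) (P b) (g i (\<phi> x))"
      using dir_deriv_chart_function[OF c xW(1) gT \<phi>T(1)] g(3)[OF \<phi>T(2)] by simp
    also have "conn_form (\<phi> x) (P b) (g i (\<phi> x)) = christoffel b (g i (\<phi> x)) x"
      using chart_in_dom[OF c _ xU] chart_vec_P[OF c xW(1)]
      by (simp add: conn_form_def chart_rep_at[OF c xW(1)] christoffel_def)
    finally show "\<psi> x (D x (chart_vec W \<phi> b x) (h i)) = 0" by simp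
  qed
  have "fibre_basis (fibre E x) (\<lambda>i. h i x)" if x: "x \<in> U" for x
  proof -
    have xO: "x \<in> O'" using x by (auto simp: U_def)
    have "invertible (?G (\<phi> x))" using x by (simp add: U_def T_def invertible_det_nz)
    then show ?thesis
      using coordinate_iso.fibre_basis_iff[OF triv_iso[OF E t xO], where e = "\<lambda>i. h i x", OF hc(2)[OF x]] hc(1)[OF x] by simp
  qed
  then have "parallel_frame_on E D U h"
    unfolding parallel_frame_on_def parallel_section_def using hs par by blast
  moreover have "x0 \<in> U" using x0 pT by (simp add: U_def)
  ultimately show thesis using that oU by blast
qed

end

lemma ex_local_parallel_frame:
  fixes E :: "('m, 'e, 'n::finite) vbundle"
  assumes E: "vector_bundle \<A> E" and D: "flat_connection \<A> E D"
  obtains U h where "open U" "x \<in> U" "parallel_frame_on E D U h"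
proof -
  obtain W \<phi> where c: "(W, \<phi>) \<in> \<A>" "x \<in> W" by (rule ex_chart)
  obtain O' \<psi> where t: "(O', \<psi>) \<in> trivs E" "x \<in> O'" using ex_triv[OF E] .
  show thesis
    by (rule local_parallel_frame[OF E D c(1) t(1), of x]) (use c t that in auto)
qed

end

section \<open>Cech classes\<close>

lemma GL_sectionsI:
  assumes "\<And>x. x \<in> U \<Longrightarrow> invertible (g x)"
    and "\<And>x. x \<in> U \<Longrightarrow> \<exists>W. open W \<and> x \<in> W \<and> (\<forall>y\<in>U \<inter> W. g y = g x)"
  shows "g \<in> GL_sections U"
  using assms by (simp add: GL_sections_def)

lemma GL_sections_invertible: "g \<in> GL_sections U \<Longrightarrow> x \<in> U \<Longrightarrow> invertible (g x)"
  by (simp add: GL_sections_def)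

lemma GL_sections_local:
  "g \<in> GL_sections U \<Longrightarrow> x \<in> U \<Longrightarrow> \<exists>W. open W \<and> x \<in> W \<and> (\<forall>y\<in>U \<inter> W. g y = g x)"
  by (simp add: GL_sections_def)

lemma GL_sections_subset:
  assumes "g \<in> GL_sections U" "U' \<subseteq> U" shows "g \<in> GL_sections U'"
proof (rule GL_sectionsI)
  fix x assume x: "x \<in> U'"
  then have xU: "x \<in> U" using assms(2) by auto
  show "invertible (g x)" by (rule GL_sections_invertible[OF assms(1) xU])
  obtain W where "open W" "x \<in> W" "\<forall>y\<in>U \<inter> W. g y = g x"
    using GL_sections_local[OF assms(1) xU] by blast
  then show "\<exists>W. open W \<and> x \<in> W \<and> (\<forall>y\<in>U' \<inter> W. g y = g x)"
    using assms(2) by (intro exI[of _ W]) auto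
qed

lemma GL_sections_combine:
  assumes f: "f \<in> GL_sections U" and g: "g \<in> GL_sections U"
    and inv: "\<And>A B. invertible A \<Longrightarrow> invertible B \<Longrightarrow> invertible (c A B)"
  shows "(\<lambda>x. c (f x) (g x)) \<in> GL_sections U"
proof (rule GL_sectionsI)
  fix x assume x: "x \<in> U"
  show "invertible (c (f x) (g x))"
    by (rule inv[OF GL_sections_invertible[OF f x] GL_sections_invertible[OF g x]])
  obtain W where W: "open W" "x \<in> W" "\<forall>y\<in>U \<inter> W. f y = f x"
    using GL_sections_local[OF f x] by blast
  obtain W' where W': "open W'" "x \<in> W'" "\<forall>y\<in>U \<inter> W'. g y = g x"
    using GL_sections_local[OF g x] by blast
  show "\<exists>W. open W \<and> x \<in> W \<and> (\<forall>y\<in>U \<inter> W. c (f y) (g y) = c (f x) (g x))"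
    using W W' by (intro exI[of _ "W \<inter> W'"]) auto
qed

lemma invertible_mult: "invertible A \<Longrightarrow> invertible B \<Longrightarrow> invertible (A ** B)"
  for A B :: "real ^ 'n ^ 'n"
  by (simp add: invertible_det_nz det_mul)

lemma GL_sections_mult: "f \<in> GL_sections U \<Longrightarrow> g \<in> GL_sections U \<Longrightarrow> (\<lambda>x. f x ** g x) \<in> GL_sections U"
  by (rule GL_sections_combine[where c = "(**)"]) (auto intro: invertible_mult)

lemma GL_sections_inv: "f \<in> GL_sections U \<Longrightarrow> (\<lambda>x. matrix_inv (f x)) \<in> GL_sections U"
  by (rule GL_sections_combine[where c = "\<lambda>A B. matrix_inv A"]) (auto intro: invertible_matrix_inv)

lemma invertible_mat_1: "invertible (mat 1 :: real ^ 'n ^ 'n)"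
  by (simp add: invertible_det_nz)

lemma GL_sections_one: "(\<lambda>x. mat 1) \<in> GL_sections U"
  by (rule GL_sectionsI) (auto simp: invertible_mat_1)

lemma delta1_eq_one_iff:
  assumes "invertible (a \<alpha> \<gamma> x)"
  shows "delta1 a \<alpha> \<beta> \<gamma> x = mat 1 \<longleftrightarrow> a \<alpha> \<gamma> x = a \<alpha> \<beta> x ** a \<beta> \<gamma> x"
proof
  assume "delta1 a \<alpha> \<beta> \<gamma> x = mat 1"
  then have "a \<alpha> \<gamma> x ** (matrix_inv (a \<alpha> \<gamma> x) ** (a \<alpha> \<beta> x ** a \<beta> \<gamma> x)) = a \<alpha> \<gamma> x"
    by (simp add: delta1_def matrix_mul_assoc)
  then show "a \<alpha> \<gamma> x = a \<alpha> \<beta> x ** a \<beta> \<gamma> x" by (simp add: matrix_mult_inv_cancel(3)[OF assms])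
next
  assume "a \<alpha> \<gamma> x = a \<alpha> \<beta> x ** a \<beta> \<gamma> x"
  then show "delta1 a \<alpha> \<beta> \<gamma> x = mat 1"
    using matrix_inv_left[OF assms] by (simp add: delta1_def matrix_mul_assoc[symmetric])
qed

lemma Z1I:
  assumes "\<And>\<alpha> \<beta>. \<alpha> \<in> fst \<U> \<Longrightarrow> \<beta> \<in> fst \<U> \<Longrightarrow> a \<alpha> \<beta> \<in> GL_sections (snd \<U> \<alpha> \<inter> snd \<U> \<beta>)"
    and "\<And>\<alpha> \<beta> \<gamma> x. \<alpha> \<in> fst \<U> \<Longrightarrow> \<beta> \<in> fst \<U> \<Longrightarrow> \<gamma> \<in> fst \<U> \<Longrightarrow> x \<in> snd \<U> \<alpha> \<Longrightarrow> x \<in> snd \<U> \<beta> \<Longrightarrow> x \<in> snd \<U> \<gamma> \<Longrightarrow>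
      a \<alpha> \<gamma> x = a \<alpha> \<beta> x ** a \<beta> \<gamma> x"
  shows "a \<in> Z1 \<U>"
  unfolding Z1_def mem_Collect_eq
proof (intro conjI ballI)
  show "a \<in> C1 \<U>" using assms(1) by (simp add: C1_def)
  fix \<alpha> \<beta> \<gamma> x assume i: "\<alpha> \<in> fst \<U>" "\<beta> \<in> fst \<U>" "\<gamma> \<in> fst \<U>" and x: "x \<in> snd \<U> \<alpha> \<inter> snd \<U> \<beta> \<inter> snd \<U> \<gamma>"
  have "invertible (a \<alpha> \<gamma> x)"
    using x by (intro GL_sections_invertible[OF assms(1)[OF i(1,3)]]) auto
  then show "delta1 a \<alpha> \<beta> \<gamma> x = mat 1"
    using assms(2)[OF i] x by (simp add: delta1_eq_one_iff[where a = a and \<alpha> = \<alpha> and \<gamma> = \<gamma> and x = x])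
qed

lemma Z1_GL: "a \<in> Z1 \<U> \<Longrightarrow> \<alpha> \<in> fst \<U> \<Longrightarrow> \<beta> \<in> fst \<U> \<Longrightarrow> a \<alpha> \<beta> \<in> GL_sections (snd \<U> \<alpha> \<inter> snd \<U> \<beta>)"
  by (simp add: Z1_def C1_def)

lemma Z1_invertible:
  "a \<in> Z1 \<U> \<Longrightarrow> \<alpha> \<in> fst \<U> \<Longrightarrow> \<beta> \<in> fst \<U> \<Longrightarrow> x \<in> snd \<U> \<alpha> \<Longrightarrow> x \<in> snd \<U> \<beta> \<Longrightarrow> invertible (a \<alpha> \<beta> x)"
  by (rule GL_sections_invertible[OF Z1_GL]) auto

lemma Z1_mult:
  assumes "a \<in> Z1 \<U>" "\<alpha> \<in> fst \<U>" "\<beta> \<in> fst \<U>" "\<gamma> \<in> fst \<U>" "x \<in> snd \<U> \<alpha>" "x \<in> snd \<U> \<beta>" "x \<in> snd \<U> \<gamma>"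
  shows "a \<alpha> \<beta> x ** a \<beta> \<gamma> x = a \<alpha> \<gamma> x"
proof -
  have "delta1 a \<alpha> \<beta> \<gamma> x = mat 1" using assms by (simp add: Z1_def)
  then show ?thesis using delta1_eq_one_iff[where a = a and \<alpha> = \<alpha> and \<gamma> = \<gamma> and x = x, OF Z1_invertible[OF assms(1,2,4,5,7)]] by simp
qed

lemma Z1_diag:
  assumes "a \<in> Z1 \<U>" "\<alpha> \<in> fst \<U>" "x \<in> snd \<U> \<alpha>"
  shows "a \<alpha> \<alpha> x = mat 1"
proof -
  have "a \<alpha> \<alpha> x ** a \<alpha> \<alpha> x = a \<alpha> \<alpha> x" by (rule Z1_mult) (use assms in auto)
  then show ?thesis
    using matrix_mult_inv_cancel(1)[OF Z1_invertible[OF assms(1,2,2,3,3)], of "a \<alpha> \<alpha> x"]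
      matrix_inv_right[OF Z1_invertible[OF assms(1,2,2,3,3)]] by simp
qed

text \<open>The relation between cohomologous cocycles, freed from inverses.\<close>

definition intertwines ::
  "('i, 'm::topological_space) cover \<Rightarrow> ('i, 'm, 'n::finite) cochain1 \<Rightarrow> ('i, 'm, 'n) cochain1 \<Rightarrow>
    ('i \<Rightarrow> 'm \<Rightarrow> real ^ 'n ^ 'n) \<Rightarrow> bool" where
  "intertwines \<U> a a' b \<longleftrightarrow> (\<forall>\<alpha>\<in>fst \<U>. b \<alpha> \<in> GL_sections (snd \<U> \<alpha>)) \<and>
     (\<forall>\<alpha>\<in>fst \<U>. \<forall>\<beta>\<in>fst \<U>. \<forall>x\<in>snd \<U> \<alpha> \<inter> snd \<U> \<beta>. b \<alpha> x ** a' \<alpha> \<beta> x = a \<alpha> \<beta> x ** b \<beta> x)"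

lemma intertwinesD:
  "intertwines \<U> a a' b \<Longrightarrow> \<alpha> \<in> fst \<U> \<Longrightarrow> b \<alpha> \<in> GL_sections (snd \<U> \<alpha>)"
  "intertwines \<U> a a' b \<Longrightarrow> \<alpha> \<in> fst \<U> \<Longrightarrow> \<beta> \<in> fst \<U> \<Longrightarrow> x \<in> snd \<U> \<alpha> \<Longrightarrow> x \<in> snd \<U> \<beta> \<Longrightarrow>
    b \<alpha> x ** a' \<alpha> \<beta> x = a \<alpha> \<beta> x ** b \<beta> x"
  by (simp_all add: intertwines_def)

lemma cohomologous_iff:
  "(a, a') \<in> cohomologous \<U> \<longleftrightarrow> a \<in> Z1 \<U> \<and> a' \<in> Z1 \<U> \<and> (\<exists>b. intertwines \<U> a a' b)"
proof -
  have "b \<in> C0 \<U> \<and> (\<forall>\<alpha>\<in>fst \<U>. \<forall>\<beta>\<in>fst \<U>. \<forall>x\<in>snd \<U> \<alpha> \<inter> snd \<U> \<beta>.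
      a' \<alpha> \<beta> x = matrix_inv (b \<alpha> x) ** a \<alpha> \<beta> x ** b \<beta> x) \<longleftrightarrow> intertwines \<U> a a' b" for b
  proof (cases "b \<in> C0 \<U>")
    case True
    have *: "a' \<alpha> \<beta> x = matrix_inv (b \<alpha> x) ** a \<alpha> \<beta> x ** b \<beta> x \<longleftrightarrow> b \<alpha> x ** a' \<alpha> \<beta> x = a \<alpha> \<beta> x ** b \<beta> x"
      if "\<alpha> \<in> fst \<U>" "x \<in> snd \<U> \<alpha> \<inter> snd \<U> \<beta>" for \<alpha> \<beta> x
    proof -
      have i: "invertible (b \<alpha> x)"
        using True that by (intro GL_sections_invertible[of "b \<alpha>" "snd \<U> \<alpha>"]) (auto simp: C0_def)
      show ?thesis
        unfolding matrix_mul_assoc[symmetric]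
        using matrix_mult_inv_cancel(3)[OF i, of "a \<alpha> \<beta> x ** b \<beta> x"] matrix_mult_inv_cancel(4)[OF i, of "a' \<alpha> \<beta> x"]
        by metis
    qed
    have "(\<forall>\<alpha>\<in>fst \<U>. \<forall>\<beta>\<in>fst \<U>. \<forall>x\<in>snd \<U> \<alpha> \<inter> snd \<U> \<beta>. a' \<alpha> \<beta> x = matrix_inv (b \<alpha> x) ** a \<alpha> \<beta> x ** b \<beta> x)
      \<longleftrightarrow> (\<forall>\<alpha>\<in>fst \<U>. \<forall>\<beta>\<in>fst \<U>. \<forall>x\<in>snd \<U> \<alpha> \<inter> snd \<U> \<beta>. b \<alpha> x ** a' \<alpha> \<beta> x = a \<alpha> \<beta> x ** b \<beta> x)"
      by (intro ball_cong refl *)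
    then show ?thesis using True unfolding intertwines_def C0_def by blast
  next
    case False
    then show ?thesis unfolding intertwines_def C0_def by blast
  qed
  then show ?thesis unfolding cohomologous_def Bex_def by simp
qed

lemma cohomologousI:
  assumes "a \<in> Z1 \<U>" "a' \<in> Z1 \<U>" "\<And>\<alpha>. \<alpha> \<in> fst \<U> \<Longrightarrow> b \<alpha> \<in> GL_sections (snd \<U> \<alpha>)"
    and "\<And>\<alpha> \<beta> x. \<alpha> \<in> fst \<U> \<Longrightarrow> \<beta> \<in> fst \<U> \<Longrightarrow> x \<in> snd \<U> \<alpha> \<Longrightarrow> x \<in> snd \<U> \<beta> \<Longrightarrow> b \<alpha> x ** a' \<alpha> \<beta> x = a \<alpha> \<beta> x ** b \<beta> x"
  shows "(a, a') \<in> cohomologous \<U>"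
proof -
  have "intertwines \<U> a a' b" using assms(3,4) by (simp add: intertwines_def)
  then show ?thesis using assms(1,2) cohomologous_iff by blast
qed

lemma equiv_cohomologous: "equiv (Z1 \<U>) (cohomologous \<U>)"
proof (rule equivI)
  show "cohomologous \<U> \<subseteq> Z1 \<U> \<times> Z1 \<U>" by (auto simp: cohomologous_def)
  show "refl_on (Z1 \<U>) (cohomologous \<U>)"
    by (rule refl_onI) (auto intro!: cohomologousI[where b = "\<lambda>\<alpha> x. mat 1"] GL_sections_one)
  show "sym (cohomologous \<U>)"
  proof (rule symI)
    fix a a' assume "(a, a') \<in> cohomologous \<U>"
    then obtain b where b0: "a \<in> Z1 \<U>" "a' \<in> Z1 \<U>" "intertwines \<U> a a' b"
      using cohomologous_iff by blast
    note b = b0(1,2) intertwinesD[OF b0(3)]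
    show "(a', a) \<in> cohomologous \<U>"
    proof (rule cohomologousI[OF b(2,1), where b = "\<lambda>\<alpha> x. matrix_inv (b \<alpha> x)"])
      fix \<alpha> \<beta> x assume i: "\<alpha> \<in> fst \<U>" "\<beta> \<in> fst \<U>" and x: "x \<in> snd \<U> \<alpha>" "x \<in> snd \<U> \<beta>"
      note ia = GL_sections_invertible[OF b(3)[OF i(1)] x(1)] and ib = GL_sections_invertible[OF b(3)[OF i(2)] x(2)]
      have "matrix_inv (b \<alpha> x) ** a \<alpha> \<beta> x = matrix_inv (b \<alpha> x) ** (a \<alpha> \<beta> x ** b \<beta> x) ** matrix_inv (b \<beta> x)"
        using matrix_mult_inv_cancel(1)[OF ib, of "a \<alpha> \<beta> x"] by (simp add: matrix_mul_assoc[symmetric])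
      also have "\<dots> = a' \<alpha> \<beta> x ** matrix_inv (b \<beta> x)"
        unfolding b(4)[OF i x, symmetric] by (simp add: matrix_mult_inv_cancel(4)[OF ia])
      finally show "matrix_inv (b \<alpha> x) ** a \<alpha> \<beta> x = a' \<alpha> \<beta> x ** matrix_inv (b \<beta> x)" .
    qed (intro GL_sections_inv b(3))
  qed
  show "trans (cohomologous \<U>)"
  proof (rule transI)
    fix a a' a'' assume *: "(a, a') \<in> cohomologous \<U>" "(a', a'') \<in> cohomologous \<U>"
    obtain b where b0: "a \<in> Z1 \<U>" "a' \<in> Z1 \<U>" "intertwines \<U> a a' b"
      using *(1) cohomologous_iff by blast
    note b = b0(1,2) intertwinesD[OF b0(3)]
    obtain b' where b'0: "a' \<in> Z1 \<U>" "a'' \<in> Z1 \<U>" "intertwines \<U> a' a'' b'"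
      using *(2) cohomologous_iff by blast
    note b' = b'0(1,2) intertwinesD[OF b'0(3)]
    show "(a, a'') \<in> cohomologous \<U>"
    proof (rule cohomologousI[OF b(1) b'(2), where b = "\<lambda>\<alpha> x. b \<alpha> x ** b' \<alpha> x"])
      fix \<alpha> \<beta> x assume i: "\<alpha> \<in> fst \<U>" "\<beta> \<in> fst \<U>" and x: "x \<in> snd \<U> \<alpha>" "x \<in> snd \<U> \<beta>"
      have "b \<alpha> x ** b' \<alpha> x ** a'' \<alpha> \<beta> x = b \<alpha> x ** (a' \<alpha> \<beta> x ** b' \<beta> x)"
        unfolding b'(4)[OF i x, symmetric] by (simp add: matrix_mul_assoc)
      also have "\<dots> = a \<alpha> \<beta> x ** (b \<beta> x ** b' \<beta> x)"
        by (simp add: matrix_mul_assoc b(4)[OF i x])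
      finally show "b \<alpha> x ** b' \<alpha> x ** a'' \<alpha> \<beta> x = a \<alpha> \<beta> x ** (b \<beta> x ** b' \<beta> x)" .
    qed (intro GL_sections_mult b(3) b'(3))
  qed
qed

definition pullback :: "('i \<Rightarrow> 'i) \<Rightarrow> ('i, 'm, 'n::finite) cochain1 \<Rightarrow> ('i, 'm, 'n) cochain1" where
  "pullback r a \<alpha> \<beta> = a (r \<alpha>) (r \<beta>)"

lemma refinement_mapD:
  "refinement_map \<V> \<U> r \<Longrightarrow> \<alpha> \<in> fst \<V> \<Longrightarrow> r \<alpha> \<in> fst \<U>"
  "refinement_map \<V> \<U> r \<Longrightarrow> \<alpha> \<in> fst \<V> \<Longrightarrow> snd \<V> \<alpha> \<subseteq> snd \<U> (r \<alpha>)"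
  "refinement_map \<V> \<U> r \<Longrightarrow> \<alpha> \<in> fst \<V> \<Longrightarrow> x \<in> snd \<V> \<alpha> \<Longrightarrow> x \<in> snd \<U> (r \<alpha>)"
  by (auto simp: refinement_map_def)

lemma refinement_map_comp:
  "refinement_map \<W> \<V> r \<Longrightarrow> refinement_map \<V> \<U> q \<Longrightarrow> refinement_map \<W> \<U> (q \<circ> r)"
  unfolding refinement_map_def by fastforce

lemma pullback_comp: "pullback r (pullback q a) = pullback (q \<circ> r) a"
  by (simp add: pullback_def fun_eq_iff)

lemma pullback_Z1:
  assumes r: "refinement_map \<V> \<U> r" and a: "a \<in> Z1 \<U>"
  shows "pullback r a \<in> Z1 \<V>"
proof (rule Z1I)
  fix \<alpha> \<beta> assume i: "\<alpha> \<in> fst \<V>" "\<beta> \<in> fst \<V>"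
  show "pullback r a \<alpha> \<beta> \<in> GL_sections (snd \<V> \<alpha> \<inter> snd \<V> \<beta>)"
    unfolding pullback_def
    by (rule GL_sections_subset[OF Z1_GL[OF a refinement_mapD(1)[OF r i(1)] refinement_mapD(1)[OF r i(2)]]])
      (use refinement_mapD(2)[OF r] i in blast)
next
  fix \<alpha> \<beta> \<gamma> x assume "\<alpha> \<in> fst \<V>" "\<beta> \<in> fst \<V>" "\<gamma> \<in> fst \<V>" "x \<in> snd \<V> \<alpha>" "x \<in> snd \<V> \<beta>" "x \<in> snd \<V> \<gamma>"
  then show "pullback r a \<alpha> \<gamma> x = pullback r a \<alpha> \<beta> x ** pullback r a \<beta> \<gamma> x"
    unfolding pullback_def by (intro Z1_mult[OF a, symmetric] refinement_mapD[OF r])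
qed

lemma pullback_cohomologous:
  assumes r: "refinement_map \<V> \<U> r" and a: "(a, a') \<in> cohomologous \<U>"
  shows "(pullback r a, pullback r a') \<in> cohomologous \<V>"
proof -
  obtain b where b0: "a \<in> Z1 \<U>" "a' \<in> Z1 \<U>" "intertwines \<U> a a' b"
      using a cohomologous_iff by blast
    note b = b0(1,2) intertwinesD[OF b0(3)]
  show ?thesis
  proof (rule cohomologousI[OF pullback_Z1[OF r b(1)] pullback_Z1[OF r b(2)], where b = "\<lambda>\<alpha>. b (r \<alpha>)"])
    show "b (r \<alpha>) \<in> GL_sections (snd \<V> \<alpha>)" if "\<alpha> \<in> fst \<V>" for \<alpha>
      by (rule GL_sections_subset[OF b(3)[OF refinement_mapD(1)[OF r that]] refinement_mapD(2)[OF r that]])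
  qed (unfold pullback_def, intro b(4) refinement_mapD[OF r])
qed

text \<open>Two refinement maps \<open>r\<close> and \<open>q\<close> differ by the cochain \<open>a\<^sub>r\<^sub>(\<^sub>\<alpha>\<^sub>)\<^sub>q\<^sub>(\<^sub>\<alpha>\<^sub>)\<close>.\<close>

lemma pullback_independent:
  assumes r: "refinement_map \<V> \<U> r" and q: "refinement_map \<V> \<U> q" and a: "a \<in> Z1 \<U>"
  shows "(pullback r a, pullback q a) \<in> cohomologous \<V>"
proof (rule cohomologousI[OF pullback_Z1[OF r a] pullback_Z1[OF q a], where b = "\<lambda>\<alpha>. a (r \<alpha>) (q \<alpha>)"])
  show "a (r \<alpha>) (q \<alpha>) \<in> GL_sections (snd \<V> \<alpha>)" if i: "\<alpha> \<in> fst \<V>" for \<alpha>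
    by (rule GL_sections_subset[OF Z1_GL[OF a refinement_mapD(1)[OF r i] refinement_mapD(1)[OF q i]]])
      (use refinement_mapD(2)[OF r i] refinement_mapD(2)[OF q i] in blast)
  fix \<alpha> \<beta> x assume i: "\<alpha> \<in> fst \<V>" "\<beta> \<in> fst \<V>" "x \<in> snd \<V> \<alpha>" "x \<in> snd \<V> \<beta>"
  note m = Z1_mult[OF a] and rd = refinement_mapD(1,3)[OF r] and qd = refinement_mapD(1,3)[OF q]
  have "a (r \<alpha>) (q \<alpha>) x ** a (q \<alpha>) (q \<beta>) x = a (r \<alpha>) (q \<beta>) x"
    by (intro m rd qd i)
  also have "\<dots> = a (r \<alpha>) (r \<beta>) x ** a (r \<beta>) (q \<beta>) x"
    by (intro m[symmetric] rd qd i)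
  finally show "a (r \<alpha>) (q \<alpha>) x ** pullback q a \<alpha> \<beta> x = pullback r a \<alpha> \<beta> x ** a (r \<beta>) (q \<beta>) x"
    by (simp add: pullback_def)
qed

lemma restrict_class_eq:
  assumes r: "refinement_map \<V> \<U> r" and a: "a \<in> Z1 \<U>"
  shows "restrict_class \<V> r (cohomologous \<U> `` {a}) = cohomologous \<V> `` {pullback r a}"
proof -
  have c: "cohomologous \<V> `` {pullback r a'} = cohomologous \<V> `` {pullback r a}" if "(a, a') \<in> cohomologous \<U>" for a'
    using equiv_class_eq[OF equiv_cohomologous pullback_cohomologous[OF r that]] by simp
  have "(a, a) \<in> cohomologous \<U>" using equiv_cohomologous a by (meson equiv_class_self equivE refl_onD)
  then have "(\<lambda>a \<alpha> \<beta>. a (r \<alpha>) (r \<beta>)) ` (cohomologous \<U> `` {a}) = pullback r ` (cohomologous \<U> `` {a})"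
    by (simp add: pullback_def[abs_def])
  moreover have "cohomologous \<V> `` (pullback r ` (cohomologous \<U> `` {a})) = (\<Union>a'\<in>cohomologous \<U> `` {a}. cohomologous \<V> `` {pullback r a'})"
    by auto
  moreover have "\<dots> = cohomologous \<V> `` {pullback r a}"
  proof (rule SUP_eq_const)
    show "cohomologous \<U> `` {a} \<noteq> {}" using \<open>(a, a) \<in> cohomologous \<U>\<close> by blast
    show "cohomologous \<V> `` {pullback r a'} = cohomologous \<V> `` {pullback r a}" if "a' \<in> cohomologous \<U> `` {a}" for a'
      by (rule c) (use that in simp)
  qed
  ultimately show ?thesis by (simp add: restrict_class_def)
qed

text \<open>Equality in the direct limit, expressed through representing cocycles.\<close>

definition common_refinement_equiv ::
  "('i, 'm::topological_space) cover \<Rightarrow> ('i, 'm, 'n::finite) cochain1 \<Rightarrow> ('i, 'm) cover \<Rightarrow> ('i, 'm, 'n) cochain1 \<Rightarrow> bool" where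
  "common_refinement_equiv \<U> a \<U>' a' \<longleftrightarrow>
     (\<exists>\<V> r r'. open_cover \<V> \<and> refinement_map \<V> \<U> r \<and> refinement_map \<V> \<U>' r' \<and>
        (pullback r a, pullback r' a') \<in> cohomologous \<V>)"

lemma limit_rel_iff:
  assumes "open_cover \<U>" "open_cover \<U>'" "a \<in> Z1 \<U>" "a' \<in> Z1 \<U>'"
  shows "((\<U>, cohomologous \<U> `` {a}), (\<U>', cohomologous \<U>' `` {a'})) \<in> limit_rel
    \<longleftrightarrow> common_refinement_equiv \<U> a \<U>' a'"
proof -
  have "restrict_class \<V> r (cohomologous \<U> `` {a}) = restrict_class \<V> r' (cohomologous \<U>' `` {a'})
    \<longleftrightarrow> (pullback r a, pullback r' a') \<in> cohomologous \<V>"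
    if "refinement_map \<V> \<U> r" "refinement_map \<V> \<U>' r'" for \<V> r r'
    using eq_equiv_class_iff[OF equiv_cohomologous pullback_Z1[OF that(1) assms(3)] pullback_Z1[OF that(2) assms(4)]]
    by (simp add: restrict_class_eq[OF that(1) assms(3)] restrict_class_eq[OF that(2) assms(4)])
  moreover have "(\<U>, cohomologous \<U> `` {a}) \<in> cover_classes" "(\<U>', cohomologous \<U>' `` {a'}) \<in> cover_classes"
    using assms by (auto simp: cover_classes_def H1_cover_def quotientI)
  ultimately show ?thesis
    unfolding limit_rel_def common_refinement_equiv_def mem_Collect_eq prod.case by blast
qed

lemma cover_classesE:
  assumes "p \<in> cover_classes"
  obtains \<U> a where "p = (\<U>, cohomologous \<U> `` {a})" "open_cover \<U>" "a \<in> Z1 \<U>"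
  using assms unfolding cover_classes_def H1_cover_def by (auto elim!: quotientE)

text \<open>Since sets index themselves through an injection into the index type, there are enough
  covers: any property that holds for small open sets is shared by all the sets of some cover.\<close>

lemma ex_cover:
  fixes index_emb :: "'m::topological_space set \<Rightarrow> 'i"
  assumes inj: "inj index_emb" and Q: "\<And>x. \<exists>S. open S \<and> x \<in> S \<and> Q S"
  obtains \<V> :: "('i, 'm) cover" where "open_cover \<V>" "\<And>\<alpha>. \<alpha> \<in> fst \<V> \<Longrightarrow> Q (snd \<V> \<alpha>)"
proof
  let ?V = "(index_emb ` {S. open S \<and> Q S}, inv_into UNIV index_emb)"
  show "open_cover ?V"
    using Q by (auto simp: open_cover_def inv_f_f[OF inj])
  show "Q (snd ?V \<alpha>)" if "\<alpha> \<in> fst ?V" for \<alpha> using that by (auto simp: inv_f_f[OF inj])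
qed

lemma open_cover_ex: "open_cover \<U> \<Longrightarrow> \<exists>\<alpha>\<in>fst \<U>. x \<in> snd \<U> \<alpha>"
  unfolding open_cover_def by blast

lemma common_refinement:
  fixes index_emb :: "'m::topological_space set \<Rightarrow> 'i" and \<U> \<U>' :: "('i, 'm) cover"
  assumes inj: "inj index_emb" and U: "open_cover \<U>" "open_cover \<U>'"
  obtains \<V> r r' where "open_cover \<V>" "refinement_map \<V> \<U> r" "refinement_map \<V> \<U>' r'"
proof -
  have "\<exists>S. open S \<and> x \<in> S \<and> ((\<exists>\<alpha>\<in>fst \<U>. S \<subseteq> snd \<U> \<alpha>) \<and> (\<exists>\<alpha>\<in>fst \<U>'. S \<subseteq> snd \<U>' \<alpha>))" for x
  proof -
    obtain \<alpha> where a: "\<alpha> \<in> fst \<U>" "x \<in> snd \<U> \<alpha>" using open_cover_ex[OF U(1)] by blast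
    obtain \<beta> where b: "\<beta> \<in> fst \<U>'" "x \<in> snd \<U>' \<beta>" using open_cover_ex[OF U(2)] by blast
    have "open (snd \<U> \<alpha> \<inter> snd \<U>' \<beta>)" using U a b by (auto simp: open_cover_def)
    then show ?thesis using a b by (intro exI[of _ "snd \<U> \<alpha> \<inter> snd \<U>' \<beta>"]) auto
  qed
  from ex_cover[OF inj this] obtain \<V> :: "('i, 'm) cover" where V: "open_cover \<V>"
    "\<And>\<alpha>. \<alpha> \<in> fst \<V> \<Longrightarrow> (\<exists>\<beta>\<in>fst \<U>. snd \<V> \<alpha> \<subseteq> snd \<U> \<beta>) \<and> (\<exists>\<beta>\<in>fst \<U>'. snd \<V> \<alpha> \<subseteq> snd \<U>' \<beta>)" by blast
  have "\<forall>\<alpha>. \<exists>\<beta>. \<alpha> \<in> fst \<V> \<longrightarrow> \<beta> \<in> fst \<U> \<and> snd \<V> \<alpha> \<subseteq> snd \<U> \<beta>" using V(2) by blast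
  then obtain r where "\<forall>\<alpha>. \<alpha> \<in> fst \<V> \<longrightarrow> r \<alpha> \<in> fst \<U> \<and> snd \<V> \<alpha> \<subseteq> snd \<U> (r \<alpha>)" by metis
  moreover have "\<forall>\<alpha>. \<exists>\<beta>. \<alpha> \<in> fst \<V> \<longrightarrow> \<beta> \<in> fst \<U>' \<and> snd \<V> \<alpha> \<subseteq> snd \<U>' \<beta>" using V(2) by blast
  then obtain r' where "\<forall>\<alpha>. \<alpha> \<in> fst \<V> \<longrightarrow> r' \<alpha> \<in> fst \<U>' \<and> snd \<V> \<alpha> \<subseteq> snd \<U>' (r' \<alpha>)" by metis
  ultimately show thesis using that[OF V(1), of r r'] by (simp add: refinement_map_def)
qed

lemma cohomologous_trans: "(a, b) \<in> cohomologous \<U> \<Longrightarrow> (b, c) \<in> cohomologous \<U> \<Longrightarrow> (a, c) \<in> cohomologous \<U>"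
  using equiv_cohomologous[of \<U>] by (auto simp: equiv_def dest: transD)

text \<open>For transitivity, the two given refinements are refined once more. The middle cocycle is then
  pulled back along two different refinement maps, which makes no difference up to cohomology.\<close>

lemma equiv_limit_rel:
  fixes index_emb :: "'m::topological_space set \<Rightarrow> 'i"
  assumes inj: "inj index_emb"
  shows "equiv cover_classes (limit_rel :: (('i, 'm, 'n::finite) cover_class \<times> ('i, 'm, 'n) cover_class) set)"
proof (rule equivI)
  show "limit_rel \<subseteq> cover_classes \<times> (cover_classes :: ('i, 'm, 'n) cover_class set)"
    by (auto simp: limit_rel_def)
  have id: "refinement_map \<U> \<U> id" for \<U> :: "('i, 'm) cover" by (simp add: refinement_map_def)
  show "refl_on cover_classes (limit_rel :: (('i, 'm, 'n) cover_class \<times> ('i, 'm, 'n) cover_class) set)"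
  proof (rule refl_onI)
    fix p :: "('i, 'm, 'n) cover_class" assume "p \<in> cover_classes"
    then show "(p, p) \<in> limit_rel"
      using id by (cases p) (auto simp: limit_rel_def cover_classes_def intro!: exI[of _ id])
  qed
  show "sym (limit_rel :: (('i, 'm, 'n) cover_class \<times> ('i, 'm, 'n) cover_class) set)"
    by (rule symI) (force simp: limit_rel_def)
  show "trans (limit_rel :: (('i, 'm, 'n) cover_class \<times> ('i, 'm, 'n) cover_class) set)"
  proof (rule transI)
    fix p p' p'' :: "('i, 'm, 'n) cover_class" assume *: "(p, p') \<in> limit_rel" "(p', p'') \<in> limit_rel"
    then have "p \<in> cover_classes" "p' \<in> cover_classes" "p'' \<in> cover_classes" by (auto simp: limit_rel_def)
    then obtain \<U> a \<U>' a' \<U>'' a'' where p: "p = (\<U>, cohomologous \<U> `` {a})" "open_cover \<U>" "a \<in> Z1 \<U>"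
      "p' = (\<U>', cohomologous \<U>' `` {a'})" "open_cover \<U>'" "a' \<in> Z1 \<U>'"
      "p'' = (\<U>'', cohomologous \<U>'' `` {a''})" "open_cover \<U>''" "a'' \<in> Z1 \<U>''"
      by (elim cover_classesE) blast
    have "common_refinement_equiv \<U> a \<U>' a'" "common_refinement_equiv \<U>' a' \<U>'' a''"
      using * unfolding p(1,4,7) by (simp_all add: limit_rel_iff p)
    then obtain \<V> r r' \<V>' q q' where V: "open_cover \<V>" "refinement_map \<V> \<U> r" "refinement_map \<V> \<U>' r'"
      "(pullback r a, pullback r' a') \<in> cohomologous \<V>"
      "open_cover \<V>'" "refinement_map \<V>' \<U>' q" "refinement_map \<V>' \<U>'' q'"
      "(pullback q a', pullback q' a'') \<in> cohomologous \<V>'"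
      unfolding common_refinement_equiv_def by blast
    obtain \<W> s s' where W: "open_cover \<W>" "refinement_map \<W> \<V> s" "refinement_map \<W> \<V>' s'"
      by (rule common_refinement[OF inj V(1,5)])
    have "(pullback (r \<circ> s) a, pullback (r' \<circ> s) a') \<in> cohomologous \<W>"
      using pullback_cohomologous[OF W(2) V(4)] by (simp add: pullback_comp)
    moreover have "(pullback (r' \<circ> s) a', pullback (q \<circ> s') a') \<in> cohomologous \<W>"
      by (rule pullback_independent[OF refinement_map_comp[OF W(2) V(3)] refinement_map_comp[OF W(3) V(6)] p(6)])
    moreover have "(pullback (q \<circ> s') a', pullback (q' \<circ> s') a'') \<in> cohomologous \<W>"
      using pullback_cohomologous[OF W(3) V(8)] by (simp add: pullback_comp)
    ultimately have "(pullback (r \<circ> s) a, pullback (q' \<circ> s') a'') \<in> cohomologous \<W>"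
      using cohomologous_trans by blast
    then have "common_refinement_equiv \<U> a \<U>'' a''"
      unfolding common_refinement_equiv_def
      using W(1) refinement_map_comp[OF W(2) V(2)] refinement_map_comp[OF W(3) V(7)] by blast
    then show "(p, p'') \<in> limit_rel" unfolding p(1,7) by (simp add: limit_rel_iff p)
  qed
qed

definition cech_class :: "('i, 'm::topological_space) cover \<Rightarrow> ('i, 'm, 'n::finite) cochain1 \<Rightarrow> ('i, 'm, 'n) cover_class set" where
  "cech_class \<U> a = limit_rel `` {(\<U>, cohomologous \<U> `` {a})}"

lemma cech_class_eq_iff:
  fixes index_emb :: "'m::topological_space set \<Rightarrow> 'i" and \<U> :: "('i, 'm) cover"
  assumes "inj index_emb" "open_cover \<U>" "open_cover \<U>'" "a \<in> Z1 \<U>" "a' \<in> Z1 \<U>'"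
  shows "cech_class \<U> a = cech_class \<U>' a' \<longleftrightarrow> common_refinement_equiv \<U> a \<U>' a'"
proof -
  have "(\<U>, cohomologous \<U> `` {a}) \<in> cover_classes" "(\<U>', cohomologous \<U>' `` {a'}) \<in> cover_classes"
    using assms by (auto simp: cover_classes_def H1_cover_def quotientI)
  from eq_equiv_class_iff[OF equiv_limit_rel[OF assms(1)] this]
  show ?thesis unfolding cech_class_def limit_rel_iff[OF assms(2-5)] .
qed

lemma H1_eq: "H1 = {cech_class \<U> a |\<U> a. open_cover \<U> \<and> a \<in> Z1 \<U>}"
proof (intro equalityI subsetI)
  fix \<tau> :: "('i, 'm::topological_space, 'n::finite) cover_class set" assume "\<tau> \<in> H1"
  then obtain p where "p \<in> cover_classes" "\<tau> = limit_rel `` {p}" unfolding H1_def by (rule quotientE)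
  moreover from \<open>p \<in> cover_classes\<close> obtain \<U> a where "p = (\<U>, cohomologous \<U> `` {a})" "open_cover \<U>" "a \<in> Z1 \<U>"
    by (rule cover_classesE)
  ultimately have "\<tau> = cech_class \<U> a" "open_cover \<U>" "a \<in> Z1 \<U>" by (simp_all only: cech_class_def)
  then show "\<tau> \<in> {cech_class \<U> a |\<U> a. open_cover \<U> \<and> a \<in> Z1 \<U>}" by blast
next
  fix \<tau> :: "('i, 'm::topological_space, 'n::finite) cover_class set"
  assume "\<tau> \<in> {cech_class \<U> a |\<U> a. open_cover \<U> \<and> a \<in> Z1 \<U>}"
  then obtain \<U> a where *: "\<tau> = cech_class \<U> a" "open_cover \<U>" "a \<in> Z1 \<U>" by blast
  then have "(\<U>, cohomologous \<U> `` {a}) \<in> cover_classes"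
    by (auto simp: cover_classes_def H1_cover_def quotientI)
  then show "\<tau> \<in> H1" unfolding H1_def *(1) cech_class_def by (rule quotientI)
qed

section \<open>Isomorphisms of flat bundles\<close>

lemma fibre_linear_lincomb:
  fixes f :: "'e \<Rightarrow> real ^ 'n" and g :: "'e' \<Rightarrow> real ^ 'n" and e :: "'n \<Rightarrow> 'e" and c :: "real ^ 'n"
  assumes M: "coordinate_iso M f" and N: "coordinate_iso N g" and F: "fibre_linear M N F"
    and e: "\<And>i. e i \<in> carrier M"
  shows "F (\<Oplus>\<^bsub>M\<^esub>i\<in>UNIV. (c $ i) \<odot>\<^bsub>M\<^esub> e i) = (\<Oplus>\<^bsub>N\<^esub>i\<in>UNIV. (c $ i) \<odot>\<^bsub>N\<^esub> F (e i))"
proof -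
  interpret M: coordinate_iso M f by (rule M)
  interpret N: coordinate_iso N g by (rule N)
  let ?A = "matrix (g \<circ> F \<circ> inv_into (carrier M) f)"
  have Fe: "F u \<in> carrier N" if "u \<in> carrier M" for u using F that by (auto simp: fibre_linear_def)
  have s: "(\<Oplus>\<^bsub>M\<^esub>i\<in>UNIV. (c $ i) \<odot>\<^bsub>M\<^esub> e i) \<in> carrier M" using e by auto
  have "g (F (\<Oplus>\<^bsub>M\<^esub>i\<in>UNIV. (c $ i) \<odot>\<^bsub>M\<^esub> e i)) = ?A *v (c v* (\<chi> i. f (e i)))"
    using matrix_fibre_map[OF M N F s] M.map_lincomb[where e = e and c = c, OF e] by simp
  also have "\<dots> = (\<Sum>i\<in>UNIV. c $ i *\<^sub>R (?A *v f (e i)))"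
  proof -
    have "c v* (\<chi> i. f (e i)) = (\<Sum>i\<in>UNIV. c $ i *\<^sub>R f (e i))"
      by (simp add: vector_matrix_mult_def vec_eq_iff mult.commute)
    then show ?thesis
      by (simp add: linear_sum[OF matrix_vector_mul_linear] linear_scale[OF matrix_vector_mul_linear])
  qed
  also have "\<dots> = (\<Sum>i\<in>UNIV. c $ i *\<^sub>R g (F (e i)))"
    using matrix_fibre_map[OF M N F e] by simp
  also have "\<dots> = g (\<Oplus>\<^bsub>N\<^esub>i\<in>UNIV. (c $ i) \<odot>\<^bsub>N\<^esub> F (e i))"
    using Fe[OF e] by (simp add: N.map_finsum N.map_scale)
  finally show ?thesis
    using N.map_eq_iff[OF Fe[OF s]] Fe[OF e] by simp
qed

context smooth_manifold
begin

text \<open>Isomorphisms of bundles with connection, with the inverse \<open>G\<close> as part of the data. That the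
  inverse preserves the connections too is \<open>flat_iso_map_sym\<close>.\<close>

definition flat_iso_map ::
  "('m, 'e, 'n::finite) vbundle \<Rightarrow> ('m, 'e) cov_deriv \<Rightarrow> ('m, 'e, 'n) vbundle \<Rightarrow> ('m, 'e) cov_deriv \<Rightarrow>
    ('m \<Rightarrow> 'e \<Rightarrow> 'e) \<Rightarrow> ('m \<Rightarrow> 'e \<Rightarrow> 'e) \<Rightarrow> bool" where
  "flat_iso_map E D E' D' F G \<longleftrightarrow> bundle_map \<A> E E' F \<and> bundle_map \<A> E' E G \<and>
        (\<forall>x. \<forall>u\<in>carrier (fibre E x). G x (F x u) = u) \<and>
        (\<forall>x. \<forall>u\<in>carrier (fibre E' x). F x (G x u) = u) \<and>
        (\<forall>x. \<forall>v\<in>tangent_space \<A> x. \<forall>s. section_near \<A> E x s \<longrightarrow>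
           D' x v (\<lambda>y. F y (s y)) = F x (D x v s))"

lemma flat_iso_iff:
  "((E, D), (E', D')) \<in> flat_iso \<A> \<longleftrightarrow>
    (E, D) \<in> flat_bundles \<A> \<and> (E', D') \<in> flat_bundles \<A> \<and> (\<exists>F G. flat_iso_map E D E' D' F G)"
  unfolding flat_iso_def flat_iso_map_def by simp

lemma flat_iso_mapD:
  assumes "flat_iso_map E D E' D' F G"
  shows "bundle_map \<A> E E' F" "bundle_map \<A> E' E G"
    "u \<in> carrier (fibre E x) \<Longrightarrow> G x (F x u) = u"
    "u' \<in> carrier (fibre E' x) \<Longrightarrow> F x (G x u') = u'"
    "v \<in> tangent_space \<A> x \<Longrightarrow> section_near \<A> E x s \<Longrightarrow> D' x v (\<lambda>y. F y (s y)) = F x (D x v s)"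
  using assms unfolding flat_iso_map_def by blast+

lemma flat_bundlesD:
  "(E, D) \<in> flat_bundles \<A> \<Longrightarrow> vector_bundle \<A> E"
  "(E, D) \<in> flat_bundles \<A> \<Longrightarrow> flat_connection \<A> E D"
  "(E, D) \<in> flat_bundles \<A> \<Longrightarrow> bundle_connection \<A> E D"
  by (simp_all add: flat_bundles_def flat_connection_def)

lemma bundle_map_linear: "bundle_map \<A> E E' F \<Longrightarrow> fibre_linear (fibre E x) (fibre E' x) (F x)"
  by (simp add: bundle_map_def)

lemma bundle_map_carrier: "bundle_map \<A> E E' F \<Longrightarrow> u \<in> carrier (fibre E x) \<Longrightarrow> F x u \<in> carrier (fibre E' x)"
  using bundle_map_linear by (fastforce simp: fibre_linear_def)

lemma bundle_map_smooth:
  assumes "bundle_map \<A> E E' F" "(W, \<psi>) \<in> trivs E" "(W', \<psi>') \<in> trivs E'"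
  shows "smooth_fun \<A> (W \<inter> W') (triv_matrix E \<psi> \<psi>' F)"
proof -
  have "\<forall>(W, \<phi>)\<in>trivs E. \<forall>(W', \<psi>)\<in>trivs E'. smooth_fun \<A> (W \<inter> W') (triv_matrix E \<phi> \<psi> F)"
    using assms(1) unfolding bundle_map_def by (elim conjE)
  from bspec[OF this assms(2)] have "\<forall>(W', \<psi>')\<in>trivs E'. smooth_fun \<A> (W \<inter> W') (triv_matrix E \<psi> \<psi>' F)"
    by simp
  from bspec[OF this assms(3)] show ?thesis by simp
qed

lemma bundle_mapI:
  assumes "\<And>x. fibre_linear (fibre E x) (fibre E' x) (F x)"
    and "\<And>W \<psi> W' \<psi>'. (W, \<psi>) \<in> trivs E \<Longrightarrow> (W', \<psi>') \<in> trivs E' \<Longrightarrow> smooth_fun \<A> (W \<inter> W') (triv_matrix E \<psi> \<psi>' F)"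
  shows "bundle_map \<A> E E' F"
  unfolding bundle_map_def using assms by auto

lemma bundle_map_section:
  assumes E: "vector_bundle \<A> E" "vector_bundle \<A> E'" and F: "bundle_map \<A> E E' F" and s: "smooth_section \<A> E U s"
  shows "smooth_section \<A> E' U (\<lambda>x. F x (s x))"
proof (rule smooth_sectionI[OF E(2) smooth_section_open[OF s]])
  fix x assume x: "x \<in> U"
  show "F x (s x) \<in> carrier (fibre E' x)"
    by (rule bundle_map_carrier[OF F smooth_section_carrier[OF s x]])
  obtain W \<psi> where t: "(W, \<psi>) \<in> trivs E" "x \<in> W" using ex_triv[OF E(1)] .
  obtain W' \<psi>' where t': "(W', \<psi>') \<in> trivs E'" "x \<in> W'" using ex_triv[OF E(2)] .
  let ?N = "U \<inter> W \<inter> W'"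
  have o: "open ?N" using smooth_section_open[OF s] triv_open[OF E(1) t(1)] triv_open[OF E(2) t'(1)] by auto
  have "smooth_fun \<A> ?N (\<lambda>x. triv_matrix E \<psi> \<psi>' F x *v \<psi> x (s x))"
    by (intro smooth_fun_bilinear[OF bounded_bilinear_matrix_vector_mult]
        smooth_fun_subset[OF bundle_map_smooth[OF F t(1) t'(1)] o] smooth_fun_subset[OF smooth_section_coord[OF s t(1)] o]) auto
  then have "smooth_fun \<A> ?N (\<lambda>x. \<psi>' x (F x (s x)))"
  proof (rule smooth_fun_cong)
    fix y assume y: "y \<in> ?N"
    show "triv_matrix E \<psi> \<psi>' F y *v \<psi> y (s y) = \<psi>' y (F y (s y))"
      by (rule triv_matrix_apply[where F = F and x = y, OF E t(1) t'(1) _ _ bundle_map_linear[OF F] smooth_section_carrier[OF s]]) (use y in auto)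
  qed
  then show "\<exists>W \<psi> N. (W, \<psi>) \<in> trivs E' \<and> x \<in> N \<and> N \<subseteq> U \<inter> W \<and> smooth_fun \<A> N (\<lambda>x. \<psi> x (F x (s x)))"
    using x t(2) t' by - (rule exI[of _ W'], rule exI[of _ \<psi>'], rule exI[of _ ?N], auto)
qed

lemma bundle_map_section_near:
  assumes "vector_bundle \<A> E" "vector_bundle \<A> E'" "bundle_map \<A> E E' F" "section_near \<A> E x s"
  shows "section_near \<A> E' x (\<lambda>x. F x (s x))"
  using assms(4) bundle_map_section[OF assms(1-3)] unfolding section_near_def by blast

lemma section_near_carrier:
  assumes "section_near \<A> E x s" shows "\<forall>\<^sub>F y in nhds x. s y \<in> carrier (fibre E y)"
proof -
  obtain U where U: "x \<in> U" "smooth_section \<A> E U s" using assms by (auto simp: section_near_def)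
  show ?thesis
    unfolding eventually_nhds
    by (rule exI[of _ U]) (use U smooth_section_open[OF U(2)] smooth_section_carrier[OF U(2)] in simp)
qed

lemma bundle_map_id:
  assumes E: "vector_bundle \<A> E" shows "bundle_map \<A> E E (\<lambda>x u. u)"
  by (rule bundle_mapI[OF fibre_linear_id]) (rule triv_transition[OF E])

lemma fibre_linear_comp: "fibre_linear M N F \<Longrightarrow> fibre_linear N L G \<Longrightarrow> fibre_linear M L (\<lambda>u. G (F u))"
  unfolding fibre_linear_def by (auto simp: Pi_iff)

lemma bundle_map_comp:
  assumes E: "vector_bundle \<A> E" "vector_bundle \<A> E'" "vector_bundle \<A> E''"
    and F: "bundle_map \<A> E E' F" and G: "bundle_map \<A> E' E'' G"
  shows "bundle_map \<A> E E'' (\<lambda>x u. G x (F x u))"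
proof (rule bundle_mapI)
  show lin: "fibre_linear (fibre E x) (fibre E'' x) (\<lambda>u. G x (F x u))" for x
    by (rule fibre_linear_comp[OF bundle_map_linear[OF F] bundle_map_linear[OF G]])
  fix W \<psi> W'' \<psi>'' assume t: "(W, \<psi>) \<in> trivs E" and t'': "(W'', \<psi>'') \<in> trivs E''"
  show "smooth_fun \<A> (W \<inter> W'') (triv_matrix E \<psi> \<psi>'' (\<lambda>x u. G x (F x u)))"
  proof (rule smooth_fun_locally)
    show "open (W \<inter> W'')" using triv_open[OF E(1) t] triv_open[OF E(3) t''] by (rule open_Int)
    fix x assume x: "x \<in> W \<inter> W''"
    obtain W' \<psi>' where t': "(W', \<psi>') \<in> trivs E'" "x \<in> W'" using ex_triv[OF E(2)] .
    let ?N = "W \<inter> W' \<inter> W''"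
    have o: "open ?N" using triv_open[OF E(1) t] triv_open[OF E(2) t'(1)] triv_open[OF E(3) t''] by auto
    have "smooth_fun \<A> ?N (\<lambda>x. triv_matrix E' \<psi>' \<psi>'' G x ** triv_matrix E \<psi> \<psi>' F x)"
      by (intro smooth_fun_bilinear[OF bounded_bilinear_matrix_matrix_mult]
        smooth_fun_subset[OF bundle_map_smooth[OF F t t'(1)] o] smooth_fun_subset[OF bundle_map_smooth[OF G t'(1) t''] o]) auto
    then have "smooth_fun \<A> ?N (triv_matrix E \<psi> \<psi>'' (\<lambda>x u. G x (F x u)))"
    proof (rule smooth_fun_cong)
      fix y assume y: "y \<in> ?N"
      interpret y: coordinate_iso "fibre E y" "\<psi> y" using triv_iso[OF E(1) t] y by simp
      have "(triv_matrix E' \<psi>' \<psi>'' G y ** triv_matrix E \<psi> \<psi>' F y) *v w = triv_matrix E \<psi> \<psi>'' (\<lambda>x u. G x (F x u)) y *v w" for w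
      proof -
        obtain u where u: "u \<in> carrier (fibre E y)" "w = \<psi> y u" using y.inv_carrier y.map_inv by metis
        note Fu = bundle_map_carrier[OF F u(1)]
        have "triv_matrix E \<psi> \<psi>' F y *v \<psi> y u = \<psi>' y (F y u)"
          by (rule triv_matrix_apply[where F = F and x = y, OF E(1,2) t t'(1) _ _ bundle_map_linear[OF F] u(1)]) (use y in auto)
        moreover have "triv_matrix E' \<psi>' \<psi>'' G y *v \<psi>' y (F y u) = \<psi>'' y (G y (F y u))"
          by (rule triv_matrix_apply[where F = G and x = y, OF E(2,3) t'(1) t'' _ _ bundle_map_linear[OF G] Fu]) (use y in auto)
        moreover have "triv_matrix E \<psi> \<psi>'' (\<lambda>x u. G x (F x u)) y *v \<psi> y u = \<psi>'' y (G y (F y u))"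
          by (rule triv_matrix_apply[where F = "\<lambda>x u. G x (F x u)" and x = y, OF E(1,3) t t'' _ _ lin u(1)]) (use y in auto)
        ultimately show ?thesis by (simp add: u(2) matrix_vector_mul_assoc[symmetric])
      qed
      then show "triv_matrix E' \<psi>' \<psi>'' G y ** triv_matrix E \<psi> \<psi>' F y = triv_matrix E \<psi> \<psi>'' (\<lambda>x u. G x (F x u)) y"
        by (simp add: matrix_eq)
    qed
    then show "\<exists>N. x \<in> N \<and> smooth_fun \<A> N (triv_matrix E \<psi> \<psi>'' (\<lambda>x u. G x (F x u)))"
      by (intro exI[of _ ?N] conjI) (use x t'(2) in simp_all)
  qed
qed

lemma flat_iso_map_sym:
  assumes E: "(E, D) \<in> flat_bundles \<A>" "(E', D') \<in> flat_bundles \<A>" and F: "flat_iso_map E D E' D' F G"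
  shows "flat_iso_map E' D' E D G F"
proof -
  note e = flat_bundlesD[OF E(1)] and e' = flat_bundlesD[OF E(2)] and f = flat_iso_mapD[OF F]
  have "D x v (\<lambda>y. G y (s y)) = G x (D' x v s)" if v: "v \<in> tangent_space \<A> x" and s: "section_near \<A> E' x s" for x v s
  proof -
    have n: "section_near \<A> E x (\<lambda>y. G y (s y))"
      by (rule bundle_map_section_near[OF e'(1) e(1) f(2) s])
    have "\<forall>\<^sub>F y in nhds x. s y = F y (G y (s y))"
      using section_near_carrier[OF s] by (rule eventually_mono) (simp add: f(4))
    then have "D' x v s = F x (D x v (\<lambda>y. G y (s y)))"
      using conn_cong[OF e'(1,3) v s] f(5)[OF v n] by simp
    then show ?thesis using f(3)[OF conn_carrier[OF e(1,3) v n]] by simp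
  qed
  then show ?thesis unfolding flat_iso_map_def by (intro conjI allI ballI impI f(1-4))
qed

lemma flat_iso_map_trans:
  assumes E: "(E, D) \<in> flat_bundles \<A>" "(E', D') \<in> flat_bundles \<A>" "(E'', D'') \<in> flat_bundles \<A>"
    and F: "flat_iso_map E D E' D' F G" and F': "flat_iso_map E' D' E'' D'' F' G'"
  shows "flat_iso_map E D E'' D'' (\<lambda>x u. F' x (F x u)) (\<lambda>x u. G x (G' x u))"
proof -
  note e = flat_bundlesD(1)[OF E(1)] flat_bundlesD(1)[OF E(2)] flat_bundlesD(1)[OF E(3)]
  note f = flat_iso_mapD[OF F] and f' = flat_iso_mapD[OF F']
  show ?thesis
    unfolding flat_iso_map_def
  proof (intro conjI allI ballI impI)
    show "bundle_map \<A> E E'' (\<lambda>x u. F' x (F x u))" by (rule bundle_map_comp[OF e f(1) f'(1)])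
    show "bundle_map \<A> E'' E (\<lambda>x u. G x (G' x u))" by (rule bundle_map_comp[OF e(3,2,1) f'(2) f(2)])
    show "G x (G' x (F' x (F x u))) = u" if "u \<in> carrier (fibre E x)" for x u
      using that by (simp add: f(3) f'(3) bundle_map_carrier[OF f(1)])
    show "F' x (F x (G x (G' x u))) = u" if "u \<in> carrier (fibre E'' x)" for x u
      using that by (simp add: f(4) f'(4) bundle_map_carrier[OF f'(2)])
    show "D'' x v (\<lambda>y. F' y (F y (s y))) = F' x (F x (D x v s))"
      if "v \<in> tangent_space \<A> x" "section_near \<A> E x s" for x v s
      using f'(5)[OF that(1) bundle_map_section_near[OF e(1,2) f(1) that(2)]] f(5)[OF that] by simp
  qed
qed

lemma equiv_flat_iso: "equiv (flat_bundles \<A>) (flat_iso \<A> :: (('m, 'e, 'n::finite) conn_bundle \<times> ('m, 'e, 'n) conn_bundle) set)"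
proof (rule equivI)
  show "flat_iso \<A> \<subseteq> flat_bundles \<A> \<times> (flat_bundles \<A> :: ('m, 'e, 'n) conn_bundle set)"
    by (auto simp: flat_iso_def)
  show "refl_on (flat_bundles \<A>) (flat_iso \<A> :: (('m, 'e, 'n) conn_bundle \<times> ('m, 'e, 'n) conn_bundle) set)"
  proof (rule refl_onI)
    fix p :: "('m, 'e, 'n) conn_bundle" assume p: "p \<in> flat_bundles \<A>"
    obtain E D where [simp]: "p = (E, D)" by force
    have "flat_iso_map E D E D (\<lambda>x u. u) (\<lambda>x u. u)"
      unfolding flat_iso_map_def using p bundle_map_id flat_bundlesD(1) by auto
    then show "(p, p) \<in> flat_iso \<A>" using p by (auto simp: flat_iso_iff)
  qed
  show "sym (flat_iso \<A> :: (('m, 'e, 'n) conn_bundle \<times> ('m, 'e, 'n) conn_bundle) set)"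
  proof (rule symI)
    fix p q :: "('m, 'e, 'n) conn_bundle" assume pq: "(p, q) \<in> flat_iso \<A>"
    obtain E D E' D' where [simp]: "p = (E, D)" "q = (E', D')" by force
    obtain F G where FG: "flat_iso_map E D E' D' F G" and m: "(E, D) \<in> flat_bundles \<A>" "(E', D') \<in> flat_bundles \<A>"
      using pq by (auto simp: flat_iso_iff)
    show "(q, p) \<in> flat_iso \<A>"
      using flat_iso_map_sym[OF m FG] m by (auto simp: flat_iso_iff)
  qed
  show "trans (flat_iso \<A> :: (('m, 'e, 'n) conn_bundle \<times> ('m, 'e, 'n) conn_bundle) set)"
  proof (rule transI)
    fix p q r :: "('m, 'e, 'n) conn_bundle" assume pq: "(p, q) \<in> flat_iso \<A>" "(q, r) \<in> flat_iso \<A>"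
    obtain E D E' D' E'' D'' where [simp]: "p = (E, D)" "q = (E', D')" "r = (E'', D'')" by (cases p; cases q; cases r) auto
    obtain F G F' G' where FG: "flat_iso_map E D E' D' F G" "flat_iso_map E' D' E'' D'' F' G'"
      and m: "(E, D) \<in> flat_bundles \<A>" "(E', D') \<in> flat_bundles \<A>" "(E'', D'') \<in> flat_bundles \<A>"
      using pq by (auto simp: flat_iso_iff)
    show "(p, r) \<in> flat_iso \<A>"
      using flat_iso_map_trans[OF m FG] m by (auto simp: flat_iso_iff)
  qed
qed

lemma flat_iso_parallel_frame:
  assumes E: "(E, D) \<in> flat_bundles \<A>" "(E', D') \<in> flat_bundles \<A>" and F: "flat_iso_map E D E' D' F G"
    and h: "parallel_frame_on E D U h"
  shows "parallel_frame_on E' D' U (\<lambda>i x. F x (h i x))"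
proof -
  note e = flat_bundlesD[OF E(1)] and e' = flat_bundlesD[OF E(2)] and f = flat_iso_mapD[OF F]
  note hf = parallel_frame_imp_frame[OF h]
  have "parallel_section \<A> E' D' U (\<lambda>x. F x (h i x))" for i
    unfolding parallel_section_def
  proof (intro conjI ballI)
    show "smooth_section \<A> E' U (\<lambda>x. F x (h i x))"
      by (rule bundle_map_section[OF e(1) e'(1) f(1) frame_section[OF hf]])
    fix x v assume x: "x \<in> U" and v: "v \<in> tangent_space \<A> x"
    have n: "section_near \<A> E x (h i)" unfolding section_near_def using frame_section[OF hf] x by blast
    have "D x v (h i) = \<zero>\<^bsub>fibre E x\<^esub>" using h x v by (simp add: parallel_frame_on_def parallel_section_def)
    then have eq: "D' x v (\<lambda>y. F y (h i y)) = F x \<zero>\<^bsub>fibre E x\<^esub>" using f(5)[OF v n] by simp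
    obtain W \<psi> where t: "(W, \<psi>) \<in> trivs E" "x \<in> W" using ex_triv[OF e(1)] .
    obtain W' \<psi>' where t': "(W', \<psi>') \<in> trivs E'" "x \<in> W'" using ex_triv[OF e'(1)] .
    interpret a: coordinate_iso "fibre E x" "\<psi> x" by (rule triv_iso[OF e(1) t])
    interpret b: coordinate_iso "fibre E' x" "\<psi>' x" by (rule triv_iso[OF e'(1) t'])
    have "F x \<zero>\<^bsub>fibre E x\<^esub> = \<zero>\<^bsub>fibre E' x\<^esub>"
      using triv_matrix_apply[where F = F and x = x, OF e(1) e'(1) t(1) t'(1) t(2) t'(2) bundle_map_linear[OF f(1)] a.closed(3)]
        b.map_eq_iff[OF bundle_map_carrier[OF f(1) a.closed(3)] b.closed(3)]
      by (simp add: a.map_zero b.map_zero)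
    then show "D' x v (\<lambda>x. F x (h i x)) = \<zero>\<^bsub>fibre E' x\<^esub>" using eq by simp
  qed
  moreover have "fibre_basis (fibre E' x) (\<lambda>i. F x (h i x))" if x: "x \<in> U" for x
    unfolding fibre_basis_def
  proof (intro conjI allI ballI)
    show "F x (h i x) \<in> carrier (fibre E' x)" for i by (rule bundle_map_carrier[OF f(1) frame_carrier[OF hf x]])
    fix u assume u: "u \<in> carrier (fibre E' x)"
    note Gu = bundle_map_carrier[OF f(2) u]
    obtain W \<psi> where t: "(W, \<psi>) \<in> trivs E" "x \<in> W" using ex_triv[OF e(1)] .
    obtain W' \<psi>' where t': "(W', \<psi>') \<in> trivs E'" "x \<in> W'" using ex_triv[OF e'(1)] .
    interpret a: coordinate_iso "fibre E x" "\<psi> x" by (rule triv_iso[OF e(1) t])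
    have F_lin: "F x (\<Oplus>\<^bsub>fibre E x\<^esub>i\<in>UNIV. (c $ i) \<odot>\<^bsub>fibre E x\<^esub> h i x)
      = (\<Oplus>\<^bsub>fibre E' x\<^esub>i\<in>UNIV. (c $ i) \<odot>\<^bsub>fibre E' x\<^esub> F x (h i x))" for c :: "real ^ 'b"
      by (rule fibre_linear_lincomb[where e = "\<lambda>i. h i x", OF triv_iso[OF e(1) t] triv_iso[OF e'(1) t'] bundle_map_linear[OF f(1)] frame_carrier[OF hf x]])
    have car: "(\<Oplus>\<^bsub>fibre E x\<^esub>i\<in>UNIV. (c $ i) \<odot>\<^bsub>fibre E x\<^esub> h i x) \<in> carrier (fibre E x)" for c :: "real ^ 'b"
      using frame_carrier[OF hf x] by auto
    have "(G x u = (\<Oplus>\<^bsub>fibre E x\<^esub>i\<in>UNIV. (c $ i) \<odot>\<^bsub>fibre E x\<^esub> h i x))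
      \<longleftrightarrow> (u = (\<Oplus>\<^bsub>fibre E' x\<^esub>i\<in>UNIV. (c $ i) \<odot>\<^bsub>fibre E' x\<^esub> F x (h i x)))" for c :: "real ^ 'b"
      using F_lin[of c] f(3)[OF car[of c]] f(4)[OF u] by metis
    moreover have "\<exists>!c :: real ^ 'b. G x u = (\<Oplus>\<^bsub>fibre E x\<^esub>i\<in>UNIV. (c $ i) \<odot>\<^bsub>fibre E x\<^esub> h i x)"
      using h x Gu unfolding parallel_frame_on_def fibre_basis_def by blast
    ultimately show "\<exists>!c :: real ^ 'b. u = (\<Oplus>\<^bsub>fibre E' x\<^esub>i\<in>UNIV. (c $ i) \<odot>\<^bsub>fibre E' x\<^esub> F x (h i x))" by simp
  qed
  ultimately show ?thesis by (simp add: parallel_frame_on_def)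
qed

text \<open>A fibrewise linear map preserves the coefficients of \<open>k\<^sub>i = \<Sum> t\<^sub>i\<^sub>j h\<^sub>j\<close>.\<close>

lemma flat_iso_frame_change:
  assumes E: "vector_bundle \<A> E" "vector_bundle \<A> E'" and F: "bundle_map \<A> E E' F"
    and h: "frame_on E U h" "frame_on E' U (\<lambda>i x. F x (h i x))"
    and k: "frame_on E U' k" "frame_on E' U' (\<lambda>i x. F x (k i x))" and x: "x \<in> U" "x \<in> U'"
  shows "frame_change E' (\<lambda>i x. F x (h i x)) (\<lambda>i x. F x (k i x)) x = frame_change E h k x"
proof -
  let ?a = "frame_change E h k x"
  obtain W \<psi> where t: "(W, \<psi>) \<in> trivs E" "x \<in> W" using ex_triv[OF E(1)] .
  obtain W' \<psi>' where t': "(W', \<psi>') \<in> trivs E'" "x \<in> W'" using ex_triv[OF E(2)] .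
  have "k i x = (\<Oplus>\<^bsub>fibre E x\<^esub>j\<in>UNIV. (?a $ i $ j) \<odot>\<^bsub>fibre E x\<^esub> h j x)" for i
    using frame_expand_iff[OF E(1) h(1) k(1) x, of ?a] by blast
  then have "F x (k i x) = (\<Oplus>\<^bsub>fibre E' x\<^esub>j\<in>UNIV. (?a $ i $ j) \<odot>\<^bsub>fibre E' x\<^esub> F x (h j x))" for i
    using fibre_linear_lincomb[where e = "\<lambda>i. h i x" and c = "?a $ i", OF triv_iso[OF E(1) t] triv_iso[OF E(2) t'] bundle_map_linear[OF F] frame_carrier[OF h(1) x(1)]]
    by metis
  then have "\<forall>i. F x (k i x) = (\<Oplus>\<^bsub>fibre E' x\<^esub>j\<in>UNIV. (?a $ i $ j) \<odot>\<^bsub>fibre E' x\<^esub> F x (h j x))"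
    by (rule allI)
  then show ?thesis by (rule frame_expand_iff[OF E(2) h(2) k(2) x, THEN iffD1, symmetric])
qed

end

section \<open>Flat bundles with the same transition functions\<close>

context smooth_manifold
begin

lemma GL_sections_smooth:
  assumes b: "b \<in> GL_sections U" and U: "open U"
  shows "smooth_fun \<A> U b"
proof (rule smooth_fun_locally[OF _ U])
  fix x assume x: "x \<in> U"
  obtain N where N: "open N" "x \<in> N" "\<forall>y\<in>U \<inter> N. b y = b x" using GL_sections_local[OF b x] by blast
  have "smooth_fun \<A> (U \<inter> N) b"
    by (rule smooth_fun_cong[OF smooth_fun_const[OF open_Int[OF U N(1)], of "b x"]]) (use N(3) in auto)
  then show "\<exists>N. x \<in> N \<and> smooth_fun \<A> N b" using x N(2) by (intro exI[of _ "U \<inter> N"]) simp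
qed

lemma GL_sections_dir_deriv_row:
  assumes b: "b \<in> GL_sections U" and U: "open U" and x: "x \<in> U" and v: "v \<in> tangent_space \<A> x"
  shows "dir_deriv v (\<lambda>y. b y $ i) = 0"
proof -
  obtain N where N: "open N" "x \<in> N" "\<forall>y\<in>U \<inter> N. b y = b x" using GL_sections_local[OF b x] by blast
  have "dir_deriv v (\<lambda>y. b x $ i) = dir_deriv v (\<lambda>y. b y $ i)"
  proof (rule dir_deriv_cong[OF v smooth_near_const])
    show "\<forall>\<^sub>F y in nhds x. b x $ i = b y $ i"
      unfolding eventually_nhds
    proof (intro exI[of _ "U \<inter> N"] conjI ballI)
      show "open (U \<inter> N)" using U N(1) by (rule open_Int)
      show "x \<in> U \<inter> N" using x N(2) by simp
      fix y assume "y \<in> U \<inter> N"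
      then have "b y = b x" by (rule N(3)[rule_format])
      then show "b x $ i = b y $ i" by simp
    qed
  qed
  then show ?thesis by (simp add: dir_deriv_const[OF v])
qed

definition combine_frame :: "('m, 'e, 'n::finite) vbundle \<Rightarrow> ('m \<Rightarrow> real ^ 'n ^ 'n) \<Rightarrow> ('n \<Rightarrow> 'm \<Rightarrow> 'e) \<Rightarrow> 'n \<Rightarrow> 'm \<Rightarrow> 'e" where
  "combine_frame E b h i x = (\<Oplus>\<^bsub>fibre E x\<^esub>j\<in>UNIV. (b x $ i $ j) \<odot>\<^bsub>fibre E x\<^esub> h j x)"

text \<open>Locally constant combinations of parallel sections are parallel. This absorbs the cochain of a
  cohomology into the frames.\<close>

lemma parallel_frame_combine:
  fixes E :: "('m, 'e, 'n::finite) vbundle"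
  assumes E: "vector_bundle \<A> E" and D: "bundle_connection \<A> E D" and h: "parallel_frame_on E D U h"
    and b: "b \<in> GL_sections U"
  shows "parallel_frame_on E D U (combine_frame E b h)"
    and "x \<in> U \<Longrightarrow> frame_change E h (combine_frame E b h) x = b x"
proof -
  let ?k = "combine_frame E b h"
  note hf = parallel_frame_imp_frame[OF h]
  note U = frame_open[OF hf]
  have kc: "?k i x \<in> carrier (fibre E x)" if x: "x \<in> U" for i x
  proof -
    obtain W \<psi> where t: "(W, \<psi>) \<in> trivs E" "x \<in> W" using ex_triv[OF E] .
    interpret x: coordinate_iso "fibre E x" "\<psi> x" by (rule triv_iso[OF E t])
    show ?thesis unfolding combine_frame_def using frame_carrier[OF hf x] by auto
  qed
  have coord: "\<psi> x (?k i x) = (b x $ i) v* frame_matrix \<psi> h x"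
    if t: "(W, \<psi>) \<in> trivs E" and x: "x \<in> U" "x \<in> W" for W \<psi> x i
  proof -
    interpret x: coordinate_iso "fibre E x" "\<psi> x" by (rule triv_iso[OF E t x(2)])
    show ?thesis
      unfolding combine_frame_def frame_matrix_def
      by (rule x.map_lincomb[where e = "\<lambda>i. h i x", OF frame_carrier[OF hf x(1)]])
  qed
  have mat: "frame_matrix \<psi> ?k x = b x ** frame_matrix \<psi> h x"
    if t: "(W, \<psi>) \<in> trivs E" and x: "x \<in> U" "x \<in> W" for W \<psi> x
    unfolding frame_matrix_def[of \<psi> ?k] using coord[OF that]
    by (simp add: vec_eq_iff matrix_matrix_mult_def vector_matrix_mult_def mult.commute)
  have ks: "smooth_section \<A> E U (?k i)" for i
  proof (rule smooth_sectionI[OF E U kc])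
    fix x assume x: "x \<in> U"
    obtain W \<psi> where t: "(W, \<psi>) \<in> trivs E" "x \<in> W" using ex_triv[OF E] .
    have o: "open (U \<inter> W)" using U triv_open[OF E t(1)] by (rule open_Int)
    have "smooth_fun \<A> (U \<inter> W) (\<lambda>x. (b x $ i) v* frame_matrix \<psi> h x)"
      by (intro smooth_fun_bilinear[OF bounded_bilinear_vector_matrix_mult] smooth_fun_frame_matrix[OF E hf t(1)]
          smooth_fun_vec_nth smooth_fun_subset[OF GL_sections_smooth[OF b U] o]) auto
    then have "smooth_fun \<A> (U \<inter> W) (\<lambda>x. \<psi> x (?k i x))"
      by (rule smooth_fun_cong) (use coord[OF t(1)] in auto)
    then show "\<exists>W \<psi> N. (W, \<psi>) \<in> trivs E \<and> x \<in> N \<and> N \<subseteq> U \<inter> W \<and> smooth_fun \<A> N (\<lambda>x. \<psi> x (?k i x))"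
      using x t by - (rule exI[of _ W], rule exI[of _ \<psi>], rule exI[of _ "U \<inter> W"], auto)
  qed
  have par: "D x v (?k i) = \<zero>\<^bsub>fibre E x\<^esub>" if x: "x \<in> U" and v: "v \<in> tangent_space \<A> x" for x v i
  proof -
    obtain W \<psi> where t: "(W, \<psi>) \<in> trivs E" "x \<in> W" using ex_triv[OF E] .
    interpret x: coordinate_iso "fibre E x" "\<psi> x" by (rule triv_iso[OF E t])
    have o: "open (U \<inter> W)" using U triv_open[OF E t(1)] by (rule open_Int)
    have near: "section_near \<A> E x (h j)" "section_near \<A> E x (?k j)" for j
      unfolding section_near_def using frame_section[OF hf] ks x by blast+
    have h0: "D x v (h j) = \<zero>\<^bsub>fibre E x\<^esub>" for j
      using h x v by (simp add: parallel_frame_on_def parallel_section_def)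
    have bn: "smooth_near \<A> x (\<lambda>y. b y $ i)"
      by (rule smooth_near_I[OF smooth_fun_vec_nth[OF GL_sections_smooth[OF b U]] x])
    have "\<psi> x (D x v (?k i)) = dir_deriv v (\<lambda>y. b y $ i) v* frame_matrix \<psi> h x"
    proof (rule conn_parallel_frame[where h = h and c = "\<lambda>y. b y $ i" and s = "?k i" and \<psi> = \<psi> and x = x and v = v,
          OF E D t v near(1) h0 bn near(2)])
      show "\<forall>\<^sub>F y in nhds x. \<psi> y (?k i y) = (b y $ i) v* frame_matrix \<psi> h y"
        unfolding eventually_nhds
        by (rule exI[of _ "U \<inter> W"]) (use o x t(2) coord[OF t(1)] in simp)
    qed
    also have "\<dots> = 0"
      unfolding GL_sections_dir_deriv_row[OF b U x v] by (simp add: vector_matrix_mult_def vec_eq_iff)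
    finally show ?thesis
      using x.map_eq_iff[OF kc[OF x] x.closed(3)] x.map_eq_iff[OF conn_carrier[OF E D v near(2)] x.closed(3)]
      by (simp add: x.map_zero)
  qed
  have basis: "fibre_basis (fibre E x) (\<lambda>i. ?k i x)" if x: "x \<in> U" for x
  proof -
    obtain W \<psi> where t: "(W, \<psi>) \<in> trivs E" "x \<in> W" using ex_triv[OF E] .
    have "invertible (frame_matrix \<psi> ?k x)"
      unfolding mat[OF t(1) x t(2)]
      by (rule invertible_mult[OF GL_sections_invertible[OF b x] frame_matrix_invertible[OF E hf t(1) x t(2)]])
    then show ?thesis
      using coordinate_iso.fibre_basis_iff[OF triv_iso[OF E t], where e = "\<lambda>i. ?k i x", OF kc[OF x]]
      by (simp add: frame_matrix_def)
  qed
  show k: "parallel_frame_on E D U ?k"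
    unfolding parallel_frame_on_def parallel_section_def using ks par basis by simp
  show "frame_change E h ?k x = b x" if x: "x \<in> U"
  proof -
    have "\<forall>i. ?k i x = (\<Oplus>\<^bsub>fibre E x\<^esub>j\<in>UNIV. (b x $ i $ j) \<odot>\<^bsub>fibre E x\<^esub> h j x)"
      by (simp add: combine_frame_def)
    then show ?thesis by (rule frame_expand_iff[OF E hf parallel_frame_imp_frame[OF k] x x, THEN iffD1, symmetric])
  qed
qed

text \<open>The bundle map that carries one family of frames to another: \<open>u = \<Sum> c\<^sub>i k\<^sub>i\<close> is sent to
  \<open>\<Sum> c\<^sub>i k'\<^sub>i\<close>. At each point some member of the cover has to be chosen.\<close>

definition frame_map ::
  "('m, 'e, 'n::finite) vbundle \<Rightarrow> ('m, 'e, 'n) vbundle \<Rightarrow> ('i, 'm) cover \<Rightarrow>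
    ('i \<Rightarrow> 'n \<Rightarrow> 'm \<Rightarrow> 'e) \<Rightarrow> ('i \<Rightarrow> 'n \<Rightarrow> 'm \<Rightarrow> 'e) \<Rightarrow> 'm \<Rightarrow> 'e \<Rightarrow> 'e" where
  "frame_map E E' \<V> k k' x u =
     (let \<alpha> = (SOME \<alpha>. \<alpha> \<in> fst \<V> \<and> x \<in> snd \<V> \<alpha>); c = frame_coeff E (k \<alpha>) (\<lambda>y. u) x
      in \<Oplus>\<^bsub>fibre E' x\<^esub>i\<in>UNIV. (c $ i) \<odot>\<^bsub>fibre E' x\<^esub> k' \<alpha> i x)"

text \<open>Whichever member of the cover is chosen, the map is the same: if \<open>k\<^sub>\<alpha> = t k\<^sub>\<beta>\<close> and
  \<open>k'\<^sub>\<alpha> = t k'\<^sub>\<beta>\<close> for the same matrix \<open>t\<close>, then \<open>H\<^sub>\<alpha>\<^sup>-\<^sup>1 H'\<^sub>\<alpha> = H\<^sub>\<beta>\<^sup>-\<^sup>1 H'\<^sub>\<beta>\<close> for the frame matrices.\<close>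

lemma frame_map_coord:
  fixes E E' :: "('m, 'e, 'n::finite) vbundle" and \<V> :: "('i, 'm) cover"
  assumes E: "vector_bundle \<A> E" "vector_bundle \<A> E'" and V: "open_cover \<V>"
    and k: "\<And>\<alpha>. \<alpha> \<in> fst \<V> \<Longrightarrow> frame_on E (snd \<V> \<alpha>) (k \<alpha>)"
    and k': "\<And>\<alpha>. \<alpha> \<in> fst \<V> \<Longrightarrow> frame_on E' (snd \<V> \<alpha>) (k' \<alpha>)"
    and eq: "\<And>\<alpha> \<beta> x. \<alpha> \<in> fst \<V> \<Longrightarrow> \<beta> \<in> fst \<V> \<Longrightarrow> x \<in> snd \<V> \<alpha> \<Longrightarrow> x \<in> snd \<V> \<beta> \<Longrightarrow>
      frame_change E (k \<beta>) (k \<alpha>) x = frame_change E' (k' \<beta>) (k' \<alpha>) x"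
    and u: "u \<in> carrier (fibre E x)" and t: "(W, \<psi>) \<in> trivs E" "x \<in> W" and t': "(W', \<psi>') \<in> trivs E'" "x \<in> W'"
    and a: "\<alpha> \<in> fst \<V>" "x \<in> snd \<V> \<alpha>"
  shows "\<psi>' x (frame_map E E' \<V> k k' x u)
      = \<psi> x u v* (matrix_inv (frame_matrix \<psi> (k \<alpha>) x) ** frame_matrix \<psi>' (k' \<alpha>) x)"
    and "frame_map E E' \<V> k k' x u \<in> carrier (fibre E' x)"
proof -
  define \<beta> where "\<beta> = (SOME \<alpha>. \<alpha> \<in> fst \<V> \<and> x \<in> snd \<V> \<alpha>)"
  have b: "\<beta> \<in> fst \<V>" "x \<in> snd \<V> \<beta>"
    using someI[of "\<lambda>\<alpha>. \<alpha> \<in> fst \<V> \<and> x \<in> snd \<V> \<alpha>" \<alpha>] a by (auto simp: \<beta>_def)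
  interpret y: coordinate_iso "fibre E' x" "\<psi>' x" by (rule triv_iso[OF E(2) t'])
  let ?c = "frame_coeff E (k \<beta>) (\<lambda>y. u) x"
  have F: "frame_map E E' \<V> k k' x u = (\<Oplus>\<^bsub>fibre E' x\<^esub>i\<in>UNIV. (?c $ i) \<odot>\<^bsub>fibre E' x\<^esub> k' \<beta> i x)"
    by (simp add: frame_map_def \<beta>_def Let_def)
  show "frame_map E E' \<V> k k' x u \<in> carrier (fibre E' x)"
    unfolding F using frame_carrier[OF k'[OF b(1)] b(2)] by auto
  have "\<psi>' x (frame_map E E' \<V> k k' x u) = ?c v* frame_matrix \<psi>' (k' \<beta>) x"
    unfolding F frame_matrix_def
    by (rule y.map_lincomb[where e = "\<lambda>i. k' \<beta> i x", OF frame_carrier[OF k'[OF b(1)] b(2)]])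
  also have "?c = \<psi> x u v* matrix_inv (frame_matrix \<psi> (k \<beta>) x)"
    by (rule frame_coeff_eq[where s = "\<lambda>y. u" and x = x, OF E(1) k[OF b(1)] u t(1) b(2) t(2)])
  finally have 1: "\<psi>' x (frame_map E E' \<V> k k' x u)
    = \<psi> x u v* (matrix_inv (frame_matrix \<psi> (k \<beta>) x) ** frame_matrix \<psi>' (k' \<beta>) x)"
    by (simp add: vector_matrix_mul_assoc)
  let ?H = "\<lambda>\<alpha>. frame_matrix \<psi> (k \<alpha>) x" and ?H' = "\<lambda>\<alpha>. frame_matrix \<psi>' (k' \<alpha>) x"
  let ?t = "frame_change E (k \<beta>) (k \<alpha>) x"
  have "?H \<alpha> = ?t ** ?H \<beta>" by (rule frame_change_matrix[OF E(1) k[OF b(1)] k[OF a(1)] t(1) b(2) a(2) t(2)])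
  moreover have "?H' \<alpha> = ?t ** ?H' \<beta>"
    unfolding eq[OF a(1) b(1) a(2) b(2)]
    by (rule frame_change_matrix[OF E(2) k'[OF b(1)] k'[OF a(1)] t'(1) b(2) a(2) t'(2)])
  moreover note iB = frame_matrix_invertible[OF E(1) k[OF b(1)] t(1) b(2) t(2)]
    and iA = frame_matrix_invertible[OF E(1) k[OF a(1)] t(1) a(2) t(2)]
  ultimately have "?H \<alpha> ** (matrix_inv (?H \<beta>) ** ?H' \<beta>) = ?H' \<alpha>"
    using matrix_mult_inv_cancel(1)[OF iB, of ?t] by (simp add: matrix_mul_assoc)
  then have "matrix_inv (?H \<beta>) ** ?H' \<beta> = matrix_inv (?H \<alpha>) ** ?H' \<alpha>"
    using matrix_mult_inv_cancel(4)[OF iA] by metis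
  with 1 show "\<psi>' x (frame_map E E' \<V> k k' x u) = \<psi> x u v* (matrix_inv (?H \<alpha>) ** ?H' \<alpha>)" by simp
qed

lemma vector_matrix_mult_linear_left: "linear (\<lambda>c. c v* (A :: real ^ 'k ^ 'l))"
  by (rule linearI) (simp_all add: vector_matrix_mult_def vec_eq_iff algebra_simps sum.distrib sum_distrib_left)

text \<open>A map that sends parallel frames to parallel frames commutes with the connections, because
  both covariant derivatives only differentiate the coefficients. Its inverse is the map with the
  two families exchanged.\<close>

lemma flat_iso_map_if_same_transitions:
  fixes E E' :: "('m, 'e, 'n::finite) vbundle" and \<V> :: "('i, 'm) cover"
  assumes E: "(E, D) \<in> flat_bundles \<A>" "(E', D') \<in> flat_bundles \<A>" and V: "open_cover \<V>"
    and k: "\<And>\<alpha>. \<alpha> \<in> fst \<V> \<Longrightarrow> parallel_frame_on E D (snd \<V> \<alpha>) (k \<alpha>)"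
    and k': "\<And>\<alpha>. \<alpha> \<in> fst \<V> \<Longrightarrow> parallel_frame_on E' D' (snd \<V> \<alpha>) (k' \<alpha>)"
    and eq: "\<And>\<alpha> \<beta> x. \<alpha> \<in> fst \<V> \<Longrightarrow> \<beta> \<in> fst \<V> \<Longrightarrow> x \<in> snd \<V> \<alpha> \<Longrightarrow> x \<in> snd \<V> \<beta> \<Longrightarrow>
      frame_change E (k \<beta>) (k \<alpha>) x = frame_change E' (k' \<beta>) (k' \<alpha>) x"
  shows "bundle_map \<A> E E' (frame_map E E' \<V> k k')"
    and "u \<in> carrier (fibre E x) \<Longrightarrow> frame_map E' E \<V> k' k x (frame_map E E' \<V> k k' x u) = u"
    and "v \<in> tangent_space \<A> x \<Longrightarrow> section_near \<A> E x s \<Longrightarrow>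
      D' x v (\<lambda>y. frame_map E E' \<V> k k' y (s y)) = frame_map E E' \<V> k k' x (D x v s)"
proof -
  note e = flat_bundlesD[OF E(1)] and e' = flat_bundlesD[OF E(2)]
  note kf = parallel_frame_imp_frame[OF k] and kf' = parallel_frame_imp_frame[OF k']
  let ?F = "frame_map E E' \<V> k k'"
  have eq': "frame_change E' (k' \<beta>) (k' \<alpha>) x = frame_change E (k \<beta>) (k \<alpha>) x"
    if "\<alpha> \<in> fst \<V>" "\<beta> \<in> fst \<V>" "x \<in> snd \<V> \<alpha>" "x \<in> snd \<V> \<beta>" for \<alpha> \<beta> x
    using eq[OF that] by (rule sym)
  have co: "\<psi>' x (?F x u) = \<psi> x u v* (matrix_inv (frame_matrix \<psi> (k \<alpha>) x) ** frame_matrix \<psi>' (k' \<alpha>) x)"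
    and ca: "?F x u \<in> carrier (fibre E' x)"
    if "u \<in> carrier (fibre E x)" "(W, \<psi>) \<in> trivs E" "x \<in> W" "(W', \<psi>') \<in> trivs E'" "x \<in> W'"
      "\<alpha> \<in> fst \<V>" "x \<in> snd \<V> \<alpha>" for x u W \<psi> W' \<psi>' \<alpha>
    using frame_map_coord[where k = k and k' = k', OF e(1) e'(1) V _ _ _ that] kf kf' eq by blast+
  have co': "\<psi> x (frame_map E' E \<V> k' k x u) = \<psi>' x u v* (matrix_inv (frame_matrix \<psi>' (k' \<alpha>) x) ** frame_matrix \<psi> (k \<alpha>) x)"
    and ca': "frame_map E' E \<V> k' k x u \<in> carrier (fibre E x)"
    if "u \<in> carrier (fibre E' x)" "(W', \<psi>') \<in> trivs E'" "x \<in> W'" "(W, \<psi>) \<in> trivs E" "x \<in> W"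
      "\<alpha> \<in> fst \<V>" "x \<in> snd \<V> \<alpha>" for x u W \<psi> W' \<psi>' \<alpha>
    using frame_map_coord[where k = k' and k' = k, OF e'(1) e(1) V _ _ _ that] kf kf' eq' by blast+
  have lin: "fibre_linear (fibre E x) (fibre E' x) (?F x)" for x
  proof -
    obtain W \<psi> where t: "(W, \<psi>) \<in> trivs E" "x \<in> W" using ex_triv[OF e(1)] .
    obtain W' \<psi>' where t': "(W', \<psi>') \<in> trivs E'" "x \<in> W'" using ex_triv[OF e'(1)] .
    obtain \<alpha> where a: "\<alpha> \<in> fst \<V>" "x \<in> snd \<V> \<alpha>" using open_cover_ex[OF V] by blast
    interpret x: coordinate_iso "fibre E x" "\<psi> x" by (rule triv_iso[OF e(1) t])
    interpret y: coordinate_iso "fibre E' x" "\<psi>' x" by (rule triv_iso[OF e'(1) t'])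
    note c = co[OF _ t t' a] and m = ca[OF _ t t' a]
    note l = vector_matrix_mult_linear_left[of "matrix_inv (frame_matrix \<psi> (k \<alpha>) x) ** frame_matrix \<psi>' (k' \<alpha>) x"]
    show ?thesis
      unfolding fibre_linear_def
    proof (intro conjI ballI allI funcsetI)
      show "?F x u \<in> carrier (fibre E' x)" if "u \<in> carrier (fibre E x)" for u by (rule m[OF that])
      show "?F x (u \<oplus>\<^bsub>fibre E x\<^esub> w) = ?F x u \<oplus>\<^bsub>fibre E' x\<^esub> ?F x w"
        if "u \<in> carrier (fibre E x)" "w \<in> carrier (fibre E x)" for u w
        by (subst y.map_eq_iff[symmetric])
          (use that m in \<open>simp_all add: c x.map_add y.map_add linear_add[OF l]\<close>)
      show "?F x (a \<odot>\<^bsub>fibre E x\<^esub> u) = a \<odot>\<^bsub>fibre E' x\<^esub> ?F x u" if "u \<in> carrier (fibre E x)" for u a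
        by (subst y.map_eq_iff[symmetric])
          (use that m in \<open>simp_all add: c x.map_scale y.map_scale linear_scale[OF l]\<close>)
    qed
  qed
  show F: "bundle_map \<A> E E' ?F"
  proof (rule bundle_mapI[OF lin])
    fix W \<psi> W' \<psi>' assume t: "(W, \<psi>) \<in> trivs E" and t': "(W', \<psi>') \<in> trivs E'"
    show "smooth_fun \<A> (W \<inter> W') (triv_matrix E \<psi> \<psi>' ?F)"
    proof (rule smooth_fun_locally)
      show "open (W \<inter> W')" using triv_open[OF e(1) t] triv_open[OF e'(1) t'] by (rule open_Int)
      fix x assume x: "x \<in> W \<inter> W'"
      obtain \<alpha> where a: "\<alpha> \<in> fst \<V>" "x \<in> snd \<V> \<alpha>" using open_cover_ex[OF V] by blast
      let ?N = "snd \<V> \<alpha> \<inter> W \<inter> W'"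
      have o: "open ?N" using frame_open[OF kf[OF a(1)]] triv_open[OF e(1) t] triv_open[OF e'(1) t'] by auto
      have "smooth_fun \<A> ?N (\<lambda>x. transpose (matrix_inv (frame_matrix \<psi> (k \<alpha>) x) ** frame_matrix \<psi>' (k' \<alpha>) x))"
      proof (rule smooth_fun_linear[where g = transpose])
        show "bounded_linear (transpose :: real ^ 'n ^ 'n \<Rightarrow> real ^ 'n ^ 'n)"
          by (intro linear_conv_bounded_linear[THEN iffD1] linearI) (simp_all add: transpose_def vec_eq_iff)
        have "smooth_fun \<A> ?N (frame_matrix \<psi> (k \<alpha>))" "smooth_fun \<A> ?N (frame_matrix \<psi>' (k' \<alpha>))"
          by (rule smooth_fun_subset[OF smooth_fun_frame_matrix[OF e(1) kf[OF a(1)] t] o], blast)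
            (rule smooth_fun_subset[OF smooth_fun_frame_matrix[OF e'(1) kf'[OF a(1)] t'] o], blast)
        then show "smooth_fun \<A> ?N (\<lambda>x. matrix_inv (frame_matrix \<psi> (k \<alpha>) x) ** frame_matrix \<psi>' (k' \<alpha>) x)"
          by (intro smooth_fun_bilinear[OF bounded_bilinear_matrix_matrix_mult] smooth_fun_matrix_inv
              frame_matrix_invertible[OF e(1) kf[OF a(1)] t]) auto
      qed
      then have "smooth_fun \<A> ?N (triv_matrix E \<psi> \<psi>' ?F)"
      proof (rule smooth_fun_cong)
        fix y assume y: "y \<in> ?N"
        then have yW: "y \<in> W" "y \<in> W'" "y \<in> snd \<V> \<alpha>" by auto
        interpret y: coordinate_iso "fibre E y" "\<psi> y" by (rule triv_iso[OF e(1) t yW(1)])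
        let ?B = "matrix_inv (frame_matrix \<psi> (k \<alpha>) y) ** frame_matrix \<psi>' (k' \<alpha>) y"
        have "triv_matrix E \<psi> \<psi>' ?F y *v w = transpose ?B *v w" for w
        proof -
          obtain u where u: "u \<in> carrier (fibre E y)" "w = \<psi> y u" using y.inv_carrier y.map_inv by metis
          show ?thesis
            unfolding u(2) triv_matrix_apply[where F = ?F and x = y, OF e(1) e'(1) t t' yW(1,2) lin u(1)]
              co[OF u(1) t yW(1) t' yW(2) a(1) yW(3)] by simp
        qed
        then show "transpose ?B = triv_matrix E \<psi> \<psi>' ?F y" by (simp add: matrix_eq)
      qed
      then show "\<exists>N. x \<in> N \<and> smooth_fun \<A> N (triv_matrix E \<psi> \<psi>' ?F)"
        by (intro exI[of _ ?N] conjI) (use x a(2) in simp_all)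
    qed
  qed
  show "frame_map E' E \<V> k' k x (?F x u) = u" if u: "u \<in> carrier (fibre E x)"
  proof -
    obtain W \<psi> where t: "(W, \<psi>) \<in> trivs E" "x \<in> W" using ex_triv[OF e(1)] .
    obtain W' \<psi>' where t': "(W', \<psi>') \<in> trivs E'" "x \<in> W'" using ex_triv[OF e'(1)] .
    obtain \<alpha> where a: "\<alpha> \<in> fst \<V>" "x \<in> snd \<V> \<alpha>" using open_cover_ex[OF V] by blast
    interpret x: coordinate_iso "fibre E x" "\<psi> x" by (rule triv_iso[OF e(1) t])
    note Fu = ca[OF u t t' a]
    let ?H = "frame_matrix \<psi> (k \<alpha>) x" and ?H' = "frame_matrix \<psi>' (k' \<alpha>) x"
    note i = frame_matrix_invertible[OF e(1) kf[OF a(1)] t(1) a(2) t(2)]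
      frame_matrix_invertible[OF e'(1) kf'[OF a(1)] t'(1) a(2) t'(2)]
    have "\<psi> x (frame_map E' E \<V> k' k x (?F x u)) = \<psi> x u v* ((matrix_inv ?H ** ?H') ** (matrix_inv ?H' ** ?H))"
      unfolding co'[OF Fu t' t a] co[OF u t t' a] by (simp only: vector_matrix_mul_assoc)
    also have "(matrix_inv ?H ** ?H') ** (matrix_inv ?H' ** ?H) = matrix_inv ?H ** (?H' ** (matrix_inv ?H' ** ?H))"
      by (simp only: matrix_mul_assoc)
    also have "\<dots> = mat 1" by (simp only: matrix_mult_inv_cancel(3)[OF i(2)] matrix_inv_left[OF i(1)])
    finally show ?thesis
      using x.map_eq_iff[OF ca'[OF Fu t' t a] u] by simp
  qed
  show "D' x v (\<lambda>y. ?F y (s y)) = ?F x (D x v s)" if v: "v \<in> tangent_space \<A> x" and s: "section_near \<A> E x s"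
  proof -
    obtain W \<psi> where t: "(W, \<psi>) \<in> trivs E" "x \<in> W" using ex_triv[OF e(1)] .
    obtain W' \<psi>' where t': "(W', \<psi>') \<in> trivs E'" "x \<in> W'" using ex_triv[OF e'(1)] .
    obtain \<alpha> where a: "\<alpha> \<in> fst \<V>" "x \<in> snd \<V> \<alpha>" using open_cover_ex[OF V] by blast
    interpret y: coordinate_iso "fibre E' x" "\<psi>' x" by (rule triv_iso[OF e'(1) t'])
    obtain U where U: "x \<in> U" "smooth_section \<A> E U s" using s by (auto simp: section_near_def)
    let ?N = "U \<inter> snd \<V> \<alpha>"
    have oN: "open ?N" using smooth_section_open[OF U(2)] frame_open[OF kf[OF a(1)]] by (rule open_Int)
    have kN: "frame_on E ?N (k \<alpha>)" by (rule frame_on_subset[OF kf[OF a(1)] oN _ e(1)]) simp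
    have sN: "smooth_section \<A> E ?N s"
      unfolding smooth_section_def
    proof (intro conjI oN ballI, goal_cases)
      case (1 y) then show ?case using smooth_section_carrier[OF U(2)] by simp
    next
      case (2 p)
      obtain W \<psi> where p: "p = (W, \<psi>)" by force
      have "smooth_fun \<A> (?N \<inter> W) (\<lambda>x. \<psi> x (s x))"
        by (rule smooth_fun_subset[OF smooth_section_coord[OF U(2)]])
          (use 2 p triv_open[OF e(1)] oN in auto)
      then show ?case by (simp add: p)
    qed
    let ?c = "frame_coeff E (k \<alpha>) s"
    have cs: "smooth_near \<A> x ?c"
      by (rule smooth_near_I[OF smooth_fun_frame_coeff[OF e(1) kN sN]]) (use U(1) a(2) in simp)
    have near: "section_near \<A> E x (k \<alpha> i)" "section_near \<A> E' x (k' \<alpha> i)" for i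
      unfolding section_near_def using frame_section[OF kf[OF a(1)]] frame_section[OF kf'[OF a(1)]] a(2) by blast+
    have zero: "D x v (k \<alpha> i) = \<zero>\<^bsub>fibre E x\<^esub>" "D' x v (k' \<alpha> i) = \<zero>\<^bsub>fibre E' x\<^esub>" for i
      using k[OF a(1)] k'[OF a(1)] a(2) v by (simp_all add: parallel_frame_on_def parallel_section_def)
    have Fs: "section_near \<A> E' x (\<lambda>y. ?F y (s y))"
      by (rule bundle_map_section_near[OF e(1) e'(1) F s])
    have coord: "\<psi> y (s y) = ?c y v* frame_matrix \<psi> (k \<alpha>) y"
      "\<psi>' y (?F y (s y)) = ?c y v* frame_matrix \<psi>' (k' \<alpha>) y" if y: "y \<in> ?N \<inter> W \<inter> W'" for y
    proof -
      have yW: "y \<in> W" "y \<in> W'" "y \<in> snd \<V> \<alpha>" "y \<in> U" using y by auto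
      note sy = smooth_section_carrier[OF U(2) yW(4)]
      show "\<psi> y (s y) = ?c y v* frame_matrix \<psi> (k \<alpha>) y"
        by (rule frame_coeff_coord[where s = s and x = y, OF e(1) kf[OF a(1)] sy t(1) yW(3,1)])
      show "\<psi>' y (?F y (s y)) = ?c y v* frame_matrix \<psi>' (k' \<alpha>) y"
        unfolding co[OF sy t(1) yW(1) t'(1) yW(2) a(1) yW(3)]
          frame_coeff_eq[where s = s and x = y, OF e(1) kf[OF a(1)] sy t(1) yW(3,1)]
        by (simp only: vector_matrix_mul_assoc)
    qed
    have oM: "open (?N \<inter> W \<inter> W')" using oN triv_open[OF e(1) t(1)] triv_open[OF e'(1) t'(1)] by auto
    have xM: "x \<in> ?N \<inter> W \<inter> W'" using U(1) a(2) t(2) t'(2) by simp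
    have 1: "\<psi> x (D x v s) = dir_deriv v ?c v* frame_matrix \<psi> (k \<alpha>) x"
    proof (rule conn_parallel_frame[where h = "k \<alpha>" and c = ?c and s = s and \<psi> = \<psi> and x = x and v = v,
          OF e(1,3) t v near(1) zero(1) cs s])
      show "\<forall>\<^sub>F y in nhds x. \<psi> y (s y) = ?c y v* frame_matrix \<psi> (k \<alpha>) y"
        unfolding eventually_nhds by (rule exI[of _ "?N \<inter> W \<inter> W'"]) (use oM xM coord(1) in blast)
    qed
    have 2: "\<psi>' x (D' x v (\<lambda>y. ?F y (s y))) = dir_deriv v ?c v* frame_matrix \<psi>' (k' \<alpha>) x"
    proof (rule conn_parallel_frame[where h = "k' \<alpha>" and c = ?c and s = "\<lambda>y. ?F y (s y)" and \<psi> = \<psi>' and x = x and v = v,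
          OF e'(1,3) t' v near(2) zero(2) cs Fs])
      show "\<forall>\<^sub>F y in nhds x. \<psi>' y (?F y (s y)) = ?c y v* frame_matrix \<psi>' (k' \<alpha>) y"
        unfolding eventually_nhds by (rule exI[of _ "?N \<inter> W \<inter> W'"]) (use oM xM coord(2) in blast)
    qed
    note Ds = conn_carrier[OF e(1,3) v s]
    have "\<psi>' x (?F x (D x v s)) = \<psi>' x (D' x v (\<lambda>y. ?F y (s y)))"
      unfolding co[OF Ds t t' a] 1 2 vector_matrix_mul_assoc
      by (simp only: matrix_mult_inv_cancel(3)[OF frame_matrix_invertible[OF e(1) kf[OF a(1)] t(1) a(2) t(2)]])
    then show ?thesis
      using y.map_eq_iff[OF ca[OF Ds t t' a] conn_carrier[OF e'(1,3) v Fs]] by simp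
  qed
qed

end

section \<open>The flat bundle of a cocycle\<close>

text \<open>The vector space structure of \<open>\<real>\<^sup>n\<close>, carried over to the range of an injection.\<close>

definition transported_module :: "(real ^ 'n \<Rightarrow> 'e) \<Rightarrow> (real, 'e) module" where
  "transported_module em = \<lparr>carrier = range em, monoid.mult = (\<lambda>u w. undefined), one = undefined,
     ring.zero = em 0, add = (\<lambda>u w. em (inv_into UNIV em u + inv_into UNIV em w)),
     smult = (\<lambda>c u. em (c *\<^sub>R inv_into UNIV em u))\<rparr>"

lemma transported_module_simps [simp]:
  "carrier (transported_module em) = range em"
  "\<zero>\<^bsub>transported_module em\<^esub> = em 0"
  "u \<oplus>\<^bsub>transported_module em\<^esub> w = em (inv_into UNIV em u + inv_into UNIV em w)"
  "c \<odot>\<^bsub>transported_module em\<^esub> u = em (c *\<^sub>R inv_into UNIV em u)"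
  by (simp_all add: transported_module_def)

lemma module_transported_module:
  assumes em: "inj em"
  shows "Module.module real_field (transported_module em)"
proof (rule moduleI)
  show "cring real_field" by (rule cring_from_type_algebra)
  show "abelian_group (transported_module em)"
  proof (rule abelian_groupI)
    fix u assume "u \<in> carrier (transported_module em)"
    then obtain c where u: "u = em c" by auto
    have "em (- c) \<oplus>\<^bsub>transported_module em\<^esub> u = \<zero>\<^bsub>transported_module em\<^esub>" by (simp add: u inv_f_f[OF em])
    then show "\<exists>w\<in>carrier (transported_module em). w \<oplus>\<^bsub>transported_module em\<^esub> u = \<zero>\<^bsub>transported_module em\<^esub>"
      by (intro bexI[of _ "em (- c)"]) auto
  qed (auto simp: inv_f_f[OF em] add.assoc add.commute add.left_commute)
qed (auto simp: inv_f_f[OF em] ring_of_type_algebra_def algebra_simps)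

text \<open>At every point the fibre of the bundle of a cocycle is a copy of \<open>\<real>\<^sup>n\<close>, to be read as the
  coordinates with respect to the frame of this member of the cover. The choice need not be
  continuous in any sense; the trivialisations correct for it.\<close>

definition cover_index :: "('i, 'm) cover \<Rightarrow> 'm \<Rightarrow> 'i" where
  "cover_index \<U> x = (SOME \<alpha>. \<alpha> \<in> fst \<U> \<and> x \<in> snd \<U> \<alpha>)"

definition cocycle_triv :: "(real ^ 'n \<Rightarrow> 'e) \<Rightarrow> ('i, 'm) cover \<Rightarrow> ('i, 'm, 'n::finite) cochain1 \<Rightarrow> 'i \<Rightarrow> 'm \<Rightarrow> 'e \<Rightarrow> real ^ 'n" where
  "cocycle_triv em \<U> a \<alpha> x u = inv_into UNIV em u v* a (cover_index \<U> x) \<alpha> x"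

definition cocycle_bundle :: "(real ^ 'n \<Rightarrow> 'e) \<Rightarrow> ('i, 'm) cover \<Rightarrow> ('i, 'm, 'n::finite) cochain1 \<Rightarrow> ('m, 'e, 'n) vbundle" where
  "cocycle_bundle em \<U> a = \<lparr>fibre = (\<lambda>x. transported_module em),
     trivs = {(snd \<U> \<alpha>, cocycle_triv em \<U> a \<alpha>) |\<alpha>. \<alpha> \<in> fst \<U>}\<rparr>"

text \<open>The coordinates in the trivialisation chosen at \<open>x\<close> are differentiated at \<open>x\<close>; there the
  fibre is \<open>\<real>\<^sup>n\<close> in the same coordinates.\<close>

definition cocycle_conn :: "(real ^ 'n \<Rightarrow> 'e) \<Rightarrow> ('i, 'm) cover \<Rightarrow> ('i, 'm, 'n::finite) cochain1 \<Rightarrow> ('m, 'e) cov_deriv" where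
  "cocycle_conn em \<U> a x v s = em (dir_deriv v (\<lambda>y. cocycle_triv em \<U> a (cover_index \<U> x) y (s y)))"

context smooth_manifold
begin

lemma dir_deriv_add:
  assumes v: "v \<in> tangent_space \<A> x" and \<sigma>: "smooth_near \<A> x \<sigma>" "smooth_near \<A> x \<tau>"
  shows "dir_deriv v (\<lambda>y. \<sigma> y + \<tau> y) = dir_deriv v \<sigma> + dir_deriv v \<tau>"
  using tangent_space_add[OF v smooth_near_vec_nth[OF \<sigma>(1)] smooth_near_vec_nth[OF \<sigma>(2)]]
  by (simp add: dir_deriv_def vec_eq_iff)

lemma dir_deriv_scale:
  assumes v: "v \<in> tangent_space \<A> x" and f: "smooth_near \<A> x f" and \<sigma>: "smooth_near \<A> x \<sigma>"
  shows "dir_deriv v (\<lambda>y. f y *\<^sub>R \<sigma> y) = v f *\<^sub>R \<sigma> x + f x *\<^sub>R dir_deriv v \<sigma>"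
  using tangent_space_mult[OF v f smooth_near_vec_nth[OF \<sigma>]]
  by (simp add: dir_deriv_def vec_eq_iff mult.commute)

lemma dir_deriv_mult_const:
  assumes v: "v \<in> tangent_space \<A> x" and \<sigma>: "smooth_near \<A> x \<sigma>"
  shows "dir_deriv v (\<lambda>y. \<sigma> y v* B) = dir_deriv v \<sigma> v* B"
proof -
  have "v (\<lambda>y. \<Sum>i\<in>UNIV. B $ i $ j * \<sigma> y $ i) = (\<Sum>i\<in>UNIV. B $ i $ j * v (\<lambda>y. \<sigma> y $ i))" for j
    using tangent_space_sum[OF v finite, of UNIV "\<lambda>i y. B $ i $ j * \<sigma> y $ i"]
    by (simp add: tangent_space_scale[OF v smooth_near_vec_nth[OF \<sigma>]]
        smooth_near_bilinear[OF bounded_bilinear_mult smooth_near_const smooth_near_vec_nth[OF \<sigma>]])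
  then show ?thesis by (simp add: dir_deriv_def vector_matrix_mult_def vec_eq_iff mult.commute)
qed

lemma dir_deriv_mult_locally_constant:
  assumes v: "v \<in> tangent_space \<A> x" and \<sigma>: "smooth_near \<A> x \<sigma>" and b: "b \<in> GL_sections N" and N: "open N" "x \<in> N"
  shows "dir_deriv v (\<lambda>y. \<sigma> y v* b y) = dir_deriv v \<sigma> v* b x"
proof -
  obtain N' where N': "open N'" "x \<in> N'" "\<forall>y\<in>N \<inter> N'. b y = b x" using GL_sections_local[OF b N(2)] by blast
  have "dir_deriv v (\<lambda>y. \<sigma> y v* b x) = dir_deriv v (\<lambda>y. \<sigma> y v* b y)"
  proof (rule dir_deriv_cong[OF v smooth_near_bilinear[OF bounded_bilinear_vector_matrix_mult \<sigma> smooth_near_const]])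
    show "\<forall>\<^sub>F y in nhds x. \<sigma> y v* b x = \<sigma> y v* b y"
      unfolding eventually_nhds
    proof (intro exI[of _ "N \<inter> N'"] conjI ballI)
      show "open (N \<inter> N')" using N(1) N'(1) by (rule open_Int)
      show "x \<in> N \<inter> N'" using N(2) N'(2) by simp
      fix y assume "y \<in> N \<inter> N'"
      then have "b y = b x" by (rule N'(3)[rule_format])
      then show "\<sigma> y v* b x = \<sigma> y v* b y" by simp
    qed
  qed
  then show ?thesis by (simp add: dir_deriv_mult_const[OF v \<sigma>])
qed

lemma dir_deriv_lie_bracket:
  assumes "smooth_near \<A> x \<sigma>"
  shows "dir_deriv (lie_bracket \<A> Y Z x) \<sigma> = dir_deriv (Y x) (\<lambda>y. dir_deriv (Z y) \<sigma>) - dir_deriv (Z x) (\<lambda>y. dir_deriv (Y y) \<sigma>)"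
  using smooth_near_vec_nth[OF assms] by (simp add: dir_deriv_def vec_eq_iff lie_bracket_def)

lemma smooth_fun_dir_deriv:
  assumes Y: "smooth_vector_field \<A> U Y" and N: "N \<subseteq> U" and \<sigma>: "smooth_fun \<A> N \<sigma>"
  shows "smooth_fun \<A> N (\<lambda>x. dir_deriv (Y x) \<sigma>)"
  unfolding dir_deriv_def
proof (rule smooth_fun_vec_lambda[OF smooth_fun_open[OF \<sigma>]])
  fix i
  have "\<forall>W f. W \<subseteq> U \<and> smooth_fun \<A> W f \<longrightarrow> smooth_fun \<A> W (\<lambda>x. Y x f)"
    using Y by (simp add: smooth_vector_field_def)
  then show "smooth_fun \<A> N (\<lambda>x. Y x (\<lambda>y. \<sigma> y $ i))" using N smooth_fun_vec_nth[OF \<sigma>] by blast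
qed

lemma smooth_vector_field_tangent: "smooth_vector_field \<A> U Y \<Longrightarrow> x \<in> U \<Longrightarrow> Y x \<in> tangent_space \<A> x"
  by (simp add: smooth_vector_field_def)

context
  fixes em :: "real ^ 'n \<Rightarrow> 'e" and \<U> :: "('i, 'm) cover" and a :: "('i, 'm, 'n::finite) cochain1"
  assumes em: "inj em" and U: "open_cover \<U>" and a: "a \<in> Z1 \<U>"
begin

private abbreviation (input) "EE \<equiv> cocycle_bundle em \<U> a"
private abbreviation (input) "DD \<equiv> cocycle_conn em \<U> a"
private abbreviation (input) "\<psi> \<equiv> cocycle_triv em \<U> a"
private abbreviation (input) "ix \<equiv> cover_index \<U>"

lemma cover_index: "ix x \<in> fst \<U>" "x \<in> snd \<U> (ix x)"
  using open_cover_ex[OF U, of x] someI_ex[of "\<lambda>\<alpha>. \<alpha> \<in> fst \<U> \<and> x \<in> snd \<U> \<alpha>"]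
  unfolding cover_index_def by blast+

lemma cover_open: "\<alpha> \<in> fst \<U> \<Longrightarrow> open (snd \<U> \<alpha>)"
  using U by (simp add: open_cover_def)

lemma cocycle_fibre [simp]: "fibre EE x = transported_module em"
  by (simp add: cocycle_bundle_def)

lemma cocycle_trivs: "\<alpha> \<in> fst \<U> \<Longrightarrow> (snd \<U> \<alpha>, \<psi> \<alpha>) \<in> trivs EE"
  by (auto simp: cocycle_bundle_def)

lemma cocycle_triv_em: "\<psi> \<alpha> x (em w) = w v* a (ix x) \<alpha> x"
  by (simp add: cocycle_triv_def inv_f_f[OF em])

lemma cocycle_triv_change:
  assumes "\<alpha> \<in> fst \<U>" "\<beta> \<in> fst \<U>" "x \<in> snd \<U> \<alpha>" "x \<in> snd \<U> \<beta>"
  shows "\<psi> \<beta> x u = \<psi> \<alpha> x u v* a \<alpha> \<beta> x"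
  unfolding cocycle_triv_def vector_matrix_mul_assoc
  using Z1_mult[OF a cover_index(1) assms(1,2) cover_index(2) assms(3,4)] by simp

lemma cocycle_triv_iso:
  assumes \<alpha>: "\<alpha> \<in> fst \<U>" "x \<in> snd \<U> \<alpha>"
  shows "coordinate_iso (transported_module em) (\<psi> \<alpha> x)"
proof (rule coordinate_iso.intro)
  show "Module.module real_field (transported_module em)" by (rule module_transported_module[OF em])
  let ?B = "a (ix x) \<alpha> x"
  note l = vector_matrix_mult_linear_left[of ?B]
  have i: "invertible ?B" by (rule Z1_invertible[OF a cover_index(1) \<alpha>(1) cover_index(2) \<alpha>(2)])
  show "fibre_linear (transported_module em) coord_space (\<psi> \<alpha> x)"
    unfolding fibre_linear_def
    by (auto simp: cocycle_triv_def inv_f_f[OF em] linear_add[OF l] linear_scale[OF l])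
  show "bij_betw (\<psi> \<alpha> x) (carrier (transported_module em)) UNIV"
    unfolding bij_betw_def
  proof
    show "inj_on (\<psi> \<alpha> x) (carrier (transported_module em))"
    proof (rule inj_onI)
      fix u w assume "u \<in> carrier (transported_module em)" "w \<in> carrier (transported_module em)" and eq: "\<psi> \<alpha> x u = \<psi> \<alpha> x w"
      then obtain c d where uw: "u = em c" "w = em d" by auto
      have "(c v* ?B) v* matrix_inv ?B = (d v* ?B) v* matrix_inv ?B"
        using eq by (simp add: uw cocycle_triv_em)
      then show "u = w" by (simp add: uw vector_matrix_mul_assoc matrix_inv_right[OF i])
    qed
    have "w \<in> \<psi> \<alpha> x ` range em" for w
    proof -
      have "\<psi> \<alpha> x (em (w v* matrix_inv ?B)) = w"
        by (simp add: cocycle_triv_em vector_matrix_mul_assoc matrix_inv_left[OF i])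
      then show ?thesis by (metis rangeI imageI)
    qed
    then show "\<psi> \<alpha> x ` carrier (transported_module em) = UNIV" by auto
  qed
qed

lemma transpose_mult_vector: "transpose B *v w = w v* B" for B :: "real ^ 'n ^ 'n"
  by (simp add: transpose_def matrix_vector_mult_def vector_matrix_mult_def mult.commute)

lemma cocycle_vector_bundle: "vector_bundle \<A> EE"
  unfolding vector_bundle_def
proof (intro conjI allI)
  show "Module.module real_field (fibre EE x)" for x by (simp add: module_transported_module[OF em])
  show "\<exists>(W, \<phi>)\<in>trivs EE. x \<in> W" for x
    using cocycle_trivs[OF cover_index(1)] cover_index(2) by blast
  show "\<forall>(W, \<phi>)\<in>trivs EE. open W \<and> (\<forall>x\<in>W. fibre_linear (fibre EE x) coord_space (\<phi> x) \<and>
      bij_betw (\<phi> x) (carrier (fibre EE x)) UNIV)"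
  proof clarify
    fix W \<phi> assume "(W, \<phi>) \<in> trivs EE"
    then obtain \<alpha> where \<alpha>: "W = snd \<U> \<alpha>" "\<phi> = \<psi> \<alpha>" "\<alpha> \<in> fst \<U>" by (auto simp: cocycle_bundle_def)
    show "open W \<and> (\<forall>x\<in>W. fibre_linear (fibre EE x) coord_space (\<phi> x) \<and> bij_betw (\<phi> x) (carrier (fibre EE x)) UNIV)"
      using cover_open[OF \<alpha>(3)] cocycle_triv_iso[OF \<alpha>(3)] unfolding \<alpha>(1,2) cocycle_fibre coordinate_iso_def by blast
  qed
  show "\<forall>(W, \<phi>)\<in>trivs EE. \<forall>(W', \<phi>')\<in>trivs EE. smooth_fun \<A> (W \<inter> W') (triv_matrix EE \<phi> \<phi>' (\<lambda>x u. u))"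
  proof clarify
    fix W \<phi> W' \<phi>' assume "(W, \<phi>) \<in> trivs EE" "(W', \<phi>') \<in> trivs EE"
    then obtain \<alpha> \<beta> where \<alpha>: "W = snd \<U> \<alpha>" "\<phi> = \<psi> \<alpha>" "\<alpha> \<in> fst \<U>" and \<beta>: "W' = snd \<U> \<beta>" "\<phi>' = \<psi> \<beta>" "\<beta> \<in> fst \<U>"
      by (auto simp: cocycle_bundle_def)
    let ?N = "snd \<U> \<alpha> \<inter> snd \<U> \<beta>"
    have o: "open ?N" using cover_open[OF \<alpha>(3)] cover_open[OF \<beta>(3)] by (rule open_Int)
    have "smooth_fun \<A> ?N (\<lambda>x. transpose (a \<alpha> \<beta> x))"
    proof (rule smooth_fun_linear[where g = transpose])
      show "bounded_linear (transpose :: real ^ 'n ^ 'n \<Rightarrow> real ^ 'n ^ 'n)"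
        by (intro linear_conv_bounded_linear[THEN iffD1] linearI) (simp_all add: transpose_def vec_eq_iff)
      show "smooth_fun \<A> ?N (a \<alpha> \<beta>)" by (rule GL_sections_smooth[OF Z1_GL[OF a \<alpha>(3) \<beta>(3)] o])
    qed
    then show "smooth_fun \<A> (W \<inter> W') (triv_matrix EE \<phi> \<phi>' (\<lambda>x u. u))"
      unfolding \<alpha> \<beta>
    proof (rule smooth_fun_cong)
      fix x assume x: "x \<in> ?N"
      interpret x: coordinate_iso "transported_module em" "\<psi> \<alpha> x" using cocycle_triv_iso[OF \<alpha>(3)] x by blast
      interpret y: coordinate_iso "transported_module em" "\<psi> \<beta> x" using cocycle_triv_iso[OF \<beta>(3)] x by blast
      have "triv_matrix EE (\<psi> \<alpha>) (\<psi> \<beta>) (\<lambda>x u. u) x *v w = transpose (a \<alpha> \<beta> x) *v w" for w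
      proof -
        obtain u where u: "u \<in> carrier (transported_module em)" "w = \<psi> \<alpha> x u" using x.inv_carrier x.map_inv by metis
        have "triv_matrix EE (\<psi> \<alpha>) (\<psi> \<beta>) (\<lambda>x u. u) x *v \<psi> \<alpha> x u = \<psi> \<beta> x u"
          unfolding triv_matrix_def cocycle_fibre
          using matrix_fibre_map[OF x.coordinate_iso_axioms y.coordinate_iso_axioms fibre_linear_id u(1)] by simp
        also have "\<dots> = transpose (a \<alpha> \<beta> x) *v \<psi> \<alpha> x u"
          unfolding transpose_mult_vector by (rule cocycle_triv_change[OF \<alpha>(3) \<beta>(3)]) (use x in auto)
        finally show ?thesis by (simp add: u(2))
      qed
      then show "transpose (a \<alpha> \<beta> x) = triv_matrix EE (\<psi> \<alpha>) (\<psi> \<beta>) (\<lambda>x u. u) x" by (simp add: matrix_eq)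
    qed
  qed
qed

lemmas E = cocycle_vector_bundle

lemma cocycle_conn_carrier: "DD x v s \<in> carrier (fibre EE x)"
  by (simp add: cocycle_conn_def)

lemma cocycle_conn_coord_index:
  "\<psi> (ix x) x (DD x v s) = dir_deriv v (\<lambda>y. \<psi> (ix x) y (s y))"
  by (simp add: cocycle_conn_def cocycle_triv_em Z1_diag[OF a cover_index])

text \<open>Every trivialisation around \<open>x\<close> gives the same covariant derivative, because its coordinates
  differ from the chosen ones by a locally constant matrix.\<close>

lemma cocycle_conn_coord:
  assumes \<alpha>: "\<alpha> \<in> fst \<U>" "x \<in> snd \<U> \<alpha>" and v: "v \<in> tangent_space \<A> x" and s: "section_near \<A> EE x s"
  shows "\<psi> \<alpha> x (DD x v s) = dir_deriv v (\<lambda>y. \<psi> \<alpha> y (s y))"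
proof -
  let ?\<beta> = "ix x"
  let ?\<sigma> = "\<lambda>y. \<psi> ?\<beta> y (s y)"
  note b = cover_index[of x]
  have \<sigma>: "smooth_near \<A> x ?\<sigma>" by (rule section_nearD(1)[OF E cocycle_trivs[OF b(1)] b(2) s])
  let ?N = "snd \<U> ?\<beta> \<inter> snd \<U> \<alpha>"
  have o: "open ?N" using cover_open[OF b(1)] cover_open[OF \<alpha>(1)] by (rule open_Int)
  have x: "x \<in> ?N" using b(2) \<alpha>(2) by simp
  have "\<psi> \<alpha> x (DD x v s) = dir_deriv v ?\<sigma> v* a ?\<beta> \<alpha> x"
    using cocycle_triv_change[OF b(1) \<alpha>(1) b(2) \<alpha>(2)] by (simp add: cocycle_conn_coord_index)
  also have "\<dots> = dir_deriv v (\<lambda>y. ?\<sigma> y v* a ?\<beta> \<alpha> y)"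
    by (rule dir_deriv_mult_locally_constant[OF v \<sigma> Z1_GL[OF a b(1) \<alpha>(1)] o x, symmetric])
  also have "\<dots> = dir_deriv v (\<lambda>y. \<psi> \<alpha> y (s y))"
  proof (rule dir_deriv_cong[OF v, symmetric])
    show "smooth_near \<A> x (\<lambda>y. \<psi> \<alpha> y (s y))" by (rule section_nearD(1)[OF E cocycle_trivs[OF \<alpha>(1)] \<alpha>(2) s])
    show "\<forall>\<^sub>F y in nhds x. \<psi> \<alpha> y (s y) = ?\<sigma> y v* a ?\<beta> \<alpha> y"
      unfolding eventually_nhds
      by (intro exI[of _ ?N] conjI ballI o x cocycle_triv_change[OF b(1) \<alpha>(1)]) auto
  qed
  finally show ?thesis .
qed

lemma cocycle_fibre_eqI:
  assumes "u \<in> carrier (transported_module em)" "w \<in> carrier (transported_module em)" "\<psi> (ix x) x u = \<psi> (ix x) x w"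
  shows "u = w"
  using coordinate_iso.map_eq_iff[OF cocycle_triv_iso[OF cover_index] assms(1,2)] assms(3) by simp

lemma cocycle_bundle_connection: "bundle_connection \<A> EE DD"
proof -
  have near: "smooth_near \<A> x (\<lambda>y. \<psi> (ix x) y (s y))" if "section_near \<A> EE x s" for x s
    by (rule section_nearD(1)[OF E cocycle_trivs[OF cover_index(1)] cover_index(2) that])
  have ev: "\<forall>\<^sub>F y in nhds x. y \<in> snd \<U> (ix x)" for x
    by (rule eventually_nhds_in_open[OF cover_open[OF cover_index(1)] cover_index(2)])
  note iso = cocycle_triv_iso
  have car: "\<forall>\<^sub>F y in nhds x. s y \<in> carrier (transported_module em)" if "section_near \<A> EE x s" for x s
    using section_near_carrier[OF that] by simp
  have c2: "DD x v s = DD x v s'" if v: "v \<in> tangent_space \<A> x" and s: "section_near \<A> EE x s" "section_near \<A> EE x s'"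
    and eq: "\<forall>\<^sub>F y in nhds x. s y = s' y" for x v s s'
  proof -
    have "\<forall>\<^sub>F y in nhds x. \<psi> (ix x) y (s y) = \<psi> (ix x) y (s' y)" using eq by (rule eventually_mono) simp
    from dir_deriv_cong[OF v near[OF s(1)] this] show ?thesis by (simp add: cocycle_conn_def)
  qed
  have c3: "DD x (\<lambda>f. b * v f + c * w f) s = b \<odot>\<^bsub>fibre EE x\<^esub> DD x v s \<oplus>\<^bsub>fibre EE x\<^esub> c \<odot>\<^bsub>fibre EE x\<^esub> DD x w s" for x v w b c s
  proof -
    have "dir_deriv (\<lambda>f. b * v f + c * w f) \<sigma> = b *\<^sub>R dir_deriv v \<sigma> + c *\<^sub>R dir_deriv w \<sigma>" for \<sigma> :: "'m \<Rightarrow> real ^ 'n"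
      by (simp add: dir_deriv_def vec_eq_iff)
    then show ?thesis by (simp add: cocycle_conn_def inv_f_f[OF em])
  qed
  have c4: "DD x v (\<lambda>y. s y \<oplus>\<^bsub>fibre EE y\<^esub> s' y) = DD x v s \<oplus>\<^bsub>fibre EE x\<^esub> DD x v s'"
    if v: "v \<in> tangent_space \<A> x" and s: "section_near \<A> EE x s" "section_near \<A> EE x s'" for x v s s'
  proof -
    interpret x: coordinate_iso "transported_module em" "\<psi> (ix x) x" by (rule iso[OF cover_index])
    have "dir_deriv v (\<lambda>y. \<psi> (ix x) y (s y) + \<psi> (ix x) y (s' y)) = dir_deriv v (\<lambda>y. \<psi> (ix x) y (s y \<oplus>\<^bsub>transported_module em\<^esub> s' y))"
    proof (rule dir_deriv_cong[OF v smooth_near_add[OF near[OF s(1)] near[OF s(2)]]])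
      show "\<forall>\<^sub>F y in nhds x. \<psi> (ix x) y (s y) + \<psi> (ix x) y (s' y) = \<psi> (ix x) y (s y \<oplus>\<^bsub>transported_module em\<^esub> s' y)"
        using ev car[OF s(1)] car[OF s(2)]
        by eventually_elim (rule coordinate_iso.map_add[OF iso[OF cover_index(1)], symmetric])
    qed
    then have "DD x v (\<lambda>y. s y \<oplus>\<^bsub>transported_module em\<^esub> s' y)
      = em (dir_deriv v (\<lambda>y. \<psi> (ix x) y (s y)) + dir_deriv v (\<lambda>y. \<psi> (ix x) y (s' y)))"
      unfolding cocycle_conn_def dir_deriv_add[OF v near[OF s(1)] near[OF s(2)]] by simp
    then show ?thesis unfolding cocycle_fibre by (simp add: cocycle_conn_def inv_f_f[OF em])
  qed
  have c5: "DD x v (\<lambda>y. f y \<odot>\<^bsub>fibre EE y\<^esub> s y) = v f \<odot>\<^bsub>fibre EE x\<^esub> s x \<oplus>\<^bsub>fibre EE x\<^esub> f x \<odot>\<^bsub>fibre EE x\<^esub> DD x v s"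
    if v: "v \<in> tangent_space \<A> x" and f: "smooth_near \<A> x f" and s: "section_near \<A> EE x s" for x v f s
  proof -
    interpret x: coordinate_iso "transported_module em" "\<psi> (ix x) x" by (rule iso[OF cover_index])
    have sx: "s x \<in> carrier (transported_module em)"
      using section_nearD(3)[OF E cocycle_trivs[OF cover_index(1)] cover_index(2) s] by simp
    have Dx: "DD x v s \<in> carrier (transported_module em)" for s using cocycle_conn_carrier[of x v s] by simp
    have "dir_deriv v (\<lambda>y. f y *\<^sub>R \<psi> (ix x) y (s y)) = dir_deriv v (\<lambda>y. \<psi> (ix x) y (f y \<odot>\<^bsub>transported_module em\<^esub> s y))"
    proof (rule dir_deriv_cong[OF v smooth_near_bilinear[OF bounded_bilinear_scaleR f near[OF s]]])
      show "\<forall>\<^sub>F y in nhds x. f y *\<^sub>R \<psi> (ix x) y (s y) = \<psi> (ix x) y (f y \<odot>\<^bsub>transported_module em\<^esub> s y)"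
        using ev car[OF s]
        by eventually_elim (rule coordinate_iso.map_scale[OF iso[OF cover_index(1)], symmetric])
    qed
    then have "\<psi> (ix x) x (DD x v (\<lambda>y. f y \<odot>\<^bsub>transported_module em\<^esub> s y))
      = v f *\<^sub>R \<psi> (ix x) x (s x) + f x *\<^sub>R \<psi> (ix x) x (DD x v s)"
      unfolding cocycle_conn_coord_index dir_deriv_scale[OF v f near[OF s]] by (rule sym)
    also have "\<dots> = \<psi> (ix x) x (v f \<odot>\<^bsub>transported_module em\<^esub> s x \<oplus>\<^bsub>transported_module em\<^esub> f x \<odot>\<^bsub>transported_module em\<^esub> DD x v s)"
      by (simp only: x.map_add[OF x.closed(2)[OF sx] x.closed(2)[OF Dx]] x.map_scale[OF sx] x.map_scale[OF Dx])
    finally show ?thesis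
      unfolding cocycle_fibre
      by (rule cocycle_fibre_eqI[OF Dx x.closed(1)[OF x.closed(2)[OF sx] x.closed(2)[OF Dx]]])
  qed
  have c6: "smooth_section \<A> EE N (\<lambda>x. DD x (Y x) s)" if Y: "smooth_vector_field \<A> N Y" and s: "smooth_section \<A> EE N s" for N Y s
  proof (rule smooth_sectionI[OF E smooth_section_open[OF s] cocycle_conn_carrier])
    fix x assume x: "x \<in> N"
    let ?M = "N \<inter> snd \<U> (ix x)"
    have "smooth_fun \<A> ?M (\<lambda>y. dir_deriv (Y y) (\<lambda>y. \<psi> (ix x) y (s y)))"
      by (rule smooth_fun_dir_deriv[OF Y _ smooth_section_coord[OF s cocycle_trivs[OF cover_index(1)]]]) auto
    then have "smooth_fun \<A> ?M (\<lambda>y. \<psi> (ix x) y (DD y (Y y) s))"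
    proof (rule smooth_fun_cong)
      fix y assume y: "y \<in> ?M"
      have "section_near \<A> EE y s" unfolding section_near_def using s y by blast
      then show "dir_deriv (Y y) (\<lambda>y. \<psi> (ix x) y (s y)) = \<psi> (ix x) y (DD y (Y y) s)"
        using y by (intro cocycle_conn_coord[OF cover_index(1) _ smooth_vector_field_tangent[OF Y], symmetric]) auto
    qed
    then show "\<exists>W \<phi> M. (W, \<phi>) \<in> trivs EE \<and> x \<in> M \<and> M \<subseteq> N \<inter> W \<and> smooth_fun \<A> M (\<lambda>y. \<phi> y (DD y (Y y) s))"
      using x cover_index[of x] cocycle_trivs[OF cover_index(1), of x]
      by - (rule exI[of _ "snd \<U> (ix x)"], rule exI[of _ "\<psi> (ix x)"], rule exI[of _ ?M], simp)
  qed
  show ?thesis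
    unfolding bundle_connection_def
    using cocycle_conn_carrier c2 c3 c4 c5 c6 by (intro conjI allI ballI impI; (elim conjE)?; assumption?; blast?)
qed

lemma cocycle_flat_bundle: "(EE, DD) \<in> flat_bundles \<A>"
proof -
  have "curvature \<A> EE DD Y Z s x = \<zero>\<^bsub>fibre EE x\<^esub>"
    if Y: "smooth_vector_field \<A> N Y" and Z: "smooth_vector_field \<A> N Z" and s: "smooth_section \<A> EE N s" and x: "x \<in> N" for N Y Z s x
  proof -
    interpret x: coordinate_iso "transported_module em" "\<psi> (ix x) x" by (rule cocycle_triv_iso[OF cover_index])
    let ?\<sigma> = "\<lambda>y. \<psi> (ix x) y (s y)"
    have near: "section_near \<A> EE y s" if "y \<in> N" for y unfolding section_near_def using s that by blast
    let ?M = "N \<inter> snd \<U> (ix x)"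
    have o: "open ?M" using smooth_section_open[OF s] cover_open[OF cover_index(1)] by (rule open_Int)
    have xM: "x \<in> ?M" using x cover_index(2) by simp
    have \<sigma>: "smooth_fun \<A> ?M ?\<sigma>" by (rule smooth_section_coord[OF s cocycle_trivs[OF cover_index(1)]])
    have second: "\<psi> (ix x) x (DD x (Y x) (\<lambda>y. DD y (Z y) s)) = dir_deriv (Y x) (\<lambda>y. dir_deriv (Z y) ?\<sigma>)"
      if Y: "smooth_vector_field \<A> N Y" and Z: "smooth_vector_field \<A> N Z" for Y Z
      unfolding cocycle_conn_coord_index
    proof (rule dir_deriv_cong[OF smooth_vector_field_tangent[OF Y x], symmetric])
      have "smooth_fun \<A> ?M (\<lambda>y. dir_deriv (Z y) ?\<sigma>)" by (rule smooth_fun_dir_deriv[OF Z _ \<sigma>]) auto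
      then show "smooth_near \<A> x (\<lambda>y. dir_deriv (Z y) ?\<sigma>)" by (rule smooth_near_I[OF _ xM])
      show "\<forall>\<^sub>F y in nhds x. dir_deriv (Z y) ?\<sigma> = \<psi> (ix x) y (DD y (Z y) s)"
        unfolding eventually_nhds
      proof (intro exI[of _ ?M] conjI ballI o xM)
        fix y assume y: "y \<in> ?M"
        then show "dir_deriv (Z y) ?\<sigma> = \<psi> (ix x) y (DD y (Z y) s)"
          by (intro cocycle_conn_coord[OF cover_index(1) _ smooth_vector_field_tangent[OF Z] near, symmetric]) auto
      qed
    qed
    have car: "DD x v s' \<in> carrier (transported_module em)" for v s' using cocycle_conn_carrier[of x v s'] by simp
    have "\<psi> (ix x) x (curvature \<A> EE DD Y Z s x)
      = dir_deriv (Y x) (\<lambda>y. dir_deriv (Z y) ?\<sigma>) - dir_deriv (Z x) (\<lambda>y. dir_deriv (Y y) ?\<sigma>) - dir_deriv (lie_bracket \<A> Y Z x) ?\<sigma>"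
      unfolding curvature_def cocycle_fibre
      using second[OF Y Z] second[OF Z Y] cocycle_conn_coord_index[of x "lie_bracket \<A> Y Z x" s]
      by (simp only: x.map_minus[OF x.closed(4)[OF car car] car] x.map_minus[OF car car])
    also have "\<dots> = 0" unfolding dir_deriv_lie_bracket[OF smooth_near_I[OF \<sigma> xM]] by simp
    also have "\<dots> = \<psi> (ix x) x \<zero>\<^bsub>transported_module em\<^esub>" by (rule x.map_zero[symmetric])
    finally show ?thesis
      unfolding cocycle_fibre
      by (rule cocycle_fibre_eqI[rotated 2]) (simp_all only: curvature_def cocycle_fibre x.closed(4)[OF x.closed(4)[OF car car] car] x.closed(3))
  qed
  then show ?thesis
    unfolding flat_bundles_def flat_connection_def using E cocycle_bundle_connection by blast
qed

definition cocycle_frame :: "'i \<Rightarrow> 'n \<Rightarrow> 'm \<Rightarrow> 'e" where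
  "cocycle_frame \<alpha> i = lift EE (\<psi> \<alpha>) (\<lambda>x. axis i 1)"

lemma cocycle_frame_coord:
  assumes "\<alpha> \<in> fst \<U>" "x \<in> snd \<U> \<alpha>"
  shows "\<psi> \<alpha> x (cocycle_frame \<alpha> i x) = axis i 1" "cocycle_frame \<alpha> i x \<in> carrier (fibre EE x)"
  unfolding cocycle_frame_def using lift_coord(1,2)[OF E cocycle_trivs[OF assms(1)] assms(2)] by auto

lemma frame_matrix_cocycle_frame:
  assumes "\<alpha> \<in> fst \<U>" "x \<in> snd \<U> \<alpha>"
  shows "frame_matrix (\<psi> \<alpha>) (cocycle_frame \<alpha>) x = mat 1"
  using cocycle_frame_coord(1)[OF assms] by (simp add: frame_matrix_def mat_def axis_def vec_eq_iff)

lemma cocycle_frame_parallel: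
  assumes \<alpha>: "\<alpha> \<in> fst \<U>"
  shows "parallel_frame_on EE DD (snd \<U> \<alpha>) (cocycle_frame \<alpha>)"
proof -
  have s: "smooth_section \<A> EE (snd \<U> \<alpha>) (cocycle_frame \<alpha> i)" for i
    unfolding cocycle_frame_def
    by (rule smooth_section_lift[OF E cocycle_trivs[OF \<alpha>] smooth_fun_const[OF cover_open[OF \<alpha>]]]) simp
  have par: "DD x v (cocycle_frame \<alpha> i) = \<zero>\<^bsub>fibre EE x\<^esub>" if x: "x \<in> snd \<U> \<alpha>" and v: "v \<in> tangent_space \<A> x" for x v i
  proof -
    interpret x: coordinate_iso "transported_module em" "\<psi> \<alpha> x" by (rule cocycle_triv_iso[OF \<alpha> x])
    have n: "section_near \<A> EE x (cocycle_frame \<alpha> i)" unfolding section_near_def using s x by blast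
    have "\<psi> \<alpha> x (DD x v (cocycle_frame \<alpha> i)) = dir_deriv v (\<lambda>y. \<psi> \<alpha> y (cocycle_frame \<alpha> i y))"
      by (rule cocycle_conn_coord[OF \<alpha> x v n])
    also have "\<dots> = dir_deriv v (\<lambda>y. axis i 1)"
    proof (rule dir_deriv_cong[OF v smooth_near_const, symmetric])
      show "\<forall>\<^sub>F y in nhds x. axis i 1 = \<psi> \<alpha> y (cocycle_frame \<alpha> i y)"
        using eventually_nhds_in_open[OF cover_open[OF \<alpha>] x]
        by (rule eventually_mono) (rule cocycle_frame_coord(1)[OF \<alpha>, symmetric])
    qed
    also have "\<dots> = \<psi> \<alpha> x \<zero>\<^bsub>transported_module em\<^esub>" using dir_deriv_const[OF v] x.map_zero by metis
    finally show ?thesis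
      using x.map_eq_iff[OF _ x.closed(3)] cocycle_conn_carrier[of x v "cocycle_frame \<alpha> i"] by (metis cocycle_fibre)
  qed
  have "fibre_basis (fibre EE x) (\<lambda>i. cocycle_frame \<alpha> i x)" if x: "x \<in> snd \<U> \<alpha>" for x
    using coordinate_iso.fibre_basis_iff[OF triv_iso[OF E cocycle_trivs[OF \<alpha>] x], where e = "\<lambda>i. cocycle_frame \<alpha> i x",
        OF cocycle_frame_coord(2)[OF \<alpha> x]] frame_matrix_cocycle_frame[OF \<alpha> x] invertible_mat_1
    by (simp add: frame_matrix_def)
  then show ?thesis unfolding parallel_frame_on_def parallel_section_def using s par by blast
qed

lemma cocycle_frame_change:
  assumes \<alpha>: "\<alpha> \<in> fst \<U>" "x \<in> snd \<U> \<alpha>" and \<beta>: "\<beta> \<in> fst \<U>" "x \<in> snd \<U> \<beta>"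
  shows "frame_change EE (cocycle_frame \<beta>) (cocycle_frame \<alpha>) x = a \<alpha> \<beta> x"
proof -
  note f = parallel_frame_imp_frame[OF cocycle_frame_parallel]
  have "frame_change EE (cocycle_frame \<beta>) (cocycle_frame \<alpha>) x = frame_matrix (\<psi> \<beta>) (cocycle_frame \<alpha>) x"
    using frame_change_matrix[OF E f[OF \<beta>(1)] f[OF \<alpha>(1)] cocycle_trivs[OF \<beta>(1)] \<beta>(2) \<alpha>(2) \<beta>(2)]
    by (simp add: frame_matrix_cocycle_frame[OF \<beta>])
  also have "\<dots> = (\<chi> i. axis i 1 v* a \<alpha> \<beta> x)"
    unfolding frame_matrix_def cocycle_triv_change[OF \<alpha>(1) \<beta>(1) \<alpha>(2) \<beta>(2)] cocycle_frame_coord(1)[OF \<alpha>] ..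
  also have "\<dots> = a \<alpha> \<beta> x"
    by (simp add: vec_eq_iff vector_matrix_mult_def axis_def if_distrib if_distribR cong: if_cong)
  finally show ?thesis .
qed

end

end

section \<open>The classification of flat bundles\<close>

context smooth_manifold
begin

lemma parallel_frames_iff:
  "parallel_frames \<A> E D \<U> h \<longleftrightarrow> (\<forall>\<alpha>\<in>fst \<U>. parallel_frame_on E D (snd \<U> \<alpha>) (h \<alpha>))"
  by (simp add: parallel_frames_def parallel_frame_on_def)

definition frame_cocycle :: "('m, 'e, 'n::finite) vbundle \<Rightarrow> ('i \<Rightarrow> 'n \<Rightarrow> 'm \<Rightarrow> 'e) \<Rightarrow> ('i, 'm, 'n) cochain1" where
  "frame_cocycle E h \<alpha> \<beta> = frame_change E (h \<beta>) (h \<alpha>)"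

lemma frame_cocycle_Z1:
  fixes \<U> :: "('i, 'm) cover"
  assumes E: "(E, D) \<in> flat_bundles \<A>" and h: "parallel_frames \<A> E D \<U> h"
  shows "frame_cocycle E h \<in> Z1 \<U>"
proof (rule Z1I)
  note e = flat_bundlesD[OF E]
  have hp: "parallel_frame_on E D (snd \<U> \<alpha>) (h \<alpha>)" if "\<alpha> \<in> fst \<U>" for \<alpha>
    using h that by (simp add: parallel_frames_iff)
  note hf = parallel_frame_imp_frame[OF hp]
  {
    fix \<alpha> \<beta> assume i: "\<alpha> \<in> fst \<U>" "\<beta> \<in> fst \<U>"
    have o: "open (snd \<U> \<alpha> \<inter> snd \<U> \<beta>)" using frame_open[OF hf[OF i(1)]] frame_open[OF hf[OF i(2)]] by (rule open_Int)
    show "frame_cocycle E h \<alpha> \<beta> \<in> GL_sections (snd \<U> \<alpha> \<inter> snd \<U> \<beta>)"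
      unfolding frame_cocycle_def
      by (rule frame_change_locally_constant[OF e(1,3) parallel_frame_on_subset[OF hp[OF i(2)] o _ e(1)]
            parallel_frame_on_subset[OF hp[OF i(1)] o _ e(1)]]) auto
  next
    fix \<alpha> \<beta> \<gamma> x assume i: "\<alpha> \<in> fst \<U>" "\<beta> \<in> fst \<U>" "\<gamma> \<in> fst \<U>" and x: "x \<in> snd \<U> \<alpha>" "x \<in> snd \<U> \<beta>" "x \<in> snd \<U> \<gamma>"
    show "frame_cocycle E h \<alpha> \<gamma> x = frame_cocycle E h \<alpha> \<beta> x ** frame_cocycle E h \<beta> \<gamma> x"
      unfolding frame_cocycle_def
      by (rule frame_change_trans[OF e(1) hf[OF i(3)] hf[OF i(2)] hf[OF i(1)] x(3,2,1)])
  }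
qed

lemma frame_transition_iff:
  fixes \<U> :: "('i, 'm) cover"
  assumes E: "(E, D) \<in> flat_bundles \<A>" and h: "parallel_frames \<A> E D \<U> h"
  shows "frame_transition E \<U> h t \<longleftrightarrow> t \<in> C1 \<U> \<and>
    (\<forall>\<alpha>\<in>fst \<U>. \<forall>\<beta>\<in>fst \<U>. \<forall>x\<in>snd \<U> \<alpha> \<inter> snd \<U> \<beta>. t \<alpha> \<beta> x = frame_cocycle E h \<alpha> \<beta> x)"
proof -
  note e = flat_bundlesD[OF E]
  have hf: "frame_on E (snd \<U> \<alpha>) (h \<alpha>)" if "\<alpha> \<in> fst \<U>" for \<alpha>
    by (rule parallel_frame_imp_frame[where D = D]) (use h that in \<open>simp add: parallel_frames_iff\<close>)
  have "(\<forall>\<alpha>\<in>fst \<U>. \<forall>\<beta>\<in>fst \<U>. \<forall>x\<in>snd \<U> \<alpha> \<inter> snd \<U> \<beta>.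
      \<forall>i. h \<alpha> i x = (\<Oplus>\<^bsub>fibre E x\<^esub>j\<in>UNIV. (t \<alpha> \<beta> x $ i $ j) \<odot>\<^bsub>fibre E x\<^esub> h \<beta> j x))
    \<longleftrightarrow> (\<forall>\<alpha>\<in>fst \<U>. \<forall>\<beta>\<in>fst \<U>. \<forall>x\<in>snd \<U> \<alpha> \<inter> snd \<U> \<beta>. t \<alpha> \<beta> x = frame_cocycle E h \<alpha> \<beta> x)"
  proof (intro ball_cong refl)
    fix \<alpha> \<beta> x assume i: "\<alpha> \<in> fst \<U>" "\<beta> \<in> fst \<U>" and x: "x \<in> snd \<U> \<alpha> \<inter> snd \<U> \<beta>"
    show "(\<forall>i. h \<alpha> i x = (\<Oplus>\<^bsub>fibre E x\<^esub>j\<in>UNIV. (t \<alpha> \<beta> x $ i $ j) \<odot>\<^bsub>fibre E x\<^esub> h \<beta> j x))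
      \<longleftrightarrow> t \<alpha> \<beta> x = frame_cocycle E h \<alpha> \<beta> x"
      unfolding frame_cocycle_def by (rule frame_expand_iff[OF e(1) hf[OF i(2)] hf[OF i(1)]]) (use x in auto)
  qed
  then show ?thesis unfolding frame_transition_def by blast
qed

text \<open>Transition cochains of the same frames agree wherever they are compared.\<close>

lemma frame_transition_cohomologous:
  fixes \<U> :: "('i, 'm) cover"
  assumes E: "(E, D) \<in> flat_bundles \<A>" and h: "parallel_frames \<A> E D \<U> h" and t: "frame_transition E \<U> h t"
  shows "t \<in> Z1 \<U>" "cohomologous \<U> `` {t} = cohomologous \<U> `` {frame_cocycle E h}"
proof -
  note c = frame_cocycle_Z1[OF E h]
  have eq: "t \<alpha> \<beta> x = frame_cocycle E h \<alpha> \<beta> x" if "\<alpha> \<in> fst \<U>" "\<beta> \<in> fst \<U>" "x \<in> snd \<U> \<alpha>" "x \<in> snd \<U> \<beta>" for \<alpha> \<beta> x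
    using t that unfolding frame_transition_iff[OF E h] by blast
  have C1: "t \<in> C1 \<U>" using t by (simp add: frame_transition_def)
  show tZ: "t \<in> Z1 \<U>"
  proof (rule Z1I)
    show "t \<alpha> \<beta> \<in> GL_sections (snd \<U> \<alpha> \<inter> snd \<U> \<beta>)" if "\<alpha> \<in> fst \<U>" "\<beta> \<in> fst \<U>" for \<alpha> \<beta>
      using C1 that by (simp add: C1_def)
  next
    fix \<alpha> \<beta> \<gamma> x assume i: "\<alpha> \<in> fst \<U>" "\<beta> \<in> fst \<U>" "\<gamma> \<in> fst \<U>" and x: "x \<in> snd \<U> \<alpha>" "x \<in> snd \<U> \<beta>" "x \<in> snd \<U> \<gamma>"
    show "t \<alpha> \<gamma> x = t \<alpha> \<beta> x ** t \<beta> \<gamma> x"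
      using Z1_mult[OF c i x] by (simp add: eq i x)
  qed
  have "(t, frame_cocycle E h) \<in> cohomologous \<U>"
    by (rule cohomologousI[OF tZ c, where b = "\<lambda>\<alpha> x. mat 1"]) (simp_all add: GL_sections_one eq)
  then show "cohomologous \<U> `` {t} = cohomologous \<U> `` {frame_cocycle E h}"
    by (rule equiv_class_eq[OF equiv_cohomologous])
qed

lemma ex_parallel_frames:
  fixes index_emb :: "'m set \<Rightarrow> 'i"
  assumes inj: "inj index_emb" and E: "(E, D) \<in> flat_bundles \<A>"
  obtains \<U> :: "('i, 'm) cover" and h where "open_cover \<U>" "parallel_frames \<A> E D \<U> h"
proof -
  note e = flat_bundlesD[OF E]
  have "\<exists>S. open S \<and> x \<in> S \<and> (\<exists>h. parallel_frame_on E D S h)" for x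
    using ex_local_parallel_frame[OF e(1,2), of x] by metis
  then show thesis
  proof (rule ex_cover[OF inj])
    fix \<U> :: "('i, 'm) cover"
    assume U: "open_cover \<U>" "\<And>\<alpha>. \<alpha> \<in> fst \<U> \<Longrightarrow> \<exists>h. parallel_frame_on E D (snd \<U> \<alpha>) h"
    then have "\<forall>\<alpha>\<in>fst \<U>. \<exists>h. parallel_frame_on E D (snd \<U> \<alpha>) h" by blast
    from bchoice[OF this] obtain h where "\<forall>\<alpha>\<in>fst \<U>. parallel_frame_on E D (snd \<U> \<alpha>) (h \<alpha>)" by blast
    then show thesis using that[OF U(1)] by (simp add: parallel_frames_iff)
  qed
qed

text \<open>On a common refinement, the images \<open>k\<^sub>\<alpha>\<close> of the frames of \<open>E\<close> and the frames \<open>h'\<^sub>\<alpha>\<close> are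
  parallel frames of \<open>E'\<close>. The matrices \<open>b\<^sub>\<alpha>\<close> with \<open>k\<^sub>\<alpha> = b\<^sub>\<alpha> h'\<^sub>\<alpha>\<close> relate the two cocycles.\<close>

lemma isomorphic_imp_common_refinement:
  fixes index_emb :: "'m set \<Rightarrow> 'i" and \<U> \<U>' :: "('i, 'm) cover"
  assumes inj: "inj index_emb" and E: "(E, D) \<in> flat_bundles \<A>" "(E', D') \<in> flat_bundles \<A>"
    and F: "flat_iso_map E D E' D' F G"
    and U: "open_cover \<U>" "open_cover \<U>'" and h: "parallel_frames \<A> E D \<U> h" and h': "parallel_frames \<A> E' D' \<U>' h'"
  shows "common_refinement_equiv \<U> (frame_cocycle E h) \<U>' (frame_cocycle E' h')"
proof -
  note e = flat_bundlesD[OF E(1)] and e' = flat_bundlesD[OF E(2)] and f = flat_iso_mapD(1)[OF F]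
  obtain \<V> r r' where V: "open_cover \<V>" and r: "refinement_map \<V> \<U> r" and r': "refinement_map \<V> \<U>' r'"
    by (rule common_refinement[OF inj U])
  have oV: "open (snd \<V> \<alpha>)" if "\<alpha> \<in> fst \<V>" for \<alpha> using V that by (simp add: open_cover_def)
  have hV: "parallel_frame_on E D (snd \<V> \<alpha>) (h (r \<alpha>))" if "\<alpha> \<in> fst \<V>" for \<alpha>
    by (rule parallel_frame_on_subset[OF _ oV[OF that] refinement_mapD(2)[OF r that] e(1)])
      (use h refinement_mapD(1)[OF r that] in \<open>simp add: parallel_frames_iff\<close>)
  have h'V: "parallel_frame_on E' D' (snd \<V> \<alpha>) (h' (r' \<alpha>))" if "\<alpha> \<in> fst \<V>" for \<alpha>
    by (rule parallel_frame_on_subset[OF _ oV[OF that] refinement_mapD(2)[OF r' that] e'(1)])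
      (use h' refinement_mapD(1)[OF r' that] in \<open>simp add: parallel_frames_iff\<close>)
  define k where "k \<alpha> = (\<lambda>i x. F x (h (r \<alpha>) i x))" for \<alpha>
  have kV: "parallel_frame_on E' D' (snd \<V> \<alpha>) (k \<alpha>)" if "\<alpha> \<in> fst \<V>" for \<alpha>
    unfolding k_def by (rule flat_iso_parallel_frame[OF E F hV[OF that]])
  note fr = parallel_frame_imp_frame[OF hV] parallel_frame_imp_frame[OF h'V] parallel_frame_imp_frame[OF kV]
  have "(pullback r (frame_cocycle E h), pullback r' (frame_cocycle E' h')) \<in> cohomologous \<V>"
  proof (rule cohomologousI[OF pullback_Z1[OF r frame_cocycle_Z1[OF E(1) h]] pullback_Z1[OF r' frame_cocycle_Z1[OF E(2) h']],
        where b = "\<lambda>\<alpha>. frame_change E' (h' (r' \<alpha>)) (k \<alpha>)"])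
    show "frame_change E' (h' (r' \<alpha>)) (k \<alpha>) \<in> GL_sections (snd \<V> \<alpha>)" if "\<alpha> \<in> fst \<V>" for \<alpha>
      by (rule frame_change_locally_constant[OF e'(1,3) h'V[OF that] kV[OF that]])
    fix \<alpha> \<beta> x assume i: "\<alpha> \<in> fst \<V>" "\<beta> \<in> fst \<V>" and x: "x \<in> snd \<V> \<alpha>" "x \<in> snd \<V> \<beta>"
    have "frame_change E' (h' (r' \<alpha>)) (k \<alpha>) x ** frame_change E' (h' (r' \<beta>)) (h' (r' \<alpha>)) x
      = frame_change E' (h' (r' \<beta>)) (k \<alpha>) x"
      by (rule frame_change_trans[OF e'(1) fr(2)[OF i(2)] fr(2)[OF i(1)] fr(3)[OF i(1)] x(2,1,1), symmetric])
    also have "\<dots> = frame_change E' (k \<beta>) (k \<alpha>) x ** frame_change E' (h' (r' \<beta>)) (k \<beta>) x"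
      by (rule frame_change_trans[OF e'(1) fr(2)[OF i(2)] fr(3)[OF i(2)] fr(3)[OF i(1)] x(2,2,1)])
    also have "frame_change E' (k \<beta>) (k \<alpha>) x = frame_change E (h (r \<beta>)) (h (r \<alpha>)) x"
      unfolding k_def
      by (rule flat_iso_frame_change[OF e(1) e'(1) f fr(1)[OF i(2)] fr(3)[OF i(2), unfolded k_def]
            fr(1)[OF i(1)] fr(3)[OF i(1), unfolded k_def] x(2,1)])
    finally show "frame_change E' (h' (r' \<alpha>)) (k \<alpha>) x ** pullback r' (frame_cocycle E' h') \<alpha> \<beta> x
      = pullback r (frame_cocycle E h) \<alpha> \<beta> x ** frame_change E' (h' (r' \<beta>)) (k \<beta>) x"
      by (simp add: pullback_def frame_cocycle_def)
  qed
  then show ?thesis unfolding common_refinement_equiv_def using V r r' by blast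
qed

text \<open>With \<open>b\<close> the cochain relating the pulled back cocycles, the frames \<open>b\<^sub>\<alpha> h'\<^sub>\<alpha>\<close> of \<open>E'\<close> have the
  transition matrices of the frames of \<open>E\<close>.\<close>

lemma common_refinement_imp_isomorphic:
  fixes \<U> \<U>' :: "('i, 'm) cover"
  assumes E: "(E, D) \<in> flat_bundles \<A>" "(E', D') \<in> flat_bundles \<A>"
    and h: "parallel_frames \<A> E D \<U> h" and h': "parallel_frames \<A> E' D' \<U>' h'"
    and eq: "common_refinement_equiv \<U> (frame_cocycle E h) \<U>' (frame_cocycle E' h')"
  shows "((E, D), (E', D')) \<in> flat_iso \<A>"
proof -
  note e = flat_bundlesD[OF E(1)] and e' = flat_bundlesD[OF E(2)]
  obtain \<V> r r' where V: "open_cover \<V>" and r: "refinement_map \<V> \<U> r" and r': "refinement_map \<V> \<U>' r'"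
    and co: "(pullback r (frame_cocycle E h), pullback r' (frame_cocycle E' h')) \<in> cohomologous \<V>"
    using eq unfolding common_refinement_equiv_def by blast
  obtain b where b: "intertwines \<V> (pullback r (frame_cocycle E h)) (pullback r' (frame_cocycle E' h')) b"
    using co cohomologous_iff by blast
  have oV: "open (snd \<V> \<alpha>)" if "\<alpha> \<in> fst \<V>" for \<alpha> using V that by (simp add: open_cover_def)
  have hV: "parallel_frame_on E D (snd \<V> \<alpha>) (h (r \<alpha>))" if "\<alpha> \<in> fst \<V>" for \<alpha>
    by (rule parallel_frame_on_subset[OF _ oV[OF that] refinement_mapD(2)[OF r that] e(1)])
      (use h refinement_mapD(1)[OF r that] in \<open>simp add: parallel_frames_iff\<close>)
  have h'V: "parallel_frame_on E' D' (snd \<V> \<alpha>) (h' (r' \<alpha>))" if "\<alpha> \<in> fst \<V>" for \<alpha>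
    by (rule parallel_frame_on_subset[OF _ oV[OF that] refinement_mapD(2)[OF r' that] e'(1)])
      (use h' refinement_mapD(1)[OF r' that] in \<open>simp add: parallel_frames_iff\<close>)
  define k where "k \<alpha> = h (r \<alpha>)" for \<alpha>
  define k' where "k' \<alpha> = combine_frame E' (b \<alpha>) (h' (r' \<alpha>))" for \<alpha>
  have k: "parallel_frame_on E D (snd \<V> \<alpha>) (k \<alpha>)" if "\<alpha> \<in> fst \<V>" for \<alpha>
    unfolding k_def by (rule hV[OF that])
  have k': "parallel_frame_on E' D' (snd \<V> \<alpha>) (k' \<alpha>)" if "\<alpha> \<in> fst \<V>" for \<alpha>
    unfolding k'_def by (rule parallel_frame_combine(1)[OF e'(1,3) h'V[OF that] intertwinesD(1)[OF b that]])
  have bk: "frame_change E' (h' (r' \<alpha>)) (k' \<alpha>) x = b \<alpha> x" if "\<alpha> \<in> fst \<V>" "x \<in> snd \<V> \<alpha>" for \<alpha> x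
    unfolding k'_def by (rule parallel_frame_combine(2)[OF e'(1,3) h'V[OF that(1)] intertwinesD(1)[OF b that(1)] that(2)])
  note fr = parallel_frame_imp_frame[OF h'V] parallel_frame_imp_frame[OF k']
  have same: "frame_change E (k \<beta>) (k \<alpha>) x = frame_change E' (k' \<beta>) (k' \<alpha>) x"
    if i: "\<alpha> \<in> fst \<V>" "\<beta> \<in> fst \<V>" and x: "x \<in> snd \<V> \<alpha>" "x \<in> snd \<V> \<beta>" for \<alpha> \<beta> x
  proof -
    have "frame_change E' (k' \<beta>) (k' \<alpha>) x ** b \<beta> x = frame_change E' (h' (r' \<beta>)) (k' \<alpha>) x"
      unfolding bk[OF i(2) x(2), symmetric]
      by (rule frame_change_trans[OF e'(1) fr(1)[OF i(2)] fr(2)[OF i(2)] fr(2)[OF i(1)] x(2,2,1), symmetric])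
    also have "\<dots> = b \<alpha> x ** pullback r' (frame_cocycle E' h') \<alpha> \<beta> x"
      unfolding bk[OF i(1) x(1), symmetric] pullback_def frame_cocycle_def
      by (rule frame_change_trans[OF e'(1) fr(1)[OF i(2)] fr(1)[OF i(1)] fr(2)[OF i(1)] x(2,1,1)])
    also have "\<dots> = frame_change E (k \<beta>) (k \<alpha>) x ** b \<beta> x"
      using intertwinesD(2)[OF b i x] by (simp add: pullback_def frame_cocycle_def k_def)
    finally have eq: "frame_change E' (k' \<beta>) (k' \<alpha>) x ** b \<beta> x = frame_change E (k \<beta>) (k \<alpha>) x ** b \<beta> x" .
    note ib = GL_sections_invertible[OF intertwinesD(1)[OF b i(2)] x(2)]
    show ?thesis
      using arg_cong[OF eq, of "\<lambda>B. B ** matrix_inv (b \<beta> x)"] by (simp only: matrix_mult_inv_cancel(1)[OF ib])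
  qed
  have same': "frame_change E' (k' \<beta>) (k' \<alpha>) x = frame_change E (k \<beta>) (k \<alpha>) x"
    if "\<alpha> \<in> fst \<V>" "\<beta> \<in> fst \<V>" "x \<in> snd \<V> \<alpha>" "x \<in> snd \<V> \<beta>" for \<alpha> \<beta> x
    using same[OF that] by (rule sym)
  have "flat_iso_map E D E' D' (frame_map E E' \<V> k k') (frame_map E' E \<V> k' k)"
    unfolding flat_iso_map_def
  proof (intro conjI allI ballI impI)
    show "bundle_map \<A> E E' (frame_map E E' \<V> k k')"
      by (rule flat_iso_map_if_same_transitions(1)[OF E V k k' same])
    show "bundle_map \<A> E' E (frame_map E' E \<V> k' k)"
      by (rule flat_iso_map_if_same_transitions(1)[OF E(2,1) V k' k same'])
    show "frame_map E' E \<V> k' k x (frame_map E E' \<V> k k' x u) = u" if "u \<in> carrier (fibre E x)" for x u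
      by (rule flat_iso_map_if_same_transitions(2)[OF E V k k' same that])
    show "frame_map E E' \<V> k k' x (frame_map E' E \<V> k' k x u) = u" if "u \<in> carrier (fibre E' x)" for x u
      by (rule flat_iso_map_if_same_transitions(2)[OF E(2,1) V k' k same' that])
    show "D' x v (\<lambda>y. frame_map E E' \<V> k k' y (s y)) = frame_map E E' \<V> k k' x (D x v s)"
      if "v \<in> tangent_space \<A> x" "section_near \<A> E x s" for x v s
      by (rule flat_iso_map_if_same_transitions(3)[OF E V k k' same that])
  qed
  then show ?thesis using E by (auto simp: flat_iso_iff)
qed

lemma Theta_eq:
  fixes index_emb :: "'m set \<Rightarrow> 'i" and \<U> :: "('i, 'm) cover" and E :: "('m, 'e, 'n::finite) vbundle"
  assumes inj: "inj index_emb" and E: "(E, D) \<in> flat_bundles \<A>"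
    and U: "open_cover \<U>" and h: "parallel_frames \<A> E D \<U> h" and t: "frame_transition E \<U> h t"
  shows "Theta \<A> (flat_iso \<A> `` {(E, D)}) = cech_class \<U> t"
  unfolding Theta_def
proof (rule the_equality)
  have "((E, D), (E, D)) \<in> flat_iso \<A>"
    using equiv_flat_iso E by (meson equivE refl_onD)
  then show "\<exists>E' D' \<U>' h' t'. (E', D') \<in> flat_iso \<A> `` {(E, D)} \<and> open_cover \<U>' \<and>
     parallel_frames \<A> E' D' \<U>' h' \<and> frame_transition E' \<U>' h' t' \<and>
     cech_class \<U> t = limit_rel `` {(\<U>', cohomologous \<U>' `` {t'})}"
    using U h t unfolding cech_class_def by blast
  fix \<tau> :: "('i, 'm, 'n) cover_class set"
  assume "\<exists>E' D' \<U>' h' t'. (E', D') \<in> flat_iso \<A> `` {(E, D)} \<and> open_cover \<U>' \<and>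
     parallel_frames \<A> E' D' \<U>' h' \<and> frame_transition E' \<U>' h' t' \<and>
     \<tau> = limit_rel `` {(\<U>', cohomologous \<U>' `` {t'})}"
  then obtain E' D' \<U>' h' t' where *: "((E, D), (E', D')) \<in> flat_iso \<A>" "open_cover \<U>'"
    "parallel_frames \<A> E' D' \<U>' h'" "frame_transition E' \<U>' h' t'" "\<tau> = cech_class \<U>' t'"
    unfolding cech_class_def by blast
  obtain F G where E': "(E', D') \<in> flat_bundles \<A>" and F: "flat_iso_map E D E' D' F G"
    using *(1) unfolding flat_iso_iff by blast
  have "common_refinement_equiv \<U> (frame_cocycle E h) \<U>' (frame_cocycle E' h')"
    by (rule isomorphic_imp_common_refinement[OF inj E E' F U *(2) h *(3)])
  then have "cech_class \<U> (frame_cocycle E h) = cech_class \<U>' (frame_cocycle E' h')"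
    using cech_class_eq_iff[OF inj U *(2) frame_cocycle_Z1[OF E h] frame_cocycle_Z1[OF E' *(3)]] by blast
  then show "\<tau> = cech_class \<U> t"
    unfolding *(5) cech_class_def
      frame_transition_cohomologous(2)[OF E h t] frame_transition_cohomologous(2)[OF E' *(3,4)] by simp
qed

theorem bij_betw_Theta:
  fixes fibre_emb :: "real ^ 'n \<Rightarrow> 'e" and index_emb :: "'m set \<Rightarrow> 'i"
  assumes fe: "inj fibre_emb" and inj: "inj index_emb"
  shows "bij_betw (Theta \<A>) (iso_classes \<A> :: ('m, 'e, 'n::finite) conn_bundle set set) (H1 :: ('i, 'm, 'n) cover_class set set)"
proof -
  have frames: "\<exists>(\<U> :: ('i, 'm) cover) h. open_cover \<U> \<and> parallel_frames \<A> E D \<U> h \<and> frame_cocycle E h \<in> Z1 \<U> \<and>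
      Theta \<A> (flat_iso \<A> `` {(E, D)}) = cech_class \<U> (frame_cocycle E h)"
    if E: "(E, D) \<in> flat_bundles \<A>" for E :: "('m, 'e, 'n) vbundle" and D
  proof -
    obtain \<U> :: "('i, 'm) cover" and h where U: "open_cover \<U>" and h: "parallel_frames \<A> E D \<U> h"
      by (rule ex_parallel_frames[OF inj E])
    note Z = frame_cocycle_Z1[OF E h]
    have "frame_transition E \<U> h (frame_cocycle E h)"
      using Z by (simp add: frame_transition_iff[OF E h] Z1_def)
    from Theta_eq[OF inj E U h this] show ?thesis using U h Z by blast
  qed
  have classes: "\<exists>E D. (E, D) \<in> flat_bundles \<A> \<and> \<xi> = flat_iso \<A> `` {(E, D)}"
    if "\<xi> \<in> iso_classes \<A>" for \<xi> :: "('m, 'e, 'n) conn_bundle set"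
    using that unfolding iso_classes_def by (auto elim!: quotientE)
  show ?thesis
    unfolding bij_betw_def
  proof
    show "inj_on (Theta \<A> :: _ \<Rightarrow> ('i, 'm, 'n) cover_class set) (iso_classes \<A> :: ('m, 'e, 'n) conn_bundle set set)"
    proof (rule inj_onI)
    fix \<xi> \<xi>' :: "('m, 'e, 'n) conn_bundle set"
    assume "\<xi> \<in> iso_classes \<A>" "\<xi>' \<in> iso_classes \<A>" and eq: "Theta \<A> \<xi> = (Theta \<A> \<xi>' :: ('i, 'm, 'n) cover_class set)"
    then obtain E D E' D' where E: "(E, D) \<in> flat_bundles \<A>" "\<xi> = flat_iso \<A> `` {(E, D)}"
      and E': "(E', D') \<in> flat_bundles \<A>" "\<xi>' = flat_iso \<A> `` {(E', D')}" using classes by metis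
    obtain \<U> :: "('i, 'm) cover" and h where U: "open_cover \<U>" "parallel_frames \<A> E D \<U> h" "frame_cocycle E h \<in> Z1 \<U>"
      "Theta \<A> \<xi> = cech_class \<U> (frame_cocycle E h)" using frames[OF E(1)] unfolding E(2) by blast
    obtain \<U>' :: "('i, 'm) cover" and h' where U': "open_cover \<U>'" "parallel_frames \<A> E' D' \<U>' h'" "frame_cocycle E' h' \<in> Z1 \<U>'"
      "Theta \<A> \<xi>' = cech_class \<U>' (frame_cocycle E' h')" using frames[OF E'(1)] unfolding E'(2) by blast
    have "common_refinement_equiv \<U> (frame_cocycle E h) \<U>' (frame_cocycle E' h')"
      using eq cech_class_eq_iff[OF inj U(1) U'(1) U(3) U'(3)] unfolding U(4) U'(4) by blast
    then have "((E, D), (E', D')) \<in> flat_iso \<A>"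
      by (rule common_refinement_imp_isomorphic[OF E(1) E'(1) U(2) U'(2)])
    then show "\<xi> = \<xi>'" unfolding E(2) E'(2) by (rule equiv_class_eq[OF equiv_flat_iso])
    qed
  next
    show "Theta \<A> ` (iso_classes \<A> :: ('m, 'e, 'n) conn_bundle set set) = (H1 :: ('i, 'm, 'n) cover_class set set)"
    proof (intro equalityI subsetI)
    fix \<tau> :: "('i, 'm, 'n) cover_class set"
    assume "\<tau> \<in> Theta \<A> ` (iso_classes \<A> :: ('m, 'e, 'n) conn_bundle set set)"
    then obtain E :: "('m, 'e, 'n) vbundle" and D where E: "(E, D) \<in> flat_bundles \<A>" "\<tau> = Theta \<A> (flat_iso \<A> `` {(E, D)})"
      using classes by blast
    then show "\<tau> \<in> H1" using frames[OF E(1)] unfolding H1_eq E(2) by blast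
  next
    fix \<tau> :: "('i, 'm, 'n) cover_class set"
    assume "\<tau> \<in> H1"
    then obtain \<U> a where U: "open_cover \<U>" and a: "a \<in> Z1 \<U>" and \<tau>: "\<tau> = cech_class \<U> a" unfolding H1_eq by blast
    let ?E = "cocycle_bundle fibre_emb \<U> a" and ?D = "cocycle_conn fibre_emb \<U> a"
    let ?h = "cocycle_frame fibre_emb \<U> a"
    have E: "(?E, ?D) \<in> flat_bundles \<A>" by (rule cocycle_flat_bundle[OF fe U a])
    have h: "parallel_frames \<A> ?E ?D \<U> ?h"
      using cocycle_frame_parallel[OF fe U a] by (simp add: parallel_frames_iff)
    have "frame_transition ?E \<U> ?h a"
      unfolding frame_transition_iff[OF E h] frame_cocycle_def
      using cocycle_frame_change[OF fe U a] a by (auto simp: Z1_def)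
    from Theta_eq[OF inj E U h this] have "\<tau> = Theta \<A> (flat_iso \<A> `` {(?E, ?D)})" by (simp add: \<tau>)
    moreover have "flat_iso \<A> `` {(?E, ?D)} \<in> iso_classes \<A>"
      unfolding iso_classes_def using E by (rule quotientI)
    ultimately show "\<tau> \<in> Theta \<A> ` (iso_classes \<A> :: ('m, 'e, 'n) conn_bundle set set)" by blast
    qed
  qed
qed

end

theorem corollary7:
  fixes V :: "'d::euclidean_space set"
    and \<A> :: "('m::{t2_space, second_countable_topology}, 'd) atlas"
    and fibre_emb :: "real ^ 'n \<Rightarrow> 'e"
    and index_emb :: "'m set \<Rightarrow> 'i"
  assumes "smooth_atlas V \<A>"
    and "connected (UNIV :: 'm set)"
    and "inj fibre_emb"
    and "inj index_emb"
  shows "bij_betw (Theta \<A>)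
           (iso_classes \<A> :: ('m, 'e, 'n) conn_bundle set set)
           (H1 :: ('i, 'm, 'n) cover_class set set)"
proof -
  interpret smooth_manifold V \<A> by standard (rule assms(1))
  show ?thesis by (rule bij_betw_Theta[OF assms(3,4)])
qed

end
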